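(* Let $T>0$. A curve $f\in AC([0,T];(\mathcal P_2^{\mathrm{cm}}(\mathbb R),d_{\mathcal A}))$ is a weak solution of the aggregation equation $\partial_t f_t=\partial_v(f_t\,\partial_v W*f_t)$ with $W(v)=\frac{1-e}{6}|v|^3$ (in the sense defined in the context) if and only if $\mathcal G_T(f)=0$.
   Context: Notation. $\mathbb R^2_{\neq}:=\{(v,v_* )\in\mathbb R^2: v\neq v_*\}$; $\mathcal P(\mathbb R)$ is the set of Borel probability measures; $\mathcal P_2^{\mathrm{cm}}(\mathbb R)$ is the set of $f\in\mathcal P(\mathbb R)$ with $\int|v|^2df<\infty$ and $\int v\,df=0$; $\mathcal M(\mathbb R^2_{\neq})$ is the set of finite signed Radon measures on $\mathbb R^2_{\neq}$. Products $f\otimes f$ are restricted to $\mathbb R^2_{\neq}$. Fix $e\in[0,1)$ and set $\sigma_e(r)=\frac{1-e}{4}r$ for $r\ge0$. For $\varphi\in C^1(\mathbb R)$ let $\tilde\nabla\varphi(v,v_* )=\varphi'(v_* )-\varphi'(v)$. Nonlocal-local continuity equation. A pair $\{(f_t,U_t)\}_{t\in[0,T]}$ with $f_t\in\mathcal P(\mathbb R)$, $U_t\in\mathcal M(\mathbb R^2_{\neq})$, both weak-$*$ measurable in $t$, is a (weak) solution if $\int_0^T\iint_{\mathbb R^2_{\neq}}\sigma_e(|v-v_*|)\,d|U_t|\,dt<\infty$ and for every $\varphi\in C^1_c((0,T)\times\mathbb R)$ $$\int_0^T\int_{\mathbb R}\partial_t\varphi_t\,df_t\,dt+\int_0^T\iint_{\mathbb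 R^2_{\neq}}\sigma_e(|v-v_*|)\tilde\nabla\varphi_t\,dU_t\,dt=0.$$ Such $f$ is identified with its narrowly continuous representative. $\mathrm{CE}_T(\mu_0,\mu_T)$ denotes the solutions with $f_0=\mu_0$, $f_T=\mu_T$; $\mathrm{CE}_T$ the set of all solutions; $\mathrm{CE}:=\mathrm{CE}_1$. Action density. $\alpha(s,u)=u^2/s$ if $s>0$, $\alpha(s,u)=0$ if $u=0$, $\alpha(0,u)=+\infty$ if $u\neq0$; with $|\lambda|=f\otimes f+|U|$, $\mathcal A(f,U)=\iint_{\mathbb R^2_{\neq}}\alpha\big(\frac{d(f\otimes f)}{d|\lambda|},\frac{dU}{d|\lambda|}\big)\sigma_e(|v-v_*|)\,d|\lambda|$. Collision transport cost: $d_{\mathcal A}(\mu_0,\mu_1)^2=\inf\{\int_0^1\mathcal A(f_t,U_t)\,dt:(f,U)\in\mathrm{CE}(\mu_0,\mu_1)\}$. Absolutely continuous curves: $f\in AC([0,T];(X,d_{\mathcal A}))$, $X\subset\mathcal P(\mathbb R)$, means $f_t\in X$ and there is $m\in L^2(0,T)$ with $d_{\mathcal A}(f_{t_0},f_{t_1})\le\int_{t_0}^{t_1}m(t)\,dt$ for all $0<t_0\le t_1<T$. Its metric derivative is $|f'|(t)=\lim_{h\to0}d_{\mathcal A}(f_{t+h},f_t)/|h|$ for a.e. $t$. For such $f$ there is a unique flux $\{U_t\}$ with $(f,U)\in\mathrm{CE}_T$ and $|f'|^2(t)=\mathcal A(f_t,U_t)$ for a.e. $t$. Energy, dissipation, De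 Giorgi functional: $\mathcal E(f)=\frac12\int v^2\,df(v)$, with $\frac{\delta\mathcal E}{\delta f}(v)=\frac{v^2}{2}$, so $\tilde\nabla\frac{\delta\mathcal E}{\delta f}(v,v_* )=v_*-v$; $\mathcal D(f)=\iint_{\mathbb R^2_{\neq}}|v-v_*|^2\sigma_e(|v-v_*|)\,d(f\otimes f)$; for $f\in AC([0,T];(\mathcal P_2^{\mathrm{cm}}(\mathbb R),d_{\mathcal A}))$, $$\mathcal G_T(f)=\mathcal E(f_T)-\mathcal E(f_0)+\frac12\int_0^T\mathcal A(f_t,U_t)\,dt+\frac12\int_0^T\mathcal D(f_t)\,dt,$$ where $U_t$ is the unique flux with $|f'|^2(t)=\mathcal A(f_t,U_t)$ for a.e. $t$. Weak solution of the aggregation equation: a curve $\{f_t\}_{t\in[0,T]}\subset\mathcal P_2^{\mathrm{cm}}(\mathbb R)$ such that, with $dU_t^{\mathcal E}(v,v_* )=-\tilde\nabla\frac{\delta\mathcal E}{\delta f}(v,v_* )\,d(f_t\otimes f_t)=(v-v_* )\,d(f_t\otimes f_t)(v,v_* )$, the pair $\{(f_t,U_t^{\mathcal E})\}_{t\in[0,T]}$ is a solution of the nonlocal-local continuity equation. *)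

theory Defs
  imports "HOL-Probability.Probability"
begin

section \<open>Finite signed measures\<close>

text \<open>
  A finite signed measure on a measurable space \<^term>\<open>M\<close> (only \<^term>\<open>space M\<close> and
  \<^term>\<open>sets M\<close> matter) is a real-valued countably additive set function on \<^term>\<open>sets M\<close>;
  its values outside \<^term>\<open>sets M\<close> are irrelevant.  Finiteness of the total variation is automatic
  for real-valued set functions, and so is the Radon property on an open subset of the plane.
\<close>

definition signed_measure :: "'a measure \<Rightarrow> ('a set \<Rightarrow> real) \<Rightarrow> bool" where
  "signed_measure M \<nu> \<longleftrightarrow>
     \<nu> {} = 0 \<and>
     (\<forall>A :: nat \<Rightarrow> 'a set. range A \<subseteq> sets M \<longrightarrow> disjoint_family A \<longrightarrow>
        (\<lambda>i. \<nu> (A i)) sums \<nu> (\<Union>i. A i))"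

text \<open>Jordan decomposition.\<close>

definition pos_variation :: "'a measure \<Rightarrow> ('a set \<Rightarrow> real) \<Rightarrow> 'a measure" where
  "pos_variation M \<nu> =
     measure_of (space M) (sets M) (\<lambda>A. \<Squnion>B\<in>{B \<in> sets M. B \<subseteq> A}. ennreal (\<nu> B))"

definition neg_variation :: "'a measure \<Rightarrow> ('a set \<Rightarrow> real) \<Rightarrow> 'a measure" where
  "neg_variation M \<nu> = pos_variation M (\<lambda>A. - \<nu> A)"

definition add_measure :: "'a measure \<Rightarrow> 'a measure \<Rightarrow> 'a measure" where
  "add_measure \<mu> \<nu> = measure_of (space \<mu>) (sets \<mu>) (\<lambda>A. emeasure \<mu> A + emeasure \<nu> A)"

definition total_variation :: "'a measure \<Rightarrow> ('a set \<Rightarrow> real) \<Rightarrow> 'a measure" where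
  "total_variation M \<nu> = add_measure (pos_variation M \<nu>) (neg_variation M \<nu>)"

definition signed_integral :: "'a measure \<Rightarrow> ('a set \<Rightarrow> real) \<Rightarrow> ('a \<Rightarrow> real) \<Rightarrow> real" where
  "signed_integral M \<nu> g = (\<integral>x. g x \<partial>pos_variation M \<nu>) - (\<integral>x. g x \<partial>neg_variation M \<nu>)"

text \<open>The Radon--Nikodym density of the signed measure \<open>\<nu>\<close> with respect to \<open>\<Lambda>\<close>.\<close>

definition signed_RN_deriv :: "'a measure \<Rightarrow> 'a measure \<Rightarrow> ('a set \<Rightarrow> real) \<Rightarrow> 'a \<Rightarrow> real" where
  "signed_RN_deriv M \<Lambda> \<nu> x =
     enn2real (RN_deriv \<Lambda> (pos_variation M \<nu>) x) - enn2real (RN_deriv \<Lambda> (neg_variation M \<nu>) x)"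


section \<open>Spaces and test functions\<close>

definition offdiag :: "(real \<times> real) set" where
  "offdiag = {(v, w). v \<noteq> w}"

abbreviation offdiag_borel :: "(real \<times> real) measure" where
  "offdiag_borel \<equiv> restrict_space borel offdiag"

text \<open>\<open>f \<otimes> f\<close>, restricted to the off-diagonal plane.\<close>

definition tensor :: "real measure \<Rightarrow> (real \<times> real) measure" where
  "tensor f = restrict_space (f \<Otimes>\<^sub>M f) offdiag"

definition P2cm :: "real measure set" where
  "P2cm = {f. real_distribution f \<and> integrable f (\<lambda>v. v\<^sup>2) \<and> (\<integral>v. v \<partial>f) = 0}"

text \<open>Continuous functions on \<open>S\<close> vanishing at infinity (relative to \<open>S\<close>).\<close>

definition C0 :: "'a::topological_space set \<Rightarrow> ('a \<Rightarrow> real) set" where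
  "C0 S = {\<phi>. continuous_on S \<phi> \<and> (\<forall>\<epsilon>>0. compact {x \<in> S. \<epsilon> \<le> \<bar>\<phi> x\<bar>})}"

text \<open>
  \<open>C\<^sup>1\<^sub>c((0,T) \<times> \<real>)\<close>; the functions of \<open>(t, v)\<close> are extended by zero to the whole plane.
\<close>

definition C1c :: "real \<Rightarrow> (real \<times> real \<Rightarrow> real) set" where
  "C1c T = {\<phi>.
     (\<exists>\<phi>' :: real \<times> real \<Rightarrow> (real \<times> real) \<Rightarrow>\<^sub>L real.
        (\<forall>x. (\<phi> has_derivative blinfun_apply (\<phi>' x)) (at x)) \<and> continuous_on UNIV \<phi>') \<and>
     (\<exists>K. compact K \<and> K \<subseteq> {0<..<T} \<times> UNIV \<and> (\<forall>x. x \<notin> K \<longrightarrow> \<phi> x = 0))}"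

definition ngrad :: "(real \<Rightarrow> real) \<Rightarrow> real \<times> real \<Rightarrow> real" where
  "ngrad \<phi> = (\<lambda>(v, w). deriv \<phi> w - deriv \<phi> v)"

definition sigma_e :: "real \<Rightarrow> real \<Rightarrow> real" where
  "sigma_e e r = (1 - e) / 4 * r"

abbreviation kernel :: "real \<Rightarrow> real \<times> real \<Rightarrow> real" where
  "kernel e \<equiv> \<lambda>(v, w). sigma_e e \<bar>v - w\<bar>"


section \<open>The nonlocal-local continuity equation\<close>

definition narrowly_continuous :: "real \<Rightarrow> (real \<Rightarrow> real measure) \<Rightarrow> bool" where
  "narrowly_continuous T f \<longleftrightarrow>
     (\<forall>g :: real \<Rightarrow> real. continuous_on UNIV g \<longrightarrow> bounded (range g) \<longrightarrow>
        continuous_on {0..T} (\<lambda>t. \<integral>v. g v \<partial>f t))"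

text \<open>
  Curves are functions on all of \<open>\<real>\<close>, of which only the restriction to \<^term>\<open>{0..T}\<close> matters.
  Solutions are identified with their narrowly continuous representative, so that narrow
  continuity on the closed interval is part of the definition; this is what gives a meaning to the
  values at the two endpoints.
\<close>

definition CE :: "real \<Rightarrow> real \<Rightarrow> (real \<Rightarrow> real measure) \<Rightarrow> (real \<Rightarrow> (real \<times> real) set \<Rightarrow> real) \<Rightarrow> bool" where
  "CE e T f U \<longleftrightarrow>
     (\<forall>t\<in>{0..T}. real_distribution (f t)) \<and>
     (\<forall>t\<in>{0..T}. signed_measure offdiag_borel (U t)) \<and>
     (\<forall>\<phi>\<in>C0 UNIV. (\<lambda>t. \<integral>v. \<phi> v \<partial>f t) \<in> borel_measurable (lebesgue_on {0..T})) \<and>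
     (\<forall>\<phi>\<in>C0 offdiag.
        (\<lambda>t. signed_integral offdiag_borel (U t) \<phi>) \<in> borel_measurable (lebesgue_on {0..T})) \<and>
     narrowly_continuous T f \<and>
     (\<integral>\<^sup>+ t. (\<integral>\<^sup>+ z. ennreal (kernel e z) \<partial>total_variation offdiag_borel (U t))
        \<partial>lebesgue_on {0..T}) < \<infinity> \<and>
     (\<forall>\<phi>\<in>C1c T.
        (\<integral>t. (\<integral>v. deriv (\<lambda>s. \<phi> (s, v)) t \<partial>f t) \<partial>lebesgue_on {0..T}) +
        (\<integral>t. signed_integral offdiag_borel (U t) (\<lambda>z. kernel e z * ngrad (\<lambda>v. \<phi> (t, v)) z)
           \<partial>lebesgue_on {0..T}) = 0)"


section \<open>Action and collision transport cost\<close>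

definition alpha :: "real \<Rightarrow> real \<Rightarrow> ennreal" where
  "alpha s u = (if u = 0 then 0 else if s > 0 then ennreal (u\<^sup>2 / s) else \<infinity>)"

definition action :: "real \<Rightarrow> real measure \<Rightarrow> ((real \<times> real) set \<Rightarrow> real) \<Rightarrow> ennreal" where
  "action e f U =
     (let \<Lambda> = add_measure (tensor f) (total_variation offdiag_borel U) in
      \<integral>\<^sup>+ z. alpha (enn2real (RN_deriv \<Lambda> (tensor f) z)) (signed_RN_deriv offdiag_borel \<Lambda> U z)
             * ennreal (kernel e z) \<partial>\<Lambda>)"

definition ennsqrt :: "ennreal \<Rightarrow> ennreal" where
  "ennsqrt x = (if x = \<infinity> then \<infinity> else ennreal (sqrt (enn2real x)))"

text \<open>The cost is \<open>\<infinity>\<close> when no solution connects the two measures.\<close>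

definition dA :: "real \<Rightarrow> real measure \<Rightarrow> real measure \<Rightarrow> ennreal" where
  "dA e \<mu>\<^sub>0 \<mu>\<^sub>1 =
     ennsqrt (\<Sqinter>(f, U) \<in> {(f, U). CE e 1 f U \<and> f 0 = \<mu>\<^sub>0 \<and> f 1 = \<mu>\<^sub>1}.
       \<integral>\<^sup>+ t. action e (f t) (U t) \<partial>lebesgue_on {0..1})"


section \<open>Absolutely continuous curves\<close>

text \<open>
  The metric inequality is only required in the open interval.  As for solutions of the continuity
  equation, a curve is identified with its narrowly continuous representative on the closed
  interval; otherwise \<open>f 0\<close> and \<open>f T\<close> would be unconstrained.
\<close>

definition AC :: "real \<Rightarrow> real \<Rightarrow> real measure set \<Rightarrow> (real \<Rightarrow> real measure) set" where
  "AC e T X = {f.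
     (\<forall>t\<in>{0..T}. f t \<in> X) \<and>
     narrowly_continuous T f \<and>
     (\<exists>m :: real \<Rightarrow> real.
        m \<in> borel_measurable (lebesgue_on {0..T}) \<and>
        integrable (lebesgue_on {0..T}) (\<lambda>t. (m t)\<^sup>2) \<and>
        (\<forall>t\<^sub>0 t\<^sub>1. 0 < t\<^sub>0 \<and> t\<^sub>0 \<le> t\<^sub>1 \<and> t\<^sub>1 < T \<longrightarrow>
           enn2ereal (dA e (f t\<^sub>0) (f t\<^sub>1)) \<le> ereal (\<integral>t. m t \<partial>lebesgue_on {t\<^sub>0..t\<^sub>1})))}"

definition metric_deriv :: "real \<Rightarrow> (real \<Rightarrow> real measure) \<Rightarrow> real \<Rightarrow> ennreal" where
  "metric_deriv e f t = Lim (at 0) (\<lambda>h. dA e (f (t + h)) (f t) / ennreal \<bar>h\<bar>)"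

text \<open>
  The flux of an absolutely continuous curve.  It is unique only up to modification for a null set
  of times (and outside \<^term>\<open>{0..T}\<close>), hence the choice operator.
\<close>

definition is_flux ::
  "real \<Rightarrow> real \<Rightarrow> (real \<Rightarrow> real measure) \<Rightarrow> (real \<Rightarrow> (real \<times> real) set \<Rightarrow> real) \<Rightarrow> bool" where
  "is_flux e T f U \<longleftrightarrow>
     CE e T f U \<and> (AE t in lebesgue_on {0..T}. (metric_deriv e f t)\<^sup>2 = action e (f t) (U t))"

definition flux :: "real \<Rightarrow> real \<Rightarrow> (real \<Rightarrow> real measure) \<Rightarrow> real \<Rightarrow> (real \<times> real) set \<Rightarrow> real" where
  "flux e T f = (SOME U. is_flux e T f U)"


section \<open>Energy, dissipation, De Giorgi functional, aggregation equation\<close>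

definition energy :: "real measure \<Rightarrow> real" where
  "energy f = (\<integral>v. v\<^sup>2 \<partial>f) / 2"

text \<open>The first variation of the energy, which does not depend on the measure.\<close>

definition energy_variation :: "real \<Rightarrow> real" where
  "energy_variation v = v\<^sup>2 / 2"

definition dissipation :: "real \<Rightarrow> real measure \<Rightarrow> ennreal" where
  "dissipation e f = (\<integral>\<^sup>+ z. ennreal ((fst z - snd z)\<^sup>2 * kernel e z) \<partial>tensor f)"

text \<open>
  The energies are finite on \<^term>\<open>P2cm\<close>, but the dissipation is a third moment and may be infinite,
  so the functional takes values in \<open>(-\<infinity>, \<infinity>]\<close>.
\<close>

definition De_Giorgi :: "real \<Rightarrow> real \<Rightarrow> (real \<Rightarrow> real measure) \<Rightarrow> ereal" where
  "De_Giorgi e T f =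
     ereal (energy (f T) - energy (f 0))
     + enn2ereal (\<integral>\<^sup>+ t. action e (f t) (flux e T f t) \<partial>lebesgue_on {0..T}) / 2
     + enn2ereal (\<integral>\<^sup>+ t. dissipation e (f t) \<partial>lebesgue_on {0..T}) / 2"

definition energy_flux :: "real measure \<Rightarrow> (real \<times> real) set \<Rightarrow> real" where
  "energy_flux f A = set_lebesgue_integral (tensor f) A (\<lambda>z. - ngrad energy_variation z)"

text \<open>
  Weak solutions of \<open>\<partial>\<^sub>t f\<^sub>t = \<partial>\<^sub>v (f\<^sub>t (\<partial>\<^sub>v W * f\<^sub>t))\<close> with \<open>W(v) = (1 - e)/6 |v|\<^sup>3\<close>.
\<close>

definition aggregation_solution :: "real \<Rightarrow> real \<Rightarrow> (real \<Rightarrow> real measure) \<Rightarrow> bool" where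
  "aggregation_solution e T f \<longleftrightarrow>
     (\<forall>t\<in>{0..T}. f t \<in> P2cm) \<and> CE e T f (\<lambda>t. energy_flux (f t))"

end

theory Submission
  imports Defs
begin

text \<open>
  Write \<open>r(v, w) = v - w\<close>, let \<open>Th\<close> be the measure on space-time with
  density the collision kernel with respect to \<open>dt f\<^sub>t(dv) f\<^sub>t(dw)\<close>, and let the optimal flux of the
  curve have density \<open>u\<close> with respect to \<open>f\<^sub>t \<otimes> f\<^sub>t\<close>. The action of the flux is then the squared norm of
  \<open>u\<close> in \<open>L\<^sup>2(Th)\<close>, the dissipation is the squared norm of \<open>r\<close>, and the flux of the aggregation
  equation is the one of density \<open>r\<close>. The chain rule \<open>E(f\<^sub>T) - E(f\<^sub>0) = - \<langle>u, r\<rangle>\<close> turns the De Giorgi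
  functional into \<open>\<parallel>u - r\<parallel>\<^sup>2 / 2\<close>. If it vanishes, then \<open>u = r\<close> and the continuity equation of
  the curve is the aggregation equation. Conversely, for a solution \<open>u\<close> and \<open>r\<close> represent the same
  functional on gradients, and \<open>u\<close> lies in the closure of the gradients, so that
  \<open>\<langle>u - r, u\<rangle> = 0\<close>; the chain rule holds for both fluxes, hence \<open>\<langle>u, r\<rangle> = \<langle>r, r\<rangle>\<close> and
  \<open>u = r\<close> again.

  Most of the work is the existence of the optimal flux, without which the functional, defined by a
  choice among the fluxes with the metric speed, would be arbitrary.

  \<^item> A pair of measures at cost less than \<open>d\<close> can be compared through a solution of the continuity
  equation with action at most \<open>d\<^sup>2\<close>; its flow is tested with functions of linear growth
  (\<open>flow\<close>), which bounds first moments (\<open>mom_dA\<close>, \<open>mom_dA_reverse\<close>) and gives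
  \<open>\<bar>\<integral> \<psi> d\<nu> - \<integral> \<psi> d\<mu>\<bar>\<^sup>2 \<le> d\<^sup>2 (Q + o(1))\<close> with \<open>Q\<close> the Dirichlet form of \<open>\<psi>\<close> at
  \<open>\<mu>\<close> (\<open>dA_test_function\<close>).

  \<^item> Summing these estimates over short time steps shows that \<open>\<phi> \<mapsto> - \<integral>\<integral> \<partial>\<^sub>t \<phi> df\<^sub>t dt\<close> is
  bounded by the norm of the nonlocal gradient of \<open>\<phi>\<close> in \<open>L\<^sup>2(Th)\<close> (\<open>lfun_le\<close>). The Riesz
  representation (\<open>gradient_Riesz\<close>), obtained from a minimizing sequence of gradients, yields \<open>u\<close>
  and gradients converging to it.

  \<^item> The kernel vanishes on the diagonal, so that \<open>u\<close> need not be integrable against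
  \<open>f\<^sub>t \<otimes> f\<^sub>t\<close>. As a limit of increments of functions it is, at almost all times
  (\<open>increments_le_Dirichlet\<close>, \<open>good_integrable\<close>); hence it is the density of a finite flux.

  \<^item> The metric derivative is the norm of \<open>u\<close> at time \<open>t\<close> (\<open>metric_deriv_eq\<close>): running
  along the curve itself bounds it from above, and testing with the gradients that approximate \<open>u\<close>,
  frozen at a Lebesgue point \<open>t\<close>, bounds it from below.
\<close>


abbreviation (input) "LI \<equiv> integral\<^sup>L"
abbreviation (input) "NI \<equiv> nn_integral"
abbreviation (input) "bm \<equiv> borel_measurable"
abbreviation (input) lims :: "(nat => 'a::topological_space) => 'a => bool" (infixr "---->" 60)
  where "X ----> l \<equiv> X \<longlonglongrightarrow> l"
abbreviation (input) "sq f \<equiv> f \<Otimes>\<^sub>M f"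

section \<open>The Jordan decomposition of a finite signed measure\<close>

lemma signed_measure_Un:
assumes "signed_measure M nu" "A : sets M" "B : sets M" "A \<inter> B = {}"
shows "nu (A \<union> B) = nu A + nu B"
proof -
have "range (binaryset A B) \<subseteq> sets M" "disjoint_family (binaryset A B)"
	using assms by (auto simp: binaryset_def disjoint_family_on_def)
then have "(%i. nu (binaryset A B i)) sums nu (\<Union>i. binaryset A B i)"
	using assms(1) unfolding signed_measure_def by blast
moreover have "(%i. nu (binaryset A B i)) sums (nu A + nu B)"
	using assms(1) by (intro binaryset_sums) (simp add: signed_measure_def)
ultimately show ?thesis
	by (simp add: UN_binaryset_eq sums_unique2)
qed

lemma signed_measure_Diff:
assumes "signed_measure M nu" "A : sets M" "B : sets M" "B \<subseteq> A"
shows "nu (A - B) = nu A - nu B"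
using signed_measure_Un[OF assms(1), of "A - B" B] assms
by (simp add: Un_absorb2 Int_commute)

lemma signed_measure_uminus:
assumes "signed_measure M nu" shows "signed_measure M (%A. - nu A)"
using assms unfolding signed_measure_def by (auto intro: sums_minus)

lemma signed_measure_incseq:
assumes nu: "signed_measure M nu" and A: "range A \<subseteq> sets M" "incseq A"
shows "(%i. nu (A i)) ----> nu (\<Union>i. A i)"
proof -
have r: "range (disjointed A) \<subseteq> sets M"
	using A by (intro sets.range_disjointed_sets) auto
then have s: "(%i. nu (disjointed A i)) sums nu (\<Union>i. A i)"
	using nu disjoint_family_disjointed[of A] UN_disjointed_eq[of A]
	unfolding signed_measure_def by metis
have "(\<Sum>i<Suc n. nu (disjointed A i)) = nu (A n)" for n
proof (induction n)
	case (Suc n)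
	have "nu (A (Suc n) - A n) = nu (A (Suc n)) - nu (A n)"
		using A by (intro signed_measure_Diff[OF nu]) (auto simp: incseq_Suc_iff)
	then show ?case using Suc A(2) by (simp add: disjointed_mono incseq_def mono_def)
qed (simp add: disjointed_def)
then show ?thesis
	using LIMSEQ_Suc[OF s[unfolded sums_def]] by simp
qed

lemma signed_measure_decseq:
assumes nu: "signed_measure M nu" and A: "range A \<subseteq> sets M" "decseq A"
shows "(%i. nu (A i)) ----> nu (\<Inter>i. A i)"
proof -
have "(%i. nu (A 0 - A i)) ----> nu (\<Union>i. A 0 - A i)"
	using A by (intro signed_measure_incseq[OF nu]) (auto simp: decseq_def incseq_def)
moreover have "nu (A 0 - A i) = nu (A 0) - nu (A i)" for i
	using A by (intro signed_measure_Diff[OF nu]) (auto simp: decseq_def)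
moreover have "(\<Union>i. A 0 - A i) = A 0 - (\<Inter>i. A i)" by auto
moreover have "nu (A 0 - (\<Inter>i. A i)) = nu (A 0) - nu (\<Inter>i. A i)"
	using A by (intro signed_measure_Diff[OF nu]) auto
ultimately have "(%i. nu (A 0) - nu (A i)) ----> nu (A 0) - nu (\<Inter>i. A i)" by simp
from tendsto_diff[OF tendsto_const[of "nu (A 0)"] this] show ?thesis by simp
qed

text \<open>
  A real-valued signed measure cannot be unbounded: otherwise one could shrink a set of unbounded
  variation again and again to subsets of unbounded variation and ever larger values, against
  continuity from above along the resulting decreasing sequence.
\<close>

lemma signed_measure_bounded:
assumes nu: "signed_measure M nu"
shows "EX K. ALL B:sets M. \<bar>nu B\<bar> <= K"
proof (rule ccontr)
define unb where "unb A \<longleftrightarrow> A : sets M & (ALL K. EX B:sets M. B \<subseteq> A & K < \<bar>nu B\<bar>)" for A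
assume "\<not> ?thesis"
then have unb_top: "unb (space M)"
	unfolding unb_def by (auto simp: not_le) (meson sets.sets_into_space)
have step: "EX B. unb B & B \<subseteq> A & K <= \<bar>nu B\<bar>" if A: "unb A" for A and K :: real
proof -
	obtain B where B: "B : sets M" "B \<subseteq> A" "\<bar>nu A\<bar> + \<bar>K\<bar> < \<bar>nu B\<bar>"
		using A unfolding unb_def by blast
	have As: "A : sets M" using A by (simp add: unb_def)
	have d: "nu (A - B) = nu A - nu B"
		by (intro signed_measure_Diff[OF nu] As B)
	show ?thesis
	proof (cases "unb B")
		case True
		then show ?thesis using B by (intro exI[of _ B]) auto
	next
		case False
		then obtain K1 where K1: "!!C. C : sets M ==> C \<subseteq> B ==> \<bar>nu C\<bar> <= K1"
			using B unfolding unb_def by (meson not_le)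
		have "EX C:sets M. C \<subseteq> A - B & L < \<bar>nu C\<bar>" for L
		proof -
			obtain C where C: "C : sets M" "C \<subseteq> A" "K1 + L < \<bar>nu C\<bar>"
				using A unfolding unb_def by blast
			have "nu C = nu (C \<inter> B) + nu (C - B)"
				using signed_measure_Un[OF nu, of "C \<inter> B" "C - B"] B C
				by (simp add: Int_Diff_Un Diff_triv Int_Diff_disjoint)
			moreover have "\<bar>nu (C \<inter> B)\<bar> <= K1" using B C by (intro K1) auto
			ultimately have "L < \<bar>nu (C - B)\<bar>" using C by linarith
			then show ?thesis using B C by (intro bexI[of _ "C - B"]) auto
		qed
		then have "unb (A - B)" unfolding unb_def using As B by auto
		then show ?thesis using B d by (intro exI[of _ "A - B"]) auto
	qed
qed
have "EX A. ALL n. (unb (A n) & real n <= \<bar>nu (A n)\<bar>) & A (Suc n) \<subseteq> A n"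
proof (rule dependent_nat_choice)
	show "EX A. unb A & real 0 <= \<bar>nu A\<bar>" using unb_top by auto
	show "EX B. (unb B & real (Suc n) <= \<bar>nu B\<bar>) & B \<subseteq> A" if "unb A & real n <= \<bar>nu A\<bar>" for A n
		using step[of A "real (Suc n)"] that by blast
qed
then obtain A where A: "!!n. unb (A n)" "!!n. real n <= \<bar>nu (A n)\<bar>" "!!n. A (Suc n) \<subseteq> A n"
	by blast
have "(%i. nu (A i)) ----> nu (\<Inter>i. A i)"
	using A(1) by (intro signed_measure_decseq[OF nu] decseq_SucI A(3)) (auto simp: unb_def)
then have "Bseq (%i. nu (A i))" using convergent_imp_Bseq convergentI by blast
then obtain K where "!!i. \<bar>nu (A i)\<bar> <= K" unfolding Bseq_def by auto
then have "real i <= K" for i using A(2)[of i] order_trans by blast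
then show False using reals_Archimedean2[of K] by (meson not_le)
qed

lemma ennreal_add_le: "ennreal (a + b) <= ennreal a + ennreal b"
proof (cases "0 <= a & 0 <= b")
case False
then have "ennreal (a + b) <= ennreal (max a b)" by (intro ennreal_leI) auto
then show ?thesis
	by (metis add_increasing add_increasing2 dual_order.trans max_def zero_le)
qed auto

lemma ennreal_sum_le: "ennreal (\<Sum>i<n::nat. f i) <= (\<Sum>i<n. ennreal (f i))"
proof (induction n)
case (Suc n)
have "ennreal (\<Sum>i<Suc n. f i) <= ennreal (\<Sum>i<n. f i) + ennreal (f n)"
	by (simp add: ennreal_add_le)
also have "... <= (\<Sum>i<Suc n. ennreal (f i))" using Suc by (simp add: add_right_mono)
finally show ?case .
qed simp

lemma space_pos_variation [simp]: "space (pos_variation M nu) = space M"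
and sets_pos_variation [simp, measurable_cong]: "sets (pos_variation M nu) = sets M"
by (simp_all add: pos_variation_def)

lemma space_neg_variation [simp]: "space (neg_variation M nu) = space M"
and sets_neg_variation [simp, measurable_cong]: "sets (neg_variation M nu) = sets M"
by (simp_all add: neg_variation_def)

text \<open>
The supremum over subsets is countably additive: nearly optimal subsets of disjoint sets can be joined,
and a subset of a disjoint union is the disjoint union of its traces.
\<close>

lemma emeasure_pos_variation:
assumes nu: "signed_measure M nu" and X: "X : sets M"
shows "emeasure (pos_variation M nu) X = (\<Squnion>B\<in>{B : sets M. B \<subseteq> X}. ennreal (nu B))"
proof -
define pv where "pv A = (\<Squnion>B\<in>{B : sets M. B \<subseteq> A}. ennreal (nu B))" for A
have pv_fun: "pv = (%A. \<Squnion>B\<in>{B : sets M. B \<subseteq> A}. ennreal (nu B))"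
	by (auto simp: pv_def)
have nu0: "nu {} = 0" using nu by (simp add: signed_measure_def)
have upper: "ennreal (nu B) <= pv A" if "B : sets M" "B \<subseteq> A" for A B
	unfolding pv_def using that by (intro SUP_upper) auto
have mono: "pv A <= pv B" if "A \<subseteq> B" for A B
	unfolding pv_def using that by (intro SUP_subset_mono) auto
have super: "pv A + pv B <= pv (A \<union> B)" if AB: "A \<inter> B = {}" for A B
proof -
	have ne: "{C : sets M. C \<subseteq> A} ~= {}" "{C : sets M. C \<subseteq> B} ~= {}" by auto
	have "ennreal (nu C) + ennreal (nu D) <= pv (A \<union> B)"
		if C: "C : sets M" "C \<subseteq> A" and D: "D : sets M" "D \<subseteq> B" for C D
	proof (cases "0 <= nu C & 0 <= nu D")
		case True
		have "nu (C \<union> D) = nu C + nu D" using C D AB by (intro signed_measure_Un[OF nu]) auto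
		then have "ennreal (nu C) + ennreal (nu D) = ennreal (nu (C \<union> D))" using True by simp
		also have "... <= pv (A \<union> B)" using C D by (intro upper) auto
		finally show ?thesis .
	next
		case False
		then have "ennreal (nu C) = 0 | ennreal (nu D) = 0" by (auto simp: ennreal_neg)
		then show ?thesis using upper[of C "A \<union> B"] upper[of D "A \<union> B"] C D
			by (auto simp: le_supI1 le_supI2)
	qed
	note le = this
	have 1: "ennreal (nu C) + pv B <= pv (A \<union> B)" if C: "C : sets M" "C \<subseteq> A" for C
	proof -
		have "ennreal (nu C) + pv B = (\<Squnion>D\<in>{D : sets M. D \<subseteq> B}. ennreal (nu C) + ennreal (nu D))"
			unfolding pv_def[of B] by (rule ennreal_SUP_add_right[OF ne(2)])
		also have "... <= pv (A \<union> B)" using le C by (intro SUP_least) auto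
		finally show ?thesis .
	qed
	have "pv A + pv B = (\<Squnion>C\<in>{C : sets M. C \<subseteq> A}. ennreal (nu C) + pv B)"
		unfolding pv_def[of A] by (rule ennreal_SUP_add_left[OF ne(1), symmetric])
	also have "... <= pv (A \<union> B)" using 1 by (intro SUP_least) auto
	finally show ?thesis .
qed
have fin_super: "(\<Sum>i<n. pv (A i)) <= pv (\<Union>i<n. A i)" if "disjoint_family A" for A :: "nat => _" and n
proof (induction n)
	case (Suc n)
	have "(\<Sum>i<Suc n. pv (A i)) <= pv (\<Union>i<n. A i) + pv (A n)" using Suc by (simp add: add_right_mono)
	also have "... <= pv ((\<Union>i<n. A i) \<union> A n)"
	proof (rule super)
		have "A i \<inter> A n = {}" if "i < n" for i
			using \<open>disjoint_family A\<close> that by (intro disjoint_family_onD[of A UNIV]) auto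
		then show "(\<Union>i<n. A i) \<inter> A n = {}" by auto
	qed
	also have "(\<Union>i<n. A i) \<union> A n = (\<Union>i<Suc n. A i)" by (auto simp: less_Suc_eq)
	finally show ?case .
qed simp
have ca: "countably_additive (sets M) pv"
	unfolding countably_additive_def
proof safe
	fix A :: "nat => 'a set" assume A: "range A \<subseteq> sets M" "disjoint_family A"
	show "(\<Sum>i. pv (A i)) = pv (\<Union> (range A))"
	proof (rule antisym)
		have "(\<Sum>i<n. pv (A i)) <= pv (\<Union> (range A))" for n
			by (rule order_trans[OF fin_super[OF A(2)] mono]) auto
		then show "(\<Sum>i. pv (A i)) <= pv (\<Union> (range A))"
			by (intro suminf_le_const) auto
		show "pv (\<Union> (range A)) <= (\<Sum>i. pv (A i))"
			unfolding pv_def[of "\<Union> (range A)"]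
		proof -
			have "ennreal (nu B) <= (\<Sum>i. pv (A i))" if B: "B : sets M" "B \<subseteq> \<Union> (range A)" for B
			proof -
				have "(%i. nu (B \<inter> A i)) sums nu (\<Union>i. B \<inter> A i)"
				proof -
					have "range (%i. B \<inter> A i) \<subseteq> sets M" "disjoint_family (%i. B \<inter> A i)"
						using A B by (auto simp: disjoint_family_on_def)
					then show ?thesis using nu unfolding signed_measure_def by blast
				qed
				moreover have "(\<Union>i. B \<inter> A i) = B" using B by auto
				ultimately have "(%n. ennreal (\<Sum>i<n. nu (B \<inter> A i))) ----> ennreal (nu B)"
					by (intro tendsto_ennrealI) (simp add: sums_def)
				moreover have "ennreal (\<Sum>i<n. nu (B \<inter> A i)) <= (\<Sum>i. pv (A i))" for n
				proof -
					have "ennreal (\<Sum>i<n. nu (B \<inter> A i)) <= (\<Sum>i<n. ennreal (nu (B \<inter> A i)))"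
						by (rule ennreal_sum_le)
					also have "... <= (\<Sum>i<n. pv (A i))" using A B by (intro sum_mono upper) auto
					also have "... <= (\<Sum>i. pv (A i))" by (intro sum_le_suminf) auto
					finally show ?thesis .
				qed
				ultimately show ?thesis by (intro LIMSEQ_le_const2) auto
			qed
			then show "(\<Squnion>B\<in>{B : sets M. B \<subseteq> \<Union> (range A)}. ennreal (nu B)) <= (\<Sum>i. pv (A i))"
				by (auto intro: SUP_least)
		qed
	qed
qed
have pos: "positive (sets M) pv"
proof -
	have "pv {} <= 0" unfolding pv_def by (rule SUP_least) (use nu0 in auto)
	then show ?thesis by (simp add: positive_def)
qed
have "emeasure (pos_variation M nu) X = pv X"
proof (rule emeasure_measure_of[of "pos_variation M nu" "space M" "sets M" pv])
	show "pos_variation M nu = measure_of (space M) (sets M) pv"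
		unfolding pos_variation_def pv_fun ..
qed (use X pos ca in \<open>simp_all add: sets.space_closed\<close>)
then show ?thesis unfolding pv_def .
qed

lemma finite_pos_variation:
assumes nu: "signed_measure M nu" shows "finite_measure (pos_variation M nu)"
proof
obtain K where K: "!!B. B : sets M ==> \<bar>nu B\<bar> <= K" using signed_measure_bounded[OF nu] by blast
have "emeasure (pos_variation M nu) (space M) <= ennreal K"
	using K by (subst emeasure_pos_variation[OF nu]) (auto intro!: SUP_least ennreal_leI dest: K abs_le_D1)
then show "emeasure (pos_variation M nu) (space (pos_variation M nu)) ~= \<infinity>"
	by (auto simp: top_unique)
qed

lemma finite_neg_variation:
assumes nu: "signed_measure M nu" shows "finite_measure (neg_variation M nu)"
unfolding neg_variation_def by (intro finite_pos_variation signed_measure_uminus nu)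

lemma signed_measure_eq_variations:
assumes nu: "signed_measure M nu" and A: "A : sets M"
shows "nu A = measure (pos_variation M nu) A - measure (neg_variation M nu) A"
proof -
interpret P: finite_measure "pos_variation M nu" by (rule finite_pos_variation[OF nu])
interpret N: finite_measure "neg_variation M nu" by (rule finite_neg_variation[OF nu])
note nu' = signed_measure_uminus[OF nu]
let ?p = "measure (pos_variation M nu) A" and ?n = "measure (neg_variation M nu) A"
have p: "nu B <= ?p" if "B : sets M" "B \<subseteq> A" for B
proof -
	have "ennreal (nu B) <= emeasure (pos_variation M nu) A"
		using that by (subst emeasure_pos_variation[OF nu A]) (auto intro: SUP_upper)
	then show ?thesis by (simp add: P.emeasure_eq_measure)
qed
have n: "- nu B <= ?n" if "B : sets M" "B \<subseteq> A" for B
proof -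
	have "ennreal (- nu B) <= emeasure (neg_variation M nu) A"
		using that unfolding neg_variation_def
		by (subst emeasure_pos_variation[OF nu' A]) (auto intro: SUP_upper)
	then show ?thesis by (simp add: N.emeasure_eq_measure)
qed
have d: "nu (A - B) = nu A - nu B" if "B : sets M" "B \<subseteq> A" for B
	using that by (intro signed_measure_Diff[OF nu] A)
have "0 <= nu A + ?n" using n[of A] A by auto
have "emeasure (pos_variation M nu) A <= ennreal (nu A + ?n)"
proof (subst emeasure_pos_variation[OF nu A], rule SUP_least)
	fix B assume B: "B : {B : sets M. B \<subseteq> A}"
	then have "- nu (A - B) <= ?n" using A by (intro n) auto
	then show "ennreal (nu B) <= ennreal (nu A + ?n)" using d[of B] B by (intro ennreal_leI) auto
qed
then have 1: "?p <= nu A + ?n" using \<open>0 <= nu A + ?n\<close> by (simp add: P.emeasure_eq_measure)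
have "0 <= ?p - nu A" using p[of A] A by auto
have "emeasure (neg_variation M nu) A <= ennreal (?p - nu A)"
	unfolding neg_variation_def
proof (subst emeasure_pos_variation[OF nu' A], rule SUP_least)
	fix B assume B: "B : {B : sets M. B \<subseteq> A}"
	then have "nu (A - B) <= ?p" using A by (intro p) auto
	then show "ennreal (- nu B) <= ennreal (?p - nu A)" using d[of B] B by (intro ennreal_leI) auto
qed
then have "?n <= ?p - nu A" using \<open>0 <= ?p - nu A\<close> by (simp add: N.emeasure_eq_measure)
with 1 show ?thesis by simp
qed

subsection \<open>Sums of measures\<close>

lemma space_add_measure [simp]: "space (add_measure mu nu) = space mu"
and sets_add_measure [simp, measurable_cong]: "sets (add_measure mu nu) = sets mu"
by (simp_all add: add_measure_def)

lemma emeasure_add_measure: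
assumes s: "sets nu = sets mu" and X: "X : sets mu"
shows "emeasure (add_measure mu nu) X = emeasure mu X + emeasure nu X"
proof (rule emeasure_measure_of[OF add_measure_def])
show "countably_additive (sets (add_measure mu nu)) (%A. emeasure mu A + emeasure nu A)"
	unfolding countably_additive_def
proof safe
	fix A :: "nat => 'a set" assume A: "range A \<subseteq> sets (add_measure mu nu)" "disjoint_family A"
	have "(\<Sum>i. emeasure mu (A i) + emeasure nu (A i)) = (\<Sum>i. emeasure mu (A i)) + (\<Sum>i. emeasure nu (A i))"
		by (intro suminf_add[symmetric]) auto
	then show "(\<Sum>i. emeasure mu (A i) + emeasure nu (A i)) = emeasure mu (\<Union> (range A)) + emeasure nu (\<Union> (range A))"
		using A s by (simp add: suminf_emeasure)
qed
qed (use X in \<open>auto simp: positive_def dest: sets.sets_into_space\<close>)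

lemma nn_integral_add_measure:
assumes s: "sets nu = sets mu" and f: "f : bm mu"
shows "(NI (add_measure mu nu) (%x. f x)) = (NI mu (%x. f x)) + (NI nu (%x. f x))"
using f
proof (induction rule: borel_measurable_induct)
case (cong f g)
have "space nu = space mu" using s by (rule sets_eq_imp_space_eq)
then have "integral\<^sup>N nu f = integral\<^sup>N nu g" "integral\<^sup>N mu f = integral\<^sup>N mu g"
	"integral\<^sup>N (add_measure mu nu) f = integral\<^sup>N (add_measure mu nu) g"
	using cong(3) by (auto intro!: nn_integral_cong)
then show ?case using cong by simp
next
case (set A)
then show ?case using s by (simp add: emeasure_add_measure)
next
case (mult u c)
have "u : bm nu" using mult s by (simp cong: measurable_cong_sets)
then show ?case using mult by (simp add: nn_integral_cmult distrib_left)
next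
case (add u v)
have "u : bm nu" "v : bm nu"
	using add s by (simp_all cong: measurable_cong_sets)
then show ?case using add by (simp add: nn_integral_add ac_simps)
next
case (seq U)
have m: "U i : bm nu" "U i : bm (add_measure mu nu)" for i
	using seq s by (simp_all cong: measurable_cong_sets)
have "(NI N (%x. (SUP i. U i) x)) = (SUP i. NI N (%x. U i x))"
	if "!!i. U i : bm N" for N
	using that seq by (simp add: image_comp nn_integral_monotone_convergence_SUP)
moreover have "(SUP i. (NI mu (%x. U i x)) + (NI nu (%x. U i x)))
		= (SUP i. NI mu (%x. U i x)) + (SUP i. NI nu (%x. U i x))"
	using \<open>incseq U\<close> by (intro ennreal_SUP_add) (auto intro!: incseq_nn_integral)
ultimately show ?case using seq m by (simp cong: SUP_cong)
qed

lemma space_total_variation [simp]: "space (total_variation M nu) = space M"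
and sets_total_variation [simp, measurable_cong]: "sets (total_variation M nu) = sets M"
by (simp_all add: total_variation_def)

lemma nn_integral_total_variation:
assumes "f : bm M"
shows "(NI (total_variation M nu) (%x. f x)) =
	(NI (pos_variation M nu) (%x. f x)) + (NI (neg_variation M nu) (%x. f x))"
using assms unfolding total_variation_def
by (intro nn_integral_add_measure) (simp_all cong: measurable_cong_sets)

lemma finite_add_measure:
assumes "finite_measure mu" "finite_measure nu" "sets nu = sets mu"
shows "finite_measure (add_measure mu nu)"
proof
have "space nu = space mu" using assms(3) by (rule sets_eq_imp_space_eq)
then show "emeasure (add_measure mu nu) (space (add_measure mu nu)) ~= \<infinity>"
	using assms finite_measure.emeasure_finite[of mu] finite_measure.emeasure_finite[of nu]
	by (simp add: emeasure_add_measure) 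
qed

lemma finite_total_variation:
assumes "signed_measure M nu" shows "finite_measure (total_variation M nu)"
unfolding total_variation_def
by (intro finite_add_measure finite_pos_variation finite_neg_variation assms) simp

section \<open>Measurable families of signed measures\<close>

lemma abs_signed_measure_le:
assumes nu: "signed_measure M nu" and A: "A : sets M"
shows "\<bar>nu A\<bar> <= measure (total_variation M nu) A"
proof -
interpret P: finite_measure "pos_variation M nu" by (rule finite_pos_variation[OF nu])
interpret N: finite_measure "neg_variation M nu" by (rule finite_neg_variation[OF nu])
interpret T: finite_measure "total_variation M nu" by (rule finite_total_variation[OF nu])
have "emeasure (total_variation M nu) A = emeasure (pos_variation M nu) A + emeasure (neg_variation M nu) A"
	unfolding total_variation_def using A by (intro emeasure_add_measure) auto
then have "measure (total_variation M nu) A = measure (pos_variation M nu) A + measure (neg_variation M nu) A"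
	by (simp add: P.emeasure_eq_measure N.emeasure_eq_measure T.emeasure_eq_measure
			flip: ennreal_plus)
then show ?thesis
	unfolding signed_measure_eq_variations[OF nu A] by (smt (verit) measure_nonneg)
qed

lemma signed_integral_indicator:
assumes nu: "signed_measure M nu" and A: "A : sets M"
shows "signed_integral M nu (indicator A) = nu A"
proof -
have "A \<inter> space M = A" using A sets.sets_into_space by blast
then show ?thesis
	unfolding signed_measure_eq_variations[OF nu A] signed_integral_def using A by simp
qed

lemma signed_integral_tendsto:
assumes nu: "signed_measure M nu"
	and m: "!!n. ph n : bm M" "ps : bm M"
	and lim: "!!x. x : space M ==> (%n. ph n x) ----> ps x"
	and bd: "!!n x. x : space M ==> \<bar>ph n x\<bar> <= (K :: real)"
shows "(%n. signed_integral M nu (ph n)) ----> signed_integral M nu ps"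
proof -
interpret P: finite_measure "pos_variation M nu" by (rule finite_pos_variation[OF nu])
interpret N: finite_measure "neg_variation M nu" by (rule finite_neg_variation[OF nu])
show ?thesis unfolding signed_integral_def
	by (intro tendsto_diff integral_dominated_convergence[where w="%_. K"])
			(use m lim bd in \<open>auto cong: measurable_cong_sets\<close>)
qed

lemma C0I:
fixes ph :: "'a::euclidean_space => real"
assumes c: "continuous_on UNIV ph" and z: "!!x. x ~: S ==> ph x = 0"
	and b: "bounded {x. ph x ~= 0}"
shows "ph : C0 S"
proof -
have "compact {x : S. ep <= \<bar>ph x\<bar>}" if "ep > 0" for ep
proof -
	have "{x : S. ep <= \<bar>ph x\<bar>} = {x. ep <= \<bar>ph x\<bar>}" using z that by force
	moreover have "closed {x. ep <= \<bar>ph x\<bar>}"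
		by (intro closed_Collect_le continuous_intros c)
	moreover have "bounded {x. ep <= \<bar>ph x\<bar>}"
		by (rule bounded_subset[OF b]) (use that in auto)
	ultimately show ?thesis by (simp add: compact_eq_bounded_closed)
qed
then show ?thesis using c unfolding C0_def by (auto intro: continuous_on_subset)
qed

text \<open>Indicators of open sets are increasing limits of continuous functions with compact support.\<close>

lemma open_indicator_approx:
fixes O' :: "'a::euclidean_space set"
assumes O': "open O'" "O' ~= UNIV"
obtains ph :: "nat => 'a => real" where
	"!!n. continuous_on UNIV (ph n)" "!!n x. x ~: O' ==> ph n x = 0" "!!n. bounded {x. ph n x ~= 0}"
	"!!n x. 0 <= ph n x" "!!n x. ph n x <= 1" "!!x. (%n. ph n x) ----> indicator O' x"
proof
define ph :: "nat => 'a => real" where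
	"ph n x = min 1 (real n * infdist x (- O')) * max 0 (min 1 (real n - norm x))" for n x
have ne: "- O' ~= {}" using O' by auto
show "continuous_on UNIV (ph n)" for n
	unfolding ph_def by (intro continuous_intros)
show "ph n x = 0" if "x ~: O'" for n x
	using that by (simp add: ph_def)
show "0 <= ph n x" "ph n x <= 1" for n x
	unfolding ph_def by (auto intro!: mult_nonneg_nonneg mult_le_one infdist_nonneg)
have "{x. ph n x ~= 0} \<subseteq> cball 0 (real n)" for n
	by (auto simp: ph_def)
then show "bounded {x. ph n x ~= 0}" for n using bounded_cball bounded_subset by blast
show "(%n. ph n x) ----> indicator O' x" for x
proof (cases "x : O'")
	case True
	have "infdist x (- O') > 0"
		using True O' ne by (metis Compl_iff closed_Compl in_closed_iff_infdist_zero infdist_nonneg less_eq_real_def)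
	then have "EX n0::nat. ALL n>=n0. 1 <= real n * infdist x (- O')"
	proof -
		assume d: "infdist x (- O') > 0"
		obtain n0 :: nat where "1 / infdist x (- O') <= real n0" using real_arch_simple by blast
		then have "1 <= real n * infdist x (- O')" if "n >= n0" for n
			using d that by (smt (verit) divide_le_eq of_nat_mono)
		then show ?thesis by blast
	qed
	then obtain n0 where n0: "!!n. n >= n0 ==> 1 <= real n * infdist x (- O')" by blast
	obtain n1 :: nat where n1: "norm x + 1 <= real n1" using real_arch_simple by blast
	have "ph n x = 1" if "n >= max n0 n1" for n
	proof -
		have "real n1 <= real n" "n0 <= n" using that by auto
		then have "1 <= real n - norm x" "1 <= real n * infdist x (- O')" using n0[of n] n1 by auto
		then show ?thesis unfolding ph_def by simp
	qed
	then have "eventually (%n. ph n x = 1) sequentially"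
		using eventually_sequentially by blast
	then show ?thesis using True by (simp add: tendsto_eventually)
qed (simp add: ph_def)
qed

text \<open>
Integrals of functions in \<open>C0\<close> determine the values on open sets, as limits, and a Dynkin argument
extends measurability in the parameter from these to all Borel sets.
\<close>

lemma measurable_signed_measure_family:
fixes S :: "'a::euclidean_space set"
assumes S: "open S" "S ~= UNIV"
	and U: "!!t. t : space N ==> signed_measure (restrict_space borel S) (U t)"
	and m: "!!ph. ph : C0 S ==>
		(%t. signed_integral (restrict_space borel S) (U t) ph) : bm N"
	and A: "A : sets (restrict_space borel S)"
shows "(%t. U t A) : bm N"
proof -
let ?R = "restrict_space borel S"
have inS: "S \<inter> B : sets ?R" if "B : sets borel" for B
	using that S by (auto simp: sets_restrict_space)
have spS: "space ?R = S" by (simp add: space_restrict_space)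
have open_case: "(%t. U t (S \<inter> B)) : bm N" if B: "open B" for B
proof -
	have "open (S \<inter> B)" "S \<inter> B ~= UNIV" using S B by auto
	from open_indicator_approx[OF this] obtain ph :: "nat => 'a => real" where ph:
		"!!n. continuous_on UNIV (ph n)" "!!n x. x ~: S \<inter> B ==> ph n x = 0" "!!n. bounded {x. ph n x ~= 0}"
		"!!n x. 0 <= ph n x" "!!n x. ph n x <= 1" "!!x. (%n. ph n x) ----> indicator (S \<inter> B) x" by blast
	have mph: "ph n : bm ?R" for n
		using ph(1) by (intro measurable_restrict_space1 borel_measurable_continuous_onI)
	have "(%n. signed_integral ?R (U t) (ph n)) ----> U t (S \<inter> B)" if t: "t : space N" for t
		unfolding signed_integral_indicator[OF U[OF t] inS[OF borel_open[OF B]], symmetric]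
		by (rule signed_integral_tendsto[OF U[OF t] mph, where K=1])
				(use ph(4-6) inS[OF borel_open[OF B]] in \<open>auto\<close>)
	moreover have "(%t. signed_integral ?R (U t) (ph n)) : bm N" for n
		using ph(1-3) by (intro m C0I) auto
	ultimately show ?thesis by (rule borel_measurable_LIMSEQ_real)
qed
have "(%t. U t (S \<inter> B)) : bm N" if B: "B : sigma_sets UNIV {O'. open O'}" for B
proof -
	have ss: "sigma_sets UNIV {O' :: 'a set. open O'} = sets borel"
		by (simp add: sets_borel)
	have Int: "Int_stable {O' :: 'a set. open O'}" by (auto simp: Int_stable_def)
	have subset_Pow: "{O' :: 'a set. open O'} \<subseteq> Pow UNIV" by auto
	show ?thesis
		using Int subset_Pow B
	proof (induction rule: sigma_sets_induct_disjoint)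
		case (basic B) then show ?case by (intro open_case) auto
	next
		case empty
		have "U t {} = 0" if "t : space N" for t using U[OF that] by (simp add: signed_measure_def)
		then show ?case by (simp cong: measurable_cong)
	next
		case (compl B)
		have "U t (S \<inter> (UNIV - B)) = U t (S \<inter> UNIV) - U t (S \<inter> B)" if "t : space N" for t
		proof -
			have "S \<inter> (UNIV - B) = S \<inter> UNIV - S \<inter> B" by blast
			moreover have "B : sets borel" using compl unfolding ss by simp
			ultimately show ?thesis
				using signed_measure_Diff[OF U[OF that] inS[of UNIV] inS[of B]] by simp
		qed
		moreover have "(%t. U t (S \<inter> UNIV) - U t (S \<inter> B)) : bm N"
			using compl open_case[of UNIV] by (intro borel_measurable_diff) auto
		ultimately show ?case by (simp cong: measurable_cong)
	next
		case (union B)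
		have "(%i. U t (S \<inter> B i)) sums U t (S \<inter> (\<Union>i. B i))" if "t : space N" for t
		proof -
			have "range (%i. S \<inter> B i) \<subseteq> sets ?R" "disjoint_family (%i. S \<inter> B i)"
				using union inS unfolding ss by (auto simp: disjoint_family_on_def)
			moreover have "(\<Union>i. S \<inter> B i) = S \<inter> (\<Union>i. B i)" by auto
			ultimately show ?thesis using U[OF that] unfolding signed_measure_def by metis
		qed
		then have "U t (S \<inter> (\<Union>i. B i)) = (\<Sum>i. U t (S \<inter> B i))" if "t : space N" for t
			using that by (simp add: sums_iff)
		moreover have "(%t. \<Sum>i. U t (S \<inter> B i)) : bm N"
			using union by (intro borel_measurable_suminf) auto
		ultimately show ?case by (simp cong: measurable_cong)
	qed
qed
then have "(%t. U t (S \<inter> B)) : bm N" if "B : sets borel" for B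
	using that by (simp add: sets_borel)
moreover obtain B where "B : sets borel" "A = S \<inter> B"
	using A by (auto simp: sets_restrict_space)
ultimately show ?thesis by simp
qed

text \<open>
  The supremum in the Jordan decomposition may be taken over a countable family of sets, the
  same for all signed measures: by outer regularity a Borel set can be replaced by an open one, and
  an open set is an increasing union of finite unions of basic sets.
\<close>

lemma emeasure_pos_variation_countable:
fixes S :: "'a::euclidean_space set"
assumes \<B>: "countable \<B>" "topological_basis \<B>" and S: "open S"
	and nu: "signed_measure (restrict_space borel S) nu" and C: "C : sets (restrict_space borel S)"
shows "emeasure (pos_variation (restrict_space borel S) nu) C =
	(\<Squnion>A\<in>Union ` {F. F \<subseteq> \<B> & finite F}. ennreal (nu (A \<inter> C)))" (is "_ = ?sup")
proof (rule antisym)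
let ?R = "restrict_space borel S"
have C': "C : sets borel" "C \<subseteq> S" using C S by (auto simp: sets_restrict_space_iff)
have sR: "A : sets ?R \<longleftrightarrow> A : sets borel & A \<subseteq> S" for A
	using S by (auto simp: sets_restrict_space_iff)
have oB: "open b" if "b : \<B>" for b using \<B>(2) that by (rule topological_basis_open)
show "?sup <= emeasure (pos_variation ?R nu) C"
proof (rule SUP_least)
	fix A assume "A : Union ` {F. F \<subseteq> \<B> & finite F}"
	then have "open A" using oB by auto
	then have "A \<inter> C : sets ?R" using C' by (auto simp: sR)
	then show "ennreal (nu (A \<inter> C)) <= emeasure (pos_variation ?R nu) C"
		unfolding emeasure_pos_variation[OF nu C] by (intro SUP_upper) auto
qed
show "emeasure (pos_variation ?R nu) C <= ?sup"
	unfolding emeasure_pos_variation[OF nu C]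
proof (rule SUP_least)
	fix B assume "B : {B : sets ?R. B \<subseteq> C}"
	then have B: "B : sets borel" "B \<subseteq> C" by (auto simp: sR)
	interpret T: finite_measure "total_variation ?R nu" by (rule finite_total_variation[OF nu])
	define ta where "ta = distr (total_variation ?R nu) borel (%x. x)"
	have meas: "(%x. x) : measurable (total_variation ?R nu) borel"
		by (simp add: measurable_restrict_space1 cong: measurable_cong_sets)
	have sp: "space (total_variation ?R nu) = S" by (simp add: space_restrict_space)
	have emta: "emeasure ta X = emeasure (total_variation ?R nu) (X \<inter> S)" if "X : sets borel" for X
		unfolding ta_def using that meas sp by (simp add: emeasure_distr)
	have finta: "emeasure ta X ~= \<infinity>" if "X : sets borel" for X
		using emta[OF that] T.emeasure_finite by simp
	show "ennreal (nu B) <= ?sup"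
	proof (rule ennreal_le_epsilon)
		fix ep :: real assume ep: "0 < ep"
		have "emeasure ta B = (INF V\<in>{V. B \<subseteq> V & open V}. emeasure ta V)"
			using finta[of UNIV] B by (intro outer_regular) (auto simp: ta_def)
		moreover have "emeasure ta B < emeasure ta B + ennreal ep"
			using finta[OF B(1)] ep by (simp add: ennreal_add_left_cancel_less less_top
					ennreal_less_zero_iff)
		ultimately obtain V where V: "B \<subseteq> V" "open V" "emeasure ta V < emeasure ta B + ennreal ep"
			by (auto simp: INF_less_iff)
		have VC: "V \<inter> C : sets ?R" using V C' by (auto simp: sR)
		have BR: "B : sets ?R" using B C' by (auto simp: sR)
		have VCB: "V \<inter> C - B : sets ?R" using VC BR by auto
		have "measure (total_variation ?R nu) (V \<inter> C - B) <= ep"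
		proof -
			have "emeasure ta B + emeasure ta (V - B) = emeasure ta V"
				using V B by (subst plus_emeasure) (auto simp: ta_def Un_absorb1)
			then have "emeasure ta (V - B) < ennreal ep"
				using V(3) finta[OF B(1)] by (metis ennreal_add_left_cancel_less infinity_ennreal_def)
			moreover have "emeasure (total_variation ?R nu) (V \<inter> C - B) <= emeasure ta (V - B)"
				using V B C' borel_open[OF S] by (subst emta) (auto intro!: emeasure_mono simp: sR)
			ultimately have "ennreal (measure (total_variation ?R nu) (V \<inter> C - B)) <= ennreal ep"
				by (simp add: T.emeasure_eq_measure)
			then show ?thesis using ep by (simp add: ennreal_le_iff)
		qed
		then have "\<bar>nu (V \<inter> C - B)\<bar> <= ep"
			using abs_signed_measure_le[OF nu VCB] by linarith
		moreover have "nu (V \<inter> C - B) = nu (V \<inter> C) - nu B"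
			using V B by (intro signed_measure_Diff[OF nu VC BR]) auto
		ultimately have "nu B <= nu (V \<inter> C) + ep" by linarith
		then have "ennreal (nu B) <= ennreal (nu (V \<inter> C)) + ennreal ep"
			using ennreal_add_le ennreal_leI order_trans by blast
		moreover have "ennreal (nu (V \<inter> C)) <= ?sup"
		proof (cases "V = {}")
			case True
			then show ?thesis using nu by (simp add: signed_measure_def)
		next
			case False
			obtain F where F: "F \<subseteq> \<B>" "V = \<Union>F" using \<B>(2) V(2) unfolding topological_basis_def by blast
			have "F ~= {}" "countable F" using False F \<B>(1) countable_subset by auto
			then have rF: "range (from_nat_into F) = F" by (simp add: range_from_nat_into)
			define A where "A n = (\<Union>i\<le>n. from_nat_into F i)" for n :: nat
			have "(\<Union>n. A n) = V"
			proof -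
				have "(\<Union>n. A n) = \<Union> (range (from_nat_into F))" unfolding A_def by auto
				then show ?thesis using rF F(2) by simp
			qed
			then have VA: "(\<Union>n. A n \<inter> C) = V \<inter> C" by auto
			have oA: "open (A n)" for n
				unfolding A_def using rF F(1) oB by (metis open_UN range_eqI subsetD)
			have "(%n. nu (A n \<inter> C)) ----> nu (\<Union>n. A n \<inter> C)"
			proof (rule signed_measure_incseq[OF nu])
				show "range (%n. A n \<inter> C) \<subseteq> sets ?R" using oA C' by (auto simp: sR)
				show "incseq (%n. A n \<inter> C)" unfolding A_def incseq_def by force
			qed
			then have "(%n. ennreal (nu (A n \<inter> C))) ----> ennreal (nu (V \<inter> C))"
				unfolding VA by (rule tendsto_ennrealI)
			moreover have "ennreal (nu (A n \<inter> C)) <= ?sup" for n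
			proof (rule SUP_upper)
				have "from_nat_into F i : \<B>" for i using rF F(1) by auto
				then show "A n : Union ` {F. F \<subseteq> \<B> & finite F}"
					unfolding A_def by (intro image_eqI[of _ _ "from_nat_into F ` {..n}"]) auto
			qed
			ultimately show ?thesis by (intro LIMSEQ_le_const2) auto
		qed
		ultimately show "ennreal (nu B) <= ?sup + ennreal ep"
			using add_right_mono order_trans by blast
	qed
qed
qed

lemma measurable_nn_integral_pos_variation:
fixes S :: "'a::euclidean_space set"
assumes S: "open S" "S ~= UNIV"
	and U: "!!t. t : space N ==> signed_measure (restrict_space borel S) (U t)"
	and m: "!!ph. ph : C0 S ==>
		(%t. signed_integral (restrict_space borel S) (U t) ph) : bm N"
	and h: "h : bm (restrict_space borel S)"
shows "(%t. NI (pos_variation (restrict_space borel S) (U t)) (%x. h x)) : bm N"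
using h
proof (induction rule: borel_measurable_induct)
case (cong f g)
have "(NI (pos_variation (restrict_space borel S) (U t)) (%x. f x)) =
	(NI (pos_variation (restrict_space borel S) (U t)) (%x. g x))" for t
	using cong by (intro nn_integral_cong) auto
then show ?case using cong by simp
next
case (set A)
obtain \<B> :: "'a set set" where \<B>: "countable \<B>" "topological_basis \<B>"
	using ex_countable_basis by blast
have [simp]: "A \<inter> B : sets (restrict_space borel S)" if "open B" for B
	using set that S by (auto simp: sets_restrict_space_iff)
have "(%t. \<Squnion>B\<in>Union ` {F. F \<subseteq> \<B> & finite F}. ennreal (U t (B \<inter> A))) : bm N"
proof (rule borel_measurable_SUP)
	show "countable (Union ` {F. F \<subseteq> \<B> & finite F})"
		using countable_Collect_finite_subset[OF \<B>(1)] by (simp add: conj_commute)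
	fix B assume "B : Union ` {F. F \<subseteq> \<B> & finite F}"
	then have "open B" using topological_basis_open[OF \<B>(2)] by auto
	then have "B \<inter> A : sets (restrict_space borel S)" by (simp add: Int_commute)
	then show "(%t. ennreal (U t (B \<inter> A))) : bm N"
		by (intro measurable_compose[OF _ measurable_ennreal]
				measurable_signed_measure_family[OF S U m]) auto
qed
also have "?this \<longleftrightarrow> ?case"
	by (intro measurable_cong)
			(simp add: set emeasure_pos_variation_countable[OF \<B> S(1) U set])
finally show ?case .
next
case (mult u c) then show ?case by (simp add: nn_integral_cmult cong: measurable_cong_sets)
next
case (add u v)
have "(NI (pos_variation (restrict_space borel S) (U t)) (%x. v x + u x)) =
		(NI (pos_variation (restrict_space borel S) (U t)) (%x. v x)) +
		(NI (pos_variation (restrict_space borel S) (U t)) (%x. u x))" for t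
	using add by (intro nn_integral_add) (auto cong: measurable_cong_sets)
then show ?case using add by simp
next
case (seq F)
have "(NI (pos_variation (restrict_space borel S) (U t)) (%x. (SUP i. F i) x)) =
		(SUP i. NI (pos_variation (restrict_space borel S) (U t)) (%x. F i x))" for t
	using seq by (simp add: image_comp, intro nn_integral_monotone_convergence_SUP)
		(auto cong: measurable_cong_sets)
then show ?case using seq by simp
qed

lemma measurable_nn_integral_neg_variation:
fixes S :: "'a::euclidean_space set"
assumes S: "open S" "S ~= UNIV"
	and U: "!!t. t : space N ==> signed_measure (restrict_space borel S) (U t)"
	and m: "!!ph. ph : C0 S ==>
		(%t. signed_integral (restrict_space borel S) (U t) ph) : bm N"
	and h: "h : bm (restrict_space borel S)"
shows "(%t. NI (neg_variation (restrict_space borel S) (U t)) (%x. h x)) : bm N"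
unfolding neg_variation_def
proof (rule measurable_nn_integral_pos_variation[OF S signed_measure_uminus[OF U] _ h])
fix ph :: "'a => real" assume "ph : C0 S"
have "signed_integral (restrict_space borel S) (%A. - U t A) ph =
	- signed_integral (restrict_space borel S) (U t) ph" for t
	by (simp add: signed_integral_def neg_variation_def)
then show "(%t. signed_integral (restrict_space borel S) (%A. - U t A) ph) : bm N"
	using m[OF \<open>ph \<in> C0 S\<close>] by simp
qed

lemma measurable_integral_of_nn_integrals:
fixes h :: "'a => real"
assumes h: "h : bm M" and s: "!!t. t : space N ==> sets (K t) = sets M"
	and m: "!!g :: 'a => ennreal. g : bm M ==> (%t. NI (K t) (%x. g x)) : bm N"
shows "(%t. LI (K t) (%x. h x)) : bm N"
proof -
have eq: "(LI (K t) (%x. h x)) = (if (NI (K t) (%x. ennreal \<bar>h x\<bar>)) < \<infinity>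
		then enn2real (NI (K t) (%x. ennreal (h x))) - enn2real (NI (K t) (%x. ennreal (- h x))) else 0)"
	if t: "t : space N" for t
proof (cases "integrable (K t) h")
	case True
	then show ?thesis by (auto simp: real_lebesgue_integral_def integrable_iff_bounded)
next
	case False
	moreover have "h : bm (K t)" using h s[OF t] by (simp cong: measurable_cong_sets)
	ultimately show ?thesis by (auto simp: integrable_iff_bounded not_integrable_integral_eq)
qed
have "(%t. if (NI (K t) (%x. ennreal \<bar>h x\<bar>)) < \<infinity>
		then enn2real (NI (K t) (%x. ennreal (h x))) - enn2real (NI (K t) (%x. ennreal (- h x))) else 0)
		: bm N"
	using h by (intro measurable_If borel_measurable_diff measurable_compose[OF _ borel_measurable_enn2real]
			m borel_measurable_less measurable_const pred_intros_logic) (auto intro!: borel_measurable_less m)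
then show ?thesis using eq by (simp cong: measurable_cong)
qed

lemma measurable_signed_integral:
fixes S :: "'a::euclidean_space set" and h :: "'a => real"
assumes S: "open S" "S ~= UNIV"
	and U: "!!t. t : space N ==> signed_measure (restrict_space borel S) (U t)"
	and m: "!!ph. ph : C0 S ==>
		(%t. signed_integral (restrict_space borel S) (U t) ph) : bm N"
	and h: "h : bm (restrict_space borel S)"
shows "(%t. signed_integral (restrict_space borel S) (U t) h) : bm N"
unfolding signed_integral_def
by (intro borel_measurable_diff measurable_integral_of_nn_integrals[OF h]
		measurable_nn_integral_pos_variation[OF S U m] measurable_nn_integral_neg_variation[OF S U m]) auto

section \<open>Fluxes with a density and their action\<close>

lemma signed_measure_set_integral:
fixes u :: "'a => real"
assumes u: "integrable N u" and s: "sets N = sets M"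
shows "signed_measure M (%A. set_lebesgue_integral N A u)"
	and "A : sets M ==> set_lebesgue_integral N A u =
		measure (density N (%x. ennreal (u x))) A - measure (density N (%x. ennreal (- u x))) A"
	and "finite_measure (density N (%x. ennreal (u x)))"
proof -
have fin: "finite_measure (density N (%x. ennreal (v x)))" if "integrable N v" for v :: "'a => real"
proof
	have "(NI N (%x. ennreal (v x))) <= (NI N (%x. ennreal (norm (v x))))"
		by (intro nn_integral_mono ennreal_leI) auto
	also have "... < \<infinity>" using that by (simp add: integrable_iff_bounded)
	finally show "emeasure (density N (%x. ennreal (v x))) (space (density N (%x. ennreal (v x)))) ~= \<infinity>"
		using that by (subst emeasure_density) (auto simp: nn_integral_set_ennreal cong: nn_integral_cong)
qed
show "finite_measure (density N (%x. ennreal (u x)))" by (rule fin[OF u])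
interpret P: finite_measure "density N (%x. ennreal (u x))" by (rule fin[OF u])
interpret Q: finite_measure "density N (%x. ennreal (- u x))" using fin[of "%x. - u x"] u by simp
have eq: "set_lebesgue_integral N A u =
		measure (density N (%x. ennreal (u x))) A - measure (density N (%x. ennreal (- u x))) A"
	if A: "A : sets M" for A
proof -
	have A': "A : sets N" using A s by simp
	have m: "u : bm N" using u by simp
	have i: "integrable N (%x. indicator A x * u x)" 
		using integrable_real_mult_indicator[OF A' u] by (simp add: mult.commute)
	have "(NI N (%x. ennreal (indicator A x * u x))) = (NI N (%x. ennreal (u x) * indicator A x))"
				"(NI N (%x. ennreal (- (indicator A x * u x)))) = (NI N (%x. ennreal (- u x) * indicator A x))"
		by (auto intro!: nn_integral_cong simp: indicator_def)
	then show ?thesis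
		unfolding set_lebesgue_integral_def using real_lebesgue_integral_def[OF i] A' m
		by (simp add: measure_def emeasure_density)
qed
then show "A : sets M ==> set_lebesgue_integral N A u =
		measure (density N (%x. ennreal (u x))) A - measure (density N (%x. ennreal (- u x))) A" .
show "signed_measure M (%A. set_lebesgue_integral N A u)"
	unfolding signed_measure_def
proof safe
	show "set_lebesgue_integral N {} u = 0" by (simp add: set_lebesgue_integral_def)
	fix A :: "nat => 'a set" assume A: "range A \<subseteq> sets M" "disjoint_family A"
	have "(%i. measure (density N (%x. ennreal (u x))) (A i) - measure (density N (%x. ennreal (- u x))) (A i)) sums
		(measure (density N (%x. ennreal (u x))) (\<Union>i. A i) - measure (density N (%x. ennreal (- u x))) (\<Union>i. A i))"
		using A s by (intro sums_diff P.finite_measure_UNION Q.finite_measure_UNION) auto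
	moreover have "A i : sets M" "(\<Union>i. A i) : sets M" for i using A by auto
	ultimately show "(%i. set_lebesgue_integral N (A i) u) sums set_lebesgue_integral N (\<Union> (range A)) u"
		by (simp add: eq)
qed
qed

lemma pos_variation_set_integral:
fixes u :: "'a => real"
assumes u: "integrable N u" and s: "sets N = sets M"
shows "pos_variation M (%A. set_lebesgue_integral N A u) = density N (%x. ennreal (u x))"
proof (rule measure_eqI)
show "sets (pos_variation M (%A. set_lebesgue_integral N A u)) = sets (density N (%x. ennreal (u x)))"
	using s by simp
note sm = signed_measure_set_integral[OF u s]
interpret P: finite_measure "density N (%x. ennreal (u x))" by (rule sm(3))
fix A assume "A : sets (pos_variation M (%A. set_lebesgue_integral N A u))"
then have A: "A : sets M" by simp
have A': "A : sets N" using A s by simp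
have m[measurable]: "u : bm N" using u by simp
show "emeasure (pos_variation M (%A. set_lebesgue_integral N A u)) A = emeasure (density N (%x. ennreal (u x))) A"
	unfolding emeasure_pos_variation[OF sm(1) A]
proof (rule antisym)
	show "(\<Squnion>B\<in>{B : sets M. B \<subseteq> A}. ennreal (set_lebesgue_integral N B u)) <= emeasure (density N (%x. ennreal (u x))) A"
	proof (rule SUP_least)
		fix B assume "B : {B : sets M. B \<subseteq> A}"
		then have B: "B : sets M" "B \<subseteq> A" by auto
		have "set_lebesgue_integral N B u <= measure (density N (%x. ennreal (u x))) B"
			by (simp add: sm(2)[OF B(1)])
		also have "... <= measure (density N (%x. ennreal (u x))) A"
			using A' B by (intro P.finite_measure_mono) auto
		finally show "ennreal (set_lebesgue_integral N B u) <= emeasure (density N (%x. ennreal (u x))) A"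
			by (simp add: P.emeasure_eq_measure ennreal_leI)
	qed
	define B where "B = {x : A. 0 < u x}"
	have "B = A \<inter> {x : space N. 0 < u x}" using sets.sets_into_space[OF A'] by (auto simp: B_def)
	moreover have "{x : space N. 0 < u x} : sets N" by measurable
	ultimately have B: "B : sets N" using A' by simp
	have "emeasure (density N (%x. ennreal (- u x))) B = 0"
	proof -
		have "ennreal (- u x) * indicator B x = 0" for x by (auto simp: B_def indicator_def ennreal_neg)
		then have "(NI N (%x. ennreal (- u x) * indicator B x)) = (NI N (%x. 0))"
			by (rule nn_integral_cong)
		then show ?thesis using B by (subst emeasure_density) simp_all
	qed
	moreover have "emeasure (density N (%x. ennreal (u x))) B = emeasure (density N (%x. ennreal (u x))) A"
		using A' B by (subst (1 2) emeasure_density)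
			(auto simp: B_def indicator_def ennreal_neg not_less intro!: nn_integral_cong)
	ultimately have "set_lebesgue_integral N B u = measure (density N (%x. ennreal (u x))) A"
		using sm(2)[of B] B s by (simp add: measure_def)
	then have "emeasure (density N (%x. ennreal (u x))) A = ennreal (set_lebesgue_integral N B u)"
		by (simp add: P.emeasure_eq_measure)
	also have "... <= (\<Squnion>B\<in>{B : sets M. B \<subseteq> A}. ennreal (set_lebesgue_integral N B u))"
		using B s by (intro SUP_upper) (auto simp: B_def)
	finally show "emeasure (density N (%x. ennreal (u x))) A <=
			(\<Squnion>B\<in>{B : sets M. B \<subseteq> A}. ennreal (set_lebesgue_integral N B u))" .
qed
qed

lemma neg_variation_set_integral:
fixes u :: "'a => real"
assumes u: "integrable N u" and s: "sets N = sets M"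
shows "neg_variation M (%A. set_lebesgue_integral N A u) = density N (%x. ennreal (- u x))"
proof -
have "neg_variation M (%A. set_lebesgue_integral N A u) =
		pos_variation M (%A. set_lebesgue_integral N A (%x. - u x))"
	by (simp add: neg_variation_def set_lebesgue_integral_def)
then show ?thesis using pos_variation_set_integral[of N "%x. - u x" M] u s by simp
qed

lemma signed_integral_set_integral:
fixes u h :: "'a => real"
assumes u: "integrable N u" and s: "sets N = sets M" and h: "h : bm M"
	and hu: "integrable N (%x. h x * u x)"
shows "signed_integral M (%A. set_lebesgue_integral N A u) h = (LI N (%x. h x * u x))"
proof -
have m[measurable]: "u : bm N" "h : bm N"
	using u h s by (simp_all cong: measurable_cong_sets)
have "(LI (density N (%x. ennreal (v x))) (%x. h x)) = (LI N (%x. max 0 (v x) * h x))"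
	if "v : bm N" for v
proof -
	have "density N (%x. ennreal (v x)) = density N (%x. ennreal (max 0 (v x)))"
		by (intro arg_cong[where f="density N"] ext) (simp add: max_def ennreal_neg)
	then have "(LI (density N (%x. ennreal (v x))) (%x. h x)) = (LI (density N (%x. ennreal (max 0 (v x)))) (%x. h x))"
		by simp
	also have "... = (LI N (%x. max 0 (v x) *\<^sub>R h x))"
		using that m by (intro integral_density) auto
	finally show ?thesis by simp
qed
moreover have "integrable N (%x. max 0 (u x) * h x)" "integrable N (%x. max 0 (- u x) * h x)"
proof -
	have bd: "norm (max 0 v * w) <= norm (w * v)" for v w :: real
		unfolding real_norm_def abs_mult by (subst mult.commute, intro mult_left_mono) auto
	show "integrable N (%x. max 0 (u x) * h x)"
	proof (rule Bochner_Integration.integrable_bound[OF hu])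
		show "AE x in N. norm (max 0 (u x) * h x) <= norm (h x * u x)"
			using bd[of "u x" "h x" for x] by (intro AE_I2) simp
	qed simp
	show "integrable N (%x. max 0 (- u x) * h x)"
	proof (rule Bochner_Integration.integrable_bound[OF hu])
		show "AE x in N. norm (max 0 (- u x) * h x) <= norm (h x * u x)"
			using bd[of "- u x" "h x" for x] by (intro AE_I2) simp
	qed simp
qed
ultimately have "signed_integral M (%A. set_lebesgue_integral N A u) h =
		(LI N (%x. max 0 (u x) * h x - max 0 (- u x) * h x))"
	using m by (simp add: signed_integral_def pos_variation_set_integral[OF u s] neg_variation_set_integral[OF u s])
also have "... = (LI N (%x. h x * u x))"
	by (intro Bochner_Integration.integral_cong) (auto simp: max_def)
finally show ?thesis .
qed

lemma nn_integral_total_variation_set_integral: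
fixes u :: "'a => real"
assumes u: "integrable N u" and s: "sets N = sets M" and h: "h : bm M"
shows "(NI (total_variation M (%A. set_lebesgue_integral N A u)) (%x. h x)) = (NI N (%x. h x * ennreal \<bar>u x\<bar>))"
proof -
have m[measurable]: "u : bm N" "h : bm N"
	using u h s by (simp_all cong: measurable_cong_sets)
have "(NI (total_variation M (%A. set_lebesgue_integral N A u)) (%x. h x)) =
		(NI N (%x. ennreal (u x) * h x)) + (NI N (%x. ennreal (- u x) * h x))"
	using m by (simp add: nn_integral_total_variation[OF h] pos_variation_set_integral[OF u s]
		neg_variation_set_integral[OF u s] nn_integral_density)
also have "... = (NI N (%x. ennreal (u x) * h x + ennreal (- u x) * h x))"
	by (rule nn_integral_add[symmetric]) auto
also have "... = (NI N (%x. h x * ennreal \<bar>u x\<bar>))"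
	by (intro nn_integral_cong) (auto simp: abs_if ennreal_neg mult.commute)
finally show ?thesis .
qed

subsection \<open>The off-diagonal plane\<close>

lemma open_offdiag: "open offdiag"
proof -
have "offdiag = {z. fst z ~= snd z}" by (auto simp: offdiag_def)
then show ?thesis
	using open_Collect_neq[of "fst :: real \<times> real => real" snd] by (simp add: continuous_on_fst continuous_on_snd)
qed

lemma offdiag_neq_UNIV: "offdiag ~= UNIV"
by (auto simp: offdiag_def)

lemma sets_offdiag [measurable]: "offdiag : sets borel"
using open_offdiag by (rule borel_open)

lemma kernel_measurable [measurable]: "kernel e : bm borel"
unfolding sigma_e_def borel_prod[symmetric] by measurable

lemma kernel_nonneg: "e < 1 ==> 0 <= kernel e z"
by (cases z) (simp add: sigma_e_def)

lemma kernel_pos: "e < 1 ==> z : offdiag ==> 0 < kernel e z"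
by (cases z) (simp add: sigma_e_def offdiag_def)

lemma kernel_eq: "kernel e z = (1 - e) / 4 * \<bar>fst z - snd z\<bar>"
by (cases z) (simp add: sigma_e_def)

lemma sets_pair_borel: "sets f = sets (borel :: real measure) ==> sets (sq f) = sets borel"
by (metis borel_prod sets_pair_measure_cong)

lemma space_tensor: "sets f = sets borel ==> space (tensor f) = offdiag"
using sets_eq_imp_space_eq[OF sets_pair_borel] by (simp add: tensor_def space_restrict_space)

lemma sets_tensor: "sets f = sets borel ==> sets (tensor f) = sets offdiag_borel"
unfolding tensor_def by (intro sets_restrict_space_cong sets_pair_borel)

lemma measurable_offdiag_borel: "h : bm borel ==> h : bm offdiag_borel"
by (rule measurable_restrict_space1)

lemma measurable_tensor: "sets f = sets borel ==> h : bm borel ==> h : bm (tensor f)"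
using measurable_offdiag_borel[of h] measurable_cong_sets[OF sets_tensor[of f] refl] by blast

lemma prob_space_pair_self: "prob_space f ==> prob_space (sq f)"
by (intro prob_space_pair)

lemma finite_tensor: 
assumes "real_distribution f" shows "finite_measure (tensor f)"
proof -
interpret real_distribution f by fact
interpret P: prob_space "f \<Otimes>\<^sub>M f" by (rule prob_space_pair_self) unfold_locales
show ?thesis unfolding tensor_def
	using sets_pair_borel[of f] by (intro finite_measure_restrict_space P.finite_measure_axioms) simp
qed

text \<open>The kernel vanishes on the diagonal, so that restricting to the off-diagonal plane is immaterial.\<close>

lemma nn_integral_tensor:
assumes f: "sets f = sets borel" and z: "!!x. x ~: offdiag ==> h x = 0"
shows "(NI (tensor f) (%x. h x)) = (NI (sq f) (%x. h x))"
proof -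
have "offdiag : sets (sq f)" using sets_pair_borel[OF f] by simp
then have "(NI (tensor f) (%x. h x)) = (NI (sq f) (%x. h x * indicator offdiag x))"
	unfolding tensor_def by (intro nn_integral_restrict_space) (simp add: sets.Int_space_eq2)
also have "... = (NI (sq f) (%x. h x))"
	using z by (intro nn_integral_cong) (auto simp: indicator_def)
finally show ?thesis .
qed

lemma integral_tensor:
fixes h :: "real \<times> real => real"
assumes f: "sets f = sets borel" and z: "!!x. x ~: offdiag ==> h x = 0"
shows "(LI (tensor f) (%x. h x)) = (LI (sq f) (%x. h x))"
	and "integrable (tensor f) h \<longleftrightarrow> integrable (sq f) h"
proof -
have O': "offdiag \<inter> space (sq f) : sets (sq f)" using sets_pair_borel[OF f] by simp
have eq: "(%x. indicator offdiag x *\<^sub>R h x) = h" proof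
	show "indicator offdiag x *\<^sub>R h x = h x" for x
		using z[of x] by (cases "x : offdiag") simp_all
qed
show "(LI (tensor f) (%x. h x)) = (LI (sq f) (%x. h x))"
	unfolding tensor_def using integral_restrict_space[OF O', of h] eq by simp
show "integrable (tensor f) h \<longleftrightarrow> integrable (sq f) h"
	unfolding tensor_def using integrable_restrict_space[OF O', of h] eq by simp
qed

subsection \<open>The action\<close>

definition dens_flux :: "real measure => (real \<times> real => real) => (real \<times> real) set => real" where
"dens_flux f u A = set_lebesgue_integral (tensor f) A u"

lemma
assumes f: "real_distribution f" and u: "integrable (tensor f) u"
shows signed_measure_dens_flux: "signed_measure offdiag_borel (dens_flux f u)"
	and signed_integral_dens_flux: "!!h. h : bm borel ==> integrable (tensor f) (%z. h z * u z) ==>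
		signed_integral offdiag_borel (dens_flux f u) h = (LI (tensor f) (%z. h z * u z))"
	and nn_integral_total_variation_dens_flux: "!!h. h : bm borel ==>
		(NI (total_variation offdiag_borel (dens_flux f u)) (%z. h z)) = (NI (tensor f) (%z. h z * ennreal \<bar>u z\<bar>))"
proof -
have s: "sets f = sets borel" using f by (simp add: real_distribution_def real_distribution_axioms_def)
note s = sets_tensor[OF s]
show "signed_measure offdiag_borel (dens_flux f u)"
	unfolding dens_flux_def[abs_def] by (rule signed_measure_set_integral[OF u s])
show "signed_integral offdiag_borel (dens_flux f u) h = (LI (tensor f) (%z. h z * u z))"
	if "h : bm borel" "integrable (tensor f) (%z. h z * u z)" for h
	unfolding dens_flux_def[abs_def] by (intro signed_integral_set_integral u s that measurable_offdiag_borel)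
show "(NI (total_variation offdiag_borel (dens_flux f u)) (%z. h z)) = (NI (tensor f) (%z. h z * ennreal \<bar>u z\<bar>))"
	if "h : bm borel" for h :: "_ => ennreal"
	unfolding dens_flux_def[abs_def]
	by (intro nn_integral_total_variation_set_integral u s that measurable_offdiag_borel)
qed

text \<open>
With respect to the reference measure in the definition of the action, the density of the flux is
\<open>u\<close> times the density \<open>s\<close> of \<open>f \<otimes> f\<close>, and \<open>(u s)\<^sup>2 / s = u\<^sup>2 s\<close>.
\<close>

lemma action_dens_flux:
assumes e: "e < 1" and f: "real_distribution f" and u: "integrable (tensor f) u"
shows "action e f (dens_flux f u) = (NI (tensor f) (%z. ennreal (kernel e z * (u z)^2)))"
proof -
have s: "sets f = sets borel" using f by (simp add: real_distribution_def real_distribution_axioms_def)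
note st = sets_tensor[OF s]
interpret T: finite_measure "tensor f" by (rule finite_tensor[OF f])
define La where "La = add_measure (tensor f) (total_variation offdiag_borel (dens_flux f u))"
have [measurable]: "u : bm (tensor f)" using u by simp
have [measurable]: "kernel e : bm (tensor f)" by (rule measurable_tensor[OF s]) simp
have sig: "signed_measure offdiag_borel (dens_flux f u)" by (rule signed_measure_dens_flux[OF f u])
interpret L: finite_measure La unfolding La_def
	using st by (intro finite_add_measure T.finite_measure_axioms finite_total_variation sig) simp
have La: "La = density (tensor f) (%z. ennreal (1 + \<bar>u z\<bar>))"
proof (rule measure_eqI)
	fix A assume "A : sets La"
	then have A: "A : sets (tensor f)" by (simp add: La_def)
	then have iA: "indicator A : bm offdiag_borel" using st by simp
	have "emeasure La A = emeasure (tensor f) A + emeasure (total_variation offdiag_borel (dens_flux f u)) A"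
		unfolding La_def using A st by (intro emeasure_add_measure) auto
	also have "emeasure (total_variation offdiag_borel (dens_flux f u)) A =
			(NI (total_variation offdiag_borel (dens_flux f u)) (%z. indicator A z))"
		using A st by simp
	also have "... = (NI (tensor f) (%z. indicator A z * ennreal \<bar>u z\<bar>))"
		unfolding dens_flux_def[abs_def]
		by (intro nn_integral_total_variation_set_integral u st iA)
	also have "emeasure (tensor f) A + ... = (NI (tensor f) (%z. indicator A z + indicator A z * ennreal \<bar>u z\<bar>))"
		using A by (subst nn_integral_add) auto
	also have "... = (NI (tensor f) (%z. ennreal (1 + \<bar>u z\<bar>) * indicator A z))"
		by (intro nn_integral_cong) (auto simp: indicator_def)
	finally show "emeasure La A = emeasure (density (tensor f) (%z. ennreal (1 + \<bar>u z\<bar>))) A"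
		using A by (simp add: emeasure_density)
qed (simp add: La_def)
have rn: "AE z in La. RN_deriv La (density (tensor f) (%z. ennreal (v z))) z = ennreal (v z / (1 + \<bar>u z\<bar>))"
	if [measurable]: "v : bm (tensor f)" for v
proof -
	have "density La (%z. ennreal (v z / (1 + \<bar>u z\<bar>))) = density (tensor f) (%z. ennreal (v z))"
		unfolding La
	proof (subst density_density_eq, goal_cases)
		case 3
		have "ennreal (1 + \<bar>u z\<bar>) * ennreal (v z / (1 + \<bar>u z\<bar>)) = ennreal (v z)" for z
		proof -
			have "1 + \<bar>u z\<bar> ~= 0" using abs_ge_zero[of "u z"] by linarith
			then show ?thesis by (subst ennreal_mult'[symmetric]) auto
		qed
		then show ?case by simp
	qed auto
	moreover have "(%z. ennreal (v z / (1 + \<bar>u z\<bar>))) : bm La"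
		unfolding La by simp
	ultimately have "AE z in La. ennreal (v z / (1 + \<bar>u z\<bar>)) = RN_deriv La (density (tensor f) (%z. ennreal (v z))) z"
		by (intro L.RN_deriv_unique)
	then show ?thesis by eventually_elim (rule sym)
qed
have d1: "density (tensor f) (%z. ennreal 1) = tensor f" by (simp add: density_1)
have rn1: "AE z in La. RN_deriv La (tensor f) z = ennreal (1 / (1 + \<bar>u z\<bar>))"
	using rn[of "%_. 1"] unfolding d1 by simp
have rn2: "AE z in La. RN_deriv La (pos_variation offdiag_borel (dens_flux f u)) z = ennreal (u z / (1 + \<bar>u z\<bar>))"
	using rn[of u] unfolding dens_flux_def[abs_def] pos_variation_set_integral[OF u st] by simp
have rn3: "AE z in La. RN_deriv La (neg_variation offdiag_borel (dens_flux f u)) z = ennreal (- u z / (1 + \<bar>u z\<bar>))"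
	using rn[of "%z. - u z"] unfolding dens_flux_def[abs_def] neg_variation_set_integral[OF u st] by simp
have "action e f (dens_flux f u) = (NI La (%z. alpha (1 / (1 + \<bar>u z\<bar>)) (u z / (1 + \<bar>u z\<bar>)) * ennreal (kernel e z)))"
	unfolding action_def Let_def La_def[symmetric] signed_RN_deriv_def
proof (rule nn_integral_cong_AE, use rn1 rn2 rn3 in eventually_elim)
	case (elim z)
	have "enn2real (ennreal (u z / (1 + \<bar>u z\<bar>))) - enn2real (ennreal (- u z / (1 + \<bar>u z\<bar>))) = u z / (1 + \<bar>u z\<bar>)"
		by (cases "0 <= u z") (auto simp: ennreal_neg divide_nonpos_pos)
	then show ?case unfolding elim by simp
qed
also have "... = (NI La (%z. ennreal ((u z)^2 / (1 + \<bar>u z\<bar>) * kernel e z)))"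
proof (rule nn_integral_cong)
	fix z
	have p: "0 < 1 + \<bar>u z\<bar>" by simp
	have "alpha (1 / (1 + \<bar>u z\<bar>)) (u z / (1 + \<bar>u z\<bar>)) = ennreal ((u z)^2 / (1 + \<bar>u z\<bar>))"
	proof -
		have "(x / y)^2 / (1 / y) = x^2 / y" if "0 < y" for x y :: real
			using that by (simp add: power2_eq_square field_simps)
		then show ?thesis using p by (auto simp: alpha_def)
	qed
	then show "alpha (1 / (1 + \<bar>u z\<bar>)) (u z / (1 + \<bar>u z\<bar>)) * ennreal (kernel e z)
			= ennreal ((u z)^2 / (1 + \<bar>u z\<bar>) * kernel e z)"
		using kernel_nonneg[OF e, of z] by (simp only: ennreal_mult'')
qed
also have "... = (NI (tensor f) (%z. ennreal (1 + \<bar>u z\<bar>) * ennreal ((u z)^2 / (1 + \<bar>u z\<bar>) * kernel e z)))"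
	unfolding La by (intro nn_integral_density) auto
also have "... = (NI (tensor f) (%z. ennreal (kernel e z * (u z)^2)))"
proof (rule nn_integral_cong)
	fix z
	have p: "1 + \<bar>u z\<bar> ~= 0" using abs_ge_zero[of "u z"] by linarith
	have "(1 + \<bar>u z\<bar>) * ((u z)^2 / (1 + \<bar>u z\<bar>) * kernel e z) = kernel e z * (u z)^2"
		using p by simp
	then show "ennreal (1 + \<bar>u z\<bar>) * ennreal ((u z)^2 / (1 + \<bar>u z\<bar>) * kernel e z) = ennreal (kernel e z * (u z)^2)"
		by (subst ennreal_mult'[symmetric]) (simp_all add: mult.commute)
qed
finally show ?thesis .
qed

text \<open>
  Cauchy--Schwarz against the action: with respect to the common reference measure
  \<open>La\<close>, a flux density \<open>u\<close> and a density \<open>s\<close> of \<open>f \<otimes> f\<close> satisfy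
  \<open>2 |h u| \<le> \<lambda> u\<^sup>2/s + h\<^sup>2 s/\<lambda>\<close>, where the convention for \<open>s = 0\<close> makes the inequality true.
\<close>

lemma signed_integral_le_action:
assumes e: "e < 1" and f: "real_distribution f" and nu: "signed_measure offdiag_borel nu"
	and h[measurable]: "h : bm borel"
	and fin: "(NI (total_variation offdiag_borel nu) (%z. ennreal (kernel e z * \<bar>h z\<bar>))) < \<infinity>"
	and Q: "(NI (tensor f) (%z. ennreal (kernel e z * (h z)^2))) <= ennreal q" "0 < q"
	and a: "action e f nu <= ennreal a" "0 <= a"
shows "(signed_integral offdiag_borel nu (%z. kernel e z * h z))^2 <= a * q"
proof -
let ?R = "offdiag_borel"
have s: "sets f = sets borel" using f by (simp add: real_distribution_def real_distribution_axioms_def)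
note st = sets_tensor[OF s]
interpret T: finite_measure "tensor f" by (rule finite_tensor[OF f])
interpret P: finite_measure "pos_variation ?R nu" by (rule finite_pos_variation[OF nu])
interpret N: finite_measure "neg_variation ?R nu" by (rule finite_neg_variation[OF nu])
define La where "La = add_measure (tensor f) (total_variation ?R nu)"
interpret L: finite_measure La unfolding La_def
	using st by (intro finite_add_measure T.finite_measure_axioms finite_total_variation nu) simp
have sL: "sets La = sets ?R" using st by (simp add: La_def)
have em: "emeasure La A = emeasure (tensor f) A + (emeasure (pos_variation ?R nu) A + emeasure (neg_variation ?R nu) A)"
	if "A : sets La" for A
	using that st unfolding La_def total_variation_def by (simp add: emeasure_add_measure)
have ac: "absolutely_continuous La (tensor f)" "absolutely_continuous La (pos_variation ?R nu)"
	"absolutely_continuous La (neg_variation ?R nu)"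
	unfolding absolutely_continuous_def using st sL by (auto simp: null_sets_def em)
define S where "S z = enn2real (RN_deriv La (tensor f) z)" for z
define p where "p z = enn2real (RN_deriv La (pos_variation ?R nu) z)" for z
define n where "n z = enn2real (RN_deriv La (neg_variation ?R nu) z)" for z
have dens: "density La (%z. ennreal (enn2real (RN_deriv La K z))) = K"
	if "absolutely_continuous La K" "finite_measure K" "sets K = sets La" for K
proof -
	interpret K: finite_measure K by fact
	have "AE z in La. RN_deriv La K z ~= \<infinity>"
		using that by (intro L.RN_deriv_finite K.sigma_finite_measure_axioms) auto
	then have "density La (%z. ennreal (enn2real (RN_deriv La K z))) = density La (RN_deriv La K)"
		by (intro density_cong) (auto simp: less_top)
	then show ?thesis using L.density_RN_deriv that by simp
qed
have [measurable]: "S : bm La" "p : bm La" "n : bm La"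
	unfolding S_def[abs_def] p_def[abs_def] n_def[abs_def] by measurable
have nonneg: "0 <= S z" "0 <= p z" "0 <= n z" for z by (simp_all add: S_def p_def n_def)
have dS: "density La (%z. ennreal (S z)) = tensor f"
	unfolding S_def using dens[OF ac(1) T.finite_measure_axioms] st sL by simp
have dp: "density La (%z. ennreal (p z)) = pos_variation ?R nu"
	unfolding p_def using dens[OF ac(2) P.finite_measure_axioms] sL by simp
have dn: "density La (%z. ennreal (n z)) = neg_variation ?R nu"
	unfolding n_def using dens[OF ac(3) N.finite_measure_axioms] sL by simp
have mL: "g : bm La" if "g : bm borel" for g :: "_ => real"
	using measurable_offdiag_borel[OF that] sL by (simp cong: measurable_cong_sets)
have [measurable]: "h : bm La" "kernel e : bm La" by (simp_all add: mL)
have mk: "(%z. kernel e z * h z) : bm borel" by measurable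
define k where "k z = kernel e z * h z" for z
have [measurable]: "k : bm La" unfolding k_def[abs_def] by measurable
have absk: "\<bar>k z\<bar> = kernel e z * \<bar>h z\<bar>" for z
	using kernel_nonneg[OF e, of z] by (simp add: k_def abs_mult)
have "(NI (pos_variation ?R nu) (%z. ennreal \<bar>k z\<bar>)) + (NI (neg_variation ?R nu) (%z. ennreal \<bar>k z\<bar>)) < \<infinity>"
	using fin unfolding absk by (subst nn_integral_total_variation[symmetric])
		(auto intro!: measurable_offdiag_borel)
then have fk: "(NI (pos_variation ?R nu) (%z. ennreal \<bar>k z\<bar>)) < \<infinity>" "(NI (neg_variation ?R nu) (%z. ennreal \<bar>k z\<bar>)) < \<infinity>"
	by auto
have ip: "integrable La (%z. p z * k z)"
	using fk(1) unfolding dp[symmetric]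
	by (simp add: nn_integral_density integrable_iff_bounded abs_mult ennreal_mult nonneg)
have "integrable La (%z. n z * k z)"
	using fk(2) unfolding dn[symmetric]
	by (simp add: nn_integral_density integrable_iff_bounded abs_mult ennreal_mult nonneg)
note ik = ip this
define I where "I = signed_integral ?R nu (%z. kernel e z * h z)"
have "I = (LI La (%z. p z * k z)) - (LI La (%z. n z * k z))"
	unfolding I_def signed_integral_def k_def[symmetric] dp[symmetric] dn[symmetric]
	by (simp add: integral_density nonneg)
then have I: "I = (LI La (%z. (p z - n z) * k z))" using ik by (simp add: left_diff_distrib)
have act: "action e f nu = (NI La (%z. alpha (S z) (p z - n z) * ennreal (kernel e z)))"
	unfolding action_def Let_def La_def[symmetric] signed_RN_deriv_def S_def p_def n_def ..
have [measurable]: "(%z. alpha (S z) (p z - n z)) : bm La"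
	unfolding alpha_def by measurable
have key: "2 * \<bar>I\<bar> <= c * a + q / c" if c: "0 < c" for c :: real
proof -
	have pt: "ennreal (2 * \<bar>(p z - n z) * k z\<bar>) <=
			ennreal c * (alpha (S z) (p z - n z) * ennreal (kernel e z)) + ennreal (S z) * ennreal (kernel e z * (h z)^2 / c)" for z
	proof (cases "p z - n z = 0 | k z = 0")
		case False
		then have kz: "0 < kernel e z" using kernel_nonneg[OF e, of z] by (auto simp: k_def less_le)
		show ?thesis
		proof (cases "S z > 0")
			case True
			let ?d = "\<bar>p z - n z\<bar>"
			have "2 * (?d * \<bar>h z\<bar>) <= c * (?d^2 / S z) + S z * (\<bar>h z\<bar>^2 / c)"
			proof -
				have "0 <= (c * ?d - S z * \<bar>h z\<bar>)^2 / (c * S z)" using c True by simp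
				also have "... = c * (?d^2 / S z) + S z * (\<bar>h z\<bar>^2 / c) - 2 * (?d * \<bar>h z\<bar>)"
					using c True by (simp add: power2_diff field_simps power2_eq_square)
				finally show ?thesis by simp
			qed
			then have "kernel e z * (2 * (?d * \<bar>h z\<bar>)) <= kernel e z * (c * (?d^2 / S z) + S z * (\<bar>h z\<bar>^2 / c))"
				using kz by (intro mult_left_mono) auto
			moreover have "kernel e z * (2 * (?d * \<bar>h z\<bar>)) = 2 * \<bar>(p z - n z) * k z\<bar>"
				by (simp only: abs_mult absk ac_simps)
			moreover have "kernel e z * (c * (?d^2 / S z) + S z * (\<bar>h z\<bar>^2 / c)) =
					c * ((p z - n z)^2 / S z * kernel e z) + S z * (kernel e z * (h z)^2 / c)"
				by (simp add: distrib_left ac_simps)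
			ultimately have "2 * \<bar>(p z - n z) * k z\<bar> <= c * ((p z - n z)^2 / S z * kernel e z) + S z * (kernel e z * (h z)^2 / c)"
				by simp
			then have "ennreal (2 * \<bar>(p z - n z) * k z\<bar>) <=
					ennreal (c * ((p z - n z)^2 / S z * kernel e z) + S z * (kernel e z * (h z)^2 / c))"
				by (rule ennreal_leI)
			also have "... = ennreal c * (ennreal ((p z - n z)^2 / S z) * ennreal (kernel e z)) + ennreal (S z) * ennreal (kernel e z * (h z)^2 / c)"
			proof -
				have "ennreal (c * ((p z - n z)^2 / S z * kernel e z)) = ennreal c * (ennreal ((p z - n z)^2 / S z) * ennreal (kernel e z))"
					using c kz by (subst ennreal_mult', simp, subst ennreal_mult'', simp_all)
				moreover have "ennreal (S z * (kernel e z * (h z)^2 / c)) = ennreal (S z) * ennreal (kernel e z * (h z)^2 / c)"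
					using True by (intro ennreal_mult') simp
				ultimately show ?thesis using c kz True by (subst ennreal_plus) auto
			qed
			finally show ?thesis using False True by (simp add: alpha_def)
		next
			case S0: False
			then have "alpha (S z) (p z - n z) = \<infinity>" using False by (simp add: alpha_def)
			then have "ennreal c * (alpha (S z) (p z - n z) * ennreal (kernel e z)) = \<infinity>"
				using c kz by (simp add: ennreal_top_mult ennreal_mult_top)
			then show ?thesis by simp
		qed
	qed (auto simp: k_def)
	have "ennreal \<bar>I\<bar> <= (NI La (%z. ennreal \<bar>(p z - n z) * k z\<bar>))"
		unfolding I using integral_norm_bound_ennreal[of La "%z. (p z - n z) * k z"] ik
		by (simp add: left_diff_distrib)
	then have "ennreal (2 * \<bar>I\<bar>) <= 2 * (NI La (%z. ennreal \<bar>(p z - n z) * k z\<bar>))"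
		by (simp add: ennreal_mult mult_left_mono)
	also have "... = (NI La (%z. ennreal (2 * \<bar>(p z - n z) * k z\<bar>)))"
		by (subst nn_integral_cmult[symmetric]) (auto simp: ennreal_mult)
	also have "... <= (NI La (%z. ennreal c * (alpha (S z) (p z - n z) * ennreal (kernel e z)) + ennreal (S z) * ennreal (kernel e z * (h z)^2 / c)))"
		by (intro nn_integral_mono pt)
	also have "... = ennreal c * action e f nu + (NI La (%z. ennreal (S z) * ennreal (kernel e z * (h z)^2 / c)))"
		unfolding act by (subst nn_integral_add) (auto simp: nn_integral_cmult)
	also have "(NI La (%z. ennreal (S z) * ennreal (kernel e z * (h z)^2 / c))) =
			(NI (tensor f) (%z. ennreal (kernel e z * (h z)^2 / c)))"
		unfolding dS[symmetric] by (intro nn_integral_density[symmetric]) auto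
	also have "... = (NI (tensor f) (%z. ennreal (1 / c) * ennreal (kernel e z * (h z)^2)))"
		using c kernel_nonneg[OF e] by (intro nn_integral_cong) (simp add: ennreal_mult'[symmetric])
	also have "... = ennreal (1 / c) * (NI (tensor f) (%z. ennreal (kernel e z * (h z)^2)))"
		by (intro nn_integral_cmult measurable_compose[OF measurable_tensor[OF s] measurable_ennreal]) measurable
	also have "ennreal c * action e f nu + ... <= ennreal c * ennreal a + ennreal (1 / c) * ennreal q"
		using Q a by (intro add_mono mult_left_mono) auto
	also have "... = ennreal (c * a + q / c)"
		using c Q a by (simp add: ennreal_mult'[symmetric] ennreal_plus[symmetric] del: ennreal_plus)
	finally have "ennreal (2 * \<bar>I\<bar>) <= ennreal (c * a + q / c)" .
	moreover have "0 <= c * a + q / c" using c Q a by simp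
	ultimately show ?thesis by (simp only: ennreal_le_iff)
qed
show ?thesis
proof (cases "I = 0")
	case True
	then show ?thesis using Q a by (simp add: I_def)
next
	case False
	have "2 * \<bar>I\<bar> <= q / \<bar>I\<bar> * a + q / (q / \<bar>I\<bar>)" using False Q by (intro key) auto
	then have "\<bar>I\<bar> <= q / \<bar>I\<bar> * a" using Q False by simp
	then have "\<bar>I\<bar> * \<bar>I\<bar> <= q * a" using False by (simp add: field_simps)
	then show ?thesis by (simp add: I_def power2_eq_square mult.commute)
qed
qed

section \<open>Truncations and Cauchy--Schwarz\<close>

lemma DERIV_pos_part_squared:
"((%x::real. (max 0 x)^2) has_real_derivative 2 * max 0 x) (at x)"
proof -
consider "x < 0" | "x > 0" | "x = 0" by linarith
then show ?thesis
proof cases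
	case 1
	have "((%x::real. 0) has_real_derivative 2 * max 0 x) (at x)" using 1 by simp
	then show ?thesis
		by (rule has_field_derivative_transform_within_open[where S="{..<0}"]) (use 1 in auto)
next
	case 2
	have "((%x::real. x^2) has_real_derivative 2 * max 0 x) (at x)"
		using 2 by (auto intro!: derivative_eq_intros)
	then show ?thesis
		by (rule has_field_derivative_transform_within_open[where S="{0<..}"]) (use 2 in auto)
next
	case 3
	have "((%h::real. (max 0 h)^2 / h) \<longlongrightarrow> 0) (at 0)"
	proof (rule Lim_null_comparison)
		show "eventually (%h::real. norm ((max 0 h)^2 / h) <= \<bar>h\<bar>) (at 0)"
			by (auto simp: eventually_at max_def power2_eq_square intro!: exI[of _ 1])
		show "((%h::real. \<bar>h\<bar>) \<longlongrightarrow> 0) (at 0)" by (auto intro!: tendsto_eq_intros)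
	qed
	then show ?thesis unfolding 3 by (simp add: has_field_derivative_iff)
qed
qed

lemma DERIV_pos_part_squared_affine [derivative_intros]:
assumes "(g has_real_derivative g') (at x within S)"
shows "((%x::real. (max 0 (g x))^2) has_real_derivative 2 * max 0 (g x) * g') (at x within S)"
using DERIV_chain2[OF DERIV_pos_part_squared[of "g x"] assms] .

text \<open>A \<open>C\<^sup>1\<close> transition from 0 to 1 on the unit interval, made of three parabolas.\<close>

definition sstep :: "real => real" where
"sstep x = 2 * (max 0 x)^2 - 4 * (max 0 (x - 1/2))^2 + 2 * (max 0 (x - 1))^2"

definition sstep' :: "real => real" where
"sstep' x = 4 * max 0 x - 8 * max 0 (x - 1/2) + 4 * max 0 (x - 1)"

lemma DERIV_sstep: "(sstep has_real_derivative sstep' x) (at x)"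
unfolding sstep_def[abs_def] sstep'_def by (auto intro!: derivative_eq_intros)

lemma DERIV_sstep_comp [derivative_intros]:
"(g has_real_derivative g') (at x within S) ==>
	((%x. sstep (g x)) has_real_derivative sstep' (g x) * g') (at x within S)"
using DERIV_chain2[OF DERIV_sstep] .

lemma continuous_on_sstep' [continuous_intros]:
"continuous_on S g ==> continuous_on S (%x. sstep' (g x))"
unfolding sstep'_def by (intro continuous_intros)

lemma sstep_0: "x <= 0 ==> sstep x = 0"
by (simp add: sstep_def)

lemma sstep_1: "1 <= x ==> sstep x = 1"
by (simp add: sstep_def power2_eq_square algebra_simps)

lemma sstep'_0: "x <= 0 | 1 <= x ==> sstep' x = 0"
by (auto simp: sstep'_def)

lemma sstep'_bounds: "0 <= sstep' x" "sstep' x <= 2"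
by (auto simp: sstep'_def max_def)

lemma sstep_bounds: "0 <= sstep x" "sstep x <= 1"
proof -
have mono: "sstep x <= sstep y" if "x <= y" for x y
	using that by (rule DERIV_nonneg_imp_nondecreasing) (use DERIV_sstep sstep'_bounds in blast)
show "0 <= sstep x" using mono[of "min x 0" x] sstep_0[of "min x 0"] by simp
show "sstep x <= 1" using mono[of x "max x 1"] sstep_1[of "max x 1"] by simp
qed

definition cutoff :: "nat => real => real" where
"cutoff n v = 1 - sstep (v / (1 + real n) - 1) - sstep (- v / (1 + real n) - 1)"

definition cutoff' :: "nat => real => real" where
"cutoff' n v = (sstep' (- v / (1 + real n) - 1) - sstep' (v / (1 + real n) - 1)) / (1 + real n)"

lemma DERIV_cutoff: "(cutoff n has_real_derivative cutoff' n v) (at v)"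
proof -
have "((%v. sstep (v / (1 + real n) - 1)) has_real_derivative sstep' (v / (1 + real n) - 1) * (1 / (1 + real n))) (at v)"
	by (rule DERIV_sstep_comp) (auto intro!: derivative_eq_intros)
moreover have "((%v. sstep (- v / (1 + real n) - 1)) has_real_derivative sstep' (- v / (1 + real n) - 1) * (- 1 / (1 + real n))) (at v)"
	by (rule DERIV_sstep_comp) (auto intro!: derivative_eq_intros)
ultimately have "((%v. 1 - sstep (v / (1 + real n) - 1) - sstep (- v / (1 + real n) - 1)) has_real_derivative
		0 - sstep' (v / (1 + real n) - 1) * (1 / (1 + real n)) - sstep' (- v / (1 + real n) - 1) * (- 1 / (1 + real n))) (at v)"
	by (intro DERIV_diff DERIV_const)
moreover have "0 - sstep' (v / (1 + real n) - 1) * (1 / (1 + real n)) - sstep' (- v / (1 + real n) - 1) * (- 1 / (1 + real n)) = cutoff' n v"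
	by (simp add: cutoff'_def diff_divide_distrib)
ultimately show ?thesis unfolding cutoff_def[abs_def] by simp
qed

lemma continuous_on_cutoff': "continuous_on S (cutoff' n)"
unfolding cutoff'_def[abs_def] by (intro continuous_intros) auto

lemma cutoff_eq_1: "\<bar>v\<bar> <= real n ==> cutoff n v = 1"
and cutoff'_eq_0: "\<bar>v\<bar> <= real n ==> cutoff' n v = 0"
proof -
assume "\<bar>v\<bar> <= real n"
then have "v / (1 + real n) - 1 <= 0" "- v / (1 + real n) - 1 <= 0" by (auto simp: field_simps)
then show "cutoff n v = 1" "cutoff' n v = 0"
	unfolding cutoff_def cutoff'_def by (simp_all add: sstep_0 sstep'_0)
qed

lemma cutoff_bounds: "0 <= cutoff n v" "cutoff n v <= 1"
proof -
show "cutoff n v <= 1" unfolding cutoff_def using sstep_bounds[of "v / (1 + real n) - 1"]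
	sstep_bounds[of "- v / (1 + real n) - 1"] by linarith
consider "v / (1 + real n) - 1 <= 0" | "- v / (1 + real n) - 1 <= 0" by (cases "v <= 0") (auto simp: field_simps)
then show "0 <= cutoff n v"
	by cases (simp_all add: cutoff_def sstep_0 sstep_bounds)
qed

lemma cutoff_eq_0: "2 * (1 + real n) <= \<bar>v\<bar> ==> cutoff n v = 0"
and cutoff'_outside: "2 * (1 + real n) <= \<bar>v\<bar> ==> cutoff' n v = 0"
proof -
assume a: "2 * (1 + real n) <= \<bar>v\<bar>"
have "1 <= v / (1 + real n) - 1 & - v / (1 + real n) - 1 <= 0 | 1 <= - v / (1 + real n) - 1 & v / (1 + real n) - 1 <= 0"
	using a by (cases "0 <= v") (auto simp: field_simps)
then show "cutoff n v = 0" "cutoff' n v = 0"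
	unfolding cutoff_def cutoff'_def by (auto simp: sstep_0 sstep_1 sstep'_0)
qed

lemma cutoff'_bound: "\<bar>cutoff' n v\<bar> <= 2 / (1 + real n)"
proof -
have "\<bar>sstep' (- v / (1 + real n) - 1) - sstep' (v / (1 + real n) - 1)\<bar> <= 2"
	using sstep'_bounds[of "- v / (1 + real n) - 1"] sstep'_bounds[of "v / (1 + real n) - 1"] by linarith
then show ?thesis unfolding cutoff'_def by (simp add: divide_right_mono)
qed

lemma cutoff_tendsto: "(%n. cutoff n v) ----> 1" and cutoff'_tendsto: "(%n. cutoff' n v) ----> 0"
proof -
have "eventually (%n. \<bar>v\<bar> <= real n) sequentially"
	using filterlim_real_sequentially by (auto simp: filterlim_at_top)
then show "(%n. cutoff n v) ----> 1" "(%n. cutoff' n v) ----> 0"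
	by (auto intro!: tendsto_eventually elim!: eventually_mono simp: cutoff_eq_1 cutoff'_eq_0)
qed

lemma product_in_C1c:
assumes et: "!!t. (et has_real_derivative et' t) (at t)" "continuous_on UNIV et'"
	and ps: "!!v. (ps has_real_derivative ps' v) (at v)" "continuous_on UNIV ps'"
	and et0: "0 < a" "b < T" "!!t. t ~: {a..b} ==> et t = 0"
	and ps0: "!!v. R < \<bar>v\<bar> ==> ps v = 0"
shows "(%(t, v). et t * ps v) : C1c T"
proof -
define D :: "real \<times> real => (real \<times> real) \<Rightarrow>\<^sub>L real" where
	"D x = (et' (fst x) * ps (snd x)) *\<^sub>R Blinfun fst + (et (fst x) * ps' (snd x)) *\<^sub>R Blinfun snd" for x
have cet: "continuous_on UNIV et" using et(1) by (meson DERIV_isCont continuous_at_imp_continuous_on)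
have cps: "continuous_on UNIV ps" using ps(1) by (meson DERIV_isCont continuous_at_imp_continuous_on)
have "((%(t, v). et t * ps v) has_derivative blinfun_apply (D x)) (at x)" for x
proof -
	have 1: "((%x. et (fst x)) has_derivative (%h. et' (fst x) * fst h)) (at x)"
		using et(1)[of "fst x"] unfolding has_field_derivative_def
		by (rule has_derivative_compose[OF has_derivative_fst[OF has_derivative_ident]])
	have 2: "((%x. ps (snd x)) has_derivative (%h. ps' (snd x) * snd h)) (at x)"
		using ps(1)[of "snd x"] unfolding has_field_derivative_def
		by (rule has_derivative_compose[OF has_derivative_snd[OF has_derivative_ident]])
	have "blinfun_apply (D x) = (%h. et (fst x) * (ps' (snd x) * snd h) + et' (fst x) * fst h * ps (snd x))"
		by (rule ext) (simp add: D_def blinfun.add_left blinfun.scaleR_left bounded_linear_Blinfun_apply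
			bounded_linear_fst bounded_linear_snd)
	then show ?thesis using has_derivative_mult[OF 1 2] by (simp add: case_prod_beta')
qed
moreover have "continuous_on UNIV D"
	unfolding D_def
	by (intro continuous_intros continuous_on_compose2[OF cet] continuous_on_compose2[OF cps]
		continuous_on_compose2[OF et(2)] continuous_on_compose2[OF ps(2)]) auto
moreover have "compact ({a..b} \<times> {-R..R})" by (intro compact_Times) auto
moreover have "{a..b} \<times> {-R..R} \<subseteq> {0<..<T} \<times> UNIV" using et0 by auto
moreover have "(case x of (t, v) => et t * ps v) = 0" if "x ~: {a..b} \<times> {-R..R}" for x
	using that et0(3) ps0 by (cases x) (auto simp: abs_if split: if_splits)
ultimately show ?thesis unfolding C1c_def by blast
qed

lemma continuous_integrable_lebesgue_on:
fixes g :: "real => real"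
assumes "continuous_on {a..b} g"
shows "integrable (lebesgue_on {a..b}) g" "integral\<^sup>L (lebesgue_on {a..b}) g = integral {a..b} g"
proof -
show "integrable (lebesgue_on {a..b}) g" by (rule continuous_imp_integrable_real[OF assms])
then show "integral\<^sup>L (lebesgue_on {a..b}) g = integral {a..b} g"
	by (intro lebesgue_integral_eq_integral) auto
qed

text \<open>
The derivatives of steps of width \<open>1/n\<close> are approximate identities. They are the time factors that
turn the weak formulation into an identity between two times.
\<close>

lemma sstep_concentrates:
fixes l :: "real => real"
assumes l: "continuous_on {0..T} l" and T: "0 < T"
	and c: "!!n. n >= N ==> 0 <= c n" "!!n. n >= N ==> c n + 1 / real n <= T" "c ----> x"
shows "(%n. LI (lebesgue_on {0..T}) (%t. real n * sstep' (real n * (t - c n)) * l t)) ----> l x"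
proof -
let ?w = "%n t. real n * sstep' (real n * (t - c n))"
have x: "x : {0..T}"
proof -
	have "0 <= x" using c(1) by (intro LIMSEQ_le_const[OF c(3)]) auto
	moreover have "x <= T"
	proof (rule LIMSEQ_le_const2[OF c(3)], intro exI allI impI)
		fix n assume "n >= N"
		then show "c n <= T" using c(2)[of n] by (smt (verit) divide_nonneg_nonneg of_nat_0_le_iff)
	qed
	ultimately show ?thesis by simp
qed
have cw: "continuous_on {0..T} (?w n)" for n by (intro continuous_intros)
have w1: "integral\<^sup>L (lebesgue_on {0..T}) (?w n) = 1" if n: "n >= N" "n > 0" for n
proof -
	have "((%t. sstep (real n * (t - c n))) has_real_derivative ?w n t) (at t within {0..T})" for t
		by (auto intro!: derivative_eq_intros)
	then have "(?w n has_integral sstep (real n * (T - c n)) - sstep (real n * (0 - c n))) {0..T}"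
		using T by (intro fundamental_theorem_of_calculus) (auto simp flip: has_real_derivative_iff_has_vector_derivative)
	moreover have "sstep (real n * (T - c n)) = 1"
		using c(2)[OF n(1)] n by (intro sstep_1) (simp add: field_simps)
	moreover have "sstep (real n * (0 - c n)) = 0"
		using c(1)[OF n(1)] by (intro sstep_0) (simp add: mult_nonneg_nonneg)
	ultimately have "integral {0..T} (?w n) = 1" by (simp only: integral_unique diff_0_right)
	then show ?thesis by (simp only: continuous_integrable_lebesgue_on(2)[OF cw])
qed
show ?thesis
proof (rule LIMSEQ_I)
	fix r :: real assume r: "0 < r"
	obtain d where d: "0 < d" "!!t. t : {0..T} ==> dist t x < d ==> dist (l t) (l x) < r / 2"
		using l x r unfolding continuous_on_iff by (metis half_gt_zero)
	have "eventually (%n. dist (c n) x < d / 2) sequentially"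
		using c(3) d(1) unfolding tendsto_iff by (meson half_gt_zero)
	moreover have "eventually (%n. 1 / real n < d / 2) sequentially"
		using order_tendstoD(2)[OF lim_1_over_n, of "d / 2"] d(1) by simp
	moreover have "eventually (%n. n >= max N 1) sequentially" by (rule eventually_ge_at_top)
	ultimately have "eventually (%n. norm ((LI (lebesgue_on {0..T}) (%t. ?w n t * l t)) - l x) < r) sequentially"
	proof eventually_elim
		case (elim n)
		then have n: "n >= N" "n > 0" by auto
		have i1: "integrable (lebesgue_on {0..T}) (%t. ?w n t * l t)"
			by (intro continuous_integrable_lebesgue_on continuous_on_mult cw l)
		have i2: "integrable (lebesgue_on {0..T}) (?w n)" by (intro continuous_integrable_lebesgue_on cw)
		have split: "(LI (lebesgue_on {0..T}) (%t. ?w n t * l t)) - l x = (LI (lebesgue_on {0..T}) (%t. ?w n t * l t - ?w n t * l x))"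
			using i1 i2 w1[OF n] by simp
		have "norm ((LI (lebesgue_on {0..T}) (%t. ?w n t * l t)) - l x) <= (LI (lebesgue_on {0..T}) (%t. norm (?w n t * l t - ?w n t * l x)))"
			unfolding split by (rule integral_norm_bound)
		also have "... <= (LI (lebesgue_on {0..T}) (%t. ?w n t * (r / 2)))"
		proof (rule integral_mono)
			fix t assume "t : space (lebesgue_on {0..T})"
			then have t: "t : {0..T}" by simp
			show "norm (?w n t * l t - ?w n t * l x) <= ?w n t * (r / 2)"
			proof (cases "sstep' (real n * (t - c n)) = 0")
				case False
				then have "0 < real n * (t - c n)" "real n * (t - c n) < 1"
					using sstep'_0[of "real n * (t - c n)"] by (meson not_le)+
				then have "c n < t" "t < c n + 1 / real n" using n by (auto simp: zero_less_mult_iff field_simps)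
				then have "dist t x < d" using elim unfolding dist_real_def by linarith
				then have "\<bar>l t - l x\<bar> <= r / 2" using d(2)[OF t] unfolding dist_real_def by simp
				moreover have "0 <= ?w n t" using sstep'_bounds by simp
				ultimately show ?thesis
					by (metis abs_mult abs_of_nonneg mult_left_mono real_norm_def right_diff_distrib)
			qed simp
		qed (use i1 i2 in auto)
		also have "... = r / 2" using w1[OF n] i2 by simp
		also have "... < r" using r by simp
		finally show ?case .
	qed
	then show "EX no. ALL n>=no. norm ((LI (lebesgue_on {0..T}) (%t. ?w n t * l t)) - l x) < r"
		by (simp add: eventually_sequentially)
qed
qed

lemma Cauchy_Schwarz_integral:
fixes f g :: "'a => real"
assumes m: "f : bm M" "g : bm M"
	and f: "integrable M (%x. (f x)^2)" and g: "integrable M (%x. (g x)^2)"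
shows "integrable M (%x. f x * g x)"
	and "(LI M (%x. f x * g x))^2 <= (LI M (%x. (f x)^2)) * (LI M (%x. (g x)^2))"
proof -
have fg: "integrable M (%x. f x * g x)"
proof (rule Bochner_Integration.integrable_bound)
	show "integrable M (%x. (f x)^2 + (g x)^2)" using f g by simp
	show "AE x in M. norm (f x * g x) <= norm ((f x)^2 + (g x)^2)"
	proof (intro AE_I2)
		fix x
		have "2 * \<bar>f x * g x\<bar> <= (f x)^2 + (g x)^2"
			using zero_le_power2[of "\<bar>f x\<bar> - \<bar>g x\<bar>"] by (simp add: power2_diff abs_mult)
		then show "norm (f x * g x) <= norm ((f x)^2 + (g x)^2)" by auto
	qed
qed (use m in auto)
then show "integrable M (%x. f x * g x)" .
let ?A = "LI M (%x. (f x)^2)" and ?B = "LI M (%x. f x * g x)" and ?C = "LI M (%x. (g x)^2)"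
have q: "0 <= ?A * s^2 - 2 * s * ?B + ?C" for s
proof -
	have "0 <= (LI M (%x. (s * f x - g x)^2))" by simp
	also have "... = (LI M (%x. s^2 * (f x)^2 - 2 * s * (f x * g x) + (g x)^2))"
		by (intro Bochner_Integration.integral_cong) (auto simp: power2_eq_square algebra_simps)
	also have "... = s^2 * ?A - 2 * s * ?B + ?C" using f g fg by simp
	finally show ?thesis by (simp add: mult.commute)
qed
show "?B^2 <= ?A * ?C"
proof (cases "?A = 0")
	case True
	have "?B = 0"
	proof (rule ccontr)
		assume B: "?B ~= 0"
		have "2 * ((?C + 1) / (2 * ?B)) * ?B = ?C + 1" using B by simp
		moreover have "0 <= 0 - 2 * ((?C + 1) / (2 * ?B)) * ?B + ?C" using q[of "(?C + 1) / (2 * ?B)"] unfolding True by simp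
		ultimately show False by linarith
	qed
	then show ?thesis using True by simp
next
	case False
	then have A: "0 < ?A" by (smt (verit) Bochner_Integration.integral_nonneg zero_le_power2)
	have "0 <= ?A * (?B / ?A)^2 - 2 * (?B / ?A) * ?B + ?C" by (rule q)
	then have "0 <= ?C - ?B^2 / ?A" using A by (simp add: power2_eq_square field_simps)
	then show ?thesis using A by (simp add: field_simps)
qed
qed

section \<open>Consequences of the continuity equation\<close>

lemma abs_signed_integral_le:
assumes g: "g : bm M"
shows "ennreal \<bar>signed_integral M nu g\<bar> <= (NI (total_variation M nu) (%x. ennreal \<bar>g x\<bar>))"
proof -
have "ennreal \<bar>LI N (%x. g x)\<bar> <= (NI N (%x. ennreal \<bar>g x\<bar>))" if "sets N = sets M" for N
proof (cases "integrable N g")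
	case True
	then show ?thesis using integral_norm_bound_ennreal[of N g] by simp
qed (simp add: not_integrable_integral_eq)
note b = this[of "pos_variation M nu"] this[of "neg_variation M nu"]
have "ennreal \<bar>signed_integral M nu g\<bar> <= ennreal (\<bar>LI (pos_variation M nu) (%x. g x)\<bar> + \<bar>LI (neg_variation M nu) (%x. g x)\<bar>)"
	unfolding signed_integral_def by (intro ennreal_leI) linarith
also have "... <= (NI (pos_variation M nu) (%x. ennreal \<bar>g x\<bar>)) + (NI (neg_variation M nu) (%x. ennreal \<bar>g x\<bar>))"
	using b by (simp add: add_mono)
also have "... = (NI (total_variation M nu) (%x. ennreal \<bar>g x\<bar>))"
	using g by (subst nn_integral_total_variation) auto
finally show ?thesis .
qed

lemma signed_integral_cmult:
"signed_integral M nu (%x. c * g x) = c * signed_integral M nu g"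
by (simp add: signed_integral_def right_diff_distrib)

lemma ngrad_eq:
assumes "!!v. (ps has_real_derivative ps' v) (at v)"
shows "ngrad ps = (%z. ps' (snd z) - ps' (fst z))"
proof -
have "deriv ps v = ps' v" for v using assms by (rule DERIV_imp_deriv)
then show ?thesis by (intro ext) (simp add: ngrad_def case_prod_beta)
qed

lemma measurable_lebesgue_on:
fixes g :: "real => 'b::topological_space"
shows "g : bm borel ==> g : bm (lebesgue_on S)"
by (intro measurable_restrict_space1 measurable_completion) simp

definition jb :: "real => real" where "jb v = sqrt (1 + v^2)"

lemma jb_bounds: "1 <= jb v" "\<bar>v\<bar> <= jb v" "jb v <= 1 + \<bar>v\<bar>"
proof -
show "1 <= jb v" by (simp add: jb_def)
show "\<bar>v\<bar> <= jb v" unfolding jb_def by (rule real_le_rsqrt) simp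
show "jb v <= 1 + \<bar>v\<bar>" unfolding jb_def by (rule real_le_lsqrt) (auto simp: power2_sum)
qed

lemma jb_measurable [measurable]: "jb : bm borel"
unfolding jb_def[abs_def] by measurable

lemma DERIV_jb: "(jb has_real_derivative v / jb v) (at v)"
proof -
have "1 + v^2 > 0" by (simp add: add_pos_nonneg)
then show ?thesis unfolding jb_def[abs_def]
	by (auto intro!: derivative_eq_intros simp: field_simps)
qed

lemma continuous_on_jb': "continuous_on S (%v. v / jb v)"
unfolding jb_def by (intro continuous_intros) (auto simp: add_nonneg_eq_0_iff)

lemma abs_jb'_le: "\<bar>v / jb v\<bar> <= 1"
using jb_bounds[of v] by (simp add: abs_div)

definition mom :: "real measure => real" where "mom f = (LI f (%v. jb v))"

lemma real_distribution_sets: "real_distribution f ==> sets f = sets borel"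
by (simp add: real_distribution_def real_distribution_axioms_def)

lemma kernel_le_jb: "0 <= e ==> e < 1 ==> kernel e z <= (1 - e) / 4 * (jb (fst z) + jb (snd z))"
unfolding kernel_eq using jb_bounds(2)[of "fst z"] jb_bounds(2)[of "snd z"]
by (intro mult_left_mono) auto

lemma AE_lebesgue_on_neq: "AE t in lebesgue_on S. t ~= (c :: real)" if "S : sets lebesgue"
proof -
have "AE t in lborel. t ~= c" by (rule AE_lborel_singleton)
then have "AE t in lebesgue. t ~= c" by (rule AE_completion)
then have "AE t in lebesgue. t : S --> t ~= c" by (rule eventually_mono) simp
then show ?thesis using that by (subst AE_restrict_space_iff) auto
qed

lemma ngrad_measurable:
assumes [measurable]: "p : bm borel"
shows "(%z. p (snd z) - p (fst z) :: real) : bm (borel :: (real \<times> real) measure)"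
unfolding borel_prod[symmetric] by measurable

locale continuity_eq =
fixes e T :: real and f :: "real => real measure" and U :: "real => (real \<times> real) set => real"
assumes e: "0 <= e" "e < 1" and T: "0 < T" and CE: "CE e T f U"
begin

abbreviation "leb \<equiv> lebesgue_on {0..T}"

lemma distr_f: "t : {0..T} ==> real_distribution (f t)"
and signed_U: "t : {0..T} ==> signed_measure offdiag_borel (U t)"
and narrow: "narrowly_continuous T f"
using CE unfolding CE_def by blast+

lemma measurable_U: "ph : C0 offdiag ==> (%t. signed_integral offdiag_borel (U t) ph) : bm leb"
using CE unfolding CE_def by blast

definition K :: "real => ennreal" where
"K t = (NI (total_variation offdiag_borel (U t)) (%z. ennreal (kernel e z)))"

lemma K_measurable [measurable]: "K : bm leb"
proof -
have m: "(%z. ennreal (kernel e z)) : bm offdiag_borel"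
	by (intro measurable_compose[OF measurable_offdiag_borel measurable_ennreal] kernel_measurable)
have sp: "!!t. t : space leb ==> signed_measure offdiag_borel (U t)" by (simp add: signed_U)
have "(%t. (NI (pos_variation offdiag_borel (U t)) (%z. ennreal (kernel e z))) +
		(NI (neg_variation offdiag_borel (U t)) (%z. ennreal (kernel e z)))) : bm leb"
	using measurable_nn_integral_pos_variation[OF open_offdiag offdiag_neq_UNIV sp measurable_U m]
		measurable_nn_integral_neg_variation[OF open_offdiag offdiag_neq_UNIV sp measurable_U m]
	by (intro borel_measurable_add) auto
then show ?thesis
	unfolding K_def[abs_def] nn_integral_total_variation[OF m] .
qed

lemma K_finite: "(NI leb (%t. K t)) < \<infinity>"
using CE unfolding CE_def K_def by blast

lemma AE_K_finite: "AE t in leb. K t < \<infinity>"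
using nn_integral_PInf_AE[OF K_measurable] K_finite by (auto simp: less_top)

definition Kr :: "real => real" where "Kr t = enn2real (K t)"

lemma Kr_nonneg: "0 <= Kr t" by (simp add: Kr_def)

lemma Kr_integrable: "integrable leb Kr"
proof (rule integrableI_bounded)
show "Kr : bm leb" unfolding Kr_def[abs_def] by measurable
have "(NI leb (%t. ennreal (norm (Kr t)))) = (NI leb (%t. K t))"
	using AE_K_finite by (intro nn_integral_cong_AE) (auto simp: Kr_def elim!: eventually_mono)
then show "(NI leb (%t. ennreal (norm (Kr t)))) < \<infinity>" using K_finite by simp
qed

text \<open>The rate of change of \<open>\<integral> ps df\<close>; it depends on \<open>ps\<close> only through its derivative \<open>p\<close>.\<close>

definition rate :: "(real => real) => real => real" where
"rate p t = signed_integral offdiag_borel (U t) (%z. kernel e z * (p (snd z) - p (fst z)))"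

lemma rate_measurable:
assumes p[measurable]: "p : bm borel"
shows "rate p : bm leb"
proof -
have "(%z. kernel e z * (p (snd z) - p (fst z))) : bm borel"
	unfolding borel_prod[symmetric] sigma_e_def by measurable
then show ?thesis unfolding rate_def[abs_def]
	by (intro measurable_signed_integral[OF open_offdiag offdiag_neq_UNIV _ measurable_U] measurable_offdiag_borel)
		(auto simp: signed_U)
qed

lemma rate_le:
assumes p[measurable]: "p : bm borel" and L: "!!v. \<bar>p v\<bar> <= L" and K: "K t < \<infinity>"
shows "\<bar>rate p t\<bar> <= 2 * L * Kr t"
proof -
have L0: "0 <= L" using L[of 0] by linarith
have m: "(%z. kernel e z * (p (snd z) - p (fst z))) : bm borel"
	by (intro borel_measurable_times kernel_measurable ngrad_measurable p)
have "ennreal \<bar>rate p t\<bar> <= (NI (total_variation offdiag_borel (U t)) (%z. ennreal \<bar>kernel e z * (p (snd z) - p (fst z))\<bar>))"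
	unfolding rate_def by (intro abs_signed_integral_le measurable_offdiag_borel m)
also have "... <= (NI (total_variation offdiag_borel (U t)) (%z. ennreal (2 * L) * ennreal (kernel e z)))"
proof (rule nn_integral_mono)
	fix z
	have "\<bar>p (snd z) - p (fst z)\<bar> <= 2 * L" using L[of "snd z"] L[of "fst z"] by linarith
	then have "\<bar>kernel e z * (p (snd z) - p (fst z))\<bar> <= 2 * L * kernel e z"
		using kernel_nonneg[OF e(2), of z] by (simp add: abs_mult mult_mono mult.commute)
	then show "ennreal \<bar>kernel e z * (p (snd z) - p (fst z))\<bar> <= ennreal (2 * L) * ennreal (kernel e z)"
		using L0 by (simp add: ennreal_mult'[symmetric] ennreal_leI)
qed
also have "... = ennreal (2 * L) * K t"
	unfolding K_def by (intro nn_integral_cmult) (simp add: measurable_offdiag_borel cong: measurable_cong_sets)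
also have "... = ennreal (2 * L * Kr t)"
	using K L0 by (simp add: Kr_def ennreal_mult)
finally show ?thesis using L0 Kr_nonneg[of t] by (simp add: ennreal_le_iff)
qed

lemma rate_integrable:
assumes p: "p : bm borel" and L: "!!v. \<bar>p v\<bar> <= L"
shows "integrable leb (rate p)"
proof (rule Bochner_Integration.integrable_bound)
show "integrable leb (%t. 2 * L * Kr t)" using Kr_integrable by simp
show "AE t in leb. norm (rate p t) <= norm (2 * L * Kr t)"
	using AE_K_finite
proof eventually_elim
	case (elim t) then show ?case using rate_le[OF p L elim] by simp
qed
qed (rule rate_measurable[OF p])

lemma weak_product:
assumes et: "!!t. (et has_real_derivative et' t) (at t)" "continuous_on UNIV et'"
	and ps: "!!v. (ps has_real_derivative ps' v) (at v)" "continuous_on UNIV ps'"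
	and et0: "0 < a" "b < T" "!!t. t ~: {a..b} ==> et t = 0"
	and ps0: "!!v. R < \<bar>v\<bar> ==> ps v = 0"
shows "(LI leb (%t. et' t * (LI (f t) (%v. ps v)))) + (LI leb (%t. et t * rate ps' t)) = 0"
proof -
let ?ph = "%(t, v). et t * ps v"
have "?ph : C1c T" by (rule product_in_C1c[OF et ps et0 ps0])
then have "(LI leb (%t. (LI (f t) (%v. deriv (%s. ?ph (s, v)) t)))) +
			(LI leb (%t. signed_integral offdiag_borel (U t) (%z. kernel e z * ngrad (%v. ?ph (t, v)) z))) = 0"
	using CE unfolding CE_def by blast
moreover have "(LI (f t) (%v. deriv (%s. ?ph (s, v)) t)) = et' t * (LI (f t) (%v. ps v))" for t
proof -
	have "deriv (%s. ?ph (s, v)) t = et' t * ps v" for v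
		using et(1)[of t] by (auto intro!: DERIV_imp_deriv derivative_eq_intros)
	then show ?thesis by simp
qed
moreover have "signed_integral offdiag_borel (U t) (%z. kernel e z * ngrad (%v. ?ph (t, v)) z) = et t * rate ps' t" for t
proof -
	have "ngrad (%v. ?ph (t, v)) = (%z. et t * ps' (snd z) - et t * ps' (fst z))"
		using ps(1) by (intro ngrad_eq) (auto intro!: derivative_eq_intros)
	then have "(%z. kernel e z * ngrad (%v. ?ph (t, v)) z) = (%z. et t * (kernel e z * (ps' (snd z) - ps' (fst z))))"
		by (auto simp: algebra_simps)
	then show ?thesis unfolding rate_def signed_integral_cmult[symmetric] by simp
qed
ultimately show ?thesis by simp
qed

lemma continuous_integral_f:
fixes ps :: "real => real"
shows "continuous_on UNIV ps ==> bounded (range ps) ==> continuous_on {0..T} (%t. LI (f t) (%v. ps v))"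
using narrow[unfolded narrowly_continuous_def, rule_format, of ps] by simp

text \<open>The continuity equation in integrated form, first for test functions with compact support.\<close>

lemma flow_compact:
assumes ps: "!!v. (ps has_real_derivative ps' v) (at v)" "continuous_on UNIV ps'"
	and ps0: "!!v. R < \<bar>v\<bar> ==> ps v = 0" and L: "!!v. \<bar>ps' v\<bar> <= L"
	and ab: "0 <= a" "a <= b" "b <= T"
shows "(LI (f b) (%v. ps v)) - (LI (f a) (%v. ps v)) = (LI leb (%t. indicator {a..b} t * rate ps' t))"
proof (cases "a = b")
case True
have "AE t in leb. t ~= b" by (rule AE_lebesgue_on_neq) simp
then have "(LI leb (%t. indicator {a..b} t * rate ps' t)) = (LI leb (%t. 0))"
proof (intro integral_cong_AE)
	show "(%t. indicator {a..b} t * rate ps' t) : bm leb"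
		by (intro borel_measurable_times measurable_lebesgue_on
				rate_measurable[OF borel_measurable_continuous_onI[OF ps(2)]]) simp
	show "AE t in leb. indicator {a..b} t * rate ps' t = 0"
		using \<open>AE t in leb. t ~= b\<close> by eventually_elim (simp add: True)
qed simp
then show ?thesis using True by simp
next
case False
then have "a < b" using ab by simp
have mps': "ps' : bm borel" by (rule borel_measurable_continuous_onI[OF ps(2)])
have cps: "continuous_on UNIV ps" using ps(1) by (meson DERIV_isCont continuous_at_imp_continuous_on)
have "bounded (range ps)"
proof -
	have "range ps \<subseteq> insert 0 (ps ` {-R..R})"
	proof safe
		fix v assume "ps v ~: ps ` {- R..R}"
		then have "v ~: {-R..R}" by blast
		then have "R < \<bar>v\<bar>" by auto
		then show "ps v = 0" by (rule ps0)
	qed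
	moreover have "bounded (ps ` {-R..R})"
		by (intro compact_imp_bounded compact_continuous_image continuous_on_subset[OF cps]) auto
	ultimately show ?thesis by (meson bounded_insert bounded_subset)
qed
then have cl: "continuous_on {0..T} (%t. LI (f t) (%v. ps v))" by (rule continuous_integral_f[OF cps])
define an bn where "an n = a + 1 / real n" and "bn n = b - 2 / real n" for n :: nat
define et where "et n t = sstep (real n * (t - an n)) - sstep (real n * (t - bn n))" for n t
obtain N :: nat where N: "N > 0" "4 / (b - a) <= real N"
proof -
	obtain N :: nat where "max 1 (4 / (b - a)) <= real N" using real_arch_simple by blast
	then show ?thesis by (intro that[of N]) auto
qed
have small: "4 / real n <= b - a" "0 < real n" if "n >= N" for n
proof -
	have "real N <= real n" "0 < real N" using that N by auto
	then show "0 < real n" by linarith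
	have "4 / (b - a) <= real n" using N \<open>real N <= real n\<close> by linarith
	then show "4 / real n <= b - a" using \<open>a < b\<close> \<open>0 < real n\<close> by (simp add: field_simps)
qed
have frac: "2 / real n = 2 * (1 / real n)" "4 / real n = 4 * (1 / real n)" for n by simp_all
have pos: "0 < 1 / real n" if "n >= N" for n using small(2)[OF that] by simp
have det: "(et n has_real_derivative real n * sstep' (real n * (t - an n)) - real n * sstep' (real n * (t - bn n))) (at t)" for n t
	unfolding et_def[abs_def] by (auto intro!: derivative_eq_intros)
have out: "et n t = 0" if n: "n >= N" and t: "t ~: {an n..bn n + 1 / real n}" for n t
proof (cases "t < an n")
	case True
	then have "t < bn n" using small(1)[OF n] pos[OF n] unfolding an_def bn_def frac by linarith
	then show ?thesis using True small(2)[OF n] by (simp add: et_def sstep_0 mult_nonneg_nonpos)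
next
	case False
	then have t: "bn n + 1 / real n < t" using t by auto
	then have "an n + 1 / real n < t" using small(1)[OF n] pos[OF n] unfolding an_def bn_def frac by linarith
	then show ?thesis using t small(2)[OF n] by (simp add: et_def sstep_1 field_simps)
qed
have eq: "(LI leb (%t. real n * sstep' (real n * (t - an n)) * (LI (f t) (%v. ps v)))) -
		(LI leb (%t. real n * sstep' (real n * (t - bn n)) * (LI (f t) (%v. ps v)))) = - (LI leb (%t. et n t * rate ps' t))"
	if n: "n >= N" for n
proof -
	have "(LI leb (%t. (real n * sstep' (real n * (t - an n)) - real n * sstep' (real n * (t - bn n))) * (LI (f t) (%v. ps v)))) +
			(LI leb (%t. et n t * rate ps' t)) = 0"
	proof (rule weak_product[OF det _ ps _ _ out[OF n] ps0])
		show "0 < an n" "bn n + 1 / real n < T" using ab pos[OF n] unfolding an_def bn_def frac by linarith+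
	qed (auto intro!: continuous_intros)
	moreover have "integrable leb (%t. real n * sstep' (real n * (t - c)) * (LI (f t) (%v. ps v)))" for c
		by (intro continuous_integrable_lebesgue_on continuous_on_mult[OF _ cl] continuous_intros)
	ultimately show ?thesis by (simp add: left_diff_distrib)
qed
have an: "an ----> a"
	unfolding an_def[abs_def] using tendsto_add[OF tendsto_const[of a] lim_1_over_n] by simp
have bn: "bn ----> b"
	unfolding bn_def[abs_def] frac using tendsto_diff[OF tendsto_const[of b] tendsto_mult_right_zero[OF lim_1_over_n, of 2]] by simp
have l1: "(%n. LI leb (%t. real n * sstep' (real n * (t - an n)) * (LI (f t) (%v. ps v)))) ----> (LI (f a) (%v. ps v))"
proof (rule sstep_concentrates[OF cl T _ _ an])
	fix n assume n: "n >= N"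
	show "0 <= an n" "an n + 1 / real n <= T" using ab pos[OF n] small(1)[OF n] unfolding an_def frac by linarith+
qed
have l2: "(%n. LI leb (%t. real n * sstep' (real n * (t - bn n)) * (LI (f t) (%v. ps v)))) ----> (LI (f b) (%v. ps v))"
proof (rule sstep_concentrates[OF cl T _ _ bn])
	fix n assume n: "n >= N"
	show "0 <= bn n" "bn n + 1 / real n <= T" using ab pos[OF n] small(1)[OF n] unfolding bn_def frac by linarith+
qed
have l3: "(%n. LI leb (%t. et n t * rate ps' t)) ----> (LI leb (%t. indicator {a<..<b} t * rate ps' t))"
proof (rule integral_dominated_convergence[where w="%t. \<bar>rate ps' t\<bar>"])
	show "(%t. indicator {a<..<b} t * rate ps' t) : bm leb"
		by (intro borel_measurable_times rate_measurable[OF mps'] measurable_lebesgue_on[of "indicator _"]) auto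
	have "continuous_on UNIV (et n)" for n using det by (meson DERIV_isCont continuous_at_imp_continuous_on)
	then have "et n : bm borel" for n by (rule borel_measurable_continuous_onI)
	then have "et n : bm leb" for n by (rule measurable_lebesgue_on)
	then show "(%t. et n t * rate ps' t) : bm leb" for n
		using rate_measurable[OF mps'] by (intro borel_measurable_times)
	show "integrable leb (%t. \<bar>rate ps' t\<bar>)" using rate_integrable[OF mps' L] by simp
	show "AE t in leb. (%n. et n t * rate ps' t) ----> indicator {a<..<b} t * rate ps' t"
	proof (intro AE_I2 tendsto_mult tendsto_const)
		fix t
		have ev: "eventually (%n. n >= N) sequentially" by (rule eventually_ge_at_top)
		show "(%n. et n t) ----> indicator {a<..<b} t"
		proof (rule tendsto_eventually)
			consider "t <= a" | "b <= t" | "a < t" "t < b" by linarith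
			then show "eventually (%n. et n t = indicator {a<..<b} t) sequentially"
			proof cases
				case 1
				show ?thesis using ev
				proof eventually_elim
					case (elim n)
					have "t < an n" using 1 pos[OF elim] unfolding an_def by linarith
					then have "t ~: {an n..bn n + 1 / real n}" by simp
					then show ?case using out[OF elim] 1 by simp
				qed
			next
				case 2
				show ?thesis using ev
				proof eventually_elim
					case (elim n)
					have "bn n + 1 / real n < t" using 2 pos[OF elim] unfolding bn_def frac by linarith
					then have "t ~: {an n..bn n + 1 / real n}" by simp
					then show ?case using out[OF elim] 2 by simp
				qed
			next
				case 3
				have "eventually (%n. 1 / real n < (t - a) / 2) sequentially" "eventually (%n. 1 / real n < (b - t) / 2) sequentially"
					using order_tendstoD(2)[OF lim_1_over_n, of "(t - a) / 2"] order_tendstoD(2)[OF lim_1_over_n, of "(b - t) / 2"] 3 by simp_all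
				with ev show ?thesis
				proof eventually_elim
					case (elim n)
					have aux1: "a + r + r < t" if "r < (t - a) / 2" for r using that by (simp add: field_simps)
					have aux2: "t < b - 2 * r" if "r < (b - t) / 2" for r using that by (simp add: field_simps)
					have "an n + 1 / real n < t" unfolding an_def by (rule aux1[OF elim(2)])
					then have "sstep (real n * (t - an n)) = 1" using small(2)[OF elim(1)] by (intro sstep_1) (simp add: field_simps)
					moreover have "t < bn n" unfolding bn_def frac by (rule aux2[OF elim(3)])
					then have "sstep (real n * (t - bn n)) = 0" using small(2)[OF elim(1)] by (intro sstep_0) (simp add: mult_nonneg_nonpos)
					ultimately show ?case using 3 by (simp add: et_def)
				qed
			qed
		qed
	qed
	show "AE t in leb. norm (et n t * rate ps' t) <= \<bar>rate ps' t\<bar>" for n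
	proof (intro AE_I2)
		fix t
		have "\<bar>et n t\<bar> <= 1" unfolding et_def using sstep_bounds[of "real n * (t - an n)"] sstep_bounds[of "real n * (t - bn n)"] by linarith
		then show "norm (et n t * rate ps' t) <= \<bar>rate ps' t\<bar>" by (simp add: abs_mult mult_left_le_one_le)
	qed
qed
have "(%n. - (LI leb (%t. et n t * rate ps' t))) ----> (LI (f a) (%v. ps v)) - (LI (f b) (%v. ps v))"
	using tendsto_diff[OF l1 l2] by (rule Lim_transform_eventually)
		(auto simp: eventually_sequentially eq intro!: exI[of _ N])
from LIMSEQ_unique[OF this tendsto_minus[OF l3]]
have "(LI (f b) (%v. ps v)) - (LI (f a) (%v. ps v)) = (LI leb (%t. indicator {a<..<b} t * rate ps' t))" by simp
also have "... = (LI leb (%t. indicator {a..b} t * rate ps' t))"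
proof (rule integral_cong_AE)
	have *: "AE t in leb. t ~= c" for c by (rule AE_lebesgue_on_neq) simp
	show "AE t in leb. indicator {a<..<b} t * rate ps' t = indicator {a..b} t * rate ps' t"
		using *[of a] *[of b] by eventually_elim (auto simp: indicator_def)
qed (auto intro!: borel_measurable_times rate_measurable[OF mps'] measurable_lebesgue_on[of "indicator _"])
finally show ?thesis .
qed

end

section \<open>Weighted Dirichlet forms of bounded functions\<close>

lemma DERIV_bounded_imp_Lipschitz:
fixes ps :: "real => real"
assumes "!!v. (ps has_real_derivative ps' v) (at v)" "!!v. \<bar>ps' v\<bar> <= L"
shows "\<bar>ps x - ps y\<bar> <= L * \<bar>x - y\<bar>"
using field_differentiable_bound[of UNIV ps ps' L x y] assms by simp

lemma integrable_jb_pair: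
assumes mu: "real_distribution mu" "integrable mu jb" and nu: "real_distribution nu" "integrable nu jb"
shows "integrable (mu \<Otimes>\<^sub>M nu) (%z. jb (fst z) + jb (snd z))"
	and "(LI (mu \<Otimes>\<^sub>M nu) (%z. jb (fst z) + jb (snd z))) = mom mu + mom nu"
proof -
interpret M: real_distribution mu by fact
interpret N: real_distribution nu by fact
interpret P: pair_prob_space mu nu ..
have [measurable]: "jb : bm mu" "jb : bm nu"
	using mu nu by simp_all
have fin: "(NI mu (%x. ennreal (norm (jb x)))) < \<infinity>" "(NI nu (%x. ennreal (norm (jb x)))) < \<infinity>"
	using mu(2) nu(2) unfolding integrable_iff_bounded by auto
have 1: "integrable (mu \<Otimes>\<^sub>M nu) (%z. jb (fst z))"
proof (rule integrableI_bounded)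
	have "(NI (mu \<Otimes>\<^sub>M nu) (%z. ennreal (norm (jb (fst z))))) = (NI mu (%x. NI nu (%y. ennreal (norm (jb x)))))"
		by (subst N.nn_integral_fst[symmetric]) auto
	then show "(NI (mu \<Otimes>\<^sub>M nu) (%z. ennreal (norm (jb (fst z))))) < \<infinity>" using fin N.emeasure_space_1 by simp
qed measurable
have 2: "integrable (mu \<Otimes>\<^sub>M nu) (%z. jb (snd z))"
proof (rule integrableI_bounded)
	have "(NI (mu \<Otimes>\<^sub>M nu) (%z. ennreal (norm (jb (snd z))))) = (NI mu (%x. NI nu (%y. ennreal (norm (jb y)))))"
		by (subst N.nn_integral_fst[symmetric]) auto
	then show "(NI (mu \<Otimes>\<^sub>M nu) (%z. ennreal (norm (jb (snd z))))) < \<infinity>" using fin M.emeasure_space_1 by simp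
qed measurable
show "integrable (mu \<Otimes>\<^sub>M nu) (%z. jb (fst z) + jb (snd z))" using 1 2 by simp
have "(LI (mu \<Otimes>\<^sub>M nu) (%z. jb (fst z))) = mom mu"
	unfolding mom_def using P.integral_fst'[OF 1] N.prob_space by simp
moreover have "(LI (mu \<Otimes>\<^sub>M nu) (%z. jb (snd z))) = mom nu"
	unfolding mom_def using P.integral_fst'[OF 2] M.prob_space by simp
ultimately show "(LI (mu \<Otimes>\<^sub>M nu) (%z. jb (fst z) + jb (snd z))) = mom mu + mom nu"
	using 1 2 by simp
qed

lemma mom_ge_1: "real_distribution f ==> integrable f jb ==> 1 <= mom f"
proof -
assume f: "real_distribution f" "integrable f jb"
interpret real_distribution f by fact
have "(LI f (%v. 1)) <= mom f" unfolding mom_def using f jb_bounds by (intro integral_mono) auto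
then show ?thesis using prob_space by simp
qed

definition Qform :: "real => real measure => (real => real) => real" where
"Qform e f p = (LI (sq f) (%z. kernel e z * (p (snd z) - p (fst z))^2))"

lemma kernel_integrand_measurable:
assumes [measurable]: "p : bm borel" and s: "sets mu = sets borel" "sets nu = sets borel"
shows "(%z. kernel e z * (p (snd z) - p (fst z))^2) : bm (mu \<Otimes>\<^sub>M nu)"
proof -
have "(%z. kernel e z * (p (snd z) - p (fst z))^2) : bm borel"
	by (intro borel_measurable_times borel_measurable_power kernel_measurable ngrad_measurable) measurable
moreover have "sets (mu \<Otimes>\<^sub>M nu) = sets borel" using s by (metis borel_prod sets_pair_measure_cong)
ultimately show ?thesis using measurable_cong_sets by blast
qed

lemma kernel_grad_sq_le:
assumes e: "0 <= e" "e < 1" and d: "\<bar>d\<bar> <= D"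
shows "\<bar>kernel e z * d\<bar> <= (1 - e) / 4 * D * (jb (fst z) + jb (snd z))"
proof -
have "\<bar>kernel e z * d\<bar> = kernel e z * \<bar>d\<bar>" using kernel_nonneg[OF e(2), of z] by (simp add: abs_mult)
also have "... <= ((1 - e) / 4 * (jb (fst z) + jb (snd z))) * D"
	using kernel_le_jb[OF e, of z] kernel_nonneg[OF e(2), of z] d by (intro mult_mono) auto
finally show ?thesis by (simp add: ac_simps)
qed

lemma integrable_kernel_mult:
assumes e: "0 <= e" "e < 1" and mu: "real_distribution mu" "integrable mu jb" and nu: "real_distribution nu" "integrable nu jb"
	and g: "g : bm borel" "!!z. \<bar>g z\<bar> <= D"
shows "integrable (mu \<Otimes>\<^sub>M nu) (%z. kernel e z * g z)"
	and "\<bar>LI (mu \<Otimes>\<^sub>M nu) (%z. kernel e z * g z)\<bar> <= (1 - e) / 4 * D * (mom mu + mom nu)"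
proof -
note j = integrable_jb_pair[OF mu nu]
have s: "sets (mu \<Otimes>\<^sub>M nu) = sets borel"
	using real_distribution_sets[OF mu(1)] real_distribution_sets[OF nu(1)] by (metis borel_prod sets_pair_measure_cong)
have b: "\<bar>kernel e z * g z\<bar> <= (1 - e) / 4 * D * (jb (fst z) + jb (snd z))" for z
	by (rule kernel_grad_sq_le[OF e g(2)])
have i: "integrable (mu \<Otimes>\<^sub>M nu) (%z. (1 - e) / 4 * D * (jb (fst z) + jb (snd z)))" using j(1) by simp
have m: "(%z. kernel e z * g z) : bm (mu \<Otimes>\<^sub>M nu)"
	using borel_measurable_times[OF kernel_measurable[of e] g(1)] measurable_cong_sets[OF s refl] by blast
show ig: "integrable (mu \<Otimes>\<^sub>M nu) (%z. kernel e z * g z)"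
proof (rule Bochner_Integration.integrable_bound[OF i m], intro AE_I2)
	fix z
	have "\<bar>kernel e z * g z\<bar> <= \<bar>(1 - e) / 4 * D * (jb (fst z) + jb (snd z))\<bar>" using b[of z] by linarith
	then show "norm (kernel e z * g z) <= norm ((1 - e) / 4 * D * (jb (fst z) + jb (snd z)))" by simp
qed
have "\<bar>LI (mu \<Otimes>\<^sub>M nu) (%z. kernel e z * g z)\<bar> <= (LI (mu \<Otimes>\<^sub>M nu) (%z. \<bar>kernel e z * g z\<bar>))"
	by (rule integral_abs_bound)
also have "... <= (LI (mu \<Otimes>\<^sub>M nu) (%z. (1 - e) / 4 * D * (jb (fst z) + jb (snd z))))"
	using ig i b by (intro integral_mono) auto
also have "... = (1 - e) / 4 * D * (mom mu + mom nu)" using j by simp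
finally show "\<bar>LI (mu \<Otimes>\<^sub>M nu) (%z. kernel e z * g z)\<bar> <= (1 - e) / 4 * D * (mom mu + mom nu)" .
qed

lemma bounded_ngrad:
fixes p :: "real => real"
assumes "!!v. \<bar>p v\<bar> <= L" shows "\<bar>(p w - p v)^2\<bar> <= 4 * L^2"
proof -
have "\<bar>p w - p v\<bar> <= 2 * L" using assms[of w] assms[of v] by linarith
then have "\<bar>p w - p v\<bar>^2 <= (2 * L)^2" by (rule power_mono) simp
then show ?thesis by (simp add: power_mult_distrib)
qed

lemma ngrad_sq_measurable:
assumes "p : bm borel"
shows "(%z. (p (snd z) - p (fst z) :: real)^2) : bm (borel :: (real \<times> real) measure)"
by (intro borel_measurable_power ngrad_measurable assms)

lemma
assumes e: "0 <= e" "e < 1" and f: "real_distribution f" "integrable f jb"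
	and p: "p : bm borel" "!!v. \<bar>p v\<bar> <= L"
shows Qform_integrable: "integrable (sq f) (%z. kernel e z * (p (snd z) - p (fst z))^2)"
	and Qform_bound: "Qform e f p <= 2 * (1 - e) * L^2 * mom f"
	and Qform_nonneg: "0 <= Qform e f p"
	and nn_integral_Qform: "(NI (tensor f) (%z. ennreal (kernel e z * (p (snd z) - p (fst z))^2))) = ennreal (Qform e f p)"
proof -
note k = integrable_kernel_mult[OF e f f ngrad_sq_measurable[OF p(1)] bounded_ngrad[OF p(2)]]
show i: "integrable (sq f) (%z. kernel e z * (p (snd z) - p (fst z))^2)" by (rule k(1))
have "Qform e f p <= (1 - e) / 4 * (4 * L^2) * (mom f + mom f)"
	using k(2) unfolding Qform_def by linarith
then show "Qform e f p <= 2 * (1 - e) * L^2 * mom f" by (simp add: algebra_simps)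
show "0 <= Qform e f p"
	unfolding Qform_def using kernel_nonneg[OF e(2)] by (intro Bochner_Integration.integral_nonneg) auto
have s: "sets f = sets borel" by (rule real_distribution_sets[OF f(1)])
have "(NI (tensor f) (%z. ennreal (kernel e z * (p (snd z) - p (fst z))^2))) =
		(NI (sq f) (%z. ennreal (kernel e z * (p (snd z) - p (fst z))^2)))"
	by (rule nn_integral_tensor[OF s]) (auto simp: offdiag_def)
also have "... = ennreal (Qform e f p)"
	unfolding Qform_def using i kernel_nonneg[OF e(2)] by (intro nn_integral_eq_integral) auto
finally show "(NI (tensor f) (%z. ennreal (kernel e z * (p (snd z) - p (fst z))^2))) = ennreal (Qform e f p)" .
qed

lemma Qform_perturb:
assumes e: "0 <= e" "e < 1" and f: "real_distribution f" "integrable f jb"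
	and p: "p : bm borel" "!!v. \<bar>p v\<bar> <= L"
	and q: "q : bm borel" "!!v. \<bar>q v\<bar> <= L"
	and pq: "!!v. \<bar>p v - q v\<bar> <= om"
shows "\<bar>Qform e f p - Qform e f q\<bar> <= 4 * (1 - e) * L * om * mom f"
proof -
let ?d = "%z. (p (snd z) - p (fst z))^2 - (q (snd z) - q (fst z))^2"
have d: "\<bar>?d z\<bar> <= 8 * L * om" for z
proof -
	have "?d z = ((p (snd z) - q (snd z)) - (p (fst z) - q (fst z))) * ((p (snd z) - p (fst z)) + (q (snd z) - q (fst z)))"
		by (simp add: power2_eq_square algebra_simps)
	moreover have "\<bar>(p (snd z) - q (snd z)) - (p (fst z) - q (fst z))\<bar> <= 2 * om"
		using pq[of "snd z"] pq[of "fst z"] by linarith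
	moreover have "\<bar>(p (snd z) - p (fst z)) + (q (snd z) - q (fst z))\<bar> <= 4 * L"
		using p(2)[of "snd z"] p(2)[of "fst z"] q(2)[of "snd z"] q(2)[of "fst z"] by linarith
	moreover have "0 <= 2 * om" using pq[of 0] abs_ge_zero[of "p 0 - q 0"] by linarith
	ultimately have "\<bar>?d z\<bar> <= (2 * om) * (4 * L)"
		by (simp only: abs_mult) (intro mult_mono, auto)
	then show ?thesis by (simp add: ac_simps)
qed
have md: "?d : bm borel"
	by (intro borel_measurable_diff ngrad_sq_measurable p q)
have "Qform e f p - Qform e f q = (LI (sq f) (%z. kernel e z * ?d z))"
	unfolding Qform_def using Qform_integrable[OF e f p] Qform_integrable[OF e f q]
	by (simp add: right_diff_distrib)
also have "\<bar>...\<bar> <= (1 - e) / 4 * (8 * L * om) * (mom f + mom f)"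
	by (rule integrable_kernel_mult(2)[OF e f f md d])
finally show ?thesis by (simp add: algebra_simps)
qed

section \<open>Test functions of linear growth and the transport estimates\<close>

lemma cutoff_product:
fixes ps ps' :: "real => real"
assumes ps: "!!v. (ps has_real_derivative ps' v) (at v)" "continuous_on UNIV ps'" and L: "!!v. \<bar>ps' v\<bar> <= L"
shows "((%v. ps v * cutoff n v) has_real_derivative ps' v * cutoff n v + ps v * cutoff' n v) (at v)"
	and "continuous_on UNIV (%v. ps' v * cutoff n v + ps v * cutoff' n v)"
	and "!!v. 2 * (1 + real n) < \<bar>v\<bar> ==> ps v * cutoff n v = 0"
	and "\<bar>ps' v * cutoff n v + ps v * cutoff' n v\<bar> <= 5 * L + 2 * \<bar>ps 0\<bar>"
proof -
have L0: "0 <= L" using L[of 0] by linarith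
show "((%v. ps v * cutoff n v) has_real_derivative ps' v * cutoff n v + ps v * cutoff' n v) (at v)"
	using DERIV_mult[OF ps(1)[of v] DERIV_cutoff[of n v]] by (simp add: ac_simps)
have "continuous_on UNIV ps" using ps(1) by (meson DERIV_isCont continuous_at_imp_continuous_on)
moreover have "continuous_on UNIV (cutoff n)" using DERIV_cutoff by (meson DERIV_isCont continuous_at_imp_continuous_on)
ultimately show "continuous_on UNIV (%v. ps' v * cutoff n v + ps v * cutoff' n v)"
	by (intro continuous_intros ps(2) continuous_on_cutoff')
show "!!v. 2 * (1 + real n) < \<bar>v\<bar> ==> ps v * cutoff n v = 0" by (simp add: cutoff_eq_0)
have 1: "\<bar>ps' v * cutoff n v\<bar> <= L"
	using cutoff_bounds[of n v] L[of v] by (simp add: abs_mult) (metis L0 abs_ge_zero abs_of_nonneg mult.right_neutral mult_mono)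
have 2: "\<bar>ps v * cutoff' n v\<bar> <= 4 * L + 2 * \<bar>ps 0\<bar>"
proof (cases "2 * (1 + real n) <= \<bar>v\<bar>")
	case True
	then show ?thesis using L0 by (simp add: cutoff'_outside)
next
	case False
	have "\<bar>ps v\<bar> <= \<bar>ps 0\<bar> + L * \<bar>v\<bar>"
		using DERIV_bounded_imp_Lipschitz[of ps ps' L v 0] ps L by fastforce
	also have "... <= \<bar>ps 0\<bar> * (1 + real n) + L * (2 * (1 + real n))"
		using False L0 by (intro add_mono mult_left_mono) (auto simp: mult_le_cancel_left1)
	finally have "\<bar>ps v\<bar> <= (\<bar>ps 0\<bar> + 2 * L) * (1 + real n)" by (simp add: algebra_simps)
	then have "\<bar>ps v * cutoff' n v\<bar> <= ((\<bar>ps 0\<bar> + 2 * L) * (1 + real n)) * (2 / (1 + real n))"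
		unfolding abs_mult using cutoff'_bound[of n v] L0 by (intro mult_mono) auto
	also have "... = 4 * L + 2 * \<bar>ps 0\<bar>" by (simp add: field_simps)
	finally show ?thesis .
qed
show "\<bar>ps' v * cutoff n v + ps v * cutoff' n v\<bar> <= 5 * L + 2 * \<bar>ps 0\<bar>" using 1 2 by linarith
qed

lemma integrable_linear_growth:
assumes f: "real_distribution f" "integrable f jb" and ps: "continuous_on UNIV ps" and L: "!!v. \<bar>ps v\<bar> <= C * jb v"
shows "integrable f (ps :: real => real)"
proof (rule Bochner_Integration.integrable_bound)
show "integrable f (%v. C * jb v)" using f by simp
show "ps : bm f"
	using borel_measurable_continuous_onI[OF ps] measurable_cong_sets[OF real_distribution_sets[OF f(1)] refl] by blast
have "\<bar>ps v\<bar> <= \<bar>C * jb v\<bar>" for v using L[of v] by linarith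
then show "AE v in f. norm (ps v) <= norm (C * jb v)" by simp
qed

lemma DERIV_bounded_le_jb:
fixes ps :: "real => real"
assumes "!!v. (ps has_real_derivative ps' v) (at v)" "!!v. \<bar>ps' v\<bar> <= L"
shows "\<bar>ps v\<bar> <= (\<bar>ps 0\<bar> + L) * jb v"
proof -
have L0: "0 <= L" using assms(2)[of 0] by linarith
have "\<bar>ps v - ps 0\<bar> <= L * \<bar>v - 0\<bar>" by (rule DERIV_bounded_imp_Lipschitz[OF assms])
then have "\<bar>ps v\<bar> <= \<bar>ps 0\<bar> * 1 + L * \<bar>v\<bar>" by simp
also have "... <= \<bar>ps 0\<bar> * jb v + L * jb v" using jb_bounds[of v] L0 by (intro add_mono mult_left_mono) auto
finally show ?thesis by (simp add: algebra_simps)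
qed

context continuity_eq
begin

lemma rate_tendsto:
assumes p: "!!n. p n : bm borel" "q : bm borel"
	and C: "!!n v. \<bar>p n v\<bar> <= C" and lim: "!!v. (%n. p n v) ----> q v" and K: "K t < \<infinity>"
shows "(%n. rate (p n) t) ----> rate q t"
proof -
have "(%n. LI N (%z. kernel e z * (p n (snd z) - p n (fst z)))) ----> (LI N (%z. kernel e z * (q (snd z) - q (fst z))))"
	if s: "sets N = sets offdiag_borel" and fin: "(NI N (%z. ennreal (kernel e z))) < \<infinity>" for N
proof (rule integral_dominated_convergence[where w="%z. kernel e z * (2 * C)"])
	have mN: "g : bm N" if "g : bm borel" for g :: "_ => real"
		using measurable_offdiag_borel[OF that] measurable_cong_sets[OF s refl] by blast
	show "(%z. kernel e z * (q (snd z) - q (fst z))) : bm N"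
		"!!n. (%z. kernel e z * (p n (snd z) - p n (fst z))) : bm N"
		by (intro mN borel_measurable_times kernel_measurable ngrad_measurable p)+
	have "integrable N (kernel e)"
		using fin kernel_nonneg[OF e(2)] mN[OF kernel_measurable] by (simp add: integrable_iff_bounded)
	then show "integrable N (%z. kernel e z * (2 * C))" by (rule integrable_mult_left)
	show "AE z in N. (%n. kernel e z * (p n (snd z) - p n (fst z))) ----> kernel e z * (q (snd z) - q (fst z))"
		by (intro AE_I2 tendsto_intros lim)
	show "AE z in N. norm (kernel e z * (p n (snd z) - p n (fst z))) <= kernel e z * (2 * C)" for n
	proof (intro AE_I2)
		fix z
		have "\<bar>p n (snd z) - p n (fst z)\<bar> <= 2 * C" using C[of n "snd z"] C[of n "fst z"] by linarith
		then show "norm (kernel e z * (p n (snd z) - p n (fst z))) <= kernel e z * (2 * C)"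
			using kernel_nonneg[OF e(2), of z] by (simp add: abs_mult mult_left_mono)
	qed
qed
moreover have "(NI (pos_variation offdiag_borel (U t)) (%z. ennreal (kernel e z))) < \<infinity>"
	"(NI (neg_variation offdiag_borel (U t)) (%z. ennreal (kernel e z))) < \<infinity>"
	using K unfolding K_def
	by (simp_all add: nn_integral_total_variation[OF measurable_compose[OF measurable_offdiag_borel[OF kernel_measurable] measurable_ennreal]])
ultimately show ?thesis unfolding rate_def signed_integral_def by (intro tendsto_diff) auto
qed

text \<open>
The moment weight \<open>jb\<close> is cut off at increasing scales; the derivatives of its truncations are bounded
uniformly, so that the continuity equation bounds their integrals by the total flux.
\<close>

lemma flow_jb_bound:
assumes f0: "integrable (f 0) jb" and t: "t : {0..T}"
shows "integrable (f t) jb" "mom (f t) <= mom (f 0) + 14 * integral\<^sup>L leb Kr"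
proof -
let ?C = "mom (f 0) + 14 * integral\<^sup>L leb Kr"
note cp = cutoff_product[OF DERIV_jb continuous_on_jb' abs_jb'_le]
interpret ft: real_distribution "f t" by (rule distr_f[OF t])
have f0d: "real_distribution (f 0)" using T by (intro distr_f) auto
have b1: "0 <= jb v * cutoff n v" "jb v * cutoff n v <= jb v" for n v
	using jb_bounds(1)[of v] cutoff_bounds[of n v] by (auto simp: mult_left_le)
have cjb: "continuous_on UNIV (%v. jb v * cutoff n v)" for n
	using cp(1) by (meson DERIV_isCont continuous_at_imp_continuous_on)
have mt: "(%v. jb v * cutoff n v) : bm (f t)" for n
	using borel_measurable_continuous_onI[OF cjb] by simp
have le: "(LI (f t) (%v. jb v * cutoff n v)) <= ?C" for n
proof -
	have "(LI (f t) (%v. jb v * cutoff n v)) - (LI (f 0) (%v. jb v * cutoff n v)) =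
		(LI leb (%s. indicator {0..t} s * rate (%v. v / jb v * cutoff n v + jb v * cutoff' n v) s))"
		using t by (intro flow_compact[OF cp(1,2,3,4)]) auto
	also have "... <= (LI leb (%s. 14 * Kr s))"
	proof (rule integral_mono_AE)
		have m: "(%v. v / jb v * cutoff n v + jb v * cutoff' n v) : bm borel"
			by (rule borel_measurable_continuous_onI[OF cp(2)])
		have b: "\<bar>v / jb v * cutoff n v + jb v * cutoff' n v\<bar> <= 7" for v
			using cp(4)[of v n] by (simp add: jb_def)
		show "integrable leb (%s. indicator {0..t} s * rate (%v. v / jb v * cutoff n v + jb v * cutoff' n v) s)"
			using integrable_real_mult_indicator[OF _ rate_integrable[OF m b], of "{0..t}"] t
			by (simp add: mult.commute sets_restrict_space_iff)
		show "integrable leb (%s. 14 * Kr s)" using Kr_integrable by simp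
		show "AE s in leb. indicator {0..t} s * rate (%v. v / jb v * cutoff n v + jb v * cutoff' n v) s <= 14 * Kr s"
			using AE_K_finite
		proof eventually_elim
			case (elim s)
			show ?case using rate_le[OF m b elim] Kr_nonneg[of s] by (auto simp: indicator_def)
		qed
	qed
	also have "... = 14 * integral\<^sup>L leb Kr" by simp
	finally have "(LI (f t) (%v. jb v * cutoff n v)) <= (LI (f 0) (%v. jb v * cutoff n v)) + 14 * integral\<^sup>L leb Kr" by simp
	also have "(LI (f 0) (%v. jb v * cutoff n v)) <= mom (f 0)"
		unfolding mom_def
	proof (rule integral_mono[OF _ f0 b1(2)])
		show "integrable (f 0) (%v. jb v * cutoff n v)"
			using b1 by (intro integrable_linear_growth[where C=1, OF f0d f0 cjb]) simp
	qed
	finally show ?thesis by simp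
qed
have ic: "integrable (f t) (%v. jb v * cutoff n v)" for n
proof (rule ft.integrable_const_bound)
	have "jb v * cutoff n v <= 3 + 2 * real n" for v
	proof (cases "2 * (1 + real n) <= \<bar>v\<bar>")
		case False
		then have "\<bar>v\<bar> <= 2 + 2 * real n" by simp
		then have "jb v <= 3 + 2 * real n" using jb_bounds(3)[of v] by simp
		then show ?thesis using b1(2)[of v n] by linarith
	qed (simp add: cutoff_eq_0)
	then show "AE v in f t. norm (jb v * cutoff n v) <= 3 + 2 * real n" using b1 by simp
qed (rule mt)
have "(NI (f t) (%v. ennreal (jb v))) = (NI (f t) (%v. liminf (%n. ennreal (jb v * cutoff n v))))"
proof (rule nn_integral_cong)
	fix v
	have "(%n. ennreal (jb v * cutoff n v)) ----> ennreal (jb v * 1)"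
		by (intro tendsto_ennrealI tendsto_mult tendsto_const cutoff_tendsto)
	then show "ennreal (jb v) = liminf (%n. ennreal (jb v * cutoff n v))"
		by (simp add: lim_imp_Liminf)
qed
also have "... <= liminf (%n. NI (f t) (%v. ennreal (jb v * cutoff n v)))"
	using mt by (intro nn_integral_liminf) auto
also have "... = liminf (%n. ennreal (LI (f t) (%v. jb v * cutoff n v)))"
	using ic b1 by (subst nn_integral_eq_integral) auto
also have "... <= liminf (%n::nat. ennreal ?C)"
	by (intro Liminf_mono always_eventually allI ennreal_leI le)
also have "... = ennreal ?C" by (simp add: Liminf_const)
finally have fin: "(NI (f t) (%v. ennreal (jb v))) <= ennreal ?C" .
have nn: "0 <= jb v" for v using jb_bounds(1)[of v] by linarith
show i: "integrable (f t) jb"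
	using fin nn by (intro integrableI_bounded) (auto simp: less_top[symmetric] top_unique intro: le_less_trans)
have "ennreal (mom (f t)) <= ennreal ?C"
	using fin i nn unfolding mom_def by (subst nn_integral_eq_integral[symmetric]) auto
moreover have "0 <= ?C"
	using mom_ge_1[OF f0d f0] Kr_nonneg by (intro add_nonneg_nonneg mult_nonneg_nonneg Bochner_Integration.integral_nonneg) auto
ultimately show "mom (f t) <= ?C" by (simp add: ennreal_le_iff)
qed

lemma flow:
assumes f0: "integrable (f 0) jb"
	and ps: "!!v. (ps has_real_derivative ps' v) (at v)" "continuous_on UNIV ps'" and L: "!!v. \<bar>ps' v\<bar> <= L"
	and ab: "0 <= a" "a <= b" "b <= T"
shows "(LI (f b) (%v. ps v)) - (LI (f a) (%v. ps v)) = (LI leb (%t. indicator {a..b} t * rate ps' t))"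
proof -
note cp = cutoff_product[OF ps L]
define p where "p n v = ps' v * cutoff n v + ps v * cutoff' n v" for n v
let ?C = "5 * L + 2 * \<bar>ps 0\<bar>"
have cps: "continuous_on UNIV ps" using ps(1) by (meson DERIV_isCont continuous_at_imp_continuous_on)
have m: "p n : bm borel" for n
	unfolding p_def by (rule borel_measurable_continuous_onI[OF cp(2)])
have mps': "ps' : bm borel" by (rule borel_measurable_continuous_onI[OF ps(2)])
have b: "\<bar>p n v\<bar> <= ?C" for n v unfolding p_def by (rule cp(4))
have plim: "(%n. p n v) ----> ps' v" for v
	unfolding p_def using tendsto_add[OF tendsto_mult[OF tendsto_const[of "ps' v"] cutoff_tendsto[of v]]
		tendsto_mult[OF tendsto_const[of "ps v"] cutoff'_tendsto[of v]]] by simp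
have lim: "(%n. LI (f t) (%v. ps v * cutoff n v)) ----> (LI (f t) (%v. ps v))" if t: "t : {0..T}" for t
proof (rule integral_dominated_convergence[where w="%v. (\<bar>ps 0\<bar> + L) * jb v"])
	have s: "sets (f t) = sets borel" by (rule real_distribution_sets[OF distr_f[OF t]])
	have mt: "g : bm (f t)" if "continuous_on UNIV g" for g :: "real => real"
		using borel_measurable_continuous_onI[OF that] measurable_cong_sets[OF s refl] by blast
	show "ps : bm (f t)" by (rule mt[OF cps])
	show "(%v. ps v * cutoff n v) : bm (f t)" for n
		using cp(1) by (intro mt) (meson DERIV_isCont continuous_at_imp_continuous_on)
	show "integrable (f t) (%v. (\<bar>ps 0\<bar> + L) * jb v)" using flow_jb_bound(1)[OF f0 t] by simp
	show "AE v in f t. (%n. ps v * cutoff n v) ----> ps v"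
		using tendsto_mult[OF tendsto_const cutoff_tendsto] by (intro AE_I2) fastforce
	show "AE v in f t. norm (ps v * cutoff n v) <= (\<bar>ps 0\<bar> + L) * jb v" for n
	proof (intro AE_I2)
		fix v
		have "norm (ps v * cutoff n v) <= \<bar>ps v\<bar>" using cutoff_bounds[of n v] by (simp add: abs_mult mult_left_le)
		then show "norm (ps v * cutoff n v) <= (\<bar>ps 0\<bar> + L) * jb v"
			using DERIV_bounded_le_jb[of ps ps' L v] ps(1) L by fastforce
	qed
qed
have eq: "(LI (f b) (%v. ps v * cutoff n v)) - (LI (f a) (%v. ps v * cutoff n v)) = (LI leb (%t. indicator {a..b} t * rate (p n) t))" for n
	unfolding p_def[abs_def] by (rule flow_compact[OF cp(1,2,3,4) ab]) auto
have "(%n. LI leb (%t. indicator {a..b} t * rate (p n) t)) ----> (LI leb (%t. indicator {a..b} t * rate ps' t))"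
proof (rule integral_dominated_convergence[where w="%t. 2 * ?C * Kr t"])
	have i: "indicator {a..b} : bm leb" by (rule measurable_lebesgue_on) simp
	show "(%t. indicator {a..b} t * rate ps' t) : bm leb"
		by (intro borel_measurable_times i rate_measurable mps')
	show "(%t. indicator {a..b} t * rate (p n) t) : bm leb" for n
		by (intro borel_measurable_times i rate_measurable m)
	show "integrable leb (%t. 2 * ?C * Kr t)" using Kr_integrable by simp
	show "AE t in leb. (%n. indicator {a..b} t * rate (p n) t) ----> indicator {a..b} t * rate ps' t"
		using AE_K_finite
	proof eventually_elim
		case (elim t)
		show ?case by (intro tendsto_mult tendsto_const rate_tendsto[OF m mps' b plim elim])
	qed
	show "AE t in leb. norm (indicator {a..b} t * rate (p n) t) <= 2 * ?C * Kr t" for n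
		using AE_K_finite
	proof eventually_elim
		case (elim t)
		show ?case using rate_le[OF m b elim, of n] by (auto simp: indicator_def)
	qed
qed
moreover have "(%n. (LI (f b) (%v. ps v * cutoff n v)) - (LI (f a) (%v. ps v * cutoff n v))) ----> (LI (f b) (%v. ps v)) - (LI (f a) (%v. ps v))"
	using ab by (intro tendsto_diff lim) auto
ultimately show ?thesis unfolding eq by (rule LIMSEQ_unique[rotated])
qed

text \<open>
Cauchy--Schwarz twice, first against the action at fixed time and then in time.
\<close>

lemma flow_action_estimate:
assumes f0: "integrable (f 0) jb" and act: "(NI leb (%t. action e (f t) (U t))) <= ennreal A" "0 <= A"
	and ps: "!!v. (ps has_real_derivative ps' v) (at v)" "continuous_on UNIV ps'" and L: "!!v. \<bar>ps' v\<bar> <= L"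
	and q: "!!t. t : {0..T} ==> Qform e (f t) ps' <= q" "0 < q"
	and ab: "0 <= a" "a <= b" "b <= T"
shows "((LI (f b) (%v. ps v)) - (LI (f a) (%v. ps v)))^2 <= (b - a) * A * q"
proof -
have mps': "ps' : bm borel" by (rule borel_measurable_continuous_onI[OF ps(2)])
have mr: "rate ps' : bm leb" by (rule rate_measurable[OF mps'])
have L0: "0 <= L" using L[of 0] by linarith
have pt: "AE t in leb. ennreal ((rate ps' t)^2 / q) <= action e (f t) (U t)"
proof -
	have "AE t in leb. t : {0..T}" by (rule AE_I2) simp
	with AE_K_finite show ?thesis
	proof eventually_elim
		case (elim t)
		show ?case
		proof (cases "action e (f t) (U t) = \<infinity>")
			case False
			then obtain r where r: "action e (f t) (U t) = ennreal r" "0 <= r" by (cases "action e (f t) (U t)") auto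
			have "(NI (total_variation offdiag_borel (U t)) (%z. ennreal (kernel e z * \<bar>ps' (snd z) - ps' (fst z)\<bar>))) <=
				(NI (total_variation offdiag_borel (U t)) (%z. ennreal (2 * L) * ennreal (kernel e z)))"
			proof (rule nn_integral_mono)
				fix z
				have "\<bar>ps' (snd z) - ps' (fst z)\<bar> <= 2 * L" using L[of "snd z"] L[of "fst z"] by linarith
				then show "ennreal (kernel e z * \<bar>ps' (snd z) - ps' (fst z)\<bar>) <= ennreal (2 * L) * ennreal (kernel e z)"
					using kernel_nonneg[OF e(2), of z] L0
					by (subst ennreal_mult'[symmetric])
						(auto intro!: ennreal_leI simp: mult.commute[of "kernel e z"] mult_right_mono simp del: prod.case)
			qed
			also have "... = ennreal (2 * L) * K t"
				unfolding K_def by (intro nn_integral_cmult) (simp add: measurable_offdiag_borel cong: measurable_cong_sets)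
			also have "... < \<infinity>" using elim by (simp add: ennreal_mult_less_top)
			finally have fin: "(NI (total_variation offdiag_borel (U t)) (%z. ennreal (kernel e z * \<bar>ps' (snd z) - ps' (fst z)\<bar>))) < \<infinity>" .
			have Q: "(NI (tensor (f t)) (%z. ennreal (kernel e z * (ps' (snd z) - ps' (fst z))^2))) <= ennreal q"
				unfolding nn_integral_Qform[OF e distr_f[OF elim(2)] flow_jb_bound(1)[OF f0 elim(2)] mps' L]
				using q(1)[OF elim(2)] by (rule ennreal_leI)
			have "(rate ps' t)^2 <= r * q"
				unfolding rate_def
				using signed_integral_le_action[OF e(2) distr_f[OF elim(2)] signed_U[OF elim(2)] ngrad_measurable[OF mps'] fin Q q(2)] r
				by simp
			then show ?thesis unfolding r(1) using q(2) by (intro ennreal_leI) (simp add: field_simps)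
		qed simp
	qed
qed
have "(NI leb (%t. ennreal ((rate ps' t)^2 / q))) <= ennreal A"
	using nn_integral_mono_AE[OF pt] act(1) by (rule order_trans)
moreover have "(NI leb (%t. ennreal ((rate ps' t)^2))) = (NI leb (%t. ennreal q * ennreal ((rate ps' t)^2 / q)))"
	using q(2) by (intro nn_integral_cong) (simp add: ennreal_mult'[symmetric])
moreover have "... = ennreal q * (NI leb (%t. ennreal ((rate ps' t)^2 / q)))"
	by (intro nn_integral_cmult measurable_compose[OF _ measurable_ennreal] borel_measurable_divide
			borel_measurable_power mr borel_measurable_const)
ultimately have "(NI leb (%t. ennreal ((rate ps' t)^2))) <= ennreal q * ennreal A"
	by (auto intro: mult_left_mono)
also have "ennreal q * ennreal A = ennreal (A * q)"
	using q(2) by (subst ennreal_mult'[symmetric]) (simp_all add: mult.commute)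
finally have le: "(NI leb (%t. ennreal ((rate ps' t)^2))) <= ennreal (A * q)" .
have i2: "integrable leb (%t. (rate ps' t)^2)"
	using le mr by (intro integrableI_bounded) (auto intro: le_less_trans)
have "ennreal (LI leb (%t. (rate ps' t)^2)) <= ennreal (A * q)"
	using le i2 by (subst nn_integral_eq_integral[symmetric]) auto
then have r2: "(LI leb (%t. (rate ps' t)^2)) <= A * q"
	using act(2) q(2) by (simp add: ennreal_le_iff)
have mi: "indicator {a..b} : bm leb" by (rule measurable_lebesgue_on) simp
have sq: "(%t. (indicator {a..b} t :: real)^2) = indicator {a..b}" by (auto simp: indicator_def)
have ss: "{a..b} : sets leb" "emeasure leb {a..b} = ennreal (b - a)"
	using ab by (auto simp: sets_restrict_space_iff emeasure_restrict_space)
have ii: "integrable leb (%t. (indicator {a..b} t :: real)^2)" "(LI leb (%t. (indicator {a..b} t)^2)) = b - a"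
	unfolding sq using ss ab by (auto simp: measure_def)
have "((LI (f b) (%v. ps v)) - (LI (f a) (%v. ps v)))^2 = (LI leb (%t. indicator {a..b} t * rate ps' t))^2"
	using flow[OF f0 ps L ab] by simp
also have "... <= (LI leb (%t. (indicator {a..b} t)^2)) * (LI leb (%t. (rate ps' t)^2))"
	by (rule Cauchy_Schwarz_integral(2)[OF mi mr ii(1) i2])
also have "... <= (b - a) * (A * q)" unfolding ii(2) using r2 ab by (intro mult_left_mono) auto
finally show ?thesis by (simp add: mult.assoc)
qed

end

lemma Lipschitz_imp_continuous_on_real:
fixes ps :: "real => real"
assumes "!!x y. \<bar>ps x - ps y\<bar> <= L * \<bar>x - y\<bar>" "0 <= L"
shows "continuous_on UNIV ps"
proof -
have "L-lipschitz_on UNIV ps" using assms by (intro lipschitz_onI) (auto simp: dist_real_def)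
then show ?thesis by (rule lipschitz_on_continuous_on)
qed

lemma kernel_form_Lipschitz:
fixes th :: "real => real"
assumes b: "!!v. \<bar>th v\<bar> <= L" and lip: "!!x y. \<bar>th x - th y\<bar> <= K * \<bar>x - y\<bar>"
	and supp: "!!v. R < \<bar>v\<bar> ==> th v = 0" and R: "0 <= R" and K: "0 <= K" and c: "\<bar>c\<bar> <= L"
shows "\<bar>\<bar>v - w\<bar> * (c - th v)^2 - \<bar>v' - w\<bar> * (c - th v')^2\<bar> <= (4 * L^2 + 4 * L * K * (R + \<bar>w\<bar>)) * \<bar>v - v'\<bar>"
proof -
have L0: "0 <= L" using b[of 0] by linarith
have main: "\<bar>\<bar>v - w\<bar> * (c - th v)^2 - \<bar>v' - w\<bar> * (c - th v')^2\<bar> <= (4 * L^2 + 4 * L * K * (R + \<bar>w\<bar>)) * \<bar>v - v'\<bar>"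
	if v': "\<bar>v'\<bar> <= R" for v v'
proof -
	let ?P = "c - th v" and ?P' = "c - th v'"
	have P: "\<bar>?P\<bar> <= 2 * L" "\<bar>?P'\<bar> <= 2 * L" using b[of v] b[of v'] c by linarith+
	have P2: "?P^2 <= 4 * L^2" using power_mono[OF P(1), of 2] by (simp add: power_mult_distrib)
	have "\<bar>?P^2 - ?P'^2\<bar> = \<bar>th v - th v'\<bar> * \<bar>?P + ?P'\<bar>"
		by (simp add: power2_eq_square abs_mult[symmetric] algebra_simps)
	also have "... <= (K * \<bar>v - v'\<bar>) * (4 * L)"
		using lip[of v v'] P by (intro mult_mono) auto
	finally have d: "\<bar>?P^2 - ?P'^2\<bar> <= 4 * L * K * \<bar>v - v'\<bar>" by (simp add: ac_simps)
	have "\<bar>v - w\<bar> * ?P^2 - \<bar>v' - w\<bar> * ?P'^2 = (\<bar>v - w\<bar> - \<bar>v' - w\<bar>) * ?P^2 + \<bar>v' - w\<bar> * (?P^2 - ?P'^2)"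
		by (simp add: algebra_simps)
	also have "\<bar>...\<bar> <= \<bar>\<bar>v - w\<bar> - \<bar>v' - w\<bar>\<bar> * ?P^2 + \<bar>v' - w\<bar> * \<bar>?P^2 - ?P'^2\<bar>"
		by (rule order_trans[OF abs_triangle_ineq]) (simp add: abs_mult)
	also have "... <= \<bar>v - v'\<bar> * (4 * L^2) + (R + \<bar>w\<bar>) * (4 * L * K * \<bar>v - v'\<bar>)"
		using P2 d v' R by (intro add_mono mult_mono) auto
	also have "... = (4 * L^2 + 4 * L * K * (R + \<bar>w\<bar>)) * \<bar>v - v'\<bar>" by (simp add: algebra_simps)
	finally show ?thesis .
qed
consider "\<bar>v'\<bar> <= R" | "\<bar>v\<bar> <= R" | "R < \<bar>v\<bar>" "R < \<bar>v'\<bar>" by linarith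
then show ?thesis
proof cases
	case 1 then show ?thesis by (rule main)
next
	case 2 then show ?thesis using main[of v v'] by (simp add: abs_minus_commute)
next
	case 3
	then have "\<bar>\<bar>v - w\<bar> * (c - th v)^2 - \<bar>v' - w\<bar> * (c - th v')^2\<bar> = \<bar>\<bar>v - w\<bar> - \<bar>v' - w\<bar>\<bar> * c^2"
		using supp by (simp add: abs_mult[symmetric] left_diff_distrib[symmetric] del: abs_mult) (simp add: abs_mult)
	also have "... <= \<bar>v - v'\<bar> * (4 * L^2 + 4 * L * K * (R + \<bar>w\<bar>))"
	proof (intro mult_mono)
		have "c^2 <= L^2" using power_mono[OF c, of 2] by simp
		moreover have "0 <= L^2" "0 <= 4 * L * K * (R + \<bar>w\<bar>)" using L0 K R by auto
		ultimately show "c^2 <= 4 * L^2 + 4 * L * K * (R + \<bar>w\<bar>)" by linarith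
	qed auto
	finally show ?thesis by (simp add: mult.commute)
qed
qed

text \<open>Averages over short intervals smooth a Lipschitz function without spoiling its constant.\<close>

lemma Lipschitz_C1_approx:
fixes ps :: "real => real"
assumes lip: "!!x y. \<bar>ps x - ps y\<bar> <= L * \<bar>x - y\<bar>" and ep: "0 < ep"
obtains ph ph' where "!!v. (ph has_real_derivative ph' v) (at v)" "continuous_on UNIV ph'"
	"!!v. \<bar>ph' v\<bar> <= L" "!!v. \<bar>ph v - ps v\<bar> <= L * ep"
proof -
have L0: "0 <= L" using lip[of 1 0] by simp
have cps: "continuous_on UNIV ps"
	by (rule Lipschitz_imp_continuous_on_real[OF lip L0])
then have "EX F. ALL x::real. - \<infinity> < ereal x --> ereal x < \<infinity> --> (F has_vector_derivative ps x) (at x)"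
	by (intro einterval_antiderivative) (auto simp: continuous_on_eq_continuous_at)
then obtain F where F: "!!x. (F has_real_derivative ps x) (at x)"
	by (auto simp: has_real_derivative_iff_has_vector_derivative)
define ph where "ph v = (F (v + ep) - F v) / ep" for v
define ph' where "ph' v = (ps (v + ep) - ps v) / ep" for v
show ?thesis
proof
	show "(ph has_real_derivative ph' v) (at v)" for v
	proof -
		have "((%v. F (v + ep)) has_real_derivative ps (v + ep)) (at v)"
			using F[of "v + ep"] by (simp add: DERIV_shift)
		then show ?thesis unfolding ph_def[abs_def] ph'_def using F[of v] ep
			by (intro DERIV_cdivide DERIV_diff)
	qed
	show "continuous_on UNIV ph'"
		unfolding ph'_def using ep by (intro continuous_intros continuous_on_compose2[OF cps]) auto
	show "\<bar>ph' v\<bar> <= L" for v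
		unfolding ph'_def using lip[of "v + ep" v] ep by (simp add: field_simps)
	show "\<bar>ph v - ps v\<bar> <= L * ep" for v
	proof -
		have "EX z>v. z < v + ep & F (v + ep) - F v = (v + ep - v) * ps z"
			using ep F by (intro MVT2) auto
		then obtain z where z: "v < z" "z < v + ep" "F (v + ep) - F v = ep * ps z" by auto
		then have "ph v = ps z" using ep by (simp add: ph_def)
		then have "\<bar>ph v - ps v\<bar> <= L * \<bar>z - v\<bar>" using lip by simp
		also have "... <= L * ep" using z L0 by (intro mult_left_mono) auto
		finally show ?thesis .
	qed
qed
qed

context continuity_eq
begin

lemma mom_flow:
assumes f0: "integrable (f 0) jb" and act: "(NI leb (%t. action e (f t) (U t))) <= ennreal A" "0 <= A"
	and t: "t : {0..T}"
shows "mom (f t) <= 2 * mom (f 0) + 2 * (1 - e) * (T * A)"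
proof -
define B where "B = (SUP t\<in>{0..T}. mom (f t))"
have bdd: "bdd_above ((%t. mom (f t)) ` {0..T})"
	using flow_jb_bound(2)[OF f0] by (intro bdd_aboveI2)
have le: "mom (f s) <= B" if "s : {0..T}" for s
	unfolding B_def using that bdd by (intro cSUP_upper)
have B1: "1 <= B"
proof -
	have z: "0 : {0..T}" using T by simp
	show ?thesis using le[OF z] mom_ge_1[OF distr_f[OF z] f0] by linarith
qed
have step: "mom (f s) <= mom (f 0) + B / 2 + (1 - e) * (T * A)" if s: "s : {0..T}" for s
proof -
	have q: "0 < 2 * (1 - e) * B" using e B1 by simp
	have "((LI (f s) (%v. jb v)) - (LI (f 0) (%v. jb v)))^2 <= (s - 0) * A * (2 * (1 - e) * B)"
	proof (rule flow_action_estimate[OF f0 act DERIV_jb continuous_on_jb' abs_jb'_le _ q])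
		fix r assume r: "r : {0..T}"
		have 1: "Qform e (f r) (%v. v / jb v) <= 2 * (1 - e) * 1^2 * mom (f r)"
			by (rule Qform_bound[OF e distr_f[OF r] flow_jb_bound(1)[OF f0 r]
				borel_measurable_continuous_onI[OF continuous_on_jb'] abs_jb'_le])
		have 2: "0 <= 2 * (1 - e) * 1^2" using e by simp
		have 3: "2 * (1 - e) * 1^2 * mom (f r) <= 2 * (1 - e) * 1^2 * B"
			by (rule mult_left_mono[OF le[OF r] 2])
		show "Qform e (f r) (%v. v / jb v) <= 2 * (1 - e) * B"
			using order_trans[OF 1 3] by simp
	qed (use s in auto)
	also have "... <= T * A * (2 * (1 - e) * B)" using s act q by (intro mult_right_mono) auto
	also have "... <= (B / 2 + (1 - e) * (T * A))^2"
	proof -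
		have "(B / 2 + (1 - e) * (T * A))^2 - T * A * (2 * (1 - e) * B) = (B / 2 - (1 - e) * (T * A))^2"
			by (simp add: power2_eq_square algebra_simps)
		then show ?thesis using zero_le_power2[of "B / 2 - (1 - e) * (T * A)"] by linarith
	qed
	finally have "(mom (f s) - mom (f 0))^2 <= (B / 2 + (1 - e) * (T * A))^2" by (simp add: mom_def)
	then have "mom (f s) - mom (f 0) <= B / 2 + (1 - e) * (T * A)"
	proof (rule power2_le_imp_le)
		have "0 <= (1 - e) * (T * A)" using e act(2) T by (intro mult_nonneg_nonneg) auto
		then show "0 <= B / 2 + (1 - e) * (T * A)" using B1 by linarith
	qed
	then show ?thesis by simp
qed
have "B <= mom (f 0) + B / 2 + (1 - e) * (T * A)"
	unfolding B_def[symmetric] using step T by (subst B_def) (intro cSUP_least, auto)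
moreover have "2 * (1 - e) * (T * A) = 2 * ((1 - e) * (T * A))" by simp
ultimately show ?thesis using le[OF t] by linarith
qed

lemma Lipschitz_flow:
fixes ps :: "real => real"
assumes f0: "integrable (f 0) jb" and act: "(NI leb (%t. action e (f t) (U t))) <= ennreal A" "0 <= A"
	and lip: "!!x y. \<bar>ps x - ps y\<bar> <= L * \<bar>x - y\<bar>" and L: "0 < L"
	and B: "!!t. t : {0..T} ==> mom (f t) <= B"
	and t: "t : {0..T}"
shows "\<bar>(LI (f t) (%v. ps v)) - (LI (f 0) (%v. ps v))\<bar> <= L * sqrt (T * A * (2 * (1 - e) * B))"
proof (rule field_le_epsilon)
fix ep' :: real assume ep': "0 < ep'"
define ep where "ep = ep' / (2 * L)"
have ep: "0 < ep" using ep' L by (simp add: ep_def)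
have z: "0 : {0..T}" using T by simp
have B1: "1 <= B" using B[OF z] mom_ge_1[OF distr_f[OF z] f0] by simp
obtain ph ph' where ph: "!!v. (ph has_real_derivative ph' v) (at v)" "continuous_on UNIV ph'"
	"!!v. \<bar>ph' v\<bar> <= L" "!!v. \<bar>ph v - ps v\<bar> <= L * ep"
	using Lipschitz_C1_approx[OF lip ep] by blast
have q: "0 < 2 * (1 - e) * L^2 * B" using e L B1 by simp
have "((LI (f t) (%v. ph v)) - (LI (f 0) (%v. ph v)))^2 <= (t - 0) * A * (2 * (1 - e) * L^2 * B)"
proof (rule flow_action_estimate[OF f0 act ph(1,2,3) _ q])
	fix r assume r: "r : {0..T}"
	have "Qform e (f r) ph' <= 2 * (1 - e) * L^2 * mom (f r)"
		by (rule Qform_bound[OF e distr_f[OF r] flow_jb_bound(1)[OF f0 r]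
				borel_measurable_continuous_onI[OF ph(2)] ph(3)])
	also have "... <= 2 * (1 - e) * L^2 * B" using B[OF r] e by (intro mult_left_mono) auto
	finally show "Qform e (f r) ph' <= 2 * (1 - e) * L^2 * B" .
qed (use t in auto)
also have "... <= T * A * (2 * (1 - e) * L^2 * B)" using t act q by (intro mult_right_mono) auto
also have "... = L^2 * (T * A * (2 * (1 - e) * B))" by simp
finally have "\<bar>(LI (f t) (%v. ph v)) - (LI (f 0) (%v. ph v))\<bar> <= sqrt (L^2 * (T * A * (2 * (1 - e) * B)))"
	by (rule real_le_rsqrt[OF order_trans[OF eq_refl[OF power2_abs]]])
then have 1: "\<bar>(LI (f t) (%v. ph v)) - (LI (f 0) (%v. ph v))\<bar> <= L * sqrt (T * A * (2 * (1 - e) * B))"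
	using L by (simp add: real_sqrt_mult)
have 2: "\<bar>(LI (f s) (%v. ph v)) - (LI (f s) (%v. ps v))\<bar> <= L * ep" if s: "s : {0..T}" for s
proof -
	interpret real_distribution "f s" by (rule distr_f[OF s])
	have cph: "continuous_on UNIV ph" using ph(1) by (meson DERIV_isCont continuous_at_imp_continuous_on)
	have cps: "continuous_on UNIV ps" by (rule Lipschitz_imp_continuous_on_real[OF lip]) (use L in simp)
	note j = flow_jb_bound(1)[OF f0 s]
	have iph: "integrable (f s) ph"
		by (rule integrable_linear_growth[OF distr_f[OF s] j cph DERIV_bounded_le_jb[OF ph(1,3)]])
	have bps: "\<bar>ps v\<bar> <= (\<bar>ps 0\<bar> + L) * jb v" for v
	proof -
		have "\<bar>ps v\<bar> <= \<bar>ps 0\<bar> * 1 + L * \<bar>v\<bar>" using lip[of v 0] by simp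
		also have "... <= \<bar>ps 0\<bar> * jb v + L * jb v" using jb_bounds[of v] L by (intro add_mono mult_left_mono) auto
		finally show ?thesis by (simp add: algebra_simps)
	qed
	have ips: "integrable (f s) ps"
		by (rule integrable_linear_growth[OF distr_f[OF s] j cps bps])
	have "\<bar>(LI (f s) (%v. ph v)) - (LI (f s) (%v. ps v))\<bar> = \<bar>LI (f s) (%v. ph v - ps v)\<bar>" using iph ips by simp
	also have "... <= (LI (f s) (%v. \<bar>ph v - ps v\<bar>))" by (rule integral_abs_bound)
	also have "... <= (LI (f s) (%v. L * ep))" using iph ips ph(4) by (intro integral_mono) auto
	also have "... = L * ep" using prob_space by simp
	finally show ?thesis .
qed
have "\<bar>(LI (f t) (%v. ps v)) - (LI (f 0) (%v. ps v))\<bar> <= L * sqrt (T * A * (2 * (1 - e) * B)) + 2 * (L * ep)"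
	using 1 2[OF t] 2[OF z] by linarith
also have "2 * (L * ep) = ep'" using L by (simp add: ep_def)
finally show "\<bar>(LI (f t) (%v. ps v)) - (LI (f 0) (%v. ps v))\<bar> <= L * sqrt (T * A * (2 * (1 - e) * B)) + ep'" .
qed

text \<open>
  For fixed \<open>w\<close> the integrand of the Dirichlet form is Lipschitz in \<open>v\<close>, with a
  constant growing linearly in \<open>w\<close>. Replacing the two factors of the product measure one after the
  other, the Lipschitz estimate therefore controls the change of the form along the curve.
\<close>

lemma Qform_flow:
fixes th :: "real => real"
assumes f0: "integrable (f 0) jb" and act: "(NI leb (%t. action e (f t) (U t))) <= ennreal A" "0 <= A"
	and b: "!!v. \<bar>th v\<bar> <= L" and lip: "!!x y. \<bar>th x - th y\<bar> <= K' * \<bar>x - y\<bar>"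
	and supp: "!!v. R < \<bar>v\<bar> ==> th v = 0" and R: "0 <= R" and K': "0 <= K'" and L: "0 < L"
	and B: "!!t. t : {0..T} ==> mom (f t) <= B"
	and t: "t : {0..T}"
shows "Qform e (f t) th <= Qform e (f 0) th +
	(1 - e) / 2 * (4 * L^2 + 4 * L * K' * (R + 1)) * B * sqrt (T * A * (2 * (1 - e) * B))"
proof -
define C where "C = 4 * L^2 + 4 * L * K' * (R + 1)"
define X where "X = sqrt (T * A * (2 * (1 - e) * B))"
define k where "k v w = kernel e (v, w) * (th w - th v)^2" for v w
have C0: "0 < C" unfolding C_def using L K' R by (intro add_pos_nonneg) auto
have z: "0 : {0..T}" using T by simp
note ft = distr_f[OF t] flow_jb_bound(1)[OF f0 t]
note f0' = distr_f[OF z] f0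
interpret ft: real_distribution "f t" by (rule ft)
interpret f0: real_distribution "f 0" by (rule f0')
have cth: "continuous_on UNIV th" by (rule Lipschitz_imp_continuous_on_real[OF lip K'])
have mth: "th : bm borel" by (rule borel_measurable_continuous_onI[OF cth])
have X0: "0 <= X" using T act e B[OF z] mom_ge_1[OF f0'] by (simp add: X_def)
have ksym: "k v w = k w v" for v w by (simp add: k_def sigma_e_def power2_commute abs_minus_commute)
have klip: "\<bar>k v w - k v' w\<bar> <= ((1 - e) / 4 * C * jb w) * \<bar>v - v'\<bar>" for v v' w
proof -
	have "k v w - k v' w = (1 - e) / 4 * (\<bar>v - w\<bar> * (th w - th v)^2 - \<bar>v' - w\<bar> * (th w - th v')^2)"
		by (simp add: k_def sigma_e_def algebra_simps)
	also have "\<bar>...\<bar> = (1 - e) / 4 * \<bar>\<bar>v - w\<bar> * (th w - th v)^2 - \<bar>v' - w\<bar> * (th w - th v')^2\<bar>"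
		using e by (simp add: abs_mult)
	also have "... <= (1 - e) / 4 * ((4 * L^2 + 4 * L * K' * (R + \<bar>w\<bar>)) * \<bar>v - v'\<bar>)"
		using e by (intro mult_left_mono kernel_form_Lipschitz[OF b lip supp R K' b]) auto
	also have "... <= (1 - e) / 4 * ((C * jb w) * \<bar>v - v'\<bar>)"
	proof (intro mult_left_mono mult_right_mono)
		have "4 * L^2 * 1 <= 4 * L^2 * jb w" using jb_bounds[of w] by (intro mult_left_mono) auto
		moreover have "4 * L * K' * (R + \<bar>w\<bar>) <= 4 * L * K' * ((R + 1) * jb w)"
		proof (intro mult_left_mono)
			have "R * 1 <= R * jb w" using jb_bounds[of w] R by (intro mult_left_mono) auto
			then show "R + \<bar>w\<bar> <= (R + 1) * jb w" using jb_bounds[of w] by (simp add: algebra_simps)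
		qed (use L K' in auto)
		ultimately show "4 * L^2 + 4 * L * K' * (R + \<bar>w\<bar>) <= C * jb w" by (simp add: C_def algebra_simps)
	qed (use e in auto)
	finally show ?thesis by (simp add: ac_simps)
qed
have hdiff: "\<bar>(LI (f t) (%v. k v w)) - (LI (f 0) (%v. k v w))\<bar> <= (1 - e) / 4 * C * X * jb w" for w
proof -
	have "0 < (1 - e) / 4 * C * jb w" using e C0 jb_bounds(1)[of w] by auto
	from Lipschitz_flow[OF f0 act klip this B t] show ?thesis unfolding X_def by (simp add: ac_simps)
qed
note k_int = integrable_kernel_mult(1)[OF e _ _ _ _ ngrad_sq_measurable[OF mth] bounded_ngrad[OF b]]
have kpair: "(%z. kernel e z * (th (snd z) - th (fst z))^2) = case_prod k" by (auto simp: k_def)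
have itt: "integrable (sq (f t)) (case_prod k)" using k_int[OF ft ft] by (simp only: kpair)
have it0: "integrable (f t \<Otimes>\<^sub>M f 0) (case_prod k)" using k_int[OF ft f0'] by (simp only: kpair)
have i00: "integrable (sq (f 0)) (case_prod k)" using k_int[OF f0' f0'] by (simp only: kpair)
interpret Ptt: pair_sigma_finite "f t" "f t" ..
interpret Pt0: pair_sigma_finite "f t" "f 0" ..
interpret P00: pair_sigma_finite "f 0" "f 0" ..
let ?ht = "%w. LI (f t) (%v. k v w)" and ?h0 = "%w. LI (f 0) (%v. k v w)"
have sw: "(LI M (%w. k v w)) = (LI M (%w. k w v))" for v M by (intro Bochner_Integration.integral_cong) (auto simp: ksym)
have Qt: "Qform e (f t) th = (LI (f t) (%w. ?ht w))"
	unfolding Qform_def kpair using Ptt.integral_snd[OF itt] by simp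
have Q0: "Qform e (f 0) th = (LI (f 0) (%w. ?h0 w))"
	unfolding Qform_def kpair using P00.integral_snd[OF i00] by simp
have mid: "(LI (f 0) (%w. ?ht w)) = (LI (f t) (%v. ?h0 v))"
	using Pt0.integral_snd[OF it0] Pt0.integral_fst[OF it0] by (simp add: sw)
have iht_t: "integrable (f t) ?ht" using Ptt.integrable_snd[OF itt] .
have iht_0: "integrable (f 0) ?ht" using Pt0.integrable_snd[OF it0] .
have ih0_0: "integrable (f 0) ?h0" using P00.integrable_snd[OF i00] .
have ih0_t: "integrable (f t) ?h0" using Pt0.integrable_fst[OF it0] by (simp add: sw)
have est: "(LI M (%w. ?ht w)) - (LI M (%w. ?h0 w)) <= (1 - e) / 4 * C * X * B"
	if i: "integrable M ?ht" "integrable M ?h0" "integrable M jb" and mB: "mom M <= B" for M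
proof -
	have "(LI M (%w. ?ht w)) - (LI M (%w. ?h0 w)) = (LI M (%w. ?ht w - ?h0 w))" using i by simp
	also have "... <= (LI M (%w. (1 - e) / 4 * C * X * jb w))"
	proof (rule integral_mono)
		show "integrable M (%w. ?ht w - ?h0 w)" using i by (intro Bochner_Integration.integrable_diff)
		show "integrable M (%w. (1 - e) / 4 * C * X * jb w)" using i by simp
		show "?ht w - ?h0 w <= (1 - e) / 4 * C * X * jb w" for w using hdiff[of w] by linarith
	qed
	also have "... = (1 - e) / 4 * C * X * mom M" by (simp add: mom_def)
	also have "... <= (1 - e) / 4 * C * X * B" using e C0 X0 mB by (intro mult_left_mono) auto
	finally show ?thesis .
qed
have "Qform e (f t) th - Qform e (f 0) th =
		((LI (f t) (%w. ?ht w)) - (LI (f t) (%w. ?h0 w))) + ((LI (f 0) (%w. ?ht w)) - (LI (f 0) (%w. ?h0 w)))"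
	unfolding Qt Q0 mid by simp
also have "... <= (1 - e) / 4 * C * X * B + (1 - e) / 4 * C * X * B"
	by (intro add_mono est iht_t ih0_t iht_0 ih0_0 ft(2) f0 B t z)
finally show ?thesis by (simp add: C_def X_def field_simps)
qed

end

section \<open>Estimates in terms of the collision transport cost\<close>

lemma ennsqrt_less:
assumes "ennsqrt x < ennreal d" shows "x < ennreal (d^2)" "0 < d"
proof -
have "\<not> ennreal d <= 0"
proof
	assume "ennreal d <= 0"
	then have "ennreal d = 0" by simp
	with assms show False by simp
qed
then show d: "0 < d" by (auto simp: not_le ennreal_eq_0_iff)
obtain r where r: "x = ennreal r" "0 <= r" using assms by (cases x) (auto simp: ennsqrt_def)
then have "sqrt r < d" using assms d by (simp add: ennsqrt_def ennreal_less_iff)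
then have "r < d^2" using r by (metis abs_of_nonneg d less_imp_le real_sqrt_abs real_sqrt_less_iff)
then show "x < ennreal (d^2)" using r by (simp add: ennreal_less_iff)
qed

lemma dA_less_obtains:
assumes "dA e mu nu < ennreal d"
obtains g U where "CE e 1 g U" "g 0 = mu" "g 1 = nu" "(NI (lebesgue_on {0..1}) (%t. action e (g t) (U t))) <= ennreal (d^2)" "0 < d"
proof -
have d: "0 < d" and "(\<Sqinter>(f, U)\<in>{(f, U). CE e 1 f U & f 0 = mu & f 1 = nu}.
			NI (lebesgue_on {0..1}) (%t. action e (f t) (U t))) < ennreal (d^2)"
	using ennsqrt_less[OF assms[unfolded dA_def]] by auto
then obtain g U where "CE e 1 g U" "g 0 = mu" "g 1 = nu"
		"(NI (lebesgue_on {0..1}) (%t. action e (g t) (U t))) < ennreal (d^2)"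
	by (auto simp: INF_less_iff)
then show ?thesis using that d less_imp_le by blast
qed

lemma mom_dA:
assumes e: "0 <= e" "e < 1" and mu: "integrable mu jb" and d: "dA e mu nu < ennreal d"
shows "mom nu <= 2 * mom mu + 2 * (1 - e) * d^2"
proof -
obtain g U where g: "CE e 1 g U" "g 0 = mu" "g 1 = nu"
	"(NI (lebesgue_on {0..1}) (%t. action e (g t) (U t))) <= ennreal (d^2)" "0 < d"
	using dA_less_obtains[OF d] .
interpret continuity_eq e 1 g U using e g(1) by unfold_locales auto
show ?thesis using mom_flow[of "d^2" 1] g mu by simp
qed

text \<open>The initial moment is controlled by the final one through the quadratic inequality for the increment
  of the moment along the flow.\<close>

lemma mom_dA_reverse:
assumes e: "0 <= e" "e < 1" and mu: "real_distribution mu" "integrable mu jb" and d: "dA e mu nu < ennreal d"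
shows "mom mu <= 2 * mom nu + 17 * ((1 - e) * d^2)"
proof -
obtain g U where g: "CE e 1 g U" "g 0 = mu" "g 1 = nu"
	"(NI (lebesgue_on {0..1}) (%t. action e (g t) (U t))) <= ennreal (d^2)" "0 < d"
	using dA_less_obtains[OF d] .
interpret continuity_eq e 1 g U using e g(1) by unfold_locales auto
have g0: "integrable (g 0) jb" using mu g by simp
have act: "(NI (lebesgue_on {0..1}) (%t. action e (g t) (U t))) <= ennreal (d^2)" "0 <= d^2" using g by auto
define k x y where "k = (1 - e) * d^2" and "x = mom mu" and "y = mom nu"
have k: "0 < k" using e g(5) by (simp add: k_def)
have x: "1 <= x" unfolding x_def by (rule mom_ge_1[OF mu])
have y: "1 <= y" unfolding y_def g(3)[symmetric]
	by (rule mom_ge_1[OF distr_f flow_jb_bound(1)[OF g0]]) auto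
have Q: "Qform e (g t) (%v. v / jb v) <= 4 * (1 - e) * (x + k)" if t: "t : {0..1}" for t
proof -
	have "Qform e (g t) (%v. v / jb v) <= 2 * (1 - e) * 1^2 * mom (g t)"
		by (rule Qform_bound[OF e distr_f[OF t] flow_jb_bound(1)[OF g0 t]
					borel_measurable_continuous_onI[OF continuous_on_jb'] abs_jb'_le])
	also have "... <= 2 * (1 - e) * 1^2 * (2 * x + 2 * k)"
		using mom_flow[OF g0 act t] e(2) unfolding x_def k_def g(2)
		by (intro mult_left_mono) (auto simp: algebra_simps)
	finally show ?thesis by (simp add: algebra_simps)
qed
have "((LI (g 1) (%v. jb v)) - (LI (g 0) (%v. jb v)))^2 <= (1 - 0) * d^2 * (4 * (1 - e) * (x + k))"
	using e x k by (intro flow_action_estimate[OF g0 act DERIV_jb continuous_on_jb' abs_jb'_le Q]) auto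
moreover have "(1 - 0) * d^2 * (4 * (1 - e) * (x + k)) = 4 * k * (x + k)" by (simp add: k_def)
ultimately have "(y - x)^2 <= 4 * k * (x + k)"
	by (simp only: g mom_def[symmetric] x_def[symmetric] y_def[symmetric])
moreover have False if *: "2 * y + 17 * k < x" "(y - x)^2 <= 4 * k * (x + k)"
proof -
	have "(x / 2)^2 <= (x - y)^2" using * x y k by (intro power_mono) auto
	then have "x * x <= 16 * (k * x) + 16 * (k * k)"
		using *(2) by (simp add: power2_eq_square algebra_simps)
	moreover have "(17 * k) * x < x * x" using * x y by (intro mult_strict_right_mono) auto
	moreover have "k * (17 * k) < k * x" using * k y by (intro mult_strict_left_mono) auto
	moreover have "0 < k * k" using k by simp
	ultimately show False by (simp add: mult.assoc mult.left_commute)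
qed
ultimately show ?thesis unfolding x_def y_def k_def by (meson not_le)
qed

text \<open>
  The error by which the Dirichlet form may grow along an almost optimal curve, for test functions
  whose derivative is bounded by \<open>L\<close>, supported in \<open>[-R, R]\<close> and oscillates by at most
  \<open>om\<close> at scale \<open>de\<close>.
\<close>

definition transport_err :: "real => real => real => real => real => real => real => real" where
"transport_err e L R de om M d =
	8 * (1 - e) * L * om * (2 * M + 2 * (1 - e) * d^2) +
	(1 - e) / 2 * (4 * L^2 + 4 * L * (2 * L / de) * (R + de + 1)) * (2 * M + 2 * (1 - e) * d^2) *
		sqrt (d^2 * (2 * (1 - e) * (2 * M + 2 * (1 - e) * d^2)))"

lemma transport_err_tendsto: "(transport_err e L R de om M \<longlongrightarrow> 16 * (1 - e) * L * om * M) (at 0)"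
proof -
have "continuous_on UNIV (transport_err e L R de om M)"
	unfolding transport_err_def[abs_def] by (intro continuous_intros)
then have "(transport_err e L R de om M \<longlongrightarrow> transport_err e L R de om M 0) (at 0)"
	by (simp add: continuous_on_def)
then show ?thesis by (simp add: transport_err_def ac_simps)
qed

text \<open>
Along a nearly optimal curve the Dirichlet form is compared with its initial value. The derivative of
\<open>ps\<close> is only continuous, so it is replaced by a difference quotient of \<open>ps\<close>, which is Lipschitz and
uniformly close to it, before the growth of the form is estimated.
\<close>

lemma dA_test_function:
fixes ps ps' :: "real => real"
assumes e: "0 <= e" "e < 1" and mu: "real_distribution mu" "integrable mu jb" "mom mu <= M"
	and d: "dA e mu nu < ennreal d"
	and ps: "!!v. (ps has_real_derivative ps' v) (at v)" "continuous_on UNIV ps'" and L: "!!v. \<bar>ps' v\<bar> <= L" "0 < L"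
	and R: "!!v. R < \<bar>v\<bar> ==> ps v = 0" "0 <= R"
	and om: "!!x y. \<bar>x - y\<bar> <= de ==> \<bar>ps' x - ps' y\<bar> <= om" and de: "0 < de"
shows "((LI nu (%v. ps v)) - (LI mu (%v. ps v)))^2 <= d^2 * (Qform e mu ps' + transport_err e L R de om M d)"
	and "Qform e nu ps' <= Qform e mu ps' + transport_err e L R de om M d"
proof -
obtain g U where g: "CE e 1 g U" "g 0 = mu" "g 1 = nu"
	"(NI (lebesgue_on {0..1}) (%t. action e (g t) (U t))) <= ennreal (d^2)" "0 < d"
	using dA_less_obtains[OF d] .
interpret continuity_eq e 1 g U using e g(1) by unfold_locales auto
define B where "B = 2 * M + 2 * (1 - e) * d^2"
have g0: "integrable (g 0) jb" using mu g by simp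
have act: "(NI (lebesgue_on {0..1}) (%t. action e (g t) (U t))) <= ennreal (d^2)" "0 <= d^2" using g by auto
have B: "mom (g t) <= B" if "t : {0..1}" for t
	using mom_flow[OF g0 act that] mu(3) g(2) by (simp add: B_def)
have B1: "1 <= B" using B[of 0] mom_ge_1[OF mu(1,2)] g(2) by simp
have om0: "0 <= om" using om[of 0 0] de by simp
define th where "th v = (ps (v + de) - ps v) / de" for v
have mv: "EX z. v < z & z < v + de & th v = ps' z" for v
proof -
	have "EX z>v. z < v + de & ps (v + de) - ps v = (v + de - v) * ps' z"
		using de ps(1) by (intro MVT2) auto
	then show ?thesis using de by (auto simp: th_def)
qed
have thL: "\<bar>th v\<bar> <= L" for v using mv[of v] L by auto
have thps: "\<bar>ps' v - th v\<bar> <= om" for v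
proof -
	obtain z where "v < z" "z < v + de" "th v = ps' z" using mv by blast
	then show ?thesis using om[of v z] by simp
qed
have thlip: "\<bar>th x - th y\<bar> <= 2 * L / de * \<bar>x - y\<bar>" for x y
proof -
	have "th x - th y = ((ps (x + de) - ps (y + de)) - (ps x - ps y)) / de"
		by (simp add: th_def diff_divide_distrib)
	moreover have "\<bar>(ps (x + de) - ps (y + de)) - (ps x - ps y)\<bar> <= 2 * L * \<bar>x - y\<bar>"
		using DERIV_bounded_imp_Lipschitz[of ps ps' L "x + de" "y + de"] DERIV_bounded_imp_Lipschitz[of ps ps' L x y] ps(1) L(1)
		by fastforce
	ultimately show ?thesis using de by (simp add: divide_right_mono)
qed
have th0: "th v = 0" if "R + de < \<bar>v\<bar>" for v
proof -
	have "R < \<bar>v\<bar>" "R < \<bar>v + de\<bar>" using that de by linarith+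
	then show ?thesis by (simp add: th_def R(1))
qed
have cps: "continuous_on UNIV ps" using ps(1) by (meson DERIV_isCont continuous_at_imp_continuous_on)
have mps': "ps' : bm borel" by (rule borel_measurable_continuous_onI[OF ps(2)])
have mth: "th : bm borel"
	unfolding th_def[abs_def] using de
	by (intro borel_measurable_continuous_onI continuous_intros continuous_on_compose2[OF cps]) auto
define err where "err = 8 * (1 - e) * L * om * B +
	(1 - e) / 2 * (4 * L^2 + 4 * L * (2 * L / de) * (R + de + 1)) * B * sqrt (d^2 * (2 * (1 - e) * B))"
have err: "err = transport_err e L R de om M d" by (simp add: err_def transport_err_def B_def)
have errpos: "0 < err"
proof -
	have "0 < 4 * L^2 + 4 * L * (2 * L / de) * (R + de + 1)"
		using L(2) de R(2) by (intro add_pos_nonneg) auto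
	moreover have "0 < sqrt (d^2 * (2 * (1 - e) * B))" using g(5) e B1 by simp
	ultimately have "0 < (1 - e) / 2 * (4 * L^2 + 4 * L * (2 * L / de) * (R + de + 1)) * B * sqrt (d^2 * (2 * (1 - e) * B))"
		using e B1 by (intro mult_pos_pos) auto
	moreover have "0 <= 8 * (1 - e) * L * om * B" using e L om0 B1 by simp
	ultimately show ?thesis unfolding err_def by linarith
qed
have Q: "Qform e (g t) ps' <= Qform e mu ps' + err" if t: "t : {0..1}" for t
proof -
	note gt = distr_f[OF t] flow_jb_bound(1)[OF g0 t]
	have p: "\<bar>Qform e rh ps' - Qform e rh th\<bar> <= 4 * (1 - e) * L * om * B"
		if rh: "real_distribution rh" "integrable rh jb" "mom rh <= B" for rh
	proof -
		have "\<bar>Qform e rh ps' - Qform e rh th\<bar> <= 4 * (1 - e) * L * om * mom rh"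
			by (rule Qform_perturb[OF e rh(1,2) mps' L(1) mth thL thps])
		also have "... <= 4 * (1 - e) * L * om * B" using e L om0 rh(3) by (intro mult_left_mono) auto
		finally show ?thesis .
	qed
	have "Qform e (g t) ps' <= Qform e (g t) th + 4 * (1 - e) * L * om * B"
		using p[OF gt B[OF t]] by linarith
	moreover have "Qform e (g t) th <= Qform e (g 0) th + (1 - e) / 2 * (4 * L^2 + 4 * L * (2 * L / de) * (R + de + 1)) * B * sqrt (1 * d^2 * (2 * (1 - e) * B))"
		using R de L by (intro Qform_flow[OF g0 act thL thlip th0 _ _ L(2) B t]) auto
	moreover have "Qform e mu th <= Qform e mu ps' + 4 * (1 - e) * L * om * B"
		using p[OF mu(1,2)] B[of 0] g(2) by simp
	moreover have "8 * (1 - e) * L * om * B = 2 * (4 * (1 - e) * L * om * B)" by simp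
	ultimately show ?thesis unfolding err_def g(2) mult_1_left by linarith
qed
have Q0: "0 <= Qform e mu ps'" by (rule Qform_nonneg[OF e mu(1,2) mps' L(1)])
have "((LI (g 1) (%v. ps v)) - (LI (g 0) (%v. ps v)))^2 <= (1 - 0) * d^2 * (Qform e mu ps' + err)"
	using Q0 errpos by (intro flow_action_estimate[OF g0 act ps L(1) Q]) auto
then show "((LI nu (%v. ps v)) - (LI mu (%v. ps v)))^2 <= d^2 * (Qform e mu ps' + transport_err e L R de om M d)"
	unfolding err g by simp
show "Qform e nu ps' <= Qform e mu ps' + transport_err e L R de om M d"
	using Q[of 1] g(3) unfolding err by simp
qed

section \<open>Minimising sequences of gradients\<close>

text \<open>
  A Riesz representation for the closure of a space of gradients \<open>G ph\<close> in \<open>L\<^sup>2\<close>: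
  the functional \<open>\<parallel>G ph\<parallel>\<^sup>2 - 2 l(ph)\<close> is bounded below, by the parallelogram
  identity every minimising sequence is Cauchy, and the limit \<open>u\<close> of its gradients represents
  \<open>l\<close>. Besides \<open>u\<close> the lemma provides the approximating gradients with a rate of convergence.
\<close>

lemma gradient_Riesz:
fixes M :: "'a measure" and V :: "('c => real) set" and G :: "('c => real) => 'a => real"
	and l :: "('c => real) => real"
assumes ne: "V ~= {}"
	and V: "!!ph ps a b. ph : V ==> ps : V ==> (%x. a * ph x + b * ps x) : V"
	and G: "!!ph ps a b z. ph : V ==> ps : V ==> G (%x. a * ph x + b * ps x) z = a * G ph z + b * G ps z"
	and l: "!!ph ps a b. ph : V ==> ps : V ==> l (%x. a * ph x + b * ps x) = a * l ph + b * l ps"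
	and mG: "!!ph. ph : V ==> G ph : bm M"
	and iG: "!!ph. ph : V ==> integrable M (%z. (G ph z)^2)"
	and bound: "!!ph. ph : V ==> 2 * l ph <= C + (LI M (%z. (G ph z)^2))"
obtains u Ph where "u : bm M" "integrable M (%z. (u z)^2)"
	"!!n::nat. Ph n : V" "!!n. integrable M (%z. (u z - G (Ph n) z)^2)"
	"!!n. (LI M (%z. (u z - G (Ph n) z)^2)) <= (1/2)^n"
	"!!ph. ph : V ==> l ph = (LI M (%z. u z * G ph z))"
proof -
define N where "N ph = (LI M (%z. (G ph z)^2))" for ph
define J where "J ph = N ph - 2 * l ph" for ph
define j where "j = (INF ph\<in>V. J ph)"
have bdd: "bdd_below (J ` V)"
proof (rule bdd_belowI2[where m="- C"])
	fix ph assume "ph : V"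
	then show "- C <= J ph" using bound[of ph] unfolding J_def N_def by linarith
qed
have jle: "j <= J ph" if "ph : V" for ph unfolding j_def using bdd that by (rule cINF_lower)
have "EX ph:V. J ph < j + (1/8)^(n+1)" for n :: nat
proof -
	have "j < j + (1/8)^(n+1)" by simp
	then show ?thesis unfolding j_def using cINF_less_iff[OF ne bdd] by blast
qed
then obtain Ph where Ph: "!!n::nat. Ph n : V" "!!n. J (Ph n) < j + (1/8)^(n+1)" by metis
define g where "g n = G (Ph n)" for n
have mg[measurable]: "g n : bm M" and ig: "integrable M (%z. (g n z)^2)" for n
	unfolding g_def using Ph(1) mG iG by auto
have igg: "integrable M (%z. g n z * g m z)" for n m
	by (rule Cauchy_Schwarz_integral(1)[OF mg mg ig ig])
have id: "integrable M (%z. (g n z - g m z)^2)" for n m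
proof -
	have "(%z. (g n z - g m z)^2) = (%z. (g n z)^2 + (g m z)^2 - 2 * (g n z * g m z))"
		by (rule ext) (simp add: power2_diff)
	then show ?thesis using ig[of n] ig[of m] igg[of n m] by simp
qed
have dd: "(LI M (%z. (g n z - g m z)^2)) <= 2 * ((1/8)^(n+1) + (1/8)^(m+1))" for n m
proof -
	define ph where "ph x = 1/2 * Ph n x + 1/2 * Ph m x" for x
	have ph: "ph : V" unfolding ph_def[abs_def] by (intro V Ph)
	have Gph: "G ph z = 1/2 * g n z + 1/2 * g m z" for z
		unfolding ph_def[abs_def] g_def by (rule G[OF Ph(1) Ph(1)])
	have lph: "l ph = 1/2 * l (Ph n) + 1/2 * l (Ph m)"
		unfolding ph_def[abs_def] by (rule l[OF Ph(1) Ph(1)])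
	have "4 * N ph = (LI M (%z. (g n z)^2 + (g m z)^2 + 2 * (g n z * g m z)))"
		unfolding N_def Gph integral_mult_right_zero[symmetric]
		by (intro Bochner_Integration.integral_cong) (auto simp: power2_eq_square algebra_simps)
	also have "... = N (Ph n) + N (Ph m) + 2 * (LI M (%z. g n z * g m z))"
		using ig igg by (simp add: N_def g_def)
	finally have 1: "4 * N ph = N (Ph n) + N (Ph m) + 2 * (LI M (%z. g n z * g m z))" .
	have "(LI M (%z. (g n z - g m z)^2)) = (LI M (%z. (g n z)^2 + (g m z)^2 - 2 * (g n z * g m z)))"
		by (intro Bochner_Integration.integral_cong) (auto simp: power2_eq_square algebra_simps)
	also have "... = N (Ph n) + N (Ph m) - 2 * (LI M (%z. g n z * g m z))"
		using ig igg by (simp add: N_def g_def)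
	finally have "(LI M (%z. (g n z - g m z)^2)) = 2 * J (Ph n) + 2 * J (Ph m) - 4 * J ph"
		using 1 lph unfolding J_def by (simp add: algebra_simps)
	then show ?thesis using Ph(2)[of n] Ph(2)[of m] jle[OF ph] by (simp add: algebra_simps)
qed
define a where "a n z = 2^n * (g (Suc n) z - g n z)^2" for n z
have a0: "0 <= a n z" for n z by (simp add: a_def)
have ia: "integrable M (a n)" for n unfolding a_def using id by simp
have am: "a n : bm M" for n using ia by simp
have "(NI M (%z. (\<Sum>n. ennreal (a n z)))) = (\<Sum>n. NI M (%z. ennreal (a n z)))"
	using am by (intro nn_integral_suminf) auto
also have "... = (\<Sum>n. ennreal (LI M (%z. a n z)))"
	using ia a0 by (subst nn_integral_eq_integral) auto
also have "... <= (\<Sum>n. ennreal ((1/4)^n))"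
proof (intro suminf_le ennreal_leI)
	fix n :: nat
	have "(LI M (%z. a n z)) = 2^n * (LI M (%z. (g (Suc n) z - g n z)^2))" unfolding a_def by simp
	also have "... <= 2^n * (2 * ((1/8)^(Suc n+1) + (1/8)^(n+1)))" by (intro mult_left_mono dd) auto
	also have "... = 2^n * (1/8)^n * (9/32)" by (simp add: algebra_simps)
	also have "... = (1/4)^n * (9/32)" by (simp add: power_mult_distrib[symmetric])
	also have "... <= (1/4)^n" by simp
	finally show "(LI M (%z. a n z)) <= (1/4)^n" .
qed auto
also have "... < \<infinity>"
	by (subst suminf_ennreal2) (auto intro: summable_geometric)
finally have "(NI M (%z. (\<Sum>n. ennreal (a n z)))) ~= \<infinity>" by simp
then have AE1: "AE z in M. (\<Sum>n. ennreal (a n z)) ~= \<infinity>"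
	using am by (intro nn_integral_PInf_AE) auto
define u where "u z = lim (%n. g n z)" for z
have mu[measurable]: "u : bm M" unfolding u_def by (rule borel_measurable_lim_metric) simp
have AE2: "AE z in M. (%n. g n z) ----> u z"
	using AE1
proof eventually_elim
	case (elim z)
	have s: "summable (%n. a n z)" using elim a0 by (intro summable_suminf_not_top) auto
	have "summable (%n. \<bar>g (Suc n) z - g n z\<bar>)"
	proof (rule summable_comparison_test')
		show "summable (%n. 1/2 * (a n z + (1/2)^n))"
			using s by (intro summable_mult summable_add summable_geometric) auto
		fix n :: nat
		let ?D = "\<bar>g (Suc n) z - g n z\<bar>"
		have yc: "(2::real)^n * (1/2)^n = 1" by (simp add: power_mult_distrib[symmetric])
		have "0 <= (?D * 2^n - 1)^2 * (1/2)^n" by simp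
		also have "... = 2^n * ?D^2 * (2^n * (1/2)^n) - 2 * ?D * (2^n * (1/2)^n) + (1/2)^n"
			by (simp add: power2_eq_square algebra_simps)
		also have "... = a n z - 2 * ?D + (1/2)^n" unfolding yc by (simp add: a_def)
		finally show "norm ?D <= 1/2 * (a n z + (1/2)^n)" by simp
	qed
	then have "summable (%n. g (Suc n) z - g n z)" by (rule summable_rabs_cancel)
	then have "convergent (%n. \<Sum>i<n. g (Suc i) z - g i z)" by (simp add: summable_iff_convergent)
	then have "convergent (%n. g n z - g 0 z)" by (simp only: sum_lessThan_telescope[of "%n. g n z"])
	then have "convergent (%n. g n z)"
		using convergent_add[OF _ convergent_const[of "g 0 z"], of "%n. g n z - g 0 z"] by simp
	then show ?case unfolding u_def by (simp add: convergent_LIMSEQ_iff)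
qed
have ug: "(NI M (%z. ennreal ((u z - g n z)^2))) <= ennreal ((1/2)^n)" for n
proof -
	have "(NI M (%z. ennreal ((u z - g n z)^2))) = (NI M (%z. liminf (%m. ennreal ((g m z - g n z)^2))))"
	proof (rule nn_integral_cong_AE, use AE2 in eventually_elim)
		case (elim z)
		have "(%m. ennreal ((g m z - g n z)^2)) ----> ennreal ((u z - g n z)^2)"
			by (intro tendsto_ennrealI tendsto_power tendsto_diff elim tendsto_const)
		then show ?case by (rule lim_imp_Liminf[OF trivial_limit_sequentially, symmetric])
	qed
	also have "... <= liminf (%m. NI M (%z. ennreal ((g m z - g n z)^2)))"
		by (intro nn_integral_liminf) measurable
	also have "... = liminf (%m. ennreal (LI M (%z. (g m z - g n z)^2)))"
		using id by (subst nn_integral_eq_integral) auto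
	also have "... <= liminf (%m::nat. ennreal ((1/2)^n))"
	proof (rule Liminf_mono, rule eventually_mono[OF eventually_ge_at_top[of n]], rule ennreal_leI)
		fix m assume m: "n <= m"
		have "(1/8::real)^(m+1) <= (1/8)^(n+1)" using m by (intro power_decreasing) auto
		then have "2 * ((1/8::real)^(m+1) + (1/8)^(n+1)) <= 2 * ((1/8)^(n+1) + (1/8)^(n+1))"
			by (intro mult_left_mono add_mono) auto
		then have "(LI M (%z. (g m z - g n z)^2)) <= 2 * ((1/8)^(n+1) + (1/8)^(n+1))" by (rule order_trans[OF dd])
		also have "... = 1/2 * (1/8)^n" by simp
		also have "... <= 1 * (1/2)^n" by (intro mult_mono power_mono) auto
		finally show "(LI M (%z. (g m z - g n z)^2)) <= (1/2)^n" by simp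
	qed
	also have "... = ennreal ((1/2)^n)" by (simp add: Liminf_const)
	finally show ?thesis .
qed
have iug: "integrable M (%z. (u z - g n z)^2)" for n
	using ug[of n] by (intro integrableI_bounded) (auto intro: le_less_trans)
have ugr: "(LI M (%z. (u z - g n z)^2)) <= (1/2)^n" for n
proof -
	have "ennreal (LI M (%z. (u z - g n z)^2)) <= ennreal ((1/2)^n)"
		using ug[of n] iug[of n] by (subst nn_integral_eq_integral[symmetric]) auto
	then show ?thesis by (subst (asm) ennreal_le_iff) auto
qed
have iu: "integrable M (%z. (u z)^2)"
proof (rule Bochner_Integration.integrable_bound)
	show "integrable M (%z. 2 * (u z - g 0 z)^2 + 2 * (g 0 z)^2)" using iug ig by simp
	have "(u z)^2 <= 2 * (u z - g 0 z)^2 + 2 * (g 0 z)^2" for z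
	proof -
		have "2 * (u z - g 0 z)^2 + 2 * (g 0 z)^2 - (u z)^2 = (u z - 2 * g 0 z)^2"
			by (simp add: power2_eq_square algebra_simps)
		then show ?thesis using zero_le_power2[of "u z - 2 * g 0 z"] by linarith
	qed
	then show "AE z in M. norm ((u z)^2) <= norm (2 * (u z - g 0 z)^2 + 2 * (g 0 z)^2)" by simp
qed measurable
have EL: "l ph = (LI M (%z. u z * G ph z))" if ph: "ph : V" for ph
proof -
	note mph[measurable] = mG[OF ph] and iph = iG[OF ph]
	let ?I = "LI M (%z. u z * G ph z)" and ?In = "%n. LI M (%z. g n z * G ph z)"
	have iuph: "integrable M (%z. u z * G ph z)" by (rule Cauchy_Schwarz_integral(1)[OF mu mph iu iph])
	have igph: "integrable M (%z. g n z * G ph z)" for n by (rule Cauchy_Schwarz_integral(1)[OF mg mph ig iph])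
	have N0: "0 <= N ph" by (simp add: N_def)
	have sq: "(?I - ?In n)^2 <= (1/2)^n * N ph" for n
	proof -
		have "?I - ?In n = (LI M (%z. (u z - g n z) * G ph z))" using iuph igph by (simp add: left_diff_distrib)
		also have "...^2 <= (LI M (%z. (u z - g n z)^2)) * N ph"
			unfolding N_def by (rule Cauchy_Schwarz_integral(2)[OF _ mph iug iph]) measurable
		also have "... <= (1/2)^n * N ph" by (intro mult_right_mono ugr N0)
		finally show ?thesis .
	qed
	have "(%n. (1/2)^n * N ph) ----> 0"
		by (intro tendsto_mult_left_zero LIMSEQ_power_zero) simp
	then have "(%n. (?I - ?In n)^2) ----> 0"
		by (rule Lim_null_comparison[rotated]) (use sq in simp)
	then have "(%n. sqrt ((?I - ?In n)^2)) ----> sqrt 0" by (rule tendsto_real_sqrt)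
	then have "(%n. ?I - ?In n) ----> 0" by (simp add: tendsto_rabs_zero_iff)
	then have "(%n. ?I - (?I - ?In n)) ----> ?I - 0" by (intro tendsto_diff tendsto_const)
	then have lim: "?In ----> ?I" by simp
	have "0 <= 2 * s * (?I - l ph) + s^2 * N ph" for s
	proof -
		have ineq: "- ((1/8)^(n+1)) <= 2 * s * (?In n - l ph) + s^2 * N ph" for n
		proof -
			define ps where "ps x = 1 * Ph n x + s * ph x" for x
			have ps: "ps : V" unfolding ps_def[abs_def] by (intro V Ph ph)
			have Gps: "G ps z = 1 * g n z + s * G ph z" for z
				unfolding ps_def[abs_def] g_def by (rule G[OF Ph(1) ph])
			have lps: "l ps = 1 * l (Ph n) + s * l ph"
				unfolding ps_def[abs_def] by (rule l[OF Ph(1) ph])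
			have "N ps = (LI M (%z. (g n z)^2 + 2 * s * (g n z * G ph z) + s^2 * (G ph z)^2))"
				unfolding N_def Gps by (intro Bochner_Integration.integral_cong) (auto simp: power2_eq_square algebra_simps)
			also have "... = N (Ph n) + 2 * s * ?In n + s^2 * N ph"
				using ig igph iph by (simp add: N_def g_def)
			finally have "J ps = J (Ph n) + (2 * s * (?In n - l ph) + s^2 * N ph)"
				using lps unfolding J_def by (simp add: algebra_simps)
			then show ?thesis using jle[OF ps] Ph(2)[of n] by linarith
		qed
		have lim1: "(%n. - ((1/8::real)^(n+1))) ----> - 0"
			by (intro tendsto_minus LIMSEQ_ignore_initial_segment LIMSEQ_power_zero) simp
		have lim2: "(%n. 2 * s * (?In n - l ph) + s^2 * N ph) ----> 2 * s * (?I - l ph) + s^2 * N ph"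
			by (intro tendsto_intros lim)
		have "- 0 <= 2 * s * (?I - l ph) + s^2 * N ph"
			by (rule LIMSEQ_le[OF lim1 lim2]) (use ineq in blast)
		then show ?thesis by simp
	qed
	from this[of "- (?I - l ph) / (N ph + 1)"]
	have "0 <= 2 * (- (?I - l ph) / (N ph + 1)) * (?I - l ph) + (- (?I - l ph) / (N ph + 1))^2 * N ph" .
	then have "0 <= (2 * (- (?I - l ph) / (N ph + 1)) * (?I - l ph) + (- (?I - l ph) / (N ph + 1))^2 * N ph) * (N ph + 1)^2"
		by (intro mult_nonneg_nonneg) auto
	also have "... = - ((?I - l ph)^2 * (N ph + 2))"
	proof -
		have "N ph + 1 ~= 0" using N0 by linarith
		then have "(2 * (- X / (N ph + 1)) * X + (- X / (N ph + 1))^2 * N ph) * (N ph + 1)^2 = - (X^2 * (N ph + 2))" for X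
		proof -
			assume P: "N ph + 1 ~= 0"
			define P where "P = N ph + 1"
			have P0: "P ~= 0" using P by (simp add: P_def)
			have "(2 * (- X / P) * X + (- X / P)^2 * N ph) * P^2 = 2 * X * ((- X / P) * P^2) + N ph * ((- X / P)^2 * P^2)"
				by (simp add: algebra_simps)
			also have "(- X / P) * P^2 = - X * P" using P0 by (simp add: power2_eq_square)
			also have "(- X / P)^2 * P^2 = X^2" using P0 by (simp add: power_divide)
			also have "2 * X * (- X * P) + N ph * X^2 = - (X^2 * (N ph + 2))"
				by (simp add: P_def power2_eq_square algebra_simps)
			finally show ?thesis unfolding P_def .
		qed
		then show ?thesis .
	qed
	finally have "(?I - l ph)^2 * (N ph + 2) <= 0" by simp
	then have "(?I - l ph)^2 = 0"
		using N0 by (simp add: mult_le_0_iff)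
	then show ?thesis by simp
qed
show ?thesis
	by (rule that[of u Ph, OF mu iu Ph(1) iug[unfolded g_def] ugr[unfolded g_def] EL])
qed

section \<open>Lebesgue's differentiation theorem on the line\<close>

text \<open>
  Tagged intervals on which the average of \<open>g\<close> is far from its value at the tag form a Vitali
  cover of the bad set; the disjoint intervals that Vitali's theorem extracts have small total
  length by Henstock's lemma.
\<close>

lemma negligible_bad_averages:
fixes g :: "real => real"
assumes g: "g integrable_on {a..b}" and et: "0 < et"
shows "negligible {t : {a..b}. ALL de>0. EX x y. a <= x & x <= t & t <= y & y <= b & x < y & y - x < de &
	et * (y - x) < \<bar>integral {x..y} g - (y - x) * g t\<bar>}" (is "negligible ?E")
unfolding negligible_outer_le
proof (intro allI impI)
fix ep :: real assume ep: "0 < ep"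
have gc: "g integrable_on cbox a b" using g by simp
obtain ga where ga: "gauge ga" "!!p. p tagged_partial_division_of cbox a b ==> ga fine p ==>
		(\<Sum>(x, k)\<in>p. norm (measure lborel k *\<^sub>R g x - integral k g)) < et * ep"
proof -
	have "0 < et * ep" using et ep by simp
	then show ?thesis by (rule Henstock_lemma[OF gc]) (rule that)
qed
define I where "I = {(t, x, y). t : ?E & a <= x & x <= t & t <= y & y <= b & x < y & {x..y} \<subseteq> ga t &
	et * (y - x) < \<bar>integral {x..y} g - (y - x) * g t\<bar>}"
define c :: "real \<times> real \<times> real => real" where "c = (%(t, x, y). (x + y) / 2)"
define r :: "real \<times> real \<times> real => real" where "r = (%(t, x, y). (y - x) / 2)"
have cb: "cball (c i) (r i) = {fst (snd i)..snd (snd i)}" for i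
	by (cases i) (auto simp: c_def r_def cball_eq_atLeastAtMost field_simps)
obtain C where C: "countable C" "C \<subseteq> I"
		"pairwise (%i j. disjnt (cball (c i) (r i)) (cball (c j) (r j))) C"
		"negligible (?E - (\<Union>i\<in>C. cball (c i) (r i)))"
proof (rule Vitali_covering_theorem_cballs[of I r ?E c])
	show "0 < r i" if "i : I" for i using that by (auto simp: I_def r_def)
	fix t d :: real assume t: "t : ?E" and d: "0 < d"
	obtain de where de: "0 < de" "ball t de \<subseteq> ga t"
		using ga(1) unfolding gauge_def by (meson open_contains_ball)
	have "0 < min de d" using de d by simp
	then obtain x y where xy: "a <= x" "x <= t" "t <= y" "y <= b" "x < y" "y - x < min de d"
		"et * (y - x) < \<bar>integral {x..y} g - (y - x) * g t\<bar>"
		using t by blast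
	have "{x..y} \<subseteq> ball t de" using xy by (auto simp: dist_real_def)
	then have "(t, x, y) : I" using t xy de by (auto simp: I_def)
	moreover have "t : cball (c (t, x, y)) (r (t, x, y))" unfolding cb using xy by simp
	moreover have "r (t, x, y) < d" using xy by (simp add: r_def)
	ultimately show "EX i. i : I & t : cball (c i) (r i) & r i < d" by blast
qed blast
define S where "S i = {fst (snd i)..snd (snd i)}" for i :: "real \<times> real \<times> real"
have Sm: "S i : lmeasurable" for i unfolding S_def by simp
have fin: "measure lebesgue (\<Union>i\<in>F. S i) <= ep" if F: "F \<subseteq> C" "finite F" for F
proof -
	have FI: "F \<subseteq> I" using F C by auto
	have dis: "S i \<inter> S j = {}" if "i : F" "j : F" "i ~= j" for i j
		using C(3) F(1) that unfolding cb S_def pairwise_def disjnt_def by blast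
	have ne: "S i ~= {}" if "i : F" for i using that FI by (auto simp: S_def I_def)
	have inj: "inj_on (%i. (fst i, S i)) F"
	proof (rule inj_onI)
		fix i j assume ij: "i : F" "j : F" "(fst i, S i) = (fst j, S j)"
		then have "S i \<inter> S j ~= {}" using ne by simp
		then show "i = j" using dis ij by blast
	qed
	let ?p = "(%i. (fst i, S i)) ` F"
	have "?p tagged_partial_division_of cbox a b"
		unfolding tagged_partial_division_of_def
	proof (intro conjI allI impI)
		show "finite ?p" using F by simp
		fix x K assume xK: "(x, K) : ?p"
		obtain q q' where K: "K = {q..q'}" "a <= q" "q <= x" "x <= q'" "q' <= b"
			using xK FI by (auto simp: S_def I_def)
		show "x : K" "K \<subseteq> cbox a b" using K by auto
		show "EX a b. K = cbox a b" using K(1) box_real(2) by blast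
	next
		fix x K x' K' assume "(x, K) : ?p & (x', K') : ?p & (x, K) ~= (x', K')"
		then have xK: "(x, K) : ?p" and xK': "(x', K') : ?p" and neq: "(x, K) ~= (x', K')" by auto
		obtain i i' where i: "i : F" "i' : F" "K = S i" "K' = S i'" "x = fst i" "x' = fst i'" using xK xK' by auto
		then have "i ~= i'" using neq by auto
		then have "K \<inter> K' = {}" using dis i by auto
		then show "interior K \<inter> interior K' = {}" using interior_subset by blast
	qed
	moreover have "ga fine ?p"
	proof -
		have "S i \<subseteq> ga (fst i)" if "i : I" for i
			using that unfolding I_def S_def by (cases i) simp
		then show ?thesis unfolding fine_def using FI by auto
	qed
	ultimately have "(\<Sum>(x, k)\<in>?p. norm (measure lborel k *\<^sub>R g x - integral k g)) < et * ep" by (rule ga(2))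
	also have "(\<Sum>(x, k)\<in>?p. norm (measure lborel k *\<^sub>R g x - integral k g)) =
			(\<Sum>i\<in>F. norm (measure lborel (S i) *\<^sub>R g (fst i) - integral (S i) g))"
		by (subst sum.reindex[OF inj]) simp
	finally have lt: "(\<Sum>i\<in>F. norm (measure lborel (S i) *\<^sub>R g (fst i) - integral (S i) g)) < et * ep" .
	have "et * (\<Sum>i\<in>F. measure lebesgue (S i)) <= (\<Sum>i\<in>F. norm (measure lborel (S i) *\<^sub>R g (fst i) - integral (S i) g))"
		unfolding sum_distrib_left
	proof (rule sum_mono)
		fix i assume "i : F"
		then have "i : I" using FI by auto
		then obtain t x y where i: "i = (t, x, y)" "x < y" "et * (y - x) < \<bar>integral {x..y} g - (y - x) * g t\<bar>"
			by (auto simp: I_def)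
		then show "et * measure lebesgue (S i) <= norm (measure lborel (S i) *\<^sub>R g (fst i) - integral (S i) g)"
			by (simp add: S_def abs_minus_commute)
	qed
	then have "et * (\<Sum>i\<in>F. measure lebesgue (S i)) <= et * ep" using lt by linarith
	then have "(\<Sum>i\<in>F. measure lebesgue (S i)) <= ep" using et by simp
	moreover have "measure lebesgue (\<Union>i\<in>F. S i) <= (\<Sum>i\<in>F. measure lebesgue (S i))"
		using Sm by (intro measure_UNION_le) (auto simp: F fmeasurableD)
	ultimately show ?thesis by linarith
qed
have U: "(\<Union>i\<in>C. S i) : lmeasurable" "measure lebesgue (\<Union>i\<in>C. S i) <= ep"
	using fmeasurable_UN_bound[OF C(1) Sm fin] measure_UN_bound[OF C(1) Sm fin] by auto
define N where "N = ?E - (\<Union>i\<in>C. S i)"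
have N: "negligible N" using C(4) unfolding N_def S_def cb .
show "EX T. ?E \<subseteq> T & T : lmeasurable & measure lebesgue T <= ep"
proof (intro exI conjI)
	show "?E \<subseteq> (\<Union>i\<in>C. S i) \<union> N" by (auto simp: N_def)
	show "(\<Union>i\<in>C. S i) \<union> N : lmeasurable" using U N negligible_imp_measurable by auto
	have "measure lebesgue ((\<Union>i\<in>C. S i) \<union> N) <= measure lebesgue (\<Union>i\<in>C. S i) + measure lebesgue N"
		using U N negligible_imp_measurable by (intro measure_Un_le) auto
	also have "measure lebesgue N = 0" using N by (rule negligible_imp_measure0)
	finally show "measure lebesgue ((\<Union>i\<in>C. S i) \<union> N) <= ep" using U(2) by simp
qed
qed

lemma AE_Lebesgue_point:
fixes g :: "real => real"
assumes g: "integrable (lebesgue_on {a..b}) g"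
shows "AE t in lebesgue_on {a..b}. ALL et>0. EX de>0. ALL x y. a <= x & x <= t & t <= y & y <= b & x < y & y - x < de -->
	\<bar>integral {x..y} g - (y - x) * g t\<bar> <= et * (y - x)"
proof -
have gi: "g integrable_on {a..b}" using g by (intro integrable_on_lebesgue_on) auto
define E where "E n = {t : {a..b}. ALL de>0. EX x y. a <= x & x <= t & t <= y & y <= b & x < y & y - x < de &
	1 / real (Suc n) * (y - x) < \<bar>integral {x..y} g - (y - x) * g t\<bar>}" for n
have neg: "negligible (E n)" for n
	unfolding E_def by (rule negligible_bad_averages[OF gi]) simp
have "(\<Union>n. E n) : null_sets lebesgue"
	using neg by (simp add: negligible_iff_null_sets null_sets_UN)
then have "AE t in lebesgue. t ~: (\<Union>n. E n)" by (rule AE_not_in)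
then have "AE t in lebesgue. t : {a..b} --> t ~: (\<Union>n. E n)" by (rule eventually_mono) simp
then have "AE t in lebesgue_on {a..b}. t ~: (\<Union>n. E n)" by (subst AE_restrict_space_iff) auto
moreover have "AE t in lebesgue_on {a..b}. t : {a..b}" by (rule AE_I2) simp
ultimately show ?thesis
proof eventually_elim
	case (elim t)
	show ?case
	proof (intro allI impI)
		fix et :: real assume "0 < et"
		then obtain n where n: "1 / real (Suc n) < et" using nat_approx_posE by metis
		have "t ~: E n" using elim by blast
		then obtain de where de: "0 < de" "!!x y. \<not> (a <= x & x <= t & t <= y & y <= b & x < y & y - x < de &
				1 / real (Suc n) * (y - x) < \<bar>integral {x..y} g - (y - x) * g t\<bar>)"
			using elim(2) unfolding E_def by blast
		show "EX de>0. ALL x y. a <= x & x <= t & t <= y & y <= b & x < y & y - x < de -->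
				\<bar>integral {x..y} g - (y - x) * g t\<bar> <= et * (y - x)"
		proof (intro exI[of _ de] conjI allI impI)
			fix x y assume "a <= x & x <= t & t <= y & y <= b & x < y & y - x < de"
			then have xy: "a <= x" "x <= t" "t <= y" "y <= b" "x < y" "y - x < de" by auto
			have "\<bar>integral {x..y} g - (y - x) * g t\<bar> <= 1 / real (Suc n) * (y - x)"
			proof (rule ccontr)
				assume "\<not> ?thesis"
				then have "1 / real (Suc n) * (y - x) < \<bar>integral {x..y} g - (y - x) * g t\<bar>" by (simp only: not_le)
				then show False using de(2)[of x y] xy by blast
			qed
			also have "... <= et * (y - x)" using n xy by (intro mult_right_mono) auto
			finally show "\<bar>integral {x..y} g - (y - x) * g t\<bar> <= et * (y - x)" .
		qed (rule de(1))
	qed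
qed
qed

section \<open>Test functions in time and velocity\<close>

definition tder :: "(real \<times> real => real) => real \<times> real => real" where
"tder ph x = deriv (%s. ph (s, snd x)) (fst x)"

definition vder :: "(real \<times> real => real) => real \<times> real => real" where
"vder ph x = deriv (%w. ph (fst x, w)) (snd x)"

lemma C1c_partials:
assumes ph: "ph : C1c T"
shows "((%s. ph (s, v)) has_real_derivative tder ph (t, v)) (at t)"
	and "((%w. ph (t, w)) has_real_derivative vder ph (t, v)) (at v)"
	and "continuous_on UNIV (tder ph)" and "continuous_on UNIV (vder ph)" and "continuous_on UNIV ph"
proof -
obtain D where D: "!!x. (ph has_derivative blinfun_apply (D x)) (at x)" "continuous_on UNIV D"
	using ph unfolding C1c_def by blast
have 1: "((%s. ph (s, v)) has_real_derivative blinfun_apply (D (t, v)) (1, 0)) (at t)" for t v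
proof -
	have "((%s. (s, v)) has_derivative (%h. (h, 0))) (at t)" by (auto intro!: derivative_eq_intros)
	from has_derivative_compose[OF this, of ph "blinfun_apply (D (t, v))"] D(1)
	have "((%s. ph (s, v)) has_derivative (%h. blinfun_apply (D (t, v)) (h, 0))) (at t)" by simp
	moreover have "(%h. blinfun_apply (D (t, v)) (h, 0)) = (*) (blinfun_apply (D (t, v)) (1, 0))"
	proof (rule ext)
		show "blinfun_apply (D (t, v)) (h, 0) = blinfun_apply (D (t, v)) (1, 0) * h" for h
			using blinfun.scaleR_right[of "D (t, v)" h "(1, 0)"] by (simp add: mult.commute)
	qed
	ultimately show ?thesis unfolding has_field_derivative_def by metis
qed
have 2: "((%w. ph (t, w)) has_real_derivative blinfun_apply (D (t, v)) (0, 1)) (at v)" for t v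
proof -
	have "((%w. (t, w)) has_derivative (%h. (0, h))) (at v)" by (auto intro!: derivative_eq_intros)
	from has_derivative_compose[OF this, of ph "blinfun_apply (D (t, v))"] D(1)
	have "((%w. ph (t, w)) has_derivative (%h. blinfun_apply (D (t, v)) (0, h))) (at v)" by simp
	moreover have "(%h. blinfun_apply (D (t, v)) (0, h)) = (*) (blinfun_apply (D (t, v)) (0, 1))"
	proof (rule ext)
		show "blinfun_apply (D (t, v)) (0, h) = blinfun_apply (D (t, v)) (0, 1) * h" for h
			using blinfun.scaleR_right[of "D (t, v)" h "(0, 1)"] by (simp add: mult.commute)
	qed
	ultimately show ?thesis unfolding has_field_derivative_def by metis
qed
have t: "tder ph x = blinfun_apply (D x) (1, 0)" for x
	unfolding tder_def using DERIV_imp_deriv[OF 1[of "snd x" "fst x"]] by simp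
have v: "vder ph x = blinfun_apply (D x) (0, 1)" for x
	unfolding vder_def using DERIV_imp_deriv[OF 2[of "fst x" "snd x"]] by simp
show "((%s. ph (s, v)) has_real_derivative tder ph (t, v)) (at t)" using 1 by (simp add: t)
show "((%w. ph (t, w)) has_real_derivative vder ph (t, v)) (at v)" using 2 by (simp add: v)
show "continuous_on UNIV (tder ph)"
	unfolding t[abs_def] by (intro continuous_intros D(2))
show "continuous_on UNIV (vder ph)"
	unfolding v[abs_def] by (intro continuous_intros D(2))
show "continuous_on UNIV ph"
	using D(1) by (meson continuous_at_imp_continuous_on has_derivative_continuous)
qed

lemma C1c_support:
assumes ph: "ph : C1c T" and T: "0 < T"
obtains a b R where "0 < a" "a <= b" "b < T" "0 <= R"
	"!!t v. t ~: {a..b} | R < \<bar>v\<bar> ==> ph (t, v) = 0"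
	"!!t v. t ~: {a..b} | R < \<bar>v\<bar> ==> tder ph (t, v) = 0"
	"!!t v. t ~: {a..b} | R < \<bar>v\<bar> ==> vder ph (t, v) = 0"
proof -
obtain K where K: "compact K" "K \<subseteq> {0<..<T} \<times> UNIV" "!!x. x ~: K ==> ph x = 0"
	using ph unfolding C1c_def by blast
have "EX a b R. 0 < a & a <= b & b < T & 0 <= R & K \<subseteq> {a..b} \<times> {-R..R}"
proof (cases "K = {}")
	case True
	then show ?thesis using T by (intro exI[of _ "T/2"] exI[of _ "0::real"]) auto
next
	case False
	have cf: "compact (fst ` K)" using K(1) by (intro compact_continuous_image continuous_on_fst continuous_on_id)
	obtain a where a: "a : fst ` K" "!!t. t : fst ` K ==> a <= t" using compact_attains_inf[OF cf] False by auto
	obtain b where b: "b : fst ` K" "!!t. t : fst ` K ==> t <= b" using compact_attains_sup[OF cf] False by auto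
	have "bounded (snd ` K)"
		using K(1) by (intro compact_imp_bounded compact_continuous_image continuous_on_snd continuous_on_id)
	then obtain R where R: "!!v. v : snd ` K ==> \<bar>v\<bar> <= R" unfolding bounded_iff by auto
	have "fst ` K \<subseteq> {0<..<T}" using K(2) by auto
	then have ab: "0 < a" "b < T" using a(1) b(1) by auto
	have "K \<subseteq> {a..b} \<times> {-max R 0..max R 0}"
	proof
		fix x assume "x : K"
		then have "a <= fst x" "fst x <= b" "\<bar>snd x\<bar> <= R" using a(2) b(2) R by auto
		then show "x : {a..b} \<times> {-max R 0..max R 0}" by (cases x) (auto simp: abs_le_iff)
	qed
	moreover have "a <= b" using a b by auto
	ultimately show ?thesis using ab by (intro exI[of _ a] exI[of _ b] exI[of _ "max R 0"]) auto
qed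
then obtain a b R where abR: "0 < a" "a <= b" "b < T" "0 <= R" "K \<subseteq> {a..b} \<times> {-R..R}" by blast
have z: "ph (t, v) = 0" if "t ~: {a..b} | R < \<bar>v\<bar>" for t v
proof (rule K(3), rule notI)
	assume "(t, v) : K"
	then have "t : {a..b}" "v : {-R..R}" using abR(5) by auto
	then have "t : {a..b}" "\<bar>v\<bar> <= R" by (auto simp: abs_le_iff)
	then show False using that by auto
qed
have o1: "open (- {a..b})" "open {v::real. R < \<bar>v\<bar>}"
	by (auto intro!: open_Collect_less continuous_intros)
have tz: "tder ph (t, v) = 0" if tv: "t ~: {a..b} | R < \<bar>v\<bar>" for t v
proof -
	have "((%s. ph (s, v)) has_real_derivative 0) (at t)"
	proof (cases "R < \<bar>v\<bar>")
		case True
		then show ?thesis using z by (simp add: z)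
	next
		case False
		have "((%s. 0) has_real_derivative 0) (at t)" by simp
		then show ?thesis
			by (rule has_field_derivative_transform_within_open[OF _ o1(1)]) (use z tv False in auto)
	qed
	then show ?thesis using C1c_partials(1)[OF ph] DERIV_unique by blast
qed
have vz: "vder ph (t, v) = 0" if tv: "t ~: {a..b} | R < \<bar>v\<bar>" for t v
proof -
	have "((%w. ph (t, w)) has_real_derivative 0) (at v)"
	proof (cases "t : {a..b}")
		case False
		then show ?thesis using z by (simp add: z)
	next
		case True
		have "((%w. 0) has_real_derivative 0) (at v)" by simp
		then show ?thesis
			by (rule has_field_derivative_transform_within_open[OF _ o1(2)]) (use z tv True in auto)
	qed
	then show ?thesis using C1c_partials(2)[OF ph] DERIV_unique by blast
qed
show ?thesis using that[OF abR(1-4) z tz vz] .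
qed

lemma C1c_bounds:
assumes ph: "ph : C1c T" and T: "0 < T"
obtains B where "0 < B" "!!x. \<bar>ph x\<bar> <= B" "!!x. \<bar>tder ph x\<bar> <= B" "!!x. \<bar>vder ph x\<bar> <= B"
proof -
obtain a b R where s: "0 < a" "a <= b" "b < T" "0 <= R"
	"!!t v. t ~: {a..b} | R < \<bar>v\<bar> ==> ph (t, v) = 0"
	"!!t v. t ~: {a..b} | R < \<bar>v\<bar> ==> tder ph (t, v) = 0"
	"!!t v. t ~: {a..b} | R < \<bar>v\<bar> ==> vder ph (t, v) = 0" 
	by (rule C1c_support[OF ph T]) (rule that; assumption)
have "EX B>0. ALL x. \<bar>g x\<bar> <= B" if c: "continuous_on UNIV g" and z: "!!t v. t ~: {a..b} | R < \<bar>v\<bar> ==> g (t, v) = 0"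
	for g :: "real \<times> real => real"
proof -
	have "compact (g ` ({a..b} \<times> {-R..R}))"
		by (intro compact_continuous_image compact_Times continuous_on_subset[OF c]) auto
	then have "bounded (g ` ({a..b} \<times> {-R..R}))" by (rule compact_imp_bounded)
	then obtain B where "ALL y:g ` ({a..b} \<times> {-R..R}). norm y <= B" unfolding bounded_iff by blast
	then have B: "!!x. x : {a..b} \<times> {-R..R} ==> \<bar>g x\<bar> <= B" by auto
	have "\<bar>g x\<bar> <= \<bar>B\<bar> + 1" for x
	proof (cases "x : {a..b} \<times> {-R..R}")
		case True
		then show ?thesis using B[of x] by linarith
	next
		case False
		then have "fst x ~: {a..b} | R < \<bar>snd x\<bar>" by (cases x) auto
		then have "g x = 0" using z[of "fst x" "snd x"] by simp
		then show ?thesis by simp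
	qed
	then show ?thesis by (intro exI[of _ "\<bar>B\<bar> + 1"]) auto
qed
note b = this
obtain B1 where B1: "B1 > 0" "!!x. \<bar>ph x\<bar> <= B1" using b[OF C1c_partials(5)[OF ph] s(5)] by blast
obtain B2 where B2: "B2 > 0" "!!x. \<bar>tder ph x\<bar> <= B2" using b[OF C1c_partials(3)[OF ph] s(6)] by blast
obtain B3 where B3: "B3 > 0" "!!x. \<bar>vder ph x\<bar> <= B3" using b[OF C1c_partials(4)[OF ph] s(7)] by blast
show ?thesis
proof (rule that[of "B1 + B2 + B3"])
	show "0 < B1 + B2 + B3" using B1 B2 B3 by simp
	fix x show "\<bar>ph x\<bar> <= B1 + B2 + B3" "\<bar>tder ph x\<bar> <= B1 + B2 + B3" "\<bar>vder ph x\<bar> <= B1 + B2 + B3"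
		using B1(1) B2(1) B3(1) B1(2)[of x] B2(2)[of x] B3(2)[of x] by linarith+
qed
qed

lemma C1c_vder_uniform:
assumes ph: "ph : C1c T" and T: "0 < T" and om: "0 < om"
obtains de where "0 < de" "!!x y. dist x y <= de ==> \<bar>vder ph x - vder ph y\<bar> <= om"
proof -
obtain a b R where s: "0 < a" "a <= b" "b < T" "0 <= R"
	"!!t v. t ~: {a..b} | R < \<bar>v\<bar> ==> ph (t, v) = 0"
	"!!t v. t ~: {a..b} | R < \<bar>v\<bar> ==> tder ph (t, v) = 0"
	"!!t v. t ~: {a..b} | R < \<bar>v\<bar> ==> vder ph (t, v) = 0" 
	by (rule C1c_support[OF ph T]) (rule that; assumption)
let ?K = "{a-1..b+1} \<times> {-(R+1)..R+1}"
have "uniformly_continuous_on ?K (vder ph)"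
	by (intro compact_uniformly_continuous compact_Times continuous_on_subset[OF C1c_partials(4)[OF ph]]) auto
then obtain de where de: "0 < de" "!!x y. x : ?K ==> y : ?K ==> dist y x < de ==> dist (vder ph y) (vder ph x) < om"
	unfolding uniformly_continuous_on_def using om by metis
have out: "vder ph x = 0" if "x ~: {a..b} \<times> {-R..R}" for x
proof -
	have "fst x ~: {a..b} | R < \<bar>snd x\<bar>" using that by (cases x) auto
	then show ?thesis using s(7)[of "fst x" "snd x"] by simp
qed
have near: "y : ?K" if "x : {a..b} \<times> {-R..R}" "dist x y <= 1" for x y
proof -
	have "dist (fst x) (fst y) <= 1" "dist (snd x) (snd y) <= 1"
		using that(2) dist_fst_le[of x y] dist_snd_le[of x y] by linarith+
	then show ?thesis using that(1) by (cases x, cases y) (auto simp: dist_real_def)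
qed
show ?thesis
proof (rule that[of "min (de/2) 1"])
	show "0 < min (de/2) 1" using de by simp
	fix x y :: "real \<times> real" assume d: "dist x y <= min (de/2) 1"
	show "\<bar>vder ph x - vder ph y\<bar> <= om"
	proof (cases "x : {a..b} \<times> {-R..R} | y : {a..b} \<times> {-R..R}")
		case True
		have "{a..b} \<times> {-R..R} \<subseteq> ?K" by auto
		then have "x : ?K" "y : ?K" using True near[of x y] near[of y x] d by (auto simp: dist_commute)
		then have "dist (vder ph x) (vder ph y) < om" using d de(1) by (intro de(2)) auto
		then show ?thesis by (simp add: dist_real_def)
	next
		case False
		then show ?thesis using out om by simp
	qed
qed
qed

lemma C1c_linear:
assumes ph: "ph : C1c T" and ps: "ps : C1c T"
shows "(%x. a * ph x + b * ps x) : C1c T"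
	and "tder (%x. a * ph x + b * ps x) x = a * tder ph x + b * tder ps x"
	and "vder (%x. a * ph x + b * ps x) x = a * vder ph x + b * vder ps x"
proof -
obtain D where D: "!!x. (ph has_derivative blinfun_apply (D x)) (at x)" "continuous_on UNIV D"
	using ph unfolding C1c_def by blast
obtain E where E: "!!x. (ps has_derivative blinfun_apply (E x)) (at x)" "continuous_on UNIV E"
	using ps unfolding C1c_def by blast
obtain K where K: "compact K" "K \<subseteq> {0<..<T} \<times> UNIV" "!!x. x ~: K ==> ph x = 0"
	using ph unfolding C1c_def by blast
obtain K' where K': "compact K'" "K' \<subseteq> {0<..<T} \<times> UNIV" "!!x. x ~: K' ==> ps x = 0"
	using ps unfolding C1c_def by blast
have "((%x. a * ph x + b * ps x) has_derivative blinfun_apply (a *\<^sub>R D x + b *\<^sub>R E x)) (at x)" for x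
	using D(1)[of x] E(1)[of x]
	by (auto intro!: derivative_eq_intros simp: blinfun.add_left blinfun.scaleR_left)
moreover have "continuous_on UNIV (%x. a *\<^sub>R D x + b *\<^sub>R E x)" by (intro continuous_intros D E)
moreover have "compact (K \<union> K')" "K \<union> K' \<subseteq> {0<..<T} \<times> UNIV" "!!x. x ~: K \<union> K' ==> a * ph x + b * ps x = 0"
	using K K' by auto
ultimately show "(%x. a * ph x + b * ps x) : C1c T"
	unfolding C1c_def by (intro CollectI conjI) (rule exI[of _ "%x. a *\<^sub>R D x + b *\<^sub>R E x"], blast, blast)
have "((%s. a * ph (s, snd x) + b * ps (s, snd x)) has_real_derivative a * tder ph (fst x, snd x) + b * tder ps (fst x, snd x)) (at (fst x))"
	using C1c_partials(1)[OF ph, of "snd x" "fst x"] C1c_partials(1)[OF ps, of "snd x" "fst x"]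
	by (auto intro!: derivative_eq_intros)
then show "tder (%x. a * ph x + b * ps x) x = a * tder ph x + b * tder ps x"
	unfolding tder_def by (intro DERIV_imp_deriv) (simp add: tder_def)
have "((%w. a * ph (fst x, w) + b * ps (fst x, w)) has_real_derivative a * vder ph (fst x, snd x) + b * vder ps (fst x, snd x)) (at (snd x))"
	using C1c_partials(2)[OF ph, of "fst x" "snd x"] C1c_partials(2)[OF ps, of "fst x" "snd x"]
	by (auto intro!: derivative_eq_intros)
then show "vder (%x. a * ph x + b * ps x) x = a * vder ph x + b * vder ps x"
	unfolding vder_def by (intro DERIV_imp_deriv) (simp add: vder_def)
qed

lemma C1c_zero: "(%_. 0) : C1c T"
unfolding C1c_def by (auto intro!: exI[of _ "%_. 0"] exI[of _ "{}"] simp: zero_blinfun.rep_eq)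

definition vgrad :: "(real \<times> real => real) => real \<times> (real \<times> real) => real" where
"vgrad ph x = vder ph (fst x, snd (snd x)) - vder ph (fst x, fst (snd x))"

lemma vgrad_eq_ngrad: "ngrad (%v. ph (t, v)) z = vgrad ph (t, z)"
by (simp add: vgrad_def vder_def ngrad_def case_prod_beta)

lemma vgrad_measurable: "ph : C1c T ==> vgrad ph : bm borel"
unfolding vgrad_def[abs_def]
by (intro borel_measurable_continuous_onI continuous_intros continuous_on_compose2[OF C1c_partials(4)]) auto

section \<open>The space-time measure of a curve\<close>

text \<open>
Masses of open sets are limits of integrals of continuous functions, hence measurable in time, and the
open sets generate.
\<close>

lemma narrow_kernel:
assumes distr_f: "!!t. t : {0..T} ==> real_distribution (f t)" and narrow: "narrowly_continuous T f"
shows "f : measurable (restrict_space borel {0..T}) (subprob_algebra borel)"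
proof (rule measurable_subprob_algebra_generated[where \<Omega>=UNIV and G="{O'. open O'}"])
show "sets borel = sigma_sets UNIV {O' :: real set. open O'}" by (simp add: sets_borel)
show "Int_stable {O' :: real set. open O'}" by (auto simp: Int_stable_def)
fix t assume "t : space (restrict_space borel {0..T})"
then have t: "t : {0..T}" by (simp add: space_restrict_space)
interpret real_distribution "f t" by (rule distr_f[OF t])
show "subprob_space (f t)" by unfold_locales
show "sets (f t) = sets borel" by (rule real_distribution_sets[OF distr_f[OF t]])
next
have 1: "emeasure (f t) UNIV = 1" if t: "t : {0..T}" for t
proof -
	interpret real_distribution "f t" by (rule distr_f[OF t])
	show ?thesis using emeasure_space_1 by simp
qed
have *: "(%t. emeasure (f t) UNIV) : bm (restrict_space borel {0..T})"
	using 1 by (subst measurable_cong[where g="%_. 1"]) (auto simp: space_restrict_space)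
then show "(%t. emeasure (f t) UNIV) : bm (restrict_space borel {0..T})" .
fix A :: "real set" assume "A : {O'. open O'}"
then have A: "open A" by simp
show "(%t. emeasure (f t) A) : bm (restrict_space borel {0..T})"
proof (cases "A = UNIV")
	case True then show ?thesis using * by simp
next
	case False
	from open_indicator_approx[OF A False] obtain ph :: "nat => real => real" where ph:
		"!!n. continuous_on UNIV (ph n)" "!!n x. x ~: A ==> ph n x = 0" "!!n. bounded {x. ph n x ~= 0}"
		"!!n x. 0 <= ph n x" "!!n x. ph n x <= 1" "!!x. (%n. ph n x) ----> indicator A x" by blast
	have "(%t. measure (f t) A) : bm (restrict_space borel {0..T})"
	proof (rule borel_measurable_LIMSEQ_real)
		fix t assume "t : space (restrict_space borel {0..T})"
		then have t: "t : {0..T}" by (simp add: space_restrict_space)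
		interpret real_distribution "f t" by (rule distr_f[OF t])
		have "(%n. LI (f t) (%v. ph n v)) ----> (LI (f t) (%v. indicator A v))"
			using ph(4-6) A borel_measurable_continuous_onI[OF ph(1)]
			by (intro integral_dominated_convergence[where w="%_. 1"]) auto
		then show "(%n. LI (f t) (%v. ph n v)) ----> measure (f t) A" by simp
	next
		fix n
		have "range (ph n) \<subseteq> {0..1}" using ph(4,5) by auto
		then have "bounded (range (ph n))" by (rule bounded_subset[OF bounded_closed_interval])
		with ph(1) have "continuous_on {0..T} (%t. LI (f t) (%v. ph n v))"
			using narrow[unfolded narrowly_continuous_def, rule_format, of "ph n"] by simp
		then show "(%t. LI (f t) (%v. ph n v)) : bm (restrict_space borel {0..T})"
			by (rule borel_measurable_continuous_on_restrict)
	qed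
	then have "(%t. ennreal (measure (f t) A)) : bm (restrict_space borel {0..T})" by measurable
	moreover have "emeasure (f t) A = ennreal (measure (f t) A)" if t: "t : {0..T}" for t
	proof -
		interpret real_distribution "f t" by (rule distr_f[OF t])
		show ?thesis by (rule emeasure_eq_measure)
	qed
	ultimately show ?thesis by (subst measurable_cong[where g="%t. ennreal (measure (f t) A)"]) (auto simp: space_restrict_space)
qed
qed auto

lemma measurable_restrict_borel_lebesgue:
"F : measurable (restrict_space borel S) N ==> F : measurable (lebesgue_on S) N" for S :: "real set"
proof -
have "(%x. x) : measurable (lebesgue_on S) (restrict_space borel S)"
	by (intro measurable_restrict_space2 measurable_lebesgue_on) auto
then show "F : measurable (restrict_space borel S) N ==> F : measurable (lebesgue_on S) N"
	by (rule measurable_compose)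
qed

lemma integral_measurable_kernel:
fixes h :: "'a => 'b => real"
assumes h: "(%x. h (fst x) (snd x)) : bm (N \<Otimes>\<^sub>M M)" and K: "K : measurable N (subprob_algebra M)"
shows "(%t. LI (K t) (%z. h t z)) : bm N"
proof -
have hp: "(%(t, z). h t z) : bm (N \<Otimes>\<^sub>M M)" using h by (simp add: case_prod_beta')
have eq: "(LI (K t) (%z. h t z)) = (if (NI (K t) (%z. ennreal \<bar>h t z\<bar>)) < \<infinity>
		then enn2real (NI (K t) (%z. ennreal (h t z))) - enn2real (NI (K t) (%z. ennreal (- h t z))) else 0)"
	if t: "t : space N" for t
proof (cases "integrable (K t) (h t)")
	case True
	then show ?thesis by (auto simp: real_lebesgue_integral_def integrable_iff_bounded)
next
	case False
	have "h t : bm M" using measurable_Pair2[OF hp t] by simp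
	moreover have "sets (K t) = sets M" using K t by (rule sets_kernel)
	ultimately have "h t : bm (K t)" using measurable_cong_sets by blast
	then show ?thesis using False by (auto simp: integrable_iff_bounded not_integrable_integral_eq)
qed
have m: "(%t. NI (K t) (%z. ennreal (g (h t z)))) : bm N" if g: "g : bm borel" for g :: "real => real"
	using measurable_compose[OF measurable_compose[OF h g] measurable_ennreal]
	by (intro nn_integral_measurable_subprob_algebra2[OF _ K]) (simp add: case_prod_beta')
have "(%t. if (NI (K t) (%z. ennreal \<bar>h t z\<bar>)) < \<infinity>
		then enn2real (NI (K t) (%z. ennreal (h t z))) - enn2real (NI (K t) (%z. ennreal (- h t z))) else 0)
		: bm N"
	using m[of abs] m[of "%x. x"] m[of uminus] by measurable
then show ?thesis by (subst measurable_cong[OF eq]) auto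
qed

locale narrow_curve =
fixes e T :: real and f :: "real => real measure" and Mb :: real
assumes e: "0 <= e" "e < 1" and T: "0 < T"
	and distr_f: "!!t. t : {0..T} ==> real_distribution (f t)"
	and jb_f: "!!t. t : {0..T} ==> integrable (f t) jb"
	and narrow: "narrowly_continuous T f"
	and mom_f: "!!t. t : {0<..<T} ==> mom (f t) <= Mb"
begin

abbreviation "leb \<equiv> lebesgue_on {0..T}"

lemma AE_interior: "AE t in leb. t : {0<..<T}"
proof -
have "AE t in leb. t : {0..T}" by (rule AE_I2) simp
moreover have "AE t in leb. t ~= 0" "AE t in leb. t ~= T" by (rule AE_lebesgue_on_neq, simp)+
ultimately show ?thesis by eventually_elim auto
qed

lemma Mb: "1 <= Mb"
proof -
have "T/2 : {0<..<T}" "T/2 : {0..T}" using T by auto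
then show ?thesis using mom_f[of "T/2"] mom_ge_1[OF distr_f jb_f, of "T/2"] by linarith
qed

lemma continuous_integral_f:
fixes ps :: "real => real"
shows "continuous_on UNIV ps ==> bounded (range ps) ==> continuous_on {0..T} (%t. LI (f t) (%v. ps v))"
using narrow[unfolded narrowly_continuous_def, rule_format, of ps] by simp

lemma kernel_f_borel: "f : measurable (restrict_space borel {0..T}) (subprob_algebra borel)"
by (rule narrow_kernel[OF distr_f narrow])

lemma kernel_f [measurable]: "f : measurable leb (subprob_algebra borel)"
by (rule measurable_restrict_borel_lebesgue[OF kernel_f_borel])

definition mu :: "real => (real \<times> real) measure" where "mu t = f t \<Otimes>\<^sub>M f t"

lemma kernel_mu [measurable]: "mu : measurable leb (subprob_algebra borel)"
using measurable_pair_measure[OF kernel_f kernel_f] unfolding mu_def[abs_def] borel_prod .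

lemma sets_mu: "t : {0..T} ==> sets (mu t) = sets borel"
unfolding mu_def by (rule sets_pair_borel[OF real_distribution_sets[OF distr_f]])

lemma space_leb_ne: "space leb ~= {}" using T by auto

definition Th :: "(real \<times> (real \<times> real)) measure" where
"Th = density (leb \<bind> (%t. distr (mu t) borel (%z. (t, z)))) (%x. ennreal (kernel e (snd x)))"

lemma leb_borel: "(%t. t) : measurable leb borel"
by (rule measurable_lebesgue_on) simp

lemma kernel_slices: "(%t. distr (mu t) borel (%z. (t, z))) : measurable leb (subprob_algebra borel)"
proof (rule measurable_distr2[OF _ kernel_mu])
have "(%x. (fst x, snd x)) : measurable (leb \<Otimes>\<^sub>M (borel :: (real \<times> real) measure)) (borel \<Otimes>\<^sub>M borel)"
	using measurable_compose[OF measurable_fst leb_borel] by (intro measurable_Pair) auto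
then show "(%(t, z). (t, z)) : measurable (leb \<Otimes>\<^sub>M (borel :: (real \<times> real) measure)) borel"
	by (simp add: borel_prod case_prod_beta)
qed

lemma sets_Th [measurable_cong]: "sets Th = sets borel"
unfolding Th_def using sets_bind[OF _ space_leb_ne, of "%t. distr (mu t) borel (%z. (t, z))" borel] by simp

lemma measurable_slice:
assumes h: "h : bm (borel :: (real \<times> (real \<times> real)) measure)"
shows "(%z. h (t, z)) : bm borel"
proof -
have "(%z::real \<times> real. (t, z)) : measurable borel borel"
	unfolding borel_prod[symmetric, where 'b="real \<times> real"] by measurable
then show ?thesis using h by (rule measurable_compose)
qed

lemma measurable_mu: "t : {0..T} ==> h : bm borel ==> h : bm (mu t)"
using measurable_cong_sets[OF sets_mu refl] by blast

lemma kernel_snd_measurable: "(%x. kernel e (snd x)) : bm (borel :: (real \<times> (real \<times> real)) measure)"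
proof -
have "snd : measurable (borel :: (real \<times> (real \<times> real)) measure) borel"
	unfolding borel_prod[symmetric, where 'b="real \<times> real"] by measurable
then show ?thesis using kernel_measurable by (rule measurable_compose)
qed

lemma
assumes h: "h : bm borel"
shows nn_integral_Th: "(NI Th (%x. h x)) = (NI leb (%t. NI (mu t) (%z. ennreal (kernel e z) * h (t, z))))"
	and nn_integral_slice_measurable: "(%t. NI (mu t) (%z. h (t, z))) : bm leb"
proof -
let ?B = "leb \<bind> (%t. distr (mu t) borel (%z. (t, z)))"
have sB: "sets ?B = sets borel"
	using sets_bind[OF _ space_leb_ne, of "%t. distr (mu t) borel (%z. (t, z))" borel] by simp
have k: "(%x. ennreal (kernel e (snd x))) : bm (borel :: (real \<times> (real \<times> real)) measure)"
	using measurable_compose[OF kernel_snd_measurable measurable_ennreal] .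
have kh: "(%x. ennreal (kernel e (snd x)) * h x) : bm borel"
	using k h by (rule borel_measurable_times_ennreal)
have slice: "(NI (distr (mu t) borel (%z. (t, z))) (%x. g x)) = (NI (mu t) (%z. g (t, z)))"
	if t: "t : {0..T}" and g: "g : bm borel" for t and g :: "_ => ennreal"
proof (rule nn_integral_distr)
	show "(%z. (t, z)) : measurable (mu t) borel"
		unfolding measurable_cong_sets[OF sets_mu[OF t] refl]
		unfolding borel_prod[symmetric, where 'b="real \<times> real"] by measurable
qed (use g in simp)
have "(NI Th (%x. h x)) = (NI ?B (%x. ennreal (kernel e (snd x)) * h x))"
	unfolding Th_def using k h measurable_cong_sets[OF sB refl] by (intro nn_integral_density) blast+
also have "... = (NI leb (%t. NI (distr (mu t) borel (%z. (t, z))) (%x. ennreal (kernel e (snd x)) * h x)))"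
	by (rule nn_integral_bind[OF kh kernel_slices])
also have "... = (NI leb (%t. NI (mu t) (%z. ennreal (kernel e z) * h (t, z))))"
proof (rule nn_integral_cong)
	fix t assume "t : space leb"
	then have t: "t : {0..T}" by simp
	show "(NI (distr (mu t) borel (%z. (t, z))) (%x. ennreal (kernel e (snd x)) * h x)) = (NI (mu t) (%z. ennreal (kernel e z) * h (t, z)))"
		by (subst slice[OF t kh]) simp
qed
finally show "(NI Th (%x. h x)) = (NI leb (%t. NI (mu t) (%z. ennreal (kernel e z) * h (t, z))))" .
have "(%t. NI (distr (mu t) borel (%z. (t, z))) (%x. h x)) : bm leb"
	by (rule measurable_compose[OF kernel_slices nn_integral_measurable_subprob_algebra[OF h]])
then show "(%t. NI (mu t) (%z. h (t, z))) : bm leb"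
	by (subst measurable_cong[where g="%t. NI (distr (mu t) borel (%z. (t, z))) (%x. h x)"]) (auto simp: slice[OF _ h])
qed

lemma integral_slice_measurable:
fixes h :: "real \<times> (real \<times> real) => real"
assumes h: "h : bm borel"
shows "(%t. LI (mu t) (%z. h (t, z))) : bm leb"
proof (rule integral_measurable_kernel[OF _ kernel_mu])
have "(%x. (fst x, snd x)) : measurable (leb \<Otimes>\<^sub>M (borel :: (real \<times> real) measure)) (borel \<Otimes>\<^sub>M borel)"
	using measurable_compose[OF measurable_fst leb_borel] by (intro measurable_Pair) auto
then have "(%x. (fst x, snd x)) : measurable (leb \<Otimes>\<^sub>M (borel :: (real \<times> real) measure)) borel" by (simp only: borel_prod)
then show "(%x. h (fst x, snd x)) : bm (leb \<Otimes>\<^sub>M borel)" using h by (rule measurable_compose)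
qed

lemma integral_Th:
fixes h :: "real \<times> (real \<times> real) => real"
assumes i: "integrable Th h"
shows "AE t in leb. integrable (mu t) (%z. kernel e z * h (t, z))"
	and "integrable leb (%t. LI (mu t) (%z. kernel e z * h (t, z)))"
	and "(LI Th (%x. h x)) = (LI leb (%t. LI (mu t) (%z. kernel e z * h (t, z))))"
proof -
have h: "h : bm borel" using i measurable_cong_sets[OF sets_Th refl] by blast
define g where "g x = kernel e (snd x) * h x" for x
have mg: "g : bm borel" unfolding g_def[abs_def] by (intro borel_measurable_times kernel_snd_measurable h)
have g: "g (t, z) = kernel e z * h (t, z)" for t z by (simp add: g_def)
have nn: "(NI Th (%x. ennreal (s (h x)))) = (NI leb (%t. NI (mu t) (%z. ennreal (s (g (t, z))))))"
	if s: "s : bm borel" "!!x y. 0 <= x ==> s (x * y) = x * s y" for s :: "real => real"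
proof -
	have "(NI Th (%x. ennreal (s (h x)))) = (NI leb (%t. NI (mu t) (%z. ennreal (kernel e z) * ennreal (s (h (t, z))))))"
		by (intro nn_integral_Th measurable_compose[OF h] measurable_compose[OF s(1) measurable_ennreal])
	also have "... = (NI leb (%t. NI (mu t) (%z. ennreal (s (g (t, z))))))"
		unfolding g using kernel_nonneg[OF e(2)] s(2) by (intro nn_integral_cong) (simp add: ennreal_mult')
	finally show ?thesis .
qed
let ?A = "%t. NI (mu t) (%z. ennreal (g (t, z)))" and ?B = "%t. NI (mu t) (%z. ennreal (- g (t, z)))"
	and ?C = "%t. NI (mu t) (%z. ennreal \<bar>g (t, z)\<bar>)"
have m: "(%t. NI (mu t) (%z. ennreal (s (g (t, z))))) : bm leb" if s: "s : bm borel" for s :: "real => real"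
	by (intro nn_integral_slice_measurable[of "%x. ennreal (s (g x))"] measurable_compose[OF mg] measurable_compose[OF s measurable_ennreal])
have mA: "?A : bm leb" and mB: "?B : bm leb" and mC: "?C : bm leb"
	using m[of "%x. x"] m[of uminus] m[of abs] by simp_all
have iA: "(NI Th (%x. ennreal (h x))) = (NI leb (%t. ?A t))" using nn[of "%x. x"] by simp
have iB: "(NI Th (%x. ennreal (- h x))) = (NI leb (%t. ?B t))" using nn[of uminus] by simp
have iC: "(NI Th (%x. ennreal \<bar>h x\<bar>)) = (NI leb (%t. ?C t))" using nn[of abs] by (simp add: abs_mult)
have fC: "(NI leb (%t. ?C t)) < \<infinity>" using i unfolding iC[symmetric] by (simp add: integrable_iff_bounded)
have finC: "AE t in leb. ?C t ~= \<infinity>" by (rule nn_integral_PInf_AE[OF mC]) (use fC in simp)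
have inS: "AE t in leb. t : {0..T}" by (rule AE_I2) simp
show AEi: "AE t in leb. integrable (mu t) (%z. kernel e z * h (t, z))"
	using finC inS
proof eventually_elim
	case (elim t)
	then show ?case
		unfolding g[symmetric] integrable_iff_bounded
		using measurable_mu[OF elim(2) measurable_slice[OF mg]] by (simp add: less_top)
qed
have le: "?A t <= ?C t" "?B t <= ?C t" for t by (auto intro!: nn_integral_mono ennreal_leI)
have fAB: "(NI leb (%t. ?A t)) < \<infinity>" "(NI leb (%t. ?B t)) < \<infinity>"
	using fC nn_integral_mono[of leb ?A ?C] nn_integral_mono[of leb ?B ?C] le by (meson le_less_trans)+
have conv: "integrable leb (%t. enn2real (F t))" "(LI leb (%t. enn2real (F t))) = enn2real (NI leb (%t. F t))"
	if F: "F : bm leb" "(NI leb (%t. F t)) < \<infinity>" for F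
proof -
	have "AE t in leb. F t ~= \<infinity>" by (rule nn_integral_PInf_AE[OF F(1)]) (use F(2) in simp)
	then have eq: "(NI leb (%t. ennreal (enn2real (F t)))) = (NI leb (%t. F t))"
		by (intro nn_integral_cong_AE) (auto elim!: eventually_mono simp: less_top)
	have mF: "(%t. enn2real (F t)) : bm leb" using F(1) by (rule borel_measurable_enn2real)
	show "integrable leb (%t. enn2real (F t))"
		using mF eq F(2) by (intro integrableI_bounded) auto
	show "(LI leb (%t. enn2real (F t))) = enn2real (NI leb (%t. F t))"
		using mF eq by (subst integral_eq_nn_integral) auto
qed
have AEeq: "AE t in leb. (LI (mu t) (%z. g (t, z))) = enn2real (?A t) - enn2real (?B t)"
	using AEi unfolding g[symmetric] by eventually_elim (simp add: real_lebesgue_integral_def)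
have mI: "(%t. LI (mu t) (%z. g (t, z))) : bm leb" by (rule integral_slice_measurable[OF mg])
have iAB: "integrable leb (%t. enn2real (?A t) - enn2real (?B t))"
	using conv(1)[OF mA fAB(1)] conv(1)[OF mB fAB(2)] by simp
have "integrable leb (%t. LI (mu t) (%z. g (t, z)))"
	using iAB AEeq mI by (subst integrable_cong_AE) auto
then show "integrable leb (%t. LI (mu t) (%z. kernel e z * h (t, z)))" unfolding g .
have "(LI leb (%t. LI (mu t) (%z. g (t, z)))) = (LI leb (%t. enn2real (?A t) - enn2real (?B t)))"
	using iAB by (intro integral_cong_AE mI AEeq) auto
also have "... = enn2real (NI leb (%t. ?A t)) - enn2real (NI leb (%t. ?B t))"
	using conv[OF mA fAB(1)] conv[OF mB fAB(2)] by simp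
also have "... = (LI Th (%x. h x))" unfolding iA[symmetric] iB[symmetric] using i by (simp add: real_lebesgue_integral_def)
finally show "(LI Th (%x. h x)) = (LI leb (%t. LI (mu t) (%z. kernel e z * h (t, z))))" unfolding g by simp
qed

lemma integrable_Th_bounded:
assumes g: "g : bm borel" "!!x. \<bar>g x\<bar> <= (D :: real)"
shows "integrable Th g"
proof (rule integrableI_bounded)
show "g : bm Th" using g measurable_cong_sets[OF sets_Th refl] by blast
have D: "0 <= D" using g(2)[of undefined] abs_ge_zero order_trans by blast
have "(NI Th (%x. ennreal (norm (g x)))) = (NI leb (%t. NI (mu t) (%z. ennreal (kernel e z) * ennreal \<bar>g (t, z)\<bar>)))"
	using g(1) by (subst nn_integral_Th) auto
also have "... <= (NI leb (%t. ennreal ((1 - e) / 4 * D * (Mb + Mb))))"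
proof (rule nn_integral_mono_AE, use AE_interior in eventually_elim)
	case (elim t)
	then have t: "t : {0..T}" by auto
	have mg: "(%z. \<bar>g (t, z)\<bar>) : bm borel"
		by (intro borel_measurable_abs measurable_slice g(1))
	have bg: "\<bar>\<bar>g (t, z)\<bar>\<bar> <= D" for z using g(2) by simp
	note k = integrable_kernel_mult[OF e distr_f[OF t] jb_f[OF t] distr_f[OF t] jb_f[OF t] mg bg, folded mu_def]
	have "(NI (mu t) (%z. ennreal (kernel e z) * ennreal \<bar>g (t, z)\<bar>)) = (NI (mu t) (%z. ennreal (kernel e z * \<bar>g (t, z)\<bar>)))"
		using kernel_nonneg[OF e(2)] by (intro nn_integral_cong) (simp add: ennreal_mult')
	also have "... = ennreal (LI (mu t) (%z. kernel e z * \<bar>g (t, z)\<bar>))"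
		using k(1) kernel_nonneg[OF e(2)] by (intro nn_integral_eq_integral) auto
	also have "... <= ennreal ((1 - e) / 4 * D * (Mb + Mb))"
	proof (rule ennreal_leI)
		have "(1 - e) / 4 * D * (mom (f t) + mom (f t)) <= (1 - e) / 4 * D * (Mb + Mb)"
			using mom_f[OF elim] e D by (intro mult_left_mono) auto
		then show "(LI (mu t) (%z. kernel e z * \<bar>g (t, z)\<bar>)) <= (1 - e) / 4 * D * (Mb + Mb)" using k(2) by linarith
	qed
	finally show ?case .
qed
also have "... < \<infinity>" using T by (simp add: emeasure_restrict_space ennreal_mult_less_top)
finally show "(NI Th (%x. ennreal (norm (g x)))) < \<infinity>" .
qed

end

section \<open>The flux of an absolutely continuous curve\<close>

locale ac_curve = narrow_curve +
fixes m :: "real => real"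
assumes m_meas: "m : bm (lebesgue_on {0..T})"
	and m_sq: "integrable (lebesgue_on {0..T}) (%t. (m t)^2)"
	and dA_m: "!!s t. 0 < s ==> s <= t ==> t < T ==> enn2ereal (dA e (f s) (f t)) <= ereal (LI (lebesgue_on {s..t}) (%r. m r))"
begin

definition speed :: "real => real" where "speed t = \<bar>m t\<bar> + 1"

lemma const_integrable: "integrable leb (%_. c :: real)"
by (rule continuous_integrable_lebesgue_on(1)[OF continuous_on_const])

lemma speed_measurable: "speed : bm leb"
unfolding speed_def[abs_def] using m_meas by measurable

lemma speed_sq_integrable: "integrable leb (%t. (speed t)^2)"
proof (rule Bochner_Integration.integrable_bound)
show "integrable leb (%t. 2 * (m t)^2 + 2)"
	by (intro Bochner_Integration.integrable_add integrable_mult_right m_sq const_integrable)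
show "(%t. (speed t)^2) : bm leb" by (intro borel_measurable_power speed_measurable)
have "(speed t)^2 <= 2 * (m t)^2 + 2" for t
proof -
	have "2 * (m t)^2 + 2 - (speed t)^2 = (\<bar>m t\<bar> - 1)^2"
		by (simp add: speed_def power2_eq_square algebra_simps abs_mult_self_eq)
	then show ?thesis using zero_le_power2[of "\<bar>m t\<bar> - 1"] by linarith
qed
then show "AE t in leb. norm ((speed t)^2) <= norm (2 * (m t)^2 + 2)" by simp
qed

lemma speed_integrable: "integrable leb speed"
proof (rule Bochner_Integration.integrable_bound[OF speed_sq_integrable speed_measurable])
have ge: "1 <= speed t" for t by (simp add: speed_def)
have "\<bar>speed t\<bar> <= \<bar>(speed t)^2\<bar>" for t
	using self_le_power[OF ge, of 2 t] by (simp add: abs_of_nonneg[OF order_trans[OF zero_le_one ge]])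
then show "AE t in leb. norm (speed t) <= norm ((speed t)^2)" by simp
qed

lemma dA_less_speed:
assumes st: "0 < s" "s < t" "t < T"
shows "dA e (f s) (f t) < ennreal (integral {s..t} speed)"
	and "0 < integral {s..t} speed"
	and "(integral {s..t} speed)^2 <= (t - s) * integral {s..t} (%r. (speed r)^2)"
proof -
have sub: "{s..t} \<subseteq> {0..T}" using st by auto
have i1: "integrable (lebesgue_on {s..t}) speed" by (rule Equivalence_Lebesgue_Henstock_Integration.integrable_subinterval[OF speed_integrable sub])
have i2: "integrable (lebesgue_on {s..t}) (%r. (speed r)^2)" by (rule Equivalence_Lebesgue_Henstock_Integration.integrable_subinterval[OF speed_sq_integrable sub])
have ic: "integrable (lebesgue_on {s..t}) (%_. c::real)" for c
	by (rule continuous_integrable_lebesgue_on(1)[OF continuous_on_const])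
have m0: "integrable leb m"
	using speed_integrable m_meas by (rule Bochner_Integration.integrable_bound) (simp add: speed_def)
have i0: "integrable (lebesgue_on {s..t}) m" by (rule Equivalence_Lebesgue_Henstock_Integration.integrable_subinterval[OF m0 sub])
have e1: "integral\<^sup>L (lebesgue_on {s..t}) speed = integral {s..t} speed"
	by (rule lebesgue_integral_eq_integral[OF i1]) simp
have e2: "integral\<^sup>L (lebesgue_on {s..t}) (%r. (speed r)^2) = integral {s..t} (%r. (speed r)^2)"
	by (rule lebesgue_integral_eq_integral[OF i2]) simp
have vol: "(LI (lebesgue_on {s..t}) (%r. c)) = c * (t - s)" for c :: real
	using st by (simp add: measure_restrict_space)
have "(LI (lebesgue_on {s..t}) (%r. m r)) + (t - s) = (LI (lebesgue_on {s..t}) (%r. m r + 1))"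
	using i0 ic[of 1] vol[of 1] by simp
also have "... <= (LI (lebesgue_on {s..t}) (%r. speed r))"
	by (rule integral_mono[OF _ i1]) (use i0 ic in \<open>auto simp: speed_def\<close>)
finally have lt: "(LI (lebesgue_on {s..t}) (%r. m r)) < integral {s..t} speed" using st e1 by simp
have "(t - s) = (LI (lebesgue_on {s..t}) (%r. 1))" using vol[of 1] by simp
also have "... <= (LI (lebesgue_on {s..t}) (%r. speed r))"
	by (rule integral_mono[OF _ i1]) (use ic in \<open>auto simp: speed_def\<close>)
finally show pos: "0 < integral {s..t} speed" using st e1 by simp
have "enn2ereal (dA e (f s) (f t)) <= ereal (LI (lebesgue_on {s..t}) (%r. m r))" using st by (intro dA_m) auto
also have "... < ereal (integral {s..t} speed)" using lt by simp
also have "... = enn2ereal (ennreal (integral {s..t} speed))" using pos by simp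
finally show "dA e (f s) (f t) < ennreal (integral {s..t} speed)" by (simp add: less_ennreal.rep_eq)
have mm: "speed : bm (lebesgue_on {s..t})" using i1 by simp
have "(LI (lebesgue_on {s..t}) (%r. speed r * 1))^2 <= (LI (lebesgue_on {s..t}) (%r. (speed r)^2)) * (LI (lebesgue_on {s..t}) (%r. 1^2))"
	using ic[of 1] by (intro Cauchy_Schwarz_integral(2) mm i2) auto
then show "(integral {s..t} speed)^2 <= (t - s) * integral {s..t} (%r. (speed r)^2)"
	using vol[of 1] e1 e2 by (simp add: mult.commute)
qed

definition H :: "real => real" where "H t = integral {0..t} (%r. (speed r)^2)"

lemma speed_sq_integrable_on: "(%r. (speed r)^2) integrable_on {0..T}"
by (rule integrable_on_lebesgue_on[OF speed_sq_integrable]) simp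

lemma H_diff:
assumes "0 <= s" "s <= t" "t <= T"
shows "integral {s..t} (%r. (speed r)^2) = H t - H s"
proof -
have "(%r. (speed r)^2) integrable_on {0..t}"
	by (rule integrable_on_subinterval[OF speed_sq_integrable_on]) (use assms in auto)
then have "integral {0..s} (%r. (speed r)^2) + integral {s..t} (%r. (speed r)^2) = integral {0..t} (%r. (speed r)^2)"
	using assms by (intro Henstock_Kurzweil_Integration.integral_combine) auto
then show ?thesis by (simp add: H_def)
qed

lemma H_mono: "0 <= s ==> s <= t ==> t <= T ==> H s <= H t"
proof -
assume a: "0 <= s" "s <= t" "t <= T"
have "(%r. (speed r)^2) integrable_on {s..t}"
	by (rule integrable_on_subinterval[OF speed_sq_integrable_on]) (use a in auto)
then have "0 <= integral {s..t} (%r. (speed r)^2)"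
	by (rule Henstock_Kurzweil_Integration.integral_nonneg) simp
then show ?thesis using H_diff[OF a] by simp
qed

lemma H_0: "H 0 = 0" by (simp add: H_def)

lemma H_continuous: "continuous_on {0..T} H"
unfolding H_def by (rule indefinite_integral_continuous_1[OF speed_sq_integrable_on])

definition S :: "(real \<times> real => real) => real => real => real" where
"S ph t s = (LI (f s) (%v. ph (t, v)))"

lemma test_slice:
assumes ph: "ph : C1c T"
shows "continuous_on UNIV (%v. ph (t, v))" "continuous_on UNIV (%v. tder ph (t, v))" "continuous_on UNIV (%v. vder ph (t, v))"
	"bounded (range (%v. ph (t, v)))" "bounded (range (%v. tder ph (t, v)))"
	"s : {0..T} ==> integrable (f s) (%v. ph (t, v))" "s : {0..T} ==> integrable (f s) (%v. tder ph (t, v))"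
proof -
show c: "continuous_on UNIV (%v. ph (t, v))" "continuous_on UNIV (%v. tder ph (t, v))" "continuous_on UNIV (%v. vder ph (t, v))"
	by (intro continuous_on_compose2[OF C1c_partials(5)[OF ph]] continuous_on_compose2[OF C1c_partials(3)[OF ph]]
			continuous_on_compose2[OF C1c_partials(4)[OF ph]] continuous_intros; simp)+
obtain B where B: "0 < B" "!!x. \<bar>ph x\<bar> <= B" "!!x. \<bar>tder ph x\<bar> <= B" "!!x. \<bar>vder ph x\<bar> <= B"
	by (rule C1c_bounds[OF ph T]) (rule that; assumption)
show "bounded (range (%v. ph (t, v)))" using B(2) by (auto intro!: boundedI[where B=B])
show "bounded (range (%v. tder ph (t, v)))" using B(3) by (auto intro!: boundedI[where B=B])
assume s: "s : {0..T}"
interpret real_distribution "f s" by (rule distr_f[OF s])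
show "integrable (f s) (%v. ph (t, v))" "integrable (f s) (%v. tder ph (t, v))"
	using B borel_measurable_continuous_onI[OF c(1)] borel_measurable_continuous_onI[OF c(2)]
	by (auto intro!: integrable_const_bound[where B=B])
qed

lemma S_continuous:
assumes ph: "ph : C1c T" and al: "continuous_on A al" and be: "continuous_on A be" "!!t. t : A ==> be t : {0..T}"
shows "continuous_on A (%t. S ph (al t) (be t))"
unfolding continuous_on_def
proof
obtain B where B: "0 < B" "!!x. \<bar>ph x\<bar> <= B" "!!x. \<bar>tder ph x\<bar> <= B" "!!x. \<bar>vder ph x\<bar> <= B"
	by (rule C1c_bounds[OF ph T]) (rule that; assumption)
fix t0 assume t0: "t0 : A"
have lip: "\<bar>S ph a s - S ph b s\<bar> <= B * \<bar>a - b\<bar>" if s: "s : {0..T}" for a b s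
proof -
	interpret real_distribution "f s" by (rule distr_f[OF s])
	have "\<bar>S ph a s - S ph b s\<bar> = \<bar>LI (f s) (%v. ph (a, v) - ph (b, v))\<bar>"
		unfolding S_def using test_slice(6)[OF ph s] by simp
	also have "... <= (LI (f s) (%v. \<bar>ph (a, v) - ph (b, v)\<bar>))" by (rule integral_abs_bound)
	also have "... <= (LI (f s) (%v. B * \<bar>a - b\<bar>))"
	proof (rule integral_mono)
		show "integrable (f s) (%v. \<bar>ph (a, v) - ph (b, v)\<bar>)"
			using test_slice(6)[OF ph s] by (intro integrable_abs Bochner_Integration.integrable_diff)
		show "\<bar>ph (a, v) - ph (b, v)\<bar> <= B * \<bar>a - b\<bar>" for v
			using DERIV_bounded_imp_Lipschitz[of "%s. ph (s, v)" "%s. tder ph (s, v)" B a b] C1c_partials(1)[OF ph] B(3) by blast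
	qed simp
	also have "... = B * \<bar>a - b\<bar>" using prob_space by simp
	finally show ?thesis .
qed
have "((%t. S ph (al t) (be t) - S ph (al t0) (be t)) \<longlongrightarrow> 0) (at t0 within A)"
proof (rule Lim_null_comparison)
	show "eventually (%t. norm (S ph (al t) (be t) - S ph (al t0) (be t)) <= B * \<bar>al t - al t0\<bar>) (at t0 within A)"
		using lip be(2) by (auto simp: eventually_at_filter)
	have "(al \<longlongrightarrow> al t0) (at t0 within A)" using al t0 by (simp add: continuous_on_def)
	then show "((%t. B * \<bar>al t - al t0\<bar>) \<longlongrightarrow> 0) (at t0 within A)"
		by (auto intro!: tendsto_eq_intros)
qed
moreover have "((%t. S ph (al t0) (be t)) \<longlongrightarrow> S ph (al t0) (be t0)) (at t0 within A)"
proof -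
	have "continuous_on {0..T} (%s. S ph (al t0) s)"
		unfolding S_def by (rule continuous_integral_f[OF test_slice(1,4)[OF ph]])
	then have "continuous_on A (%t. S ph (al t0) (be t))"
		using be by (intro continuous_on_compose2[of "{0..T}" "%s. S ph (al t0) s" A be]) auto
	then show ?thesis using t0 by (simp add: continuous_on_def)
qed
ultimately have "((%t. (S ph (al t) (be t) - S ph (al t0) (be t)) + S ph (al t0) (be t)) \<longlongrightarrow> 0 + S ph (al t0) (be t0)) (at t0 within A)"
	by (rule tendsto_add)
then show "((%t. S ph (al t) (be t)) \<longlongrightarrow> S ph (al t0) (be t0)) (at t0 within A)" by simp
qed

definition lfun :: "(real \<times> real => real) => real" where
"lfun ph = - (LI leb (%t. LI (f t) (%v. tder ph (t, v))))"

text \<open>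
The time derivative in \<open>lfun\<close> acts on the test function only. Backward difference quotients are used
because, after a shift of the integration variable, they become increments of the curve.
\<close>

lemma difference_quotients:
assumes ph: "ph : C1c T" and h: "!!n. 0 < h n" "h ----> 0"
shows "(%n::nat. LI leb (%t. (S ph (t - h n) t - S ph t t) / h n)) ----> lfun ph"
proof -
obtain B where B: "0 < B" "!!x. \<bar>ph x\<bar> <= B" "!!x. \<bar>tder ph x\<bar> <= B" "!!x. \<bar>vder ph x\<bar> <= B"
	by (rule C1c_bounds[OF ph T]) (rule that; assumption)
have b: "\<bar>(ph (t - h n, v) - ph (t, v)) / h n\<bar> <= B" for n t v
proof -
	have "\<bar>ph (t - h n, v) - ph (t, v)\<bar> <= B * \<bar>(t - h n) - t\<bar>"
		using DERIV_bounded_imp_Lipschitz[of "%s. ph (s, v)" "%s. tder ph (s, v)" B "t - h n" t] C1c_partials(1)[OF ph] B(3) by blast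
	then show ?thesis using h(1)[of n] by (simp add: field_simps)
qed
have eq: "(S ph (t - h n) t - S ph t t) / h n = (LI (f t) (%v. (ph (t - h n, v) - ph (t, v)) / h n))" if t: "t : {0..T}" for n t
	unfolding S_def using test_slice(6)[OF ph t] by simp
have inner: "(%n. (S ph (t - h n) t - S ph t t) / h n) ----> (LI (f t) (%v. - tder ph (t, v)))" if t: "t : {0..T}" for t
	unfolding eq[OF t]
proof (rule integral_dominated_convergence[where w="%_. B"])
	interpret real_distribution "f t" by (rule distr_f[OF t])
	have [measurable]: "(%v. ph (s, v)) : bm borel" "(%v. tder ph (s, v)) : bm borel" for s
		using test_slice(1,2)[OF ph] by (auto intro: borel_measurable_continuous_onI)
	have mt: "(%v. ph (s, v)) : bm (f t)" "(%v. tder ph (s, v)) : bm (f t)" for s by simp_all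
	show "(%v. - tder ph (t, v)) : bm (f t)"
		"!!n. (%v. (ph (t - h n, v) - ph (t, v)) / h n) : bm (f t)"
		by (intro borel_measurable_uminus borel_measurable_divide borel_measurable_diff borel_measurable_const mt)+
	show "integrable (f t) (%_. B)" by simp
	show "AE v in f t. (%n. (ph (t - h n, v) - ph (t, v)) / h n) ----> - tder ph (t, v)"
	proof (intro AE_I2)
		fix v
		have "((%k. (ph (t + k, v) - ph (t, v)) / k) \<longlongrightarrow> tder ph (t, v)) (at 0)"
			using C1c_partials(1)[OF ph, of v t] by (simp add: DERIV_def)
		moreover have "filterlim (%n. - h n) (at 0) sequentially"
		proof -
			have "h n ~= 0" for n using h(1)[of n] by simp
			then show ?thesis unfolding filterlim_at using tendsto_minus[OF h(2)] by simp
		qed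
		ultimately have "(%n. (ph (t + - h n, v) - ph (t, v)) / (- h n)) ----> tder ph (t, v)"
			by (rule filterlim_compose)
		then have "(%n. - ((ph (t + - h n, v) - ph (t, v)) / (- h n))) ----> - tder ph (t, v)" by (rule tendsto_minus)
		then show "(%n. (ph (t - h n, v) - ph (t, v)) / h n) ----> - tder ph (t, v)" by simp
	qed
	show "AE v in f t. norm ((ph (t - h n, v) - ph (t, v)) / h n) <= B" for n using b by simp
qed
have "(%n. LI leb (%t. (S ph (t - h n) t - S ph t t) / h n)) ----> (LI leb (%t. LI (f t) (%v. - tder ph (t, v))))"
proof (rule integral_dominated_convergence[where w="%_. B"])
	show cm: "(%t. (S ph (t - h n) t - S ph t t) / h n) : bm leb" for n
		using h(1)[of n] by (intro continuous_imp_measurable_on_sets_lebesgue continuous_intros S_continuous[OF ph]) auto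
	show "(%t. LI (f t) (%v. - tder ph (t, v))) : bm leb"
		by (rule borel_measurable_LIMSEQ_real[OF _ cm]) (use inner in simp)
	show "integrable leb (%_. B)" by (rule const_integrable)
	show "AE t in leb. (%n. (S ph (t - h n) t - S ph t t) / h n) ----> (LI (f t) (%v. - tder ph (t, v)))"
		using inner by (intro AE_I2) simp
	show "AE t in leb. norm ((S ph (t - h n) t - S ph t t) / h n) <= B" for n
	proof (intro AE_I2)
		fix t assume "t : space leb"
		then have t: "t : {0..T}" by simp
		interpret real_distribution "f t" by (rule distr_f[OF t])
		have "\<bar>LI (f t) (%v. (ph (t - h n, v) - ph (t, v)) / h n)\<bar> <= (LI (f t) (%v. \<bar>(ph (t - h n, v) - ph (t, v)) / h n\<bar>))"
			by (rule integral_abs_bound)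
		also have "... <= (LI (f t) (%v. B))"
			using test_slice(6)[OF ph t] b
			by (intro integral_mono integrable_abs Bochner_Integration.integrable_divide Bochner_Integration.integrable_diff) auto
		also have "... = B" using prob_space by simp
		finally show "norm ((S ph (t - h n) t - S ph t t) / h n) <= B" unfolding eq[OF t] by simp
	qed
qed
then show ?thesis by (simp add: lfun_def)
qed

lemma shifted_difference_quotient:
assumes ph: "ph : C1c T" and s: "0 < a" "a <= b" "b < T" "!!t v. t ~: {a..b} ==> ph (t, v) = 0"
	and h: "0 < h" "h < T - b"
shows "(LI leb (%t. (S ph (t - h) t - S ph t t) / h)) = integral {a..b} (%t. (S ph t (t + h) - S ph t t) / h)"
proof -
have z: "S ph t r = 0" if "t ~: {a..b}" for t r using s(4)[OF that] by (simp add: S_def)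
have c1: "continuous_on {0..T} (%t. S ph (t - h) t)" by (intro S_continuous[OF ph] continuous_intros) auto
have c2: "continuous_on {0..T} (%t. S ph t t)" by (intro S_continuous[OF ph] continuous_intros) auto
have i1: "(%t. S ph (t - h) t) integrable_on {a + h..b + h}" and i2: "(%t. S ph t t) integrable_on {a..b}"
	using s h by (auto intro!: integrable_continuous_interval continuous_on_subset[OF c1] continuous_on_subset[OF c2])
have "((%t. S ph (t - h) t) has_integral integral {a + h..b + h} (%t. S ph (t - h) t)) {0..T}"
	by (rule has_integral_on_superset[OF integrable_integral[OF i1]]) (use s h in \<open>auto intro!: z\<close>)
then have e1: "integral {0..T} (%t. S ph (t - h) t) = integral {a + h..b + h} (%t. S ph (t - h) t)"
	by (rule integral_unique)
have "((%t. S ph t t) has_integral integral {a..b} (%t. S ph t t)) {0..T}"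
	by (rule has_integral_on_superset[OF integrable_integral[OF i2]]) (use s h in \<open>auto intro!: z\<close>)
then have e2: "integral {0..T} (%t. S ph t t) = integral {a..b} (%t. S ph t t)"
	by (rule integral_unique)
have "integral {a..b} ((%t. S ph (t - h) t) \<circ> (%x. x + h)) = integral {a + h..b + h} (%t. S ph (t - h) t)"
	using integral_shift_Icc_real[of a b "%t. S ph (t - h) t" h] by (simp add: o_def add.commute)
then have e3: "integral {a + h..b + h} (%t. S ph (t - h) t) = integral {a..b} (%t. S ph t (t + h))"
	by (simp add: o_def)
have i3: "(%t. S ph t (t + h)) integrable_on {a..b}"
	by (intro integrable_continuous_interval S_continuous[OF ph] continuous_intros) (use s h in auto)
have "(LI leb (%t. (S ph (t - h) t - S ph t t) / h)) = integral {0..T} (%t. (S ph (t - h) t - S ph t t) / h)"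
	using h by (intro continuous_integrable_lebesgue_on continuous_intros c1 c2) auto
also have "... = (integral {0..T} (%t. S ph (t - h) t) - integral {0..T} (%t. S ph t t)) / h"
	using integrable_continuous_interval[OF c1] integrable_continuous_interval[OF c2]
	by (simp add: integral_divide Henstock_Kurzweil_Integration.integral_diff)
also have "... = integral {a..b} (%t. (S ph t (t + h) - S ph t t) / h)"
	unfolding e1 e2 e3 using i2 i3
	by (simp add: integral_divide Henstock_Kurzweil_Integration.integral_diff)
finally show ?thesis .
qed

definition Q :: "(real \<times> real => real) => real => real" where
"Q ph t = Qform e (f t) (%v. vder ph (t, v))"

lemma vgrad_sq_integrable:
assumes ph: "ph : C1c T"
shows "integrable Th (%x. (vgrad ph x)^2)" "integrable leb (Q ph)" "(LI Th (%x. (vgrad ph x)^2)) = (LI leb (%t. Q ph t))"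
proof -
obtain B where B: "0 < B" "!!x. \<bar>ph x\<bar> <= B" "!!x. \<bar>tder ph x\<bar> <= B" "!!x. \<bar>vder ph x\<bar> <= B"
	by (rule C1c_bounds[OF ph T]) (rule that; assumption)
have b: "\<bar>(vgrad ph x)^2\<bar> <= 4 * B^2" for x
	unfolding vgrad_def using bounded_ngrad[of "%v. vder ph (fst x, v)" B] B(4) by blast
show i: "integrable Th (%x. (vgrad ph x)^2)"
	by (rule integrable_Th_bounded[OF _ b]) (intro borel_measurable_power vgrad_measurable[OF ph])
have q: "(LI (mu t) (%z. kernel e z * (vgrad ph (t, z))^2)) = Q ph t" for t
	by (simp add: Q_def Qform_def mu_def vgrad_def)
show "integrable leb (Q ph)" using integral_Th(2)[OF i] unfolding q .
show "(LI Th (%x. (vgrad ph x)^2)) = (LI leb (%t. Q ph t))" using integral_Th(3)[OF i] unfolding q .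
qed

lemma Q_nonneg: "ph : C1c T ==> t : {0..T} ==> 0 <= Q ph t"
proof -
assume ph: "ph : C1c T" and t: "t : {0..T}"
obtain B where B: "0 < B" "!!x. \<bar>ph x\<bar> <= B" "!!x. \<bar>tder ph x\<bar> <= B" "!!x. \<bar>vder ph x\<bar> <= B"
	by (rule C1c_bounds[OF ph T]) (rule that; assumption)
show ?thesis unfolding Q_def
	by (rule Qform_nonneg[OF e distr_f[OF t] jb_f[OF t] borel_measurable_continuous_onI[OF test_slice(3)[OF ph]] B(4)])
qed

text \<open>
  The transport estimate at a fixed time, in a form that is uniform in time: along short time steps
  a test function changes at most by the distance times its Dirichlet norm, up to an error that
  can be made small.
\<close>

lemma test_function_increment:
assumes ph: "ph : C1c T" and et: "0 < et"
obtains d0 where "0 < d0"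
	"!!d s t nu. 0 < d ==> d < d0 ==> s : {0<..<T} ==> dA e (f s) nu < ennreal d ==>
		((LI nu (%v. ph (t, v))) - (LI (f s) (%v. ph (t, v))))^2 <= d^2 * (Qform e (f s) (%v. vder ph (t, v)) + et)"
	"!!d s t nu. 0 < d ==> d < d0 ==> s : {0<..<T} ==> dA e (f s) nu < ennreal d ==>
		Qform e nu (%v. vder ph (t, v)) <= Qform e (f s) (%v. vder ph (t, v)) + et"
proof -
obtain B where B: "0 < B" "!!x. \<bar>ph x\<bar> <= B" "!!x. \<bar>tder ph x\<bar> <= B" "!!x. \<bar>vder ph x\<bar> <= B"
	by (rule C1c_bounds[OF ph T]) (rule that; assumption)
obtain a b R where s: "0 < a" "a <= b" "b < T" "0 <= R"
	"!!t v. t ~: {a..b} | R < \<bar>v\<bar> ==> ph (t, v) = 0"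
	"!!t v. t ~: {a..b} | R < \<bar>v\<bar> ==> tder ph (t, v) = 0"
	"!!t v. t ~: {a..b} | R < \<bar>v\<bar> ==> vder ph (t, v) = 0"
	by (rule C1c_support[OF ph T]) (rule that; assumption)
define om where "om = et / (2 * (16 * (1 - e) * B * Mb))"
have p: "0 < 16 * (1 - e) * B * Mb" using e B Mb by simp
have om: "0 < om" using et p by (simp add: om_def)
obtain de where de: "0 < de" "!!x y. dist x y <= de ==> \<bar>vder ph x - vder ph y\<bar> <= om"
	by (rule C1c_vder_uniform[OF ph T om]) (rule that; assumption)
have "16 * (1 - e) * B * om * Mb = (16 * (1 - e) * B * Mb) * om" by simp
also have "... = et / 2"
proof -
	have "x * (et / (2 * x)) = et / 2" if "0 < x" for x :: real using that by simp
	from this[OF p] show ?thesis unfolding om_def .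
qed
finally have "16 * (1 - e) * B * om * Mb < et" using et by simp
from order_tendstoD(2)[OF transport_err_tendsto this, of R de]
obtain d0 where d0: "0 < d0" "!!d. d ~= 0 ==> dist d 0 < d0 ==> transport_err e B R de om Mb d < et"
	unfolding eventually_at by blast
show ?thesis
proof (rule that[OF d0(1)])
	fix d s t nu assume d: "0 < d" "d < d0" and s': "s : {0<..<T}" and lt: "dA e (f s) nu < ennreal d"
	have sT: "s : {0..T}" using s' by auto
	have v: "ph (t, v) = 0" if "R < \<bar>v\<bar>" for v using s(5) that by blast
	have de': "\<bar>vder ph (t, x) - vder ph (t, y)\<bar> <= om" if "\<bar>x - y\<bar> <= de" for x y
		using that by (intro de(2)) (simp add: dist_Pair_Pair dist_real_def)
	note tf = dA_test_function[OF e distr_f[OF sT] jb_f[OF sT] mom_f[OF s'] lt C1c_partials(2)[OF ph]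
		test_slice(3)[OF ph] B(4,1) v s(4) de' de(1)]
	have err: "transport_err e B R de om Mb d <= et" using d0(2)[of d] d by simp
	note tf(1)
	also have "d^2 * (Qform e (f s) (%v. vder ph (t, v)) + transport_err e B R de om Mb d)
			<= d^2 * (Qform e (f s) (%v. vder ph (t, v)) + et)"
		using err by (intro mult_left_mono) auto
	finally show "((LI nu (%v. ph (t, v))) - (LI (f s) (%v. ph (t, v))))^2 <= d^2 * (Qform e (f s) (%v. vder ph (t, v)) + et)" .
	show "Qform e nu (%v. vder ph (t, v)) <= Qform e (f s) (%v. vder ph (t, v)) + et"
		using tf(2) err by linarith
qed
qed

text \<open>
After the shift the integrand is the increment of a frozen test function between \<open>t\<close> and \<open>t + h\<close>,
which is at most the cost times the root of the Dirichlet form; \<open>2 a b <= a^2 + b^2\<close> separates the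
squared speed, which integrates to \<open>H T\<close>, from the squared norm of the gradient.
\<close>

lemma lfun_le:
assumes ph: "ph : C1c T"
shows "2 * lfun ph <= H T + (LI Th (%x. (vgrad ph x)^2))"
proof (rule field_le_epsilon)
fix ep :: real assume ep: "0 < ep"
define et where "et = ep / T"
have et: "0 < et" using ep T by (simp add: et_def)
obtain a b R where s: "0 < a" "a <= b" "b < T" "0 <= R"
	"!!t v. t ~: {a..b} | R < \<bar>v\<bar> ==> ph (t, v) = 0"
	"!!t v. t ~: {a..b} | R < \<bar>v\<bar> ==> tder ph (t, v) = 0"
	"!!t v. t ~: {a..b} | R < \<bar>v\<bar> ==> vder ph (t, v) = 0"
	by (rule C1c_support[OF ph T]) (rule that; assumption)
obtain d0 where d0: "0 < d0"
	"!!d s t nu. 0 < d ==> d < d0 ==> s : {0<..<T} ==> dA e (f s) nu < ennreal d ==>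
		((LI nu (%v. ph (t, v))) - (LI (f s) (%v. ph (t, v))))^2 <= d^2 * (Qform e (f s) (%v. vder ph (t, v)) + et)"
	by (rule test_function_increment[OF ph et]) (rule that; assumption)
have H0: "0 <= H T" using H_mono[of 0 T] T by (simp add: H_0)
define c where "c = min ((T - b) / 2) (d0^2 / (2 * (H T + 1)))"
have c: "0 < c" using s d0 H0 by (simp add: c_def)
have cT: "c < T - b"
proof -
	have "c <= (T - b) / 2" unfolding c_def by (rule min.cobounded1)
	then show ?thesis using s(3) by (simp add: field_simps)
qed
define h where "h n = c / real (Suc n)" for n
have h: "0 < h n" "h n <= c" for n
	using c by (auto simp: h_def field_simps)
have hl: "h ----> 0"
	unfolding h_def[abs_def] using tendsto_mult_right_zero[OF LIMSEQ_inverse_real_of_nat, of c] by (simp add: field_class.field_divide_inverse)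
have Qi: "Q ph integrable_on {0..T}" by (rule integrable_on_lebesgue_on[OF vgrad_sq_integrable(2)[OF ph]]) simp
have Qab: "Q ph integrable_on {a..b}"
	by (rule integrable_on_subinterval[OF Qi]) (use s in auto)
have Qle: "integral {a..b} (Q ph) <= (LI Th (%x. (vgrad ph x)^2))"
proof -
	have "integral {a..b} (Q ph) <= integral {0..T} (Q ph)"
		using s by (intro integral_subset_le Qab Qi) (auto intro!: Q_nonneg[OF ph])
	also have "... = (LI leb (%t. Q ph t))"
		by (rule lebesgue_integral_eq_integral[OF vgrad_sq_integrable(2)[OF ph], symmetric]) simp
	finally show ?thesis using vgrad_sq_integrable(3)[OF ph] by simp
qed
have main: "2 * integral {a..b} (%t. (S ph t (t + k) - S ph t t) / k) <= H T + (LI Th (%x. (vgrad ph x)^2)) + ep"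
	if k: "0 < k" "k <= c" for k
proof -
	have kT: "k < T - b" using k cT by simp
	have iS: "(%t. (S ph t (t + k) - S ph t t) / k) integrable_on {a..b}"
		using k by (intro integrable_continuous_interval continuous_intros S_continuous[OF ph]) (use s kT in auto)
	have cH1: "continuous_on {a..b} (%t. H (t + k))"
		by (intro continuous_on_compose2[OF H_continuous] continuous_intros) (use s k kT in auto)
	have cH2: "continuous_on {a..b} H" by (rule continuous_on_subset[OF H_continuous]) (use s in auto)
	have pt: "2 * ((S ph t (t + k) - S ph t t) / k) <= (H (t + k) - H t) / k + Q ph t + et" if t: "t : {a..b}" for t
	proof -
		have t0: "0 < t" "t < t + k" "t + k < T" using t s k kT by auto
		let ?d = "integral {t..t + k} speed"
		note d = dA_less_speed[OF t0]
		have Hd: "integral {t..t + k} (%r. (speed r)^2) = H (t + k) - H t" using t0 by (intro H_diff) auto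
		have dH: "?d^2 <= k * (H (t + k) - H t)" using d(3) Hd by simp
		have "H (t + k) <= H T" "0 <= H t" using t0 H_mono[of "t + k" T] H_mono[of 0 t] by (auto simp: H_0)
		then have "k * (H (t + k) - H t) <= k * H T" using k by (intro mult_left_mono) auto
		then have "?d^2 <= k * H T" by (rule order_trans[OF dH])
		also have "... <= d0^2 / (2 * (H T + 1)) * H T" using k H0 by (intro mult_right_mono) (auto simp: c_def)
		also have "... < d0^2" using d0(1) H0 by (simp add: field_simps) (smt (verit) mult_nonneg_nonneg zero_less_power zero_le_power2)
		finally have dd0: "?d < d0" using d0(1) by (meson less_imp_le power_less_imp_less_base)
		have "t : {0<..<T}" using t0 by auto
		from d0(2)[OF d(2) dd0 this d(1), of t]
		have X: "(S ph t (t + k) - S ph t t)^2 <= ?d^2 * (Q ph t + et)" by (simp add: S_def Q_def)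
		let ?X = "S ph t (t + k) - S ph t t"
		have "2 * (?X / k) <= (?d / k)^2 + (?X / ?d)^2"
		proof -
			have "?X / k = (?d / k) * (?X / ?d)" using d(2) by simp
			moreover have "2 * ((?d / k) * (?X / ?d)) <= (?d / k)^2 + (?X / ?d)^2"
				using zero_le_power2[of "?d / k - ?X / ?d"] unfolding power2_diff by linarith
			ultimately show ?thesis by simp
		qed
		also have "(?X / ?d)^2 <= Q ph t + et" using X d(2) by (simp add: power_divide field_simps)
		also have "(?d / k)^2 <= (H (t + k) - H t) / k"
		proof -
			have "(?d / k)^2 = ?d^2 / k^2" by (rule power_divide)
			also have "... <= (k * (H (t + k) - H t)) / k^2" using dH by (intro divide_right_mono) auto
			also have "... = (H (t + k) - H t) / k" using k by (simp add: power2_eq_square)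
			finally show ?thesis .
		qed
		finally show ?thesis by simp
	qed
	have cHk: "(%t. (H (t + k) - H t) / k) integrable_on {a..b}"
		using k by (intro integrable_continuous_interval continuous_intros cH1 cH2) auto
	have "2 * integral {a..b} (%t. (S ph t (t + k) - S ph t t) / k) = integral {a..b} (%t. 2 * ((S ph t (t + k) - S ph t t) / k))"
		by (rule integral_mult_right[symmetric])
	also have "... <= integral {a..b} (%t. (H (t + k) - H t) / k + Q ph t + et)"
		by (intro integral_le integrable_on_mult_right iS Henstock_Kurzweil_Integration.integrable_add cHk Qab pt) auto
	also have "... = integral {a..b} (%t. (H (t + k) - H t) / k) + integral {a..b} (Q ph) + et * (b - a)"
	proof -
		have "integral {a..b} (%t. (H (t + k) - H t) / k + Q ph t + et) =
				integral {a..b} (%t. (H (t + k) - H t) / k + Q ph t) + integral {a..b} (%_. et)"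
			by (intro Henstock_Kurzweil_Integration.integral_add Henstock_Kurzweil_Integration.integrable_add cHk Qab integrable_const_ivl)
		moreover have "integral {a..b} (%t. (H (t + k) - H t) / k + Q ph t) = integral {a..b} (%t. (H (t + k) - H t) / k) + integral {a..b} (Q ph)"
			by (rule Henstock_Kurzweil_Integration.integral_add[OF cHk Qab])
		moreover have "integral {a..b} (%_. et) = et * (b - a)" using s(2) by simp
		ultimately show ?thesis by (simp only:)
	qed
	also have "integral {a..b} (%t. (H (t + k) - H t) / k) <= H T"
	proof -
		have cH: "H integrable_on {a..b + k}"
			by (intro integrable_continuous_interval continuous_on_subset[OF H_continuous]) (use s kT in auto)
		have "integral {a..b} (H \<circ> (%x. x + k)) = integral {a + k..b + k} H"
			using integral_shift_Icc_real[of a b H k] by (simp add: o_def add.commute)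
		then have e1: "integral {a..b} (%t. H (t + k)) = integral {a + k..b + k} H" by (simp add: o_def)
		have "integral {a..a + k} H + integral {a + k..b + k} H = integral {a..b + k} H"
			using s k by (intro Henstock_Kurzweil_Integration.integral_combine cH) auto
		moreover have "integral {a..b} H + integral {b..b + k} H = integral {a..b + k} H"
			using s k by (intro Henstock_Kurzweil_Integration.integral_combine cH) auto
		moreover have "0 <= integral {a..a + k} H"
		proof (rule Henstock_Kurzweil_Integration.integral_nonneg)
			show "H integrable_on {a..a + k}" by (rule integrable_on_subinterval[OF cH]) (use s k in auto)
			show "0 <= H x" if "x : {a..a + k}" for x using that s kT H_mono[of 0 x] by (auto simp: H_0)
		qed
		moreover have "integral {b..b + k} H <= k * H T"
		proof -
			have "integral {b..b + k} H <= integral {b..b + k} (%_. H T)"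
			proof (rule integral_le)
				show "H integrable_on {b..b + k}" by (rule integrable_on_subinterval[OF cH]) (use s k in auto)
				show "H x <= H T" if "x : {b..b + k}" for x using that s kT by (intro H_mono) auto
			qed (rule integrable_const_ivl)
			then show ?thesis using k by simp
		qed
		ultimately have "integral {a..b} (%t. H (t + k)) - integral {a..b} H <= k * H T" unfolding e1 by linarith
		moreover have "integral {a..b} (%t. (H (t + k) - H t) / k) = (integral {a..b} (%t. H (t + k)) - integral {a..b} H) / k"
			using integrable_continuous_interval[OF cH1] integrable_continuous_interval[OF cH2]
			by (simp add: integral_divide Henstock_Kurzweil_Integration.integral_diff)
		ultimately show ?thesis using k by (simp add: field_simps)
	qed
	also have "integral {a..b} (Q ph) <= (LI Th (%x. (vgrad ph x)^2))" by (rule Qle)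
	also have "et * (b - a) <= ep"
	proof -
		have "et * (b - a) <= et * T" using et s by (intro mult_left_mono) auto
		then show ?thesis using T by (simp add: et_def)
	qed
	finally show ?thesis by simp
qed
have "2 * (LI leb (%t. (S ph (t - h n) t - S ph t t) / h n)) <= H T + (LI Th (%x. (vgrad ph x)^2)) + ep" for n
proof -
	have "h n < T - b" using h(2)[of n] cT by simp
	then show ?thesis
		using main[OF h] by (subst shifted_difference_quotient[OF ph s(1,2,3) _ h(1)]) (use s(5) in auto)
qed
then show "2 * lfun ph <= H T + (LI Th (%x. (vgrad ph x)^2)) + ep"
	using tendsto_mult_left[OF difference_quotients[OF ph h(1) hl], of 2] by (intro LIMSEQ_le_const2) auto
qed

end

section \<open>Curves whose flux has a density\<close>

lemma C0_bounded:
assumes "ph : C0 S"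
obtains K where "!!x. x : S ==> \<bar>ph x\<bar> <= K"
proof -
have c: "continuous_on S ph" and k: "compact {x : S. 1 <= \<bar>ph x\<bar>}"
	using assms unfolding C0_def by auto
have "compact (ph ` {x : S. 1 <= \<bar>ph x\<bar>})"
	by (rule compact_continuous_image[OF continuous_on_subset[OF c] k]) auto
then have "bounded (ph ` {x : S. 1 <= \<bar>ph x\<bar>})" by (rule compact_imp_bounded)
then obtain K where K: "ALL y:ph ` {x : S. 1 <= \<bar>ph x\<bar>}. norm y <= K" unfolding bounded_iff by blast
show ?thesis
proof (rule that[of "max K 1"])
	fix x assume "x : S"
	then show "\<bar>ph x\<bar> <= max K 1" using K by (cases "1 <= \<bar>ph x\<bar>") (auto simp: le_max_iff_disj)
qed
qed

lemma integral_lebesgue_on_borel: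
fixes F :: "real => real"
assumes S: "S : sets borel" and m: "(%t. indicator S t * F t) : bm borel"
shows "(LI (lebesgue_on S) (%t. F t)) = (LI lborel (%t. indicator S t * F t))"
proof -
have "(LI (lebesgue_on S) (%t. F t)) = (LI lebesgue (%t. indicator S t *\<^sub>R F t))"
	using S by (intro integral_restrict_space) auto
also have "... = (LI lborel (%t. indicator S t * F t))"
	using m by (simp add: integral_completion)
finally show ?thesis .
qed

lemma nn_integral_lebesgue_on_borel:
fixes F :: "real => ennreal"
assumes S: "S : sets borel"
shows "(NI (lebesgue_on S) (%t. F t)) = (NI lborel (%t. F t * indicator S t))"
proof -
have "(NI (lebesgue_on S) (%t. F t)) = (NI lebesgue (%t. F t * indicator S t))"
	using S by (intro nn_integral_restrict_space) auto
also have "... = (NI lborel (%t. F t * indicator S t))" by (rule nn_integral_completion)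
finally show ?thesis .
qed

lemma affine_integral:
fixes F :: "real => real"
assumes c: "c ~= 0" and m: "(%t. indicator {0..T} t * F t) : bm borel"
	and out: "!!r. r ~: {0..1} ==> F (s + c * r) = 0" and ins: "!!r. r : {0..1} ==> s + c * r : {0..T}"
shows "(LI (lebesgue_on {0..T}) (%t. F t)) = \<bar>c\<bar> * (LI (lebesgue_on {0..1}) (%r. F (s + c * r)))"
proof -
have eq: "indicator {0..T} (s + c * r) * F (s + c * r) = indicator {0..1} r * F (s + c * r)" for r
	using out[of r] ins[of r] by (auto simp: indicator_def)
have "(%r. s + c * r) : bm borel" by measurable
from measurable_compose[OF this m]
have m': "(%r. indicator {0..1} r * F (s + c * r)) : bm borel" unfolding eq .
have "(LI (lebesgue_on {0..T}) (%t. F t)) = (LI lborel (%t. indicator {0..T} t * F t))"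
	using m by (intro integral_lebesgue_on_borel) auto
also have "... = \<bar>c\<bar> *\<^sub>R (LI lborel (%r. indicator {0..T} (s + c * r) * F (s + c * r)))"
	by (rule lborel_integral_real_affine[OF c])
also have "... = \<bar>c\<bar> * (LI lborel (%r. indicator {0..1} r * F (s + c * r)))" unfolding eq by simp
also have "(LI lborel (%r. indicator {0..1} r * F (s + c * r))) = (LI (lebesgue_on {0..1}) (%r. F (s + c * r)))"
	using m' by (intro integral_lebesgue_on_borel[symmetric]) auto
finally show ?thesis .
qed

lemma affine_nn_integral:
fixes F :: "real => ennreal"
assumes c: "c ~= 0" and m: "(%t. F t * indicator {min s (s + c)..max s (s + c)} t) : bm borel"
shows "ennreal \<bar>c\<bar> * (NI (lebesgue_on {0..1}) (%r. F (s + c * r))) = (NI (lebesgue_on {min s (s + c)..max s (s + c)}) (%t. F t))"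
proof -
let ?I = "{min s (s + c)..max s (s + c)}"
have eq: "F (s + c * r) * indicator ?I (s + c * r) = F (s + c * r) * indicator {0..1} r" for r
proof -
	have "s + c * r : ?I \<longleftrightarrow> r : {0..1}"
	proof (cases "0 < c")
		case True
		then show ?thesis by (simp add: min_def max_def zero_le_mult_iff mult_le_cancel_left1)
	next
		case False
		then have "c < 0" using c by simp
		then show ?thesis by (auto simp: min_def max_def mult_le_0_iff mult_le_cancel_left1 mult_le_cancel_left2)
	qed
	then show ?thesis by (simp add: indicator_def)
qed
have "(NI (lebesgue_on ?I) (%t. F t)) = (NI lborel (%t. F t * indicator ?I t))"
	by (intro nn_integral_lebesgue_on_borel) auto
also have "... = \<bar>c\<bar> * (NI lborel (%r. F (s + c * r) * indicator ?I (s + c * r)))"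
	by (rule nn_integral_real_affine[OF m c])
also have "... = \<bar>c\<bar> * (NI lborel (%r. F (s + c * r) * indicator {0..1} r))" unfolding eq ..
also have "(NI lborel (%r. F (s + c * r) * indicator {0..1} r)) = (NI (lebesgue_on {0..1}) (%r. F (s + c * r)))"
	by (intro nn_integral_lebesgue_on_borel[symmetric]) auto
finally show ?thesis by simp
qed

lemma borel_measurable_times_indicator:
fixes k :: "'a::topological_space => ennreal"
assumes "k : bm (restrict_space borel S)" "I \<subseteq> S" "I : sets borel"
shows "(%t. k t * indicator I t) : bm borel"
using measurable_restrict_mono[OF assms(1,2)] assms(3) by (simp add: borel_measurable_restrict_space_iff_ennreal)

locale dens_curve =
fixes e T :: real and f :: "real => real measure" and w :: "real => real \<times> real => real"
assumes e: "0 <= e" "e < 1" and T: "0 < T"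
	and distr_f: "!!t. t : {0..T} ==> real_distribution (f t)"
	and narrow: "narrowly_continuous T f"
	and w_int: "!!t. t : {0..T} ==> integrable (tensor (f t)) (w t)"
	and w_kint: "!!t. t : {0..T} ==> integrable (tensor (f t)) (%z. kernel e z * w t z)"
	and w_meas: "(%x. w (fst x) (snd x)) : bm (restrict_space borel {0..T} \<Otimes>\<^sub>M borel)"
	and fin: "(NI (lebesgue_on {0..T}) (%t. NI (sq (f t)) (%z. ennreal (kernel e z * \<bar>w t z\<bar>)))) < \<infinity>"
	and weak: "!!ph. ph : C1c T ==> (LI (lebesgue_on {0..T}) (%t. LI (f t) (%v. tder ph (t, v)))) +
		(LI (lebesgue_on {0..T}) (%t. LI (sq (f t)) (%z. kernel e z * vgrad ph (t, z) * w t z))) = 0"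
begin

abbreviation "Tb \<equiv> restrict_space (borel :: real measure) {0..T}"

lemma sets_f: "t : {0..T} ==> sets (f t) = sets borel"
by (rule real_distribution_sets[OF distr_f])

lemma kernel_pair: "(%t. f t \<Otimes>\<^sub>M f t) : measurable Tb (subprob_algebra borel)"
proof -
have "f : measurable Tb (subprob_algebra borel)" by (rule narrow_kernel[OF distr_f narrow])
from measurable_pair_measure[OF this this] show ?thesis unfolding borel_prod .
qed

lemma w_slice: "t : {0..T} ==> w t : bm borel"
proof -
assume "t : {0..T}"
then have t: "t : space Tb" by (simp add: space_restrict_space)
have "(%(t, z). w t z) : bm (Tb \<Otimes>\<^sub>M borel)" using w_meas by (simp add: case_prod_beta')
from measurable_Pair2[OF this t] show ?thesis by simp
qed

lemma test_bound:
assumes ph: "ph : C1c T" obtains B where "!!x. \<bar>vgrad ph x\<bar> <= B"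
proof -
obtain B where B: "0 < B" "!!x. \<bar>ph x\<bar> <= B" "!!x. \<bar>tder ph x\<bar> <= B" "!!x. \<bar>vder ph x\<bar> <= B"
	by (rule C1c_bounds[OF ph T]) (rule that; assumption)
have "\<bar>vgrad ph x\<bar> <= 2 * B" for x
	unfolding vgrad_def using B(4)[of "(fst x, snd (snd x))"] B(4)[of "(fst x, fst (snd x))"] by linarith
then show ?thesis by (rule that)
qed

lemma vgrad_slice: "ph : C1c T' ==> (%z. vgrad ph (t, z)) : bm borel"
proof -
assume ph: "ph : C1c T'"
have "(%z::real \<times> real. (t, z)) : measurable borel borel"
	unfolding borel_prod[symmetric, where 'b="real \<times> real"] by measurable
then show ?thesis using vgrad_measurable[OF ph] by (rule measurable_compose)
qed

lemma integrable_bounded_mult: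
assumes t: "t : {0..T}" and g: "g : bm borel" "!!z. \<bar>g z\<bar> <= (B::real)"
shows "integrable (tensor (f t)) (%z. kernel e z * g z * w t z)"
proof (rule Bochner_Integration.integrable_bound)
show "integrable (tensor (f t)) (%z. B * (kernel e z * w t z))" using w_kint[OF t] by simp
show "(%z. kernel e z * g z * w t z) : bm (tensor (f t))"
	by (intro measurable_tensor[OF sets_f[OF t]] borel_measurable_times kernel_measurable g w_slice t)
have "\<bar>kernel e z * g z * w t z\<bar> <= \<bar>B * (kernel e z * w t z)\<bar>" for z
proof -
	have "\<bar>g z\<bar> <= \<bar>B\<bar>" using g(2)[of z] by linarith
	then have "\<bar>g z\<bar> * \<bar>kernel e z * w t z\<bar> <= \<bar>B\<bar> * \<bar>kernel e z * w t z\<bar>" by (intro mult_right_mono) auto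
	then show ?thesis by (simp add: abs_mult ac_simps)
qed
then show "AE z in tensor (f t). norm (kernel e z * g z * w t z) <= norm (B * (kernel e z * w t z))" by simp
qed

lemma kernel_offdiag: "x ~: offdiag ==> kernel e x = 0"
by (auto simp: offdiag_def sigma_e_def)

text \<open>The weak formulation is the assumption \<open>weak\<close>, once integrals against the flux are written as
  integrals of \<open>w\<close> against \<open>f t \<otimes> f t\<close>.\<close>

lemma CE_dens_flux: "CE e T f (%t. dens_flux (f t) (w t))"
unfolding CE_def
proof (intro conjI ballI)
fix t assume t: "t : {0..T}"
show "real_distribution (f t)" by (rule distr_f[OF t])
show "signed_measure offdiag_borel (dens_flux (f t) (w t))"
	by (rule signed_measure_dens_flux[OF distr_f[OF t] w_int[OF t]])
next
fix ph :: "real => real" assume ph: "ph : C0 UNIV"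
obtain K where K: "!!x. x : UNIV ==> \<bar>ph x\<bar> <= K" by (rule C0_bounded[OF ph]) (rule that; assumption)
have "bounded (range ph)" using K by (auto intro!: boundedI[where B=K])
moreover have "continuous_on UNIV ph" using ph by (simp add: C0_def)
ultimately have "continuous_on {0..T} (%t. LI (f t) (%v. ph v))"
	using narrow[unfolded narrowly_continuous_def, rule_format, of ph] by simp
then show "(%t. LI (f t) (%v. ph v)) : bm (lebesgue_on {0..T})"
	by (intro continuous_imp_measurable_on_sets_lebesgue) auto
next
fix ph :: "real \<times> real => real" assume ph: "ph : C0 offdiag"
obtain K where K: "!!x. x : offdiag ==> \<bar>ph x\<bar> <= K" by (rule C0_bounded[OF ph]) (rule that; assumption)
have mR: "ph : bm offdiag_borel"
	using ph by (intro borel_measurable_continuous_on_restrict) (simp add: C0_def)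
define ps where "ps z = indicator offdiag z * ph z" for z
have mps: "ps : bm borel"
	using mR borel_measurable_restrict_space_iff[of offdiag borel ph] unfolding ps_def[abs_def] by simp
have eq: "signed_integral offdiag_borel (dens_flux (f t) (w t)) ph = (LI (sq (f t)) (%z. ps z * w t z))" if t: "t : {0..T}" for t
proof -
	have spT: "space (tensor (f t)) = offdiag" by (rule space_tensor[OF sets_f[OF t]])
	have i: "integrable (tensor (f t)) (%z. ph z * w t z)"
	proof (rule Bochner_Integration.integrable_bound)
		show "integrable (tensor (f t)) (%z. K * w t z)" using w_int[OF t] by simp
		show "(%z. ph z * w t z) : bm (tensor (f t))"
			using mR w_int[OF t] measurable_cong_sets[OF sets_tensor[OF sets_f[OF t]] refl] by (intro borel_measurable_times) auto
		show "AE z in tensor (f t). norm (ph z * w t z) <= norm (K * w t z)"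
		proof (intro AE_I2)
			fix z assume "z : space (tensor (f t))"
			then have "\<bar>ph z\<bar> <= K" using K spT by simp
			then have "\<bar>ph z\<bar> <= \<bar>K\<bar>" by linarith
			then show "norm (ph z * w t z) <= norm (K * w t z)" by (simp add: abs_mult mult_right_mono)
		qed
	qed
	have "signed_integral offdiag_borel (dens_flux (f t) (w t)) ph = (LI (tensor (f t)) (%z. ph z * w t z))"
		unfolding dens_flux_def[abs_def]
		by (rule signed_integral_set_integral[OF w_int[OF t] sets_tensor[OF sets_f[OF t]] mR i])
	also have "... = (LI (tensor (f t)) (%z. ps z * w t z))"
		using spT by (intro Bochner_Integration.integral_cong) (auto simp: ps_def)
	also have "... = (LI (sq (f t)) (%z. ps z * w t z))"
		by (rule integral_tensor(1)[OF sets_f[OF t]]) (simp add: ps_def)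
	finally show ?thesis .
qed
have "(%x. ps (snd x) * w (fst x) (snd x)) : bm (Tb \<Otimes>\<^sub>M borel)"
	by (intro borel_measurable_times w_meas measurable_compose[OF measurable_snd mps])
from integral_measurable_kernel[OF this kernel_pair]
have "(%t. LI (sq (f t)) (%z. ps z * w t z)) : bm (lebesgue_on {0..T})"
	by (rule measurable_restrict_borel_lebesgue)
then show "(%t. signed_integral offdiag_borel (dens_flux (f t) (w t)) ph) : bm (lebesgue_on {0..T})"
	by (subst measurable_cong[OF eq]) auto
next
show "narrowly_continuous T f" by (rule narrow)
next
have "(NI (total_variation offdiag_borel (dens_flux (f t) (w t))) (%z. ennreal (kernel e z))) =
		(NI (sq (f t)) (%z. ennreal (kernel e z * \<bar>w t z\<bar>)))" if t: "t : {0..T}" for t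
proof -
	have "(NI (total_variation offdiag_borel (dens_flux (f t) (w t))) (%z. ennreal (kernel e z))) =
			(NI (tensor (f t)) (%z. ennreal (kernel e z) * ennreal \<bar>w t z\<bar>))"
		by (intro nn_integral_total_variation_dens_flux[OF distr_f[OF t] w_int[OF t]]
				measurable_compose[OF kernel_measurable measurable_ennreal])
	also have "... = (NI (tensor (f t)) (%z. ennreal (kernel e z * \<bar>w t z\<bar>)))"
		using kernel_nonneg[OF e(2)] by (intro nn_integral_cong) (simp add: ennreal_mult')
	also have "... = (NI (sq (f t)) (%z. ennreal (kernel e z * \<bar>w t z\<bar>)))"
		by (rule nn_integral_tensor[OF sets_f[OF t]]) (simp add: kernel_offdiag)
	finally show ?thesis .
qed
then have "(NI (lebesgue_on {0..T}) (%t. NI (total_variation offdiag_borel (dens_flux (f t) (w t))) (%z. ennreal (kernel e z)))) =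
		(NI (lebesgue_on {0..T}) (%t. NI (sq (f t)) (%z. ennreal (kernel e z * \<bar>w t z\<bar>))))"
	by (intro nn_integral_cong) simp
then show "(NI (lebesgue_on {0..T}) (%t. NI (total_variation offdiag_borel (dens_flux (f t) (w t))) (%z. ennreal (kernel e z)))) < \<infinity>"
	using fin by simp
next
fix ph assume ph: "ph : C1c T"
obtain B where B: "!!x. \<bar>vgrad ph x\<bar> <= B" by (rule test_bound[OF ph]) (rule that; assumption)
have "signed_integral offdiag_borel (dens_flux (f t) (w t)) (%z. kernel e z * ngrad (%v. ph (t, v)) z) =
		(LI (sq (f t)) (%z. kernel e z * vgrad ph (t, z) * w t z))" if t: "t : {0..T}" for t
proof -
	have i: "integrable (tensor (f t)) (%z. (kernel e z * vgrad ph (t, z)) * w t z)"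
		by (rule integrable_bounded_mult[OF t vgrad_slice[OF ph] B])
	have "signed_integral offdiag_borel (dens_flux (f t) (w t)) (%z. kernel e z * vgrad ph (t, z)) =
			(LI (tensor (f t)) (%z. (kernel e z * vgrad ph (t, z)) * w t z))"
		by (rule signed_integral_dens_flux[OF distr_f[OF t] w_int[OF t] _ i])
			(intro borel_measurable_times kernel_measurable vgrad_slice[OF ph])
	also have "... = (LI (sq (f t)) (%z. (kernel e z * vgrad ph (t, z)) * w t z))"
		by (rule integral_tensor(1)[OF sets_f[OF t]]) (simp add: kernel_offdiag)
	finally show ?thesis by (simp only: vgrad_eq_ngrad)
qed
then have "(LI (lebesgue_on {0..T}) (%t. signed_integral offdiag_borel (dens_flux (f t) (w t)) (%z. kernel e z * ngrad (%v. ph (t, v)) z))) =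
		(LI (lebesgue_on {0..T}) (%t. LI (sq (f t)) (%z. kernel e z * vgrad ph (t, z) * w t z)))"
	by (intro Bochner_Integration.integral_cong) auto
then show "(LI (lebesgue_on {0..T}) (%t. (LI (f t) (%v. deriv (%s. ph (s, v)) t)))) +
		(LI (lebesgue_on {0..T}) (%t. signed_integral offdiag_borel (dens_flux (f t) (w t)) (%z. kernel e z * ngrad (%v. ph (t, v)) z))) = 0"
	using weak[OF ph] by (simp add: tder_def)
qed

definition act :: "real => ennreal" where
"act t = (NI (sq (f t)) (%z. ennreal (kernel e z * (w t z)^2)))"

lemma action_eq_act: "t : {0..T} ==> action e (f t) (dens_flux (f t) (%z. c * w t z)) = ennreal (c^2) * act t"
proof -
assume t: "t : {0..T}"
have "action e (f t) (dens_flux (f t) (%z. c * w t z)) = (NI (tensor (f t)) (%z. ennreal (kernel e z * (c * w t z)^2)))"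
	using w_int[OF t] by (intro action_dens_flux[OF e(2) distr_f[OF t]]) simp
also have "... = (NI (sq (f t)) (%z. ennreal (kernel e z * (c * w t z)^2)))"
	by (rule nn_integral_tensor[OF sets_f[OF t]]) (simp add: kernel_offdiag)
also have "... = (NI (sq (f t)) (%z. ennreal (c^2) * ennreal (kernel e z * (w t z)^2)))"
	by (intro nn_integral_cong) (simp add: ennreal_mult'[symmetric] power_mult_distrib mult.left_commute)
also have "... = ennreal (c^2) * act t"
	unfolding act_def
proof (rule nn_integral_cmult)
	have "(%z. ennreal (kernel e z * (w t z)^2)) : bm borel"
		by (intro measurable_compose[OF _ measurable_ennreal] borel_measurable_times kernel_measurable borel_measurable_power w_slice t)
	then show "(%z. ennreal (kernel e z * (w t z)^2)) : bm (sq (f t))"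
		using measurable_cong_sets[OF sets_pair_borel[OF sets_f[OF t]] refl] by blast
qed
finally show ?thesis .
qed

lemma act_measurable: "act : bm Tb"
unfolding act_def
proof (rule nn_integral_measurable_subprob_algebra2[OF _ kernel_pair])
have "(%x. ennreal (kernel e (snd x) * (w (fst x) (snd x))^2)) : bm (Tb \<Otimes>\<^sub>M borel)"
	by (intro measurable_compose[OF _ measurable_ennreal] borel_measurable_times borel_measurable_power w_meas
			measurable_compose[OF measurable_snd kernel_measurable])
then show "(%(t, z). ennreal (kernel e z * (w t z)^2)) : bm (Tb \<Otimes>\<^sub>M borel)"
	by (simp add: case_prod_beta')
qed

lemma C1c_rescale:
assumes ph: "ph : C1c 1" and st: "s : {0..T}" "s + c : {0..T}" "c ~= 0"
shows "(%x. ph ((fst x - s) / c, snd x)) : C1c T"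
	and "tder (%x. ph ((fst x - s) / c, snd x)) (s + c * r, v) = tder ph (r, v) / c"
	and "vgrad (%x. ph ((fst x - s) / c, snd x)) (s + c * r, z) = vgrad ph (r, z)"
proof -
obtain D where D: "!!x. (ph has_derivative blinfun_apply (D x)) (at x)" "continuous_on UNIV D"
	using ph unfolding C1c_def by blast
obtain K where K: "compact K" "K \<subseteq> {0<..<1} \<times> UNIV" "!!x. x ~: K ==> ph x = 0"
	using ph unfolding C1c_def by blast
let ?A = "%x :: real \<times> real. ((fst x - s) / c, snd x)"
let ?L = "Blinfun (%h :: real \<times> real. (fst h / c, snd h))"
have bl: "bounded_linear (%h :: real \<times> real. (fst h / c, snd h))"
	by (intro bounded_linear_intros bounded_linear_Pair bounded_linear_compose[OF bounded_linear_divide])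
have dA: "(?A has_derivative (%h. (fst h / c, snd h))) (at x)" for x
	using st(3) by (auto intro!: derivative_eq_intros)
have "((%x. ph (?A x)) has_derivative blinfun_apply (D (?A x) o\<^sub>L ?L)) (at x)" for x
proof -
	have "blinfun_apply (D (?A x) o\<^sub>L ?L) = (%h. blinfun_apply (D (?A x)) (fst h / c, snd h))"
		by (rule ext) (simp add: bounded_linear_Blinfun_apply[OF bl])
	then show ?thesis using has_derivative_compose[OF dA D(1)] by simp
qed
moreover have "continuous_on UNIV (%x. D (?A x) o\<^sub>L ?L)"
	using st(3) by (intro continuous_intros continuous_on_compose2[OF D(2)]) auto
moreover have "compact ((%x. (s + c * fst x, snd x)) ` K)"
	by (intro compact_continuous_image K(1) continuous_intros)
moreover have "(%x. (s + c * fst x, snd x)) ` K \<subseteq> {0<..<T} \<times> UNIV"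
proof safe
	fix a b assume "(a, b) : K"
	then have a: "0 < a" "a < 1" using K(2) by auto
	have conv: "s + c * a = (1 - a) * s + a * (s + c)" by (simp add: algebra_simps)
	have "0 < s | 0 < s + c" "s < T | s + c < T" using st by auto
	have pos: "0 < (1 - a) * x + a * y" if "0 <= x" "0 <= y" "0 < x | 0 < y" for x y :: real
		using a that by (metis add_nonneg_pos add_pos_nonneg diff_gt_0_iff_gt less_imp_le mult_nonneg_nonneg mult_pos_pos)
	have "0 < (1 - a) * s + a * (s + c)"
		using \<open>0 < s | 0 < s + c\<close> st by (intro pos) auto
	moreover have "0 < (1 - a) * (T - s) + a * (T - (s + c))"
		using \<open>s < T | s + c < T\<close> st by (intro pos) auto
	moreover have "(1 - a) * (T - s) + a * (T - (s + c)) = T - (s + c * a)" by (simp add: algebra_simps)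
	ultimately show "s + c * fst (a, b) : {0<..<T}" unfolding conv[symmetric] by simp
qed auto
moreover have "ph (?A x) = 0" if "x ~: (%x. (s + c * fst x, snd x)) ` K" for x
proof (rule K(3), rule notI)
	assume "?A x : K"
	then have "(s + c * fst (?A x), snd (?A x)) : (%x. (s + c * fst x, snd x)) ` K" by blast
	then show False using that st(3) by simp
qed
ultimately show "(%x. ph ((fst x - s) / c, snd x)) : C1c T"
	unfolding C1c_def by (intro CollectI conjI) (rule exI[of _ "%x. D (?A x) o\<^sub>L ?L"], blast, blast)
have "((%t. (t - s) / c) has_real_derivative 1 / c) (at (s + c * r))"
	using st(3) by (auto intro!: derivative_eq_intros)
from DERIV_chain2[OF _ this, of "%ta. ph (ta, v)" "tder ph (r, v)"] C1c_partials(1)[OF ph, of v r]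
have "((%t. ph ((t - s) / c, v)) has_real_derivative tder ph (r, v) * (1 / c)) (at (s + c * r))"
	using st(3) by simp
then show "tder (%x. ph ((fst x - s) / c, snd x)) (s + c * r, v) = tder ph (r, v) / c"
	unfolding tder_def[of "%x. ph ((fst x - s) / c, snd x)"] by (simp add: DERIV_imp_deriv)
show "vgrad (%x. ph ((fst x - s) / c, snd x)) (s + c * r, z) = vgrad ph (r, z)"
	using st(3) by (simp add: vgrad_def vder_def)
qed

lemma affine_in: "s : {0..T} ==> s + c : {0..T} ==> r : {0..1} ==> s + c * r : {0..T}"
proof -
assume a: "s : {0..T}" "s + c : {0..T}" "r : {0..1}"
have "0 <= (1 - r) * s + r * (s + c)" "0 <= (1 - r) * (T - s) + r * (T - (s + c))"
	using a by auto
then have "0 <= s + c * r" "0 <= T - (s + c * r)" by (simp_all add: algebra_simps)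
then show ?thesis by simp
qed

text \<open>
  Running through a piece of the curve at constant speed \<open>c\<close> -- backwards if \<open>c\<close> is
  negative -- gives a competitor in the definition of the transport cost.
\<close>

lemma rescaled: 
assumes st: "s : {0..T}" "s + c : {0..T}" "c ~= 0"
shows "dens_curve e 1 (%r. f (s + c * r)) (%r z. c * w (s + c * r) z)"
proof (rule dens_curve.intro)
note ain = affine_in[OF st(1,2)]
show "0 <= e" "e < 1" "(0::real) < 1" using e by auto
show "narrowly_continuous 1 (%r. f (s + c * r))"
	unfolding narrowly_continuous_def
proof (intro allI impI)
	fix g :: "real => real" assume "continuous_on UNIV g" "bounded (range g)"
	then have "continuous_on {0..T} (%t. LI (f t) (%v. g v))"
		using narrow[unfolded narrowly_continuous_def, rule_format, of g] by simp
	then show "continuous_on {0..1} (%r. LI (f (s + c * r)) (%v. g v))"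
		by (rule continuous_on_compose2) (use ain in \<open>auto intro!: continuous_intros\<close>)
qed
fix r :: real assume r: "r : {0..1}"
show "real_distribution (f (s + c * r))" by (rule distr_f[OF ain[OF r]])
show "integrable (tensor (f (s + c * r))) (%z. c * w (s + c * r) z)" using w_int[OF ain[OF r]] by simp
show "integrable (tensor (f (s + c * r))) (%z. kernel e z * (c * w (s + c * r) z))"
	using integrable_mult_right[OF w_kint[OF ain[OF r]], of c] by (simp only: mult.left_commute)
next
note ain = affine_in[OF st(1,2)]
let ?T1 = "restrict_space (borel :: real measure) {0..1}"
have "(%r. s + c * r) : measurable ?T1 Tb"
	using ain by (intro measurable_restrict_space2 measurable_restrict_space1) (auto simp: space_restrict_space)
then have "(%x. (s + c * fst x, snd x)) : measurable (?T1 \<Otimes>\<^sub>M (borel :: (real \<times> real) measure)) (Tb \<Otimes>\<^sub>M borel)"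
	by (intro measurable_Pair measurable_compose[OF measurable_fst] measurable_snd)
from measurable_compose[OF this w_meas]
show "(%x. c * w (s + c * fst x) (snd x)) : bm (?T1 \<Otimes>\<^sub>M borel)" by simp
next
note ain = affine_in[OF st(1,2)]
define k where "k t = (NI (sq (f t)) (%z. ennreal (kernel e z * \<bar>w t z\<bar>)))" for t
have mk: "k : bm Tb"
	unfolding k_def
proof (rule nn_integral_measurable_subprob_algebra2[OF _ kernel_pair])
	have "(%x. ennreal (kernel e (snd x) * \<bar>w (fst x) (snd x)\<bar>)) : bm (Tb \<Otimes>\<^sub>M borel)"
		by (intro measurable_compose[OF _ measurable_ennreal] borel_measurable_times borel_measurable_abs w_meas
				measurable_compose[OF measurable_snd kernel_measurable])
	then show "(%(t, z). ennreal (kernel e z * \<bar>w t z\<bar>)) : bm (Tb \<Otimes>\<^sub>M borel)"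
		by (simp add: case_prod_beta')
qed
have I: "{min s (s + c)..max s (s + c)} \<subseteq> {0..T}" using st by auto
have mkI: "(%t. k t * indicator {min s (s + c)..max s (s + c)} t) : bm borel"
	by (rule borel_measurable_times_indicator[OF mk I]) auto
have "(NI (lebesgue_on {0..1}) (%r. NI (f (s + c * r) \<Otimes>\<^sub>M f (s + c * r)) (%z. ennreal (kernel e z * \<bar>c * w (s + c * r) z\<bar>)))) =
		(NI (lebesgue_on {0..1}) (%r. ennreal \<bar>c\<bar> * k (s + c * r)))"
proof (rule nn_integral_cong)
	fix r :: real assume "r : space (lebesgue_on {0..1})"
	then have r: "s + c * r : {0..T}" using ain by simp
	have "(%z. ennreal (kernel e z * \<bar>w (s + c * r) z\<bar>)) : bm borel"
		by (intro measurable_compose[OF _ measurable_ennreal] borel_measurable_times kernel_measurable borel_measurable_abs w_slice r)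
	then have "(%z. ennreal (kernel e z * \<bar>w (s + c * r) z\<bar>)) : bm (f (s + c * r) \<Otimes>\<^sub>M f (s + c * r))"
		using measurable_cong_sets[OF sets_pair_borel[OF sets_f[OF r]] refl] by blast
	then show "(NI (f (s + c * r) \<Otimes>\<^sub>M f (s + c * r)) (%z. ennreal (kernel e z * \<bar>c * w (s + c * r) z\<bar>))) = ennreal \<bar>c\<bar> * k (s + c * r)"
		unfolding k_def by (subst nn_integral_cmult[symmetric])
			(auto simp: ennreal_mult'[symmetric] abs_mult mult.left_commute)
qed
also have "... = ennreal \<bar>c\<bar> * (NI (lebesgue_on {0..1}) (%r. k (s + c * r)))"
proof (rule nn_integral_cmult)
	have "(%r. s + c * r) : measurable (restrict_space borel {0..1}) Tb"
		using ain by (intro measurable_restrict_space2 measurable_restrict_space1) (auto simp: space_restrict_space)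
	from measurable_compose[OF this mk]
	show "(%r. k (s + c * r)) : bm (lebesgue_on {0..1})" by (rule measurable_restrict_borel_lebesgue)
qed
also have "... = (NI (lebesgue_on {min s (s + c)..max s (s + c)}) (%t. k t))"
	by (rule affine_nn_integral[OF st(3) mkI])
also have "... <= (NI (lebesgue_on {0..T}) (%t. k t))"
	unfolding nn_integral_lebesgue_on_borel[OF borel_closed[OF closed_atLeastAtMost]]
	using I by (intro nn_integral_mono mult_left_mono) (auto simp: indicator_def)
also have "... < \<infinity>" using fin by (simp add: k_def)
finally show "(NI (lebesgue_on {0..1}) (%r. NI (f (s + c * r) \<Otimes>\<^sub>M f (s + c * r)) (%z. ennreal (kernel e z * \<bar>c * w (s + c * r) z\<bar>)))) < \<infinity>" .
next
note ain = affine_in[OF st(1,2)]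
fix ph assume ph: "ph : C1c 1"
define ps where "ps x = ph ((fst x - s) / c, snd x)" for x :: "real \<times> real"
note ps = C1c_rescale[OF ph st, folded ps_def]
have psC: "ps : C1c T" unfolding ps_def[abs_def] by (rule C1c_rescale(1)[OF ph st])
have tps: "tder ps (s + c * r, v) = tder ph (r, v) / c" for r v
	unfolding ps_def[abs_def] by (rule C1c_rescale(2)[OF ph st])
have vps: "vgrad ps (s + c * r, z) = vgrad ph (r, z)" for r z
	unfolding ps_def[abs_def] by (rule C1c_rescale(3)[OF ph st])
obtain a b R where sup: "0 < a" "a <= b" "b < 1" "0 <= R"
	"!!t v. t ~: {a..b} | R < \<bar>v\<bar> ==> ph (t, v) = 0"
	"!!t v. t ~: {a..b} | R < \<bar>v\<bar> ==> tder ph (t, v) = 0"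
	"!!t v. t ~: {a..b} | R < \<bar>v\<bar> ==> vder ph (t, v) = 0"
	by (rule C1c_support[OF ph zero_less_one]) (rule that; assumption)
define F1 where "F1 t = (LI (f t) (%v. tder ps (t, v)))" for t
define F2 where "F2 t = (LI (sq (f t)) (%z. kernel e z * vgrad ps (t, z) * w t z))" for t
have idm: "(%t. t) : measurable Tb borel" by (rule measurable_restrict_space1) simp
have mF1: "F1 : bm Tb"
	unfolding F1_def
proof (rule integral_measurable_kernel[OF _ narrow_kernel[OF distr_f narrow]])
	have "(%x. (fst x, snd x)) : measurable (Tb \<Otimes>\<^sub>M (borel :: real measure)) (borel \<Otimes>\<^sub>M borel)"
		using measurable_compose[OF measurable_fst idm] by (intro measurable_Pair) auto
	then have "(%x. (fst x, snd x)) : measurable (Tb \<Otimes>\<^sub>M (borel :: real measure)) borel" by (simp only: borel_prod)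
	then show "(%x. tder ps (fst x, snd x)) : bm (Tb \<Otimes>\<^sub>M borel)"
		using borel_measurable_continuous_onI[OF C1c_partials(3)[OF psC]] by (rule measurable_compose)
qed
have mF2: "F2 : bm Tb"
	unfolding F2_def
proof (rule integral_measurable_kernel[OF _ kernel_pair])
	have "(%x. (fst x, snd x)) : measurable (Tb \<Otimes>\<^sub>M (borel :: (real \<times> real) measure)) (borel \<Otimes>\<^sub>M borel)"
		using measurable_compose[OF measurable_fst idm] by (intro measurable_Pair) auto
	then have "(%x. (fst x, snd x)) : measurable (Tb \<Otimes>\<^sub>M (borel :: (real \<times> real) measure)) borel" by (simp only: borel_prod)
	from measurable_compose[OF this vgrad_measurable[OF psC]]
	show "(%x. kernel e (snd x) * vgrad ps (fst x, snd x) * w (fst x) (snd x)) : bm (Tb \<Otimes>\<^sub>M borel)"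
		by (intro borel_measurable_times w_meas measurable_compose[OF measurable_snd kernel_measurable])
qed
have F1r: "F1 (s + c * r) = (LI (f (s + c * r)) (%v. tder ph (r, v))) / c" for r
	unfolding F1_def tps by simp
have F2r: "F2 (s + c * r) = (LI (f (s + c * r) \<Otimes>\<^sub>M f (s + c * r)) (%z. kernel e z * vgrad ph (r, z) * (c * w (s + c * r) z))) / c" for r
proof -
	have "(LI (f (s + c * r) \<Otimes>\<^sub>M f (s + c * r)) (%z. kernel e z * vgrad ph (r, z) * (c * w (s + c * r) z))) =
			(LI (f (s + c * r) \<Otimes>\<^sub>M f (s + c * r)) (%z. c * (kernel e z * vgrad ph (r, z) * w (s + c * r) z)))"
		by (intro Bochner_Integration.integral_cong) auto
	then show ?thesis unfolding F2_def vps using st(3) by simp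
qed
have out1: "F1 (s + c * r) = 0" if "r ~: {0..1}" for r
proof -
	have "r ~: {a..b}" using that sup by auto
	then show ?thesis unfolding F1r using sup(6) by simp
qed
have out2: "F2 (s + c * r) = 0" if "r ~: {0..1}" for r
proof -
	have "r ~: {a..b}" using that sup by auto
	then have "vgrad ph (r, z) = 0" for z unfolding vgrad_def using sup(7) by simp
	then show ?thesis unfolding F2r by simp
qed
have ind: "(%t. indicator {0..T} t * F t) : bm borel" if "F : bm Tb" for F :: "real => real"
	using that borel_measurable_restrict_space_iff[of "{0..T}" borel F] by simp
have "(LI (lebesgue_on {0..T}) (%t. F1 t)) = \<bar>c\<bar> * (LI (lebesgue_on {0..1}) (%r. F1 (s + c * r)))"
	by (rule affine_integral[OF st(3) ind[OF mF1] out1 ain])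
moreover have "(LI (lebesgue_on {0..T}) (%t. F2 t)) = \<bar>c\<bar> * (LI (lebesgue_on {0..1}) (%r. F2 (s + c * r)))"
	by (rule affine_integral[OF st(3) ind[OF mF2] out2 ain])
moreover have "(LI (lebesgue_on {0..T}) (%t. F1 t)) + (LI (lebesgue_on {0..T}) (%t. F2 t)) = 0"
	using weak[OF psC] by (simp add: F1_def F2_def)
ultimately have "\<bar>c\<bar> * ((LI (lebesgue_on {0..1}) (%r. F1 (s + c * r))) + (LI (lebesgue_on {0..1}) (%r. F2 (s + c * r)))) = 0"
	by (simp add: distrib_left)
then have "(LI (lebesgue_on {0..1}) (%r. F1 (s + c * r))) + (LI (lebesgue_on {0..1}) (%r. F2 (s + c * r))) = 0"
	using st(3) by simp
then show "(LI (lebesgue_on {0..1}) (%r. LI (f (s + c * r)) (%v. tder ph (r, v)))) +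
		(LI (lebesgue_on {0..1}) (%r. LI (f (s + c * r) \<Otimes>\<^sub>M f (s + c * r)) (%z. kernel e z * vgrad ph (r, z) * (c * w (s + c * r) z)))) = 0"
	unfolding F1r F2r using st(3) by (simp add: add_divide_distrib[symmetric])
qed

lemma dA_le_act:
assumes st: "s : {0..T}" "t : {0..T}" "s ~= t"
shows "dA e (f s) (f t) <= ennsqrt (ennreal \<bar>t - s\<bar> * (NI (lebesgue_on {min s t..max s t}) (%r. act r)))"
proof -
define c where "c = t - s"
have c: "s + c : {0..T}" "c ~= 0" "s + c = t" using st by (auto simp: c_def)
note ain = affine_in[OF st(1) c(1)]
interpret R: dens_curve e 1 "%r. f (s + c * r)" "%r z. c * w (s + c * r) z"
	by (rule rescaled[OF st(1) c(1,2)])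
have mono: "ennsqrt x <= ennsqrt y" if "x <= y" for x y
	using that by (cases x; cases y) (auto simp: ennsqrt_def top_unique ennreal_le_iff intro!: ennreal_leI)
have I: "{min s (s + c)..max s (s + c)} \<subseteq> {0..T}" using st c by auto
have mI: "(%t. act t * indicator {min s (s + c)..max s (s + c)} t) : bm borel"
	by (rule borel_measurable_times_indicator[OF act_measurable I]) auto
have "(NI (lebesgue_on {0..1}) (%r. action e (f (s + c * r)) (dens_flux (f (s + c * r)) (%z. c * w (s + c * r) z)))) =
		(NI (lebesgue_on {0..1}) (%r. ennreal (c^2) * act (s + c * r)))"
	using ain by (intro nn_integral_cong) (simp add: action_eq_act)
also have "... = ennreal (c^2) * (NI (lebesgue_on {0..1}) (%r. act (s + c * r)))"
proof (rule nn_integral_cmult)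
	have "(%r. s + c * r) : measurable (restrict_space borel {0..1}) Tb"
		using ain by (intro measurable_restrict_space2 measurable_restrict_space1) (auto simp: space_restrict_space)
	from measurable_compose[OF this act_measurable]
	show "(%r. act (s + c * r)) : bm (lebesgue_on {0..1})" by (rule measurable_restrict_borel_lebesgue)
qed
also have "... = ennreal \<bar>c\<bar> * (ennreal \<bar>c\<bar> * (NI (lebesgue_on {0..1}) (%r. act (s + c * r))))"
	by (simp add: mult.assoc[symmetric] ennreal_mult'[symmetric] power2_eq_square)
also have "... = ennreal \<bar>c\<bar> * (NI (lebesgue_on {min s (s + c)..max s (s + c)}) (%r. act r))"
	by (simp only: affine_nn_integral[OF c(2) mI])
finally have eq: "(NI (lebesgue_on {0..1}) (%r. action e (f (s + c * r)) (dens_flux (f (s + c * r)) (%z. c * w (s + c * r) z)))) =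
		ennreal \<bar>t - s\<bar> * (NI (lebesgue_on {min s t..max s t}) (%r. act r))"
	using c(3) by (simp add: c_def)
show ?thesis unfolding dA_def
proof (rule mono, rule INF_lower2[where i="(%r. f (s + c * r), %r. dens_flux (f (s + c * r)) (%z. c * w (s + c * r) z))"])
	show "(%r. f (s + c * r), %r. dens_flux (f (s + c * r)) (%z. c * w (s + c * r) z)) : {(g, U). CE e 1 g U & g 0 = f s & g 1 = f t}"
		using R.CE_dens_flux c(3) by simp
qed (simp add: eq)
qed

end

section \<open>Increments are controlled by the Dirichlet form\<close>

text \<open>
  A function whose increments over distances at least \<open>(b - a)/2\<close> are integrable has integrable
  increments, as soon as \<open>f\<close> charges both \<open>{..a}\<close> and \<open>{b..}\<close>: every point is far from
  any point of one of the two half-lines, so that a short increment can be replaced by a detour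
  through points \<open>w\<^sub>1 \<le> a\<close> and \<open>b \<le> w\<^sub>2\<close>, over which one averages.
\<close>

lemma nn_integral_increments_le:
fixes p :: "real => real"
assumes f: "real_distribution f" and p[measurable]: "p : bm borel" and ab: "a < b"
shows "emeasure f {..a} * (emeasure f {b..} * (NI (sq f) (%z. ennreal \<bar>p (snd z) - p (fst z)\<bar>)))
	<= 6 * (NI (sq f) (%z. ennreal (\<bar>p (snd z) - p (fst z)\<bar> * of_bool ((b - a) / 2 <= \<bar>fst z - snd z\<bar>))))"
proof -
interpret real_distribution f by fact
have sf[measurable_cong]: "sets f = sets borel" by simp
define D where "D v w = ennreal \<bar>p w - p v\<bar>" for v w
define J where "J v w = ennreal (\<bar>p w - p v\<bar> * of_bool ((b - a) / 2 <= \<bar>v - w\<bar>))" for v w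
have mD[measurable]: "(%z. D (fst z) (snd z)) : bm (sq f)" unfolding D_def by measurable
have mJ[measurable]: "(%z. J (fst z) (snd z)) : bm (sq f)" unfolding J_def by measurable
have mD1[measurable]: "(%w. D v w) : bm f" for v unfolding D_def by measurable
have mJ1[measurable]: "(%w. J v w) : bm f" for v unfolding J_def by measurable
define h where "h v = (NI f (%w. J v w))" for v
define E I where "E = (NI (sq f) (%z. D (fst z) (snd z)))" and "I = (NI (sq f) (%z. J (fst z) (snd z)))"
have E: "E = (NI f (%v. NI f (%w. D v w)))" using nn_integral_fst[OF mD] by (simp add: E_def)
have I: "I = (NI f (%v. h v))" using nn_integral_fst[OF mJ] by (simp add: I_def h_def)
have mh[measurable]: "h : bm f"
	using borel_measurable_nn_integral_fst[OF mJ] by (simp add: h_def[abs_def])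
have one: "(NI f (%w. c)) = c" for c :: ennreal using emeasure_space_1 by simp
have U: "emeasure f UNIV = 1" using emeasure_space_1 by simp
have tri: "D v v' <= D w1 v + D w1 v'" for v v' w1
proof -
	have "\<bar>p v' - p v\<bar> <= \<bar>p v - p w1\<bar> + \<bar>p v' - p w1\<bar>" by linarith
	from ennreal_leI[OF this] show ?thesis by (simp add: D_def ennreal_plus)
qed
have detour: "D w1 v <= J w1 v + J w2 v + J w1 w2" if w: "w1 <= a" "b <= w2" for v w1 w2
proof (cases "(b - a) / 2 <= \<bar>w1 - v\<bar>")
	case True
	then have "D w1 v = J w1 v" by (simp add: D_def J_def)
	then show ?thesis by (simp add: add.assoc)
next
	case False
	then have "(b - a) / 2 <= \<bar>w2 - v\<bar>" "(b - a) / 2 <= \<bar>w1 - w2\<bar>"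
		using w ab by (auto simp: abs_if field_simps split: if_splits)
	then have "J w2 v + J w1 w2 = ennreal (\<bar>p v - p w2\<bar> + \<bar>p w2 - p w1\<bar>)"
		by (simp add: J_def ennreal_plus)
	moreover have "D w1 v <= ennreal (\<bar>p v - p w2\<bar> + \<bar>p w2 - p w1\<bar>)"
		unfolding D_def by (intro ennreal_leI) linarith
	ultimately show ?thesis by (metis add.assoc add_increasing zero_le)
qed
have E_le: "E <= 2 * (h w1 + h w2 + J w1 w2)" if w: "w1 <= a" "b <= w2" for w1 w2
proof -
	have "E <= (NI f (%v. NI f (%v'. D w1 v + D w1 v')))"
		unfolding E by (intro nn_integral_mono tri)
	also have "... = 2 * (NI f (%v. D w1 v))"
		by (simp add: nn_integral_add U mult_2)
	also have "(NI f (%v. D w1 v)) <= (NI f (%v. J w1 v + J w2 v + J w1 w2))"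
		by (intro nn_integral_mono detour w)
	also have "... = h w1 + h w2 + J w1 w2" by (simp add: nn_integral_add U h_def)
	finally show ?thesis by (simp add: mult_left_mono)
qed
have "emeasure f {b..} * E <= 2 * (h w1 + I + h w1)" if w: "w1 <= a" for w1
proof -
	have "emeasure f {b..} * E = (NI f (%w2. E * indicator {b..} w2))"
		by (simp add: nn_integral_cmult_indicator mult.commute)
	also have "... <= (NI f (%w2. 2 * (h w1 + h w2 + J w1 w2)))"
		using E_le[OF w] by (intro nn_integral_mono) (simp add: indicator_def)
	also have "... = 2 * (h w1 + I + h w1)"
		by (simp add: nn_integral_cmult nn_integral_add U I h_def[symmetric])
	finally show ?thesis .
qed
note E_le2 = this
have "emeasure f {..a} * (emeasure f {b..} * E) = (NI f (%w1. (emeasure f {b..} * E) * indicator {..a} w1))"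
	by (subst nn_integral_cmult_indicator) (simp_all add: ac_simps)
also have "... <= (NI f (%w1. 2 * (h w1 + I + h w1)))"
	using E_le2 by (intro nn_integral_mono) (simp add: indicator_def)
also have "... = 2 * (I + I + I)" by (simp add: nn_integral_cmult nn_integral_add U I[symmetric])
also have "... = 6 * I"
proof -
	have "I + I + I = 3 * I" 
	proof -
		have "(3 :: ennreal) = 1 + 1 + 1" by simp
		then show ?thesis by (simp only: distrib_right mult_1)
	qed
	then show ?thesis by (simp add: mult.assoc[symmetric])
qed
finally show ?thesis by (simp add: E_def I_def D_def J_def)
qed

text \<open>If \<open>f\<close> is not a Dirac measure, then two half-lines as above exist, and increments over long
  distances are controlled by the Dirichlet form, as the kernel is bounded below there.\<close>

lemma increments_le_Dirichlet:
assumes f: "real_distribution f" and e: "0 <= e" "e < 1"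
obtains "emeasure (sq f) offdiag = 0" |
	C where "C < \<infinity>" "!!p. p : bm borel ==> (NI (sq f) (%z. ennreal \<bar>p (snd z) - p (fst z)\<bar>))
		<= C * (1 + (NI (sq f) (%z. ennreal (kernel e z * (p (snd z) - p (fst z))^2))))"
proof (cases "EX a b :: real. a < b & emeasure f {..a} ~= 0 & emeasure f {b..} ~= 0")
case False
interpret real_distribution f by fact
interpret P: pair_sigma_finite f f ..
have S: "offdiag \<subseteq> (\<Union>(a, b)\<in>{(a, b). a : \<rat> & b : \<rat> & a < b}. {..a} \<times> {b..} \<union> {b..} \<times> {..a})"
proof
	fix z :: "real \<times> real" assume "z : offdiag"
	then have "fst z < snd z | snd z < fst z" by (auto simp: offdiag_def)
	then obtain a b where "a : \<rat>" "b : \<rat>" "a < b" "fst z <= a & b <= snd z | snd z <= a & b <= fst z"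
		by (metis Rats_dense_in_real less_imp_le)
	then show "z : (\<Union>(a, b)\<in>{(a, b). a : \<rat> & b : \<rat> & a < b}. {..a} \<times> {b..} \<union> {b..} \<times> {..a})"
		by (cases z) auto
qed
have N: "(\<Union>(a, b)\<in>{(a, b). a : \<rat> & b : \<rat> & a < b}. {..a} \<times> {b..} \<union> {b..} \<times> {..a}) : null_sets (sq f)"
proof (rule null_sets_UN')
	have "countable (\<rat> \<times> \<rat> :: (real \<times> real) set)" by (intro countable_SIGMA countable_rat)
	then show "countable {(a, b). a : \<rat> & b : \<rat> & (a :: real) < b}" by (rule countable_subset[rotated]) auto
	fix x assume "x : {(a, b). a : \<rat> & b : \<rat> & (a :: real) < b}"
	then obtain a b where x: "x = (a, b)" "a < b" by auto
	have "emeasure f {..a} * emeasure f {b..} = 0" using False x(2) by auto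
	then have "{..a} \<times> {b..} : null_sets (sq f)" "{b..} \<times> {..a} : null_sets (sq f)"
		by (auto simp: null_sets_def emeasure_pair_measure_Times mult.commute)
	then show "(case x of (a, b) => {..a} \<times> {b..} \<union> {b..} \<times> {..a}) : null_sets (sq f)"
		unfolding x(1) by (simp add: null_sets.Un)
qed
have "emeasure (sq f) offdiag = 0" by (rule emeasure_eq_0[OF null_setsD2[OF N] null_setsD1[OF N] S])
then show ?thesis by (rule that(1))
next
case True
then obtain a b :: real where ab: "a < b" "emeasure f {..a} ~= 0" "emeasure f {b..} ~= 0" by blast
interpret real_distribution f by fact
define A where "A = measure f {..a} * measure f {b..}"
have A: "emeasure f {..a} * emeasure f {b..} = ennreal A" "0 < A"
	using ab(2,3) by (auto simp: A_def emeasure_eq_measure ennreal_mult zero_less_measure_iff)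
define c where "c = (1 - e) / 4 * ((b - a) / 2)"
have c: "0 < c" using e ab by (simp add: c_def)
have "(NI (sq f) (%z. ennreal \<bar>p (snd z) - p (fst z)\<bar>))
		<= (ennreal (1 / A) * (6 * ennreal (1 + 1 / c))) * (1 + (NI (sq f) (%z. ennreal (kernel e z * (p (snd z) - p (fst z))^2))))"
	if p: "p : bm borel" for p
proof -
	define E q where "E = (NI (sq f) (%z. ennreal \<bar>p (snd z) - p (fst z)\<bar>))"
		and "q = (NI (sq f) (%z. ennreal (kernel e z * (p (snd z) - p (fst z))^2)))"
	have mk: "(%z. ennreal (kernel e z * (p (snd z) - p (fst z))^2)) : bm (sq f)"
		by (rule measurable_compose[OF kernel_integrand_measurable[OF p] measurable_ennreal]) simp_all
	have le: "ennreal (\<bar>p (snd z) - p (fst z)\<bar> * of_bool ((b - a) / 2 <= \<bar>fst z - snd z\<bar>))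
			<= 1 + ennreal (1 / c) * ennreal (kernel e z * (p (snd z) - p (fst z))^2)" for z
	proof (cases "(b - a) / 2 <= \<bar>fst z - snd z\<bar>")
		case True
		define x where "x = \<bar>p (snd z) - p (fst z)\<bar>"
		have "c <= kernel e z" unfolding kernel_eq c_def using True e by (intro mult_left_mono) auto
		then have "c * x^2 <= kernel e z * x^2" by (rule mult_right_mono) simp
		then have "x^2 <= 1 / c * (kernel e z * x^2)" using c by (simp add: field_simps)
		moreover have "x <= 1 + x^2" 
		proof -
			have "0 <= x" by (simp add: x_def)
			then show ?thesis using zero_le_power2[of "x - 1"] by (simp add: power2_diff)
		qed
		ultimately have "x <= 1 + 1 / c * (kernel e z * x^2)" by linarith
		then have "ennreal x <= ennreal (1 + 1 / c * (kernel e z * x^2))" by (rule ennreal_leI)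
		also have "... = 1 + ennreal (1 / c) * ennreal (kernel e z * x^2)"
			using c kernel_nonneg[OF e(2), of z]
			by (subst ennreal_plus) (auto simp del: ennreal_plus times_divide_eq_left mult_1_left intro!: ennreal_mult')
		finally show ?thesis using True by (simp add: x_def)
	qed simp
	have "ennreal A * E <= 6 * (NI (sq f) (%z. ennreal (\<bar>p (snd z) - p (fst z)\<bar> * of_bool ((b - a) / 2 <= \<bar>fst z - snd z\<bar>))))"
		using nn_integral_increments_le[OF f p ab(1)] by (simp add: A(1)[symmetric] E_def mult.assoc)
	also have "... <= 6 * (NI (sq f) (%z. 1 + ennreal (1 / c) * ennreal (kernel e z * (p (snd z) - p (fst z))^2)))"
		by (intro mult_left_mono nn_integral_mono le) simp
	also have "... = 6 * (1 + ennreal (1 / c) * q)"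
	proof -
		interpret P: prob_space "f \<Otimes>\<^sub>M f" by (rule prob_space_pair_self) unfold_locales
		show ?thesis using mk by (simp add: nn_integral_add nn_integral_cmult q_def P.emeasure_space_1)
	qed
	also have "... <= 6 * (ennreal (1 + 1 / c) * (1 + q))"
	proof (rule mult_left_mono)
		have "1 + ennreal (1 / c) * q <= (1 + ennreal (1 / c)) * (1 + q)"
			unfolding distrib_left distrib_right by (simp add: add.assoc add_left_mono add_increasing)
		then show "1 + ennreal (1 / c) * q <= ennreal (1 + 1 / c) * (1 + q)" using c by (simp add: ennreal_plus)
	qed simp
	finally have *: "ennreal A * E <= 6 * (ennreal (1 + 1 / c) * (1 + q))" .
	have "E = ennreal (1 / A) * (ennreal A * E)" using A(2) by (simp add: mult.assoc[symmetric] ennreal_mult[symmetric])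
	also have "... <= ennreal (1 / A) * (6 * (ennreal (1 + 1 / c) * (1 + q)))" by (rule mult_left_mono[OF *]) simp
	also have "... = (ennreal (1 / A) * (6 * ennreal (1 + 1 / c))) * (1 + q)" by (simp only: mult.assoc)
	finally show ?thesis unfolding E_def q_def .
qed
then show ?thesis by (intro that(2)[of "ennreal (1 / A) * (6 * ennreal (1 + 1 / c))"]) (auto simp: ennreal_mult_less_top)
qed

section \<open>The optimal flux\<close>

context ac_curve begin

lemma tder_integrable:
assumes ph: "ph : C1c T"
shows "integrable leb (%t. LI (f t) (%v. tder ph (t, v)))"
proof -
obtain B where B: "0 < B" "!!x. \<bar>ph x\<bar> <= B" "!!x. \<bar>tder ph x\<bar> <= B" "!!x. \<bar>vder ph x\<bar> <= B"
	by (rule C1c_bounds[OF ph T]) (rule that; assumption)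
show ?thesis
proof (rule Bochner_Integration.integrable_bound[OF const_integrable[of B]])
	have "(%x. (fst x, snd x)) : measurable (leb \<Otimes>\<^sub>M (borel :: real measure)) (borel \<Otimes>\<^sub>M borel)"
		using measurable_compose[OF measurable_fst leb_borel] by (intro measurable_Pair) auto
	then have "(%x. (fst x, snd x)) : measurable (leb \<Otimes>\<^sub>M (borel :: real measure)) borel" by (simp only: borel_prod)
	from measurable_compose[OF this borel_measurable_continuous_onI[OF C1c_partials(3)[OF ph]]]
	show "(%t. LI (f t) (%v. tder ph (t, v))) : bm leb"
		by (intro integral_measurable_kernel[OF _ kernel_f])
	show "AE t in leb. norm (LI (f t) (%v. tder ph (t, v))) <= norm B"
	proof (intro AE_I2)
		fix t assume "t : space leb"
		then have t: "t : {0..T}" by simp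
		interpret real_distribution "f t" by (rule distr_f[OF t])
		have "\<bar>LI (f t) (%v. tder ph (t, v))\<bar> <= (LI (f t) (%v. \<bar>tder ph (t, v)\<bar>))" by (rule integral_abs_bound)
		also have "... <= (LI (f t) (%v. B))"
			using test_slice(7)[OF ph t] B by (intro integral_mono integrable_abs) auto
		also have "... = B" using prob_space by simp
		finally show "norm (LI (f t) (%v. tder ph (t, v))) <= norm B" using B by simp
	qed
qed
qed

lemma lfun_linear:
assumes ph: "ph : C1c T" and ps: "ps : C1c T"
shows "lfun (%x. a * ph x + b * ps x) = a * lfun ph + b * lfun ps"
proof -
have "(LI leb (%t. LI (f t) (%v. tder (%x. a * ph x + b * ps x) (t, v)))) =
		(LI leb (%t. a * (LI (f t) (%v. tder ph (t, v))) + b * (LI (f t) (%v. tder ps (t, v)))))"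
proof (rule Bochner_Integration.integral_cong[OF refl])
	fix t assume "t : space leb"
	then have t: "t : {0..T}" by simp
	show "(LI (f t) (%v. tder (%x. a * ph x + b * ps x) (t, v))) =
			a * (LI (f t) (%v. tder ph (t, v))) + b * (LI (f t) (%v. tder ps (t, v)))"
		unfolding C1c_linear(2)[OF ph ps] using test_slice(7)[OF ph t] test_slice(7)[OF ps t] by simp
qed
also have "... = a * (LI leb (%t. LI (f t) (%v. tder ph (t, v)))) + b * (LI leb (%t. LI (f t) (%v. tder ps (t, v))))"
	using tder_integrable[OF ph] tder_integrable[OF ps] by simp
finally show ?thesis by (simp add: lfun_def)
qed

end

locale flux_curve = ac_curve +
fixes u :: "real \<times> (real \<times> real) => real" and Ph :: "nat => real \<times> real => real"
assumes u_meas: "u : bm borel"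
	and u_sq: "integrable Th (%x. (u x)^2)"
	and Ph: "!!n. Ph n : C1c T"
	and gap_int: "!!n. integrable Th (%x. (u x - vgrad (Ph n) x)^2)"
	and gap_le: "!!n. (LI Th (%x. (u x - vgrad (Ph n) x)^2)) <= (1/2)^n"
	and repr: "!!ph. ph : C1c T ==> lfun ph = (LI Th (%x. u x * vgrad ph x))"

lemma (in ac_curve) flux_exists:
obtains u Ph where "flux_curve e T f Mb m u Ph"
proof (rule gradient_Riesz[of "C1c T" vgrad lfun Th "H T"])
show "C1c T ~= {}" using C1c_zero by blast
fix ph ps :: "real \<times> real => real" and a b z assume ph: "ph : C1c T" "ps : C1c T"
show "(%x. a * ph x + b * ps x) : C1c T" by (rule C1c_linear(1)[OF ph])
show "vgrad (%x. a * ph x + b * ps x) z = a * vgrad ph z + b * vgrad ps z"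
	by (simp add: vgrad_def C1c_linear(3)[OF ph] algebra_simps)
show "lfun (%x. a * ph x + b * ps x) = a * lfun ph + b * lfun ps" by (rule lfun_linear[OF ph])
next
fix ph assume ph: "ph : C1c T"
show "vgrad ph : bm Th"
	using vgrad_measurable[OF ph] measurable_cong_sets[OF sets_Th refl] by blast
show "integrable Th (%z. (vgrad ph z)^2)" by (rule vgrad_sq_integrable(1)[OF ph])
show "2 * lfun ph <= H T + (LI Th (%z. (vgrad ph z)^2))" by (rule lfun_le[OF ph])
next
fix u Ph
assume u: "u : bm Th" "integrable Th (%z. (u z)^2)" "!!n::nat. Ph n : C1c T"
	"!!n. integrable Th (%z. (u z - vgrad (Ph n) z)^2)"
	"!!n. (LI Th (%z. (u z - vgrad (Ph n) z)^2)) <= (1/2)^n"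
	"!!ph. ph : C1c T ==> lfun ph = (LI Th (%z. u z * vgrad ph z))"
have "u : bm borel" using u(1) measurable_cong_sets[OF sets_Th refl] by blast
with u have "flux_curve e T f Mb m u Ph" by unfold_locales
then show ?thesis by (rule that)
qed

context narrow_curve begin

lemma
assumes h: "h : bm borel"
shows nn_Th: "(NI Th (%x. ennreal (h x))) = (NI leb (%t. NI (mu t) (%z. ennreal (kernel e z * h (t, z)))))"
	and nn_slice: "(%t. NI (mu t) (%z. ennreal (kernel e z * h (t, z)))) : bm leb"
	and AE_slice: "(NI Th (%x. ennreal (h x))) < \<infinity> ==> AE t in leb. (NI (mu t) (%z. ennreal (kernel e z * h (t, z)))) < \<infinity>"
proof -
show *: "(NI Th (%x. ennreal (h x))) = (NI leb (%t. NI (mu t) (%z. ennreal (kernel e z * h (t, z)))))"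
	using nn_integral_Th[OF measurable_compose[OF h measurable_ennreal]] kernel_nonneg[OF e(2)] by (simp add: ennreal_mult')
have "(%x. ennreal (kernel e (snd x) * h x)) : bm borel"
	by (intro measurable_compose[OF _ measurable_ennreal] borel_measurable_times kernel_snd_measurable h)
from nn_integral_slice_measurable[OF this]
show m: "(%t. NI (mu t) (%z. ennreal (kernel e z * h (t, z)))) : bm leb" by simp
show "AE t in leb. (NI (mu t) (%z. ennreal (kernel e z * h (t, z)))) < \<infinity>" if "(NI Th (%x. ennreal (h x))) < \<infinity>"
	using nn_integral_PInf_AE[OF m] that unfolding * by (simp add: less_top)
qed

end

context flux_curve begin

definition gap :: "nat => real => ennreal" where
"gap n t = (NI (mu t) (%z. ennreal (kernel e z * (u (t, z) - vgrad (Ph n) (t, z))^2)))"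

definition good :: "real => bool" where
"good t \<longleftrightarrow> t : {0<..<T} & (\<Sum>n. gap n t) < \<infinity> & (NI (mu t) (%z. ennreal (kernel e z * (u (t, z))^2))) < \<infinity> &
		(NI (mu t) (%z. ennreal (kernel e z * \<bar>u (t, z)\<bar>))) < \<infinity>"

lemma gap_measurable: "(%x. (u x - vgrad (Ph n) x)^2) : bm borel"
by (intro borel_measurable_power borel_measurable_diff u_meas vgrad_measurable[OF Ph])

lemma u_integrable: "integrable Th u"
proof (rule Bochner_Integration.integrable_bound)
show "integrable Th (%x. 1 + (u x)^2)"
	using integrable_Th_bounded[of "%_. 1" 1] u_sq by (intro Bochner_Integration.integrable_add) auto
show "u : bm Th" using u_meas measurable_cong_sets[OF sets_Th refl] by blast
have "\<bar>y\<bar> <= 1 + y^2" for y :: real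
	using zero_le_power2[of "\<bar>y\<bar> - 1"] by (simp add: power2_diff)
then show "AE x in Th. norm (u x) <= norm (1 + (u x)^2)" by simp
qed

lemma vgrad_bounded:
assumes ph: "ph : C1c T" obtains B where "!!x. \<bar>vgrad ph x\<bar> <= B"
proof -
obtain B where B: "0 < B" "!!x. \<bar>ph x\<bar> <= B" "!!x. \<bar>tder ph x\<bar> <= B" "!!x. \<bar>vder ph x\<bar> <= B"
	by (rule C1c_bounds[OF ph T]) (rule that; assumption)
have "\<bar>vgrad ph x\<bar> <= 2 * B" for x
	unfolding vgrad_def using B(4)[of "(fst x, snd (snd x))"] B(4)[of "(fst x, fst (snd x))"] by linarith
then show ?thesis by (rule that)
qed

lemma u_vgrad_integrable:
assumes ph: "ph : C1c T" shows "integrable Th (%x. u x * vgrad ph x)"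
proof -
obtain B where B: "!!x. \<bar>vgrad ph x\<bar> <= B" by (rule vgrad_bounded[OF ph]) (rule that; assumption)
show ?thesis
proof (rule Bochner_Integration.integrable_bound[OF integrable_mult_right[OF u_integrable, of B]])
	show "(%x. u x * vgrad ph x) : bm Th"
		using borel_measurable_times[OF u_meas vgrad_measurable[OF ph]] measurable_cong_sets[OF sets_Th refl] by blast
	have "\<bar>u x\<bar> * \<bar>vgrad ph x\<bar> <= \<bar>u x\<bar> * \<bar>B\<bar>" for x
		using B[of x] by (intro mult_left_mono) linarith+
	then show "AE x in Th. norm (u x * vgrad ph x) <= norm (B * u x)" by (simp add: abs_mult mult.commute)
qed
qed

text \<open>
The norms of \<open>u - vgrad (Ph n)\<close> decay geometrically, hence their slices are summable at almost every
time.
\<close>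

lemma AE_good: "AE t in leb. good t"
proof -
have fin: "(NI Th (%x. ennreal \<bar>h x\<bar>)) < \<infinity>" if "integrable Th h" for h :: "_ => real"
	using that by (simp add: integrable_iff_bounded)
have m: "gap n : bm leb" for n
	using nn_slice[OF gap_measurable] unfolding gap_def[abs_def] .
have "(NI leb (%t. (\<Sum>n. gap n t))) = (\<Sum>n. NI leb (%t. gap n t))" by (rule nn_integral_suminf[OF m])
also have "... <= (\<Sum>n. ennreal ((1/2)^n))"
proof (intro suminf_le)
	fix n
	have "(NI leb (%t. gap n t)) = ennreal (LI Th (%x. (u x - vgrad (Ph n) x)^2))"
		unfolding gap_def nn_Th[OF gap_measurable, symmetric] by (rule nn_integral_eq_integral[OF gap_int]) simp
	also have "... <= ennreal ((1/2)^n)" by (rule ennreal_leI[OF gap_le])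
	finally show "(NI leb (%t. gap n t)) <= ennreal ((1/2)^n)" .
qed auto
also have "... < \<infinity>"
	by (subst suminf_ennreal2) (auto intro: summable_geometric)
finally have "AE t in leb. (\<Sum>n. gap n t) ~= \<infinity>"
	by (intro nn_integral_PInf_AE) (auto intro: borel_measurable_suminf_order m)
moreover have "AE t in leb. (NI (mu t) (%z. ennreal (kernel e z * (u (t, z))^2))) < \<infinity>"
	using fin[OF u_sq] by (intro AE_slice borel_measurable_power u_meas) simp
moreover have "AE t in leb. (NI (mu t) (%z. ennreal (kernel e z * \<bar>u (t, z)\<bar>))) < \<infinity>"
	using fin[OF u_integrable] by (intro AE_slice borel_measurable_abs u_meas)
ultimately show ?thesis using AE_interior by eventually_elim (simp add: good_def less_top)
qed

lemma good_interior: "good t ==> t : {0..T}" by (auto simp: good_def)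

lemma slice_measurable_mu:
assumes "good t" and "h : bm borel"
shows "(%z. ennreal (kernel e z * h (t, z))) : bm (mu t)"
	and "(%z. kernel e z * h (t, z)) : bm (mu t)"
using assms good_interior
by (auto intro!: measurable_mu measurable_compose[OF _ measurable_ennreal] borel_measurable_times kernel_measurable measurable_slice)

lemma good_gap_tendsto:
assumes t: "good t"
shows "integrable (mu t) (%z. kernel e z * (u (t, z) - vgrad (Ph n) (t, z))^2)"
	and "(%n. LI (mu t) (%z. kernel e z * (u (t, z) - vgrad (Ph n) (t, z))^2)) ----> 0"
proof -
have s: "(\<Sum>n. gap n t) ~= \<infinity>" using t by (simp add: good_def less_top)
have g: "gap n t < \<infinity>" for n
	using sum_le_suminf[of "%n. gap n t" "{n}"] s by (simp add: less_top[symmetric] top_unique) (metis top_unique top.not_eq_extremum)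
have nn: "0 <= kernel e z * x^2" for x z using kernel_nonneg[OF e(2)] by simp
have i: "integrable (mu t) (%z. kernel e z * (u (t, z) - vgrad (Ph n) (t, z))^2)" for n
	using g[of n] nn unfolding gap_def
	by (intro integrableI_bounded slice_measurable_mu(2)[OF t gap_measurable]) simp
show "integrable (mu t) (%z. kernel e z * (u (t, z) - vgrad (Ph n) (t, z))^2)" by (rule i)
have eq: "gap n t = ennreal (LI (mu t) (%z. kernel e z * (u (t, z) - vgrad (Ph n) (t, z))^2))" for n
	unfolding gap_def using nn by (intro nn_integral_eq_integral[OF i]) auto
have "summable (%n. LI (mu t) (%z. kernel e z * (u (t, z) - vgrad (Ph n) (t, z))^2))"
	using s nn unfolding eq by (intro summable_suminf_not_top Bochner_Integration.integral_nonneg) auto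
then show "(%n. LI (mu t) (%z. kernel e z * (u (t, z) - vgrad (Ph n) (t, z))^2)) ----> 0"
	by (rule summable_LIMSEQ_zero)
qed

lemma good_pointwise:
assumes t: "good t"
shows "AE z in mu t. z : offdiag --> (%n. vgrad (Ph n) (t, z)) ----> u (t, z)"
proof -
have nn: "0 <= kernel e z * x^2" for x z using kernel_nonneg[OF e(2)] by simp
note m = slice_measurable_mu(1)[OF t gap_measurable]
have "(NI (mu t) (%z. (\<Sum>n. ennreal (kernel e z * (u (t, z) - vgrad (Ph n) (t, z))^2)))) = (\<Sum>n. gap n t)"
	unfolding gap_def by (rule nn_integral_suminf[OF m])
then have "AE z in mu t. (\<Sum>n. ennreal (kernel e z * (u (t, z) - vgrad (Ph n) (t, z))^2)) ~= \<infinity>"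
	using t by (intro nn_integral_PInf_AE borel_measurable_suminf_order m) (simp add: good_def less_top)
then show ?thesis
proof eventually_elim
	case (elim z)
	show ?case
	proof
		assume z: "z : offdiag"
		have k: "0 < kernel e z" by (rule kernel_pos[OF e(2) z])
		have "summable (%n. kernel e z * (u (t, z) - vgrad (Ph n) (t, z))^2)"
			using elim by (intro summable_suminf_not_top nn) auto
		then have "(%n. kernel e z * (u (t, z) - vgrad (Ph n) (t, z))^2) ----> 0" by (rule summable_LIMSEQ_zero)
		from tendsto_mult_left[OF this, of "1 / kernel e z"] k
		have "(%n. (u (t, z) - vgrad (Ph n) (t, z))^2) ----> 0" by simp
		from tendsto_real_sqrt[OF this] have "(%n. \<bar>u (t, z) - vgrad (Ph n) (t, z)\<bar>) ----> 0" by simp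
		then have "(%n. u (t, z) - vgrad (Ph n) (t, z)) ----> 0" by (simp add: tendsto_rabs_zero_iff)
		from tendsto_diff[OF tendsto_const[of "u (t, z)"] this]
		show "(%n. vgrad (Ph n) (t, z)) ----> u (t, z)" by simp
	qed
qed
qed

text \<open>
  At almost every time the density is integrable, not only square integrable with the degenerate
  weight: it is a limit of increments \<open>p\<^sub>n w - p\<^sub>n v\<close> with bounded Dirichlet form.
\<close>

lemma good_integrable:
assumes t: "good t"
shows "(NI (mu t) (%z. ennreal (\<bar>u (t, z)\<bar> * indicator offdiag z))) < \<infinity>"
proof (rule increments_le_Dirichlet[OF distr_f[OF good_interior[OF t]] e, folded mu_def])
assume "emeasure (mu t) offdiag = 0"
moreover have "offdiag : sets (mu t)" using sets_mu[OF good_interior[OF t]] open_offdiag by simp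
ultimately have "AE z in mu t. z ~: offdiag" by (intro AE_not_in) (simp add: null_sets_def)
then have "(NI (mu t) (%z. ennreal (\<bar>u (t, z)\<bar> * indicator offdiag z))) = (NI (mu t) (%z. 0))"
	by (intro nn_integral_cong_AE) (auto elim!: eventually_mono)
then show ?thesis by simp
next
fix C assume C: "C < \<infinity>" "!!p. p : bm borel ==> (NI (mu t) (%z. ennreal \<bar>p (snd z) - p (fst z)\<bar>))
		<= C * (1 + (NI (mu t) (%z. ennreal (kernel e z * (p (snd z) - p (fst z))^2))))"
let ?g = "%n z. vgrad (Ph n) (t, z)"
define B where "B = C * (1 + (2 * (\<Sum>n. gap n t) + 2 * (NI (mu t) (%z. ennreal (kernel e z * (u (t, z))^2)))))"
have B: "B < \<infinity>" using C(1) t by (simp add: B_def good_def ennreal_mult_less_top)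
have mg: "?g n : bm (mu t)" for n
	by (intro measurable_mu[OF good_interior[OF t]] measurable_slice vgrad_measurable[OF Ph])
have mo: "(%z. indicator offdiag z :: real) : bm (mu t)"
	using open_offdiag by (intro measurable_mu[OF good_interior[OF t]] borel_measurable_indicator) simp
have le: "(NI (mu t) (%z. ennreal (\<bar>?g n z\<bar> * indicator offdiag z))) <= B" for n
proof -
	have "(NI (mu t) (%z. ennreal (\<bar>?g n z\<bar> * indicator offdiag z))) <= (NI (mu t) (%z. ennreal \<bar>?g n z\<bar>))"
		by (intro nn_integral_mono ennreal_leI) (simp add: indicator_def)
	also have "... <= C * (1 + (NI (mu t) (%z. ennreal (kernel e z * (?g n z)^2))))"
		using C(2)[OF borel_measurable_continuous_onI[OF test_slice(3)[OF Ph[of n], of t]]] by (simp add: vgrad_def)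
	also have "(NI (mu t) (%z. ennreal (kernel e z * (?g n z)^2))) <=
			(NI (mu t) (%z. 2 * ennreal (kernel e z * (u (t, z) - ?g n z)^2) + 2 * ennreal (kernel e z * (u (t, z))^2)))"
	proof (rule nn_integral_mono)
		fix z
		have "x^2 <= 2 * (y - x)^2 + 2 * y^2" for x y :: real
			using zero_le_power2[of "2 * y - x"] by (simp add: power2_eq_square algebra_simps)
		then have "kernel e z * (?g n z)^2 <= kernel e z * (2 * (u (t, z) - ?g n z)^2 + 2 * (u (t, z))^2)"
			by (rule mult_left_mono) (rule kernel_nonneg[OF e(2)])
		also have "... = 2 * (kernel e z * (u (t, z) - ?g n z)^2) + 2 * (kernel e z * (u (t, z))^2)"
			by (simp only: distrib_left mult.left_commute)
		finally have "ennreal (kernel e z * (?g n z)^2) <= ennreal (2 * (kernel e z * (u (t, z) - ?g n z)^2) + 2 * (kernel e z * (u (t, z))^2))"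
			by (rule ennreal_leI)
		also have "... = 2 * ennreal (kernel e z * (u (t, z) - ?g n z)^2) + 2 * ennreal (kernel e z * (u (t, z))^2)"
			using kernel_nonneg[OF e(2), of z] by (subst ennreal_plus) (auto simp del: ennreal_plus simp: ennreal_mult'')
		finally show "ennreal (kernel e z * (?g n z)^2) <= 2 * ennreal (kernel e z * (u (t, z) - ?g n z)^2) + 2 * ennreal (kernel e z * (u (t, z))^2)" .
	qed
	also have "... = 2 * gap n t + 2 * (NI (mu t) (%z. ennreal (kernel e z * (u (t, z))^2)))"
		using slice_measurable_mu(1)[OF t gap_measurable, of n] slice_measurable_mu(1)[OF t borel_measurable_power[OF u_meas, of 2]]
		by (simp add: nn_integral_add nn_integral_cmult gap_def)
	also have "gap n t <= (\<Sum>n. gap n t)" using sum_le_suminf[of "%n. gap n t" "{n}"] by simp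
	finally show ?thesis unfolding B_def by (simp add: mult_left_mono add_mono)
qed
have "(NI (mu t) (%z. ennreal (\<bar>u (t, z)\<bar> * indicator offdiag z))) =
		(NI (mu t) (%z. liminf (%n. ennreal (\<bar>?g n z\<bar> * indicator offdiag z))))"
proof (rule nn_integral_cong_AE, use good_pointwise[OF t] in eventually_elim)
	case (elim z)
	have "(%n. ennreal (\<bar>?g n z\<bar> * indicator offdiag z)) ----> ennreal (\<bar>u (t, z)\<bar> * indicator offdiag z)"
		using elim by (cases "z : offdiag") (auto intro!: tendsto_ennrealI tendsto_rabs)
	from lim_imp_Liminf[OF _ this] show ?case by simp
qed
also have "... <= liminf (%n. NI (mu t) (%z. ennreal (\<bar>?g n z\<bar> * indicator offdiag z)))"
	by (intro nn_integral_liminf measurable_compose[OF _ measurable_ennreal] borel_measurable_times borel_measurable_abs mg mo)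
also have "... <= liminf (%n::nat. B)" by (intro Liminf_mono always_eventually allI le)
also have "... = B" by (simp add: Liminf_const)
finally show ?thesis using B by (rule le_less_trans)
qed

abbreviation "Tb \<equiv> restrict_space (borel :: real measure) {0..T}"

definition G :: "real set" where
"G = {t : {0..T}. (NI (mu t) (%z. ennreal (\<bar>u (t, z)\<bar> * indicator offdiag z))) < \<infinity> &
		(NI (mu t) (%z. ennreal (kernel e z * \<bar>u (t, z)\<bar>))) < \<infinity>}"

text \<open>The density of the flux, switched off at the exceptional times.\<close>

definition w :: "real => real \<times> real => real" where
"w t z = (if t : G then u (t, z) else 0)"

lemma good_G: "good t ==> t : G"
using good_integrable good_interior by (simp add: G_def good_def)

lemma mu_borel: "mu : measurable Tb (subprob_algebra borel)"
using measurable_pair_measure[OF kernel_f_borel kernel_f_borel] unfolding mu_def[abs_def] borel_prod .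

lemma pair_Tb: "(%x. (fst x, snd x)) : measurable (Tb \<Otimes>\<^sub>M (borel :: (real \<times> real) measure)) borel"
proof -
have "(%t. t) : measurable Tb borel" by (rule measurable_restrict_space1) simp
then have "(%x. (fst x, snd x)) : measurable (Tb \<Otimes>\<^sub>M (borel :: (real \<times> real) measure)) (borel \<Otimes>\<^sub>M borel)"
	using measurable_compose[OF measurable_fst] by (intro measurable_Pair) auto
then show ?thesis by (simp only: borel_prod)
qed

lemma G_sets: "G : sets Tb"
proof -
have m: "(%t. NI (mu t) (%z. ennreal (c z * \<bar>u (t, z)\<bar>))) : bm Tb" if c: "c : bm borel" for c
proof (rule nn_integral_measurable_subprob_algebra2[OF _ mu_borel])
	have "(%x. ennreal (c (snd x) * \<bar>u (fst x, snd x)\<bar>)) : bm (Tb \<Otimes>\<^sub>M borel)"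
		by (intro measurable_compose[OF _ measurable_ennreal] borel_measurable_times borel_measurable_abs
				measurable_compose[OF measurable_snd c] measurable_compose[OF pair_Tb u_meas])
	then show "(%(t, z). ennreal (c z * \<bar>u (t, z)\<bar>)) : bm (Tb \<Otimes>\<^sub>M borel)" by (simp add: case_prod_beta')
qed
have "{t : space Tb. (NI (mu t) (%z. ennreal (indicator offdiag z * \<bar>u (t, z)\<bar>))) < \<infinity>} \<inter>
		{t : space Tb. (NI (mu t) (%z. ennreal (kernel e z * \<bar>u (t, z)\<bar>))) < \<infinity>} : sets Tb"
	using open_offdiag by (intro sets.Int borel_measurable_less m kernel_measurable borel_measurable_indicator) auto
moreover have "{t : space Tb. (NI (mu t) (%z. ennreal (indicator offdiag z * \<bar>u (t, z)\<bar>))) < \<infinity>} \<inter>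
		{t : space Tb. (NI (mu t) (%z. ennreal (kernel e z * \<bar>u (t, z)\<bar>))) < \<infinity>} = G"
	by (auto simp: G_def space_restrict_space mult.commute)
ultimately show ?thesis by simp
qed

lemma w_integrable:
assumes t: "t : {0..T}"
shows "integrable (tensor (f t)) (w t)" "integrable (tensor (f t)) (%z. kernel e z * w t z)"
proof -
note s = real_distribution_sets[OF distr_f[OF t]]
have mw: "w t : bm borel"
	unfolding w_def[abs_def] by (cases "t : G") (simp_all add: measurable_slice[OF u_meas])
have "(NI (tensor (f t)) (%z. ennreal \<bar>w t z\<bar>)) = (NI (tensor (f t)) (%z. ennreal (\<bar>w t z\<bar> * indicator offdiag z)))"
	using space_tensor[OF s] by (intro nn_integral_cong) simp
also have "... = (NI (mu t) (%z. ennreal (\<bar>w t z\<bar> * indicator offdiag z)))"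
	unfolding mu_def by (rule nn_integral_tensor[OF s]) simp
also have "... < \<infinity>"
proof (cases "t : G")
	case True
	then show ?thesis unfolding w_def if_P[OF True] by (simp add: G_def)
qed (simp add: w_def)
finally show "integrable (tensor (f t)) (w t)"
	by (intro integrableI_bounded measurable_tensor[OF s mw]) simp
have "(NI (tensor (f t)) (%z. ennreal \<bar>kernel e z * w t z\<bar>)) = (NI (mu t) (%z. ennreal \<bar>kernel e z * w t z\<bar>))"
	unfolding mu_def by (rule nn_integral_tensor[OF s]) (auto simp: offdiag_def sigma_e_def)
also have "... < \<infinity>"
proof (cases "t : G")
	case True
	then show ?thesis unfolding w_def if_P[OF True] using kernel_nonneg[OF e(2)] by (simp add: G_def abs_mult)
qed (simp add: w_def)
finally show "integrable (tensor (f t)) (%z. kernel e z * w t z)"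
	by (intro integrableI_bounded measurable_tensor[OF s] borel_measurable_times kernel_measurable mw) simp
qed

lemma dens_curve_w: "dens_curve e T f w"
proof (rule dens_curve.intro[OF e T distr_f narrow w_integrable])
have "fst -` G \<inter> space (Tb \<Otimes>\<^sub>M (borel :: (real \<times> real) measure)) : sets (Tb \<Otimes>\<^sub>M (borel :: (real \<times> real) measure))"
	by (rule measurable_sets[OF measurable_fst G_sets])
then show "(%x. w (fst x) (snd x)) : bm (Tb \<Otimes>\<^sub>M borel)"
	unfolding w_def using measurable_compose[OF pair_Tb u_meas]
	by (intro measurable_If) (auto simp: vimage_def Int_def conj_commute)
have "(NI leb (%t. NI (sq (f t)) (%z. ennreal (kernel e z * \<bar>w t z\<bar>)))) <=
		(NI leb (%t. NI (mu t) (%z. ennreal (kernel e z * \<bar>u (t, z)\<bar>))))"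
	unfolding mu_def using kernel_nonneg[OF e(2)]
	by (intro nn_integral_mono ennreal_leI mult_left_mono) (simp_all add: w_def)
also have "... = (NI Th (%x. ennreal \<bar>u x\<bar>))" by (rule nn_Th[OF borel_measurable_abs[OF u_meas], symmetric])
also have "... < \<infinity>" using u_integrable by (simp add: integrable_iff_bounded)
finally show "(NI leb (%t. NI (sq (f t)) (%z. ennreal (kernel e z * \<bar>w t z\<bar>)))) < \<infinity>" .
fix ph assume ph: "ph : C1c T"
note i = u_vgrad_integrable[OF ph]
have "(LI leb (%t. LI (sq (f t)) (%z. kernel e z * vgrad ph (t, z) * w t z))) =
		(LI leb (%t. LI (mu t) (%z. kernel e z * (u (t, z) * vgrad ph (t, z)))))"
proof (rule integral_cong_AE)
	show "AE t in leb. (LI (sq (f t)) (%z. kernel e z * vgrad ph (t, z) * w t z)) = (LI (mu t) (%z. kernel e z * (u (t, z) * vgrad ph (t, z))))"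
		using AE_good
	proof eventually_elim
		case (elim t)
		then show ?case using good_G[OF elim] by (simp add: w_def mu_def ac_simps)
	qed
	show m: "(%t. LI (mu t) (%z. kernel e z * (u (t, z) * vgrad ph (t, z)))) : bm leb"
		using integral_Th(2)[OF i] by simp
	have "(%t. indicator G t :: real) : bm leb"
		by (intro measurable_restrict_borel_lebesgue borel_measurable_indicator G_sets)
	from borel_measurable_times[OF this m]
	have "(%t. indicator G t * (LI (mu t) (%z. kernel e z * (u (t, z) * vgrad ph (t, z))))) : bm leb" .
	moreover have "indicator G t * (LI (mu t) (%z. kernel e z * (u (t, z) * vgrad ph (t, z)))) =
			(LI (sq (f t)) (%z. kernel e z * vgrad ph (t, z) * w t z))" for t
		by (cases "t : G") (simp_all add: w_def mu_def ac_simps)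
	ultimately show "(%t. LI (sq (f t)) (%z. kernel e z * vgrad ph (t, z) * w t z)) : bm leb" by simp
qed
also have "... = lfun ph" unfolding repr[OF ph] by (rule integral_Th(3)[OF i, symmetric])
finally show "(LI leb (%t. LI (f t) (%v. tder ph (t, v)))) + (LI leb (%t. LI (sq (f t)) (%z. kernel e z * vgrad ph (t, z) * w t z))) = 0"
	by (simp add: lfun_def)
qed

end

section \<open>The metric derivative\<close>

lemma integral_indicator_Icc:
fixes g :: "real => real"
assumes g: "integrable (lebesgue_on {0..T}) g" and xy: "0 <= x" "y <= T"
shows "integrable (lebesgue_on {0..T}) (%t. indicator {x..y} t * g t)"
	and "(LI (lebesgue_on {0..T}) (%t. indicator {x..y} t * g t)) = integral {x..y} g"
proof -
have S: "{x..y} : sets (lebesgue_on {0..T})" using xy by (auto simp: sets_restrict_space_iff)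
show i: "integrable (lebesgue_on {0..T}) (%t. indicator {x..y} t * g t)"
	using integrable_mult_indicator[OF S g] by simp
have "(LI (lebesgue_on {0..T}) (%t. indicator {x..y} t * g t)) = integral {0..T} (%t. if t : {x..y} then g t else 0)"
	by (subst lebesgue_integral_eq_integral[OF i]) (auto simp: indicator_def intro!: arg_cong[of _ _ "integral {0..T}"])
also have "... = integral ({x..y} \<inter> {0..T}) g" by (rule integral_restrict_Int)
also have "{x..y} \<inter> {0..T} = {x..y}" using xy by auto
finally show "(LI (lebesgue_on {0..T}) (%t. indicator {x..y} t * g t)) = integral {x..y} g" .
qed

context flux_curve begin

sublocale W: dens_curve e T f w by (rule dens_curve_w)

sublocale C: continuity_eq e T f "%t. dens_flux (f t) (w t)"
by (rule continuity_eq.intro[OF e T W.CE_dens_flux])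

definition a2 :: "real => real" where "a2 t = (LI (mu t) (%z. kernel e z * (u (t, z))^2))"
definition q :: "nat => real => real" where "q n t = (LI (mu t) (%z. kernel e z * (u (t, z) * vgrad (Ph n) (t, z))))"
definition k1 :: "real => real" where "k1 t = (LI (mu t) (%z. kernel e z * \<bar>u (t, z)\<bar>))"

lemma
shows a2_integrable: "integrable leb a2" and q_integrable: "integrable leb (q n)" and k1_integrable: "integrable leb k1"
unfolding a2_def[abs_def] q_def[abs_def] k1_def[abs_def]
using integral_Th(2)[OF u_sq] integral_Th(2)[OF u_vgrad_integrable[OF Ph]] integral_Th(2)[OF integrable_abs[OF u_integrable]]
by simp_all

lemma a2_nonneg: "0 <= a2 t" and k1_nonneg: "0 <= k1 t"
unfolding a2_def k1_def using kernel_nonneg[OF e(2)] by (auto intro!: Bochner_Integration.integral_nonneg)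

lemma
assumes t: "good t"
shows good_sq_integrable: "integrable (mu t) (%z. kernel e z * (u (t, z))^2)"
	and good_abs_integrable: "integrable (mu t) (%z. kernel e z * \<bar>u (t, z)\<bar>)"
	and act_eq: "W.act t = ennreal (a2 t)"
proof -
have nn: "0 <= kernel e z" for z by (rule kernel_nonneg[OF e(2)])
show i: "integrable (mu t) (%z. kernel e z * (u (t, z))^2)"
	using t nn slice_measurable_mu(2)[OF t borel_measurable_power[OF u_meas, of 2]]
	by (intro integrableI_bounded) (auto simp: good_def)
show "integrable (mu t) (%z. kernel e z * \<bar>u (t, z)\<bar>)"
	using t nn slice_measurable_mu(2)[OF t borel_measurable_abs[OF u_meas]]
	by (intro integrableI_bounded) (auto simp: good_def abs_mult)
show "W.act t = ennreal (a2 t)"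
	unfolding W.act_def a2_def using nn good_G[OF t] i
	by (subst nn_integral_eq_integral[symmetric]) (auto simp: w_def mu_def)
qed

lemma good_mult_integrable:
assumes t: "good t" and g: "g : bm borel" "!!z. \<bar>g z\<bar> <= (B :: real)"
shows "integrable (mu t) (%z. kernel e z * (u (t, z) * g z))"
proof (rule Bochner_Integration.integrable_bound[OF integrable_mult_right[OF good_abs_integrable[OF t], of B]])
show "(%z. kernel e z * (u (t, z) * g z)) : bm (mu t)"
	by (intro measurable_mu[OF good_interior[OF t]] borel_measurable_times kernel_measurable measurable_slice u_meas g)
have "\<bar>kernel e z * (u (t, z) * g z)\<bar> <= \<bar>B * (kernel e z * \<bar>u (t, z)\<bar>)\<bar>" for z
proof -
	have "\<bar>kernel e z * u (t, z)\<bar> * \<bar>g z\<bar> <= \<bar>kernel e z * u (t, z)\<bar> * \<bar>B\<bar>"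
		using g(2)[of z] by (intro mult_left_mono) linarith+
	then show ?thesis by (simp add: abs_mult ac_simps)
qed
then show "AE z in mu t. norm (kernel e z * (u (t, z) * g z)) <= norm (B * (kernel e z * \<bar>u (t, z)\<bar>))" by simp
qed

text \<open>
By Cauchy--Schwarz with the distance of the gradients to \<open>u\<close> at time \<open>t\<close>.
\<close>

lemma good_limits:
assumes t: "good t"
shows "(%n. q n t) ----> a2 t" and "(%n. Q (Ph n) t) ----> a2 t"
proof -
define N where "N n = (LI (mu t) (%z. kernel e z * (u (t, z) - vgrad (Ph n) (t, z))^2))" for n
have N: "N ----> 0" unfolding N_def by (rule good_gap_tendsto(2)[OF t])
note iN = good_gap_tendsto(1)[OF t] and iu = good_sq_integrable[OF t]
have iq: "integrable (mu t) (%z. kernel e z * (u (t, z) * vgrad (Ph n) (t, z)))" for n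
proof -
	obtain B where B: "!!x. \<bar>vgrad (Ph n) x\<bar> <= B" by (rule vgrad_bounded[OF Ph]) (rule that; assumption)
	show ?thesis by (rule good_mult_integrable[OF t measurable_slice[OF vgrad_measurable[OF Ph]] B])
qed
have sq: "(sqrt (kernel e z) * x)^2 = kernel e z * x^2" for z x
	using kernel_nonneg[OF e(2), of z] by (simp add: power_mult_distrib)
have m: "(%z. sqrt (kernel e z) * h (t, z)) : bm (mu t)" if "h : bm borel" for h
	using that by (intro measurable_mu[OF good_interior[OF t]] borel_measurable_times measurable_slice measurable_compose[OF kernel_measurable]) simp_all
have mg: "(%x. u x - vgrad (Ph n) x) : bm borel" for n
	by (intro borel_measurable_diff u_meas vgrad_measurable[OF Ph])
have CS: "(a2 t - q n t)^2 <= N n * a2 t" for n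
proof -
	have "a2 t - q n t = (LI (mu t) (%z. kernel e z * (u (t, z))^2 - kernel e z * (u (t, z) * vgrad (Ph n) (t, z))))"
		unfolding a2_def q_def by (rule Bochner_Integration.integral_diff[OF iu iq, symmetric])
	also have "... = (LI (mu t) (%z. (sqrt (kernel e z) * (u (t, z) - vgrad (Ph n) (t, z))) * (sqrt (kernel e z) * u (t, z))))"
	proof (rule Bochner_Integration.integral_cong[OF refl])
		fix z
		have "sqrt (kernel e z) * sqrt (kernel e z) = kernel e z" using kernel_nonneg[OF e(2), of z] by simp
		moreover have "(r * x) * (r * y) = (r * r) * (x * y)" for r x y :: real by (simp only: ac_simps)
		ultimately have key: "(sqrt (kernel e z) * x) * (sqrt (kernel e z) * y) = kernel e z * (x * y)" for x y by simp
		show "kernel e z * (u (t, z))^2 - kernel e z * (u (t, z) * vgrad (Ph n) (t, z)) =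
				(sqrt (kernel e z) * (u (t, z) - vgrad (Ph n) (t, z))) * (sqrt (kernel e z) * u (t, z))"
			unfolding key by (simp add: algebra_simps power2_eq_square)
	qed
	finally have "a2 t - q n t = (LI (mu t) (%z. (sqrt (kernel e z) * (u (t, z) - vgrad (Ph n) (t, z))) * (sqrt (kernel e z) * u (t, z))))" .
	then show ?thesis
		using Cauchy_Schwarz_integral(2)[OF m[OF mg] m[OF u_meas], of n, unfolded sq, OF iN iu] by (simp add: N_def a2_def)
qed
have "(%n. (a2 t - q n t)^2) ----> 0"
	by (rule tendsto_sandwich[OF _ _ tendsto_const tendsto_mult_left_zero[OF N, of "a2 t"]]) (auto simp: CS)
from tendsto_real_sqrt[OF this] have "(%n. \<bar>a2 t - q n t\<bar>) ----> 0" by simp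
then have "(%n. a2 t - q n t) ----> 0" by (simp add: tendsto_rabs_zero_iff)
from tendsto_diff[OF tendsto_const[of "a2 t"] this] show q: "(%n. q n t) ----> a2 t" by simp
have Qn: "Q (Ph n) t = N n - a2 t + 2 * q n t" for n
proof -
	have "Q (Ph n) t = (LI (mu t) (%z. kernel e z * (vgrad (Ph n) (t, z))^2))"
		by (simp add: Q_def Qform_def vgrad_def mu_def)
	also have "... = (LI (mu t) (%z. kernel e z * (u (t, z) - vgrad (Ph n) (t, z))^2 - kernel e z * (u (t, z))^2 + 2 * (kernel e z * (u (t, z) * vgrad (Ph n) (t, z)))))"
		by (intro Bochner_Integration.integral_cong) (auto simp: power2_diff algebra_simps)
	also have "... = N n - a2 t + 2 * q n t" using iN iu iq by (simp add: N_def a2_def q_def)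
	finally show ?thesis .
qed
have "(%n. N n - a2 t + 2 * q n t) ----> 0 - a2 t + 2 * a2 t" by (intro tendsto_intros N q)
then show "(%n. Q (Ph n) t) ----> a2 t" unfolding Qn by simp
qed

definition lebesgue_pt :: "(real => real) => real => bool" where
"lebesgue_pt g t \<longleftrightarrow> (ALL et>0. EX de>0. ALL x y. 0 <= x & x <= t & t <= y & y <= T & x < y & y - x < de -->
		\<bar>integral {x..y} g - (y - x) * g t\<bar> <= et * (y - x))"

lemma AE_lebesgue_pt: "integrable leb g ==> AE t in leb. lebesgue_pt g t"
unfolding lebesgue_pt_def by (rule AE_Lebesgue_point)

lemma lebesgue_ptD:
assumes "lebesgue_pt g t" "0 < et"
obtains de where "0 < de" "!!x y. 0 <= x ==> x <= t ==> t <= y ==> y <= T ==> x < y ==> y - x < de ==>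
		\<bar>integral {x..y} g - (y - x) * g t\<bar> <= et * (y - x)"
proof -
obtain de where de: "0 < de" "ALL x y. 0 <= x & x <= t & t <= y & y <= T & x < y & y - x < de -->
		\<bar>integral {x..y} g - (y - x) * g t\<bar> <= et * (y - x)"
	using assms(1)[unfolded lebesgue_pt_def, rule_format, OF assms(2)] by auto
show ?thesis by (rule that[OF de(1)], rule de(2)[rule_format]) simp
qed

lemma dA_le_a2:
assumes st: "s : {0..T}" "t : {0..T}" "s ~= t"
shows "dA e (f s) (f t) <= ennreal (sqrt (\<bar>t - s\<bar> * integral {min s t..max s t} a2))"
proof -
let ?I = "{min s t..max s t}"
have sub: "?I \<subseteq> {0..T}" using st by auto
have ia: "integrable (lebesgue_on ?I) a2"
	by (rule Equivalence_Lebesgue_Henstock_Integration.integrable_subinterval[OF a2_integrable sub])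
have "AE r in lebesgue. r : {0..T} --> good r"
	using AE_good by (simp add: AE_restrict_space_iff)
then have AE: "AE r in lebesgue_on ?I. good r"
	using sub by (auto simp: AE_restrict_space_iff elim!: eventually_mono)
have "(NI (lebesgue_on ?I) (%r. W.act r)) = (NI (lebesgue_on ?I) (%r. ennreal (a2 r)))"
	using AE by (intro nn_integral_cong_AE) (auto simp: act_eq elim!: eventually_mono)
also have "... = ennreal (integral ?I a2)"
	using nn_integral_eq_integral[OF ia] a2_nonneg lebesgue_integral_eq_integral[OF ia] by simp
finally have "dA e (f s) (f t) <= ennsqrt (ennreal \<bar>t - s\<bar> * ennreal (integral ?I a2))"
	using W.dA_le_act[OF st] by simp
moreover have "0 <= integral ?I a2" using a2_nonneg lebesgue_integral_eq_integral[OF ia] Bochner_Integration.integral_nonneg[of "lebesgue_on ?I" a2] by simp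
ultimately show ?thesis by (simp add: ennsqrt_def ennreal_mult'[symmetric])
qed

lemma rate_good:
assumes r: "good r" and p: "p : bm borel" "!!v. \<bar>p v\<bar> <= B"
shows "C.rate p r = (LI (mu r) (%z. kernel e z * (u (r, z) * (p (snd z) - p (fst z)))))"
proof -
note rT = good_interior[OF r]
let ?d = "%z. p (snd z) - p (fst z)"
have md: "?d : bm borel" by (rule ngrad_measurable[OF p(1)])
have bd: "\<bar>?d z\<bar> <= 2 * B" for z using p(2)[of "snd z"] p(2)[of "fst z"] by linarith
have "C.rate p r = (LI (tensor (f r)) (%z. kernel e z * ?d z * w r z))"
	unfolding C.rate_def
	by (rule signed_integral_dens_flux[OF distr_f[OF rT] w_integrable(1)[OF rT]])
		(intro borel_measurable_times kernel_measurable md, rule W.integrable_bounded_mult[OF rT md bd])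
also have "... = (LI (mu r) (%z. kernel e z * ?d z * w r z))"
	unfolding mu_def by (rule integral_tensor(1)[OF real_distribution_sets[OF distr_f[OF rT]]]) (auto simp: offdiag_def sigma_e_def)
also have "... = (LI (mu r) (%z. kernel e z * (u (r, z) * ?d z)))"
	using good_G[OF r] by (simp add: w_def ac_simps)
finally show ?thesis .
qed

text \<open>
  At a common Lebesgue point of \<open>q n\<close> and of the total flux, the integral of the frozen test
  function \<open>Ph n (t, _)\<close> is differentiable along the curve, with derivative \<open>q n t\<close>.
\<close>

lemma frozen_derivative:
assumes t: "t : {0..T}" "lebesgue_pt (q n) t" "lebesgue_pt k1 t" and et: "0 < et"
obtains de where "0 < de" "!!x y. 0 <= x ==> x <= t ==> t <= y ==> y <= T ==> x < y ==> y - x < de ==>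
	\<bar>S (Ph n) t y - S (Ph n) t x - (y - x) * q n t\<bar> <= et * (y - x)"
proof -
define om where "om = et / (4 * (k1 t + 1))"
have om: "0 < om" "2 * om * (k1 t + 1) = et / 2" using et k1_nonneg[of t] by (auto simp: om_def field_simps)
obtain de1 where de1: "0 < de1" "!!x y. dist x y <= de1 ==> \<bar>vder (Ph n) x - vder (Ph n) y\<bar> <= om"
	by (rule C1c_vder_uniform[OF Ph T om(1)]) (rule that; assumption)
obtain de2 where de2: "0 < de2" "!!x y. 0 <= x ==> x <= t ==> t <= y ==> y <= T ==> x < y ==> y - x < de2 ==>
		\<bar>integral {x..y} (q n) - (y - x) * q n t\<bar> <= et / 2 * (y - x)"
	by (rule lebesgue_ptD[OF t(2) half_gt_zero[OF et]]) (rule that; assumption)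
obtain de3 where de3: "0 < de3" "!!x y. 0 <= x ==> x <= t ==> t <= y ==> y <= T ==> x < y ==> y - x < de3 ==>
		\<bar>integral {x..y} k1 - (y - x) * k1 t\<bar> <= 1 * (y - x)"
	by (rule lebesgue_ptD[OF t(3) zero_less_one]) (rule that; assumption)
obtain B where B: "0 < B" "!!x. \<bar>Ph n x\<bar> <= B" "!!x. \<bar>tder (Ph n) x\<bar> <= B" "!!x. \<bar>vder (Ph n) x\<bar> <= B"
	by (rule C1c_bounds[OF Ph T]) (rule that; assumption)
let ?p = "%v. vder (Ph n) (t, v)"
have mp: "?p : bm borel" by (rule borel_measurable_continuous_onI[OF test_slice(3)[OF Ph]])
have ip: "integrable leb (C.rate ?p)" by (rule C.rate_integrable[OF mp B(4)])
have rate: "\<bar>C.rate ?p r - q n r\<bar> <= 2 * om * k1 r" if r: "good r" "\<bar>r - t\<bar> <= de1" for r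
proof -
	note rT = good_interior[OF r(1)]
	let ?d = "%z. ?p (snd z) - ?p (fst z)"
	have md: "?d : bm borel" by (rule ngrad_measurable[OF mp])
	have bd: "\<bar>?d z\<bar> <= 2 * B" for z using B(4)[of "(t, snd z)"] B(4)[of "(t, fst z)"] by linarith
	note eq = rate_good[OF r(1) mp B(4)]
	obtain B' where B': "!!x. \<bar>vgrad (Ph n) x\<bar> <= B'" by (rule vgrad_bounded[OF Ph]) (rule that; assumption)
	note i1 = good_mult_integrable[OF r(1) md bd]
	note i2 = good_mult_integrable[OF r(1) measurable_slice[OF vgrad_measurable[OF Ph[of n]], of r] B']
	have "C.rate ?p r - q n r = (LI (mu r) (%z. kernel e z * (u (r, z) * ?d z) - kernel e z * (u (r, z) * vgrad (Ph n) (r, z))))"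
		unfolding eq q_def by (rule Bochner_Integration.integral_diff[OF i1 i2, symmetric])
	then have "\<bar>C.rate ?p r - q n r\<bar> <= (LI (mu r) (%z. \<bar>kernel e z * (u (r, z) * ?d z) - kernel e z * (u (r, z) * vgrad (Ph n) (r, z))\<bar>))"
		by (simp only: integral_abs_bound)
	also have "... <= (LI (mu r) (%z. 2 * om * (kernel e z * \<bar>u (r, z)\<bar>)))"
	proof (rule integral_mono)
		show "integrable (mu r) (%z. \<bar>kernel e z * (u (r, z) * ?d z) - kernel e z * (u (r, z) * vgrad (Ph n) (r, z))\<bar>)"
			by (rule integrable_abs[OF Bochner_Integration.integrable_diff[OF i1 i2]])
		show "integrable (mu r) (%z. 2 * om * (kernel e z * \<bar>u (r, z)\<bar>))"
			by (rule integrable_mult_right[OF good_abs_integrable[OF r(1)]])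
		fix z
		have "\<bar>vder (Ph n) (t, v) - vder (Ph n) (r, v)\<bar> <= om" for v
			using r(2) by (intro de1(2)) (simp add: dist_Pair_Pair dist_real_def abs_minus_commute)
		moreover have "\<bar>a - b\<bar> <= om ==> \<bar>c - d\<bar> <= om ==> \<bar>a - c - (b - d)\<bar> <= 2 * om" for a b c d
			by linarith
		ultimately have "\<bar>?d z - vgrad (Ph n) (r, z)\<bar> <= 2 * om"
			unfolding vgrad_def fst_conv snd_conv by blast
		then have *: "\<bar>kernel e z * u (r, z)\<bar> * \<bar>?d z - vgrad (Ph n) (r, z)\<bar> <= \<bar>kernel e z * u (r, z)\<bar> * (2 * om)"
			by (rule mult_left_mono) simp
		show "\<bar>kernel e z * (u (r, z) * ?d z) - kernel e z * (u (r, z) * vgrad (Ph n) (r, z))\<bar> <= 2 * om * (kernel e z * \<bar>u (r, z)\<bar>)"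
		proof -
			have "\<bar>a * (b * c) - a * (b * d)\<bar> = \<bar>a * b\<bar> * \<bar>c - d\<bar>" for a b c d :: real
				by (simp add: abs_mult[symmetric] algebra_simps)
			moreover have "2 * om * (kernel e z * \<bar>u (r, z)\<bar>) = \<bar>kernel e z * u (r, z)\<bar> * (2 * om)"
				using kernel_nonneg[OF e(2), of z] by (simp add: abs_mult)
			ultimately show ?thesis using * by (simp only:)
		qed
	qed
	also have "... = 2 * om * k1 r" by (simp add: k1_def)
	finally show ?thesis .
qed
show ?thesis
proof (rule that[of "min de1 (min de2 de3)"])
	fix x y assume xy: "0 <= x" "x <= t" "t <= y" "y <= T" "x < y" "y - x < min de1 (min de2 de3)"
	have eq1: "S (Ph n) t y - S (Ph n) t x = (LI leb (%r. indicator {x..y} r * C.rate ?p r))"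
		unfolding S_def using xy T
		by (intro C.flow[OF jb_f C1c_partials(2)[OF Ph] test_slice(3)[OF Ph] B(4)]) auto
	have eq2: "S (Ph n) t y - S (Ph n) t x - integral {x..y} (q n) = (LI leb (%r. indicator {x..y} r * C.rate ?p r - indicator {x..y} r * q n r))"
		unfolding eq1 using integral_indicator_Icc[OF ip xy(1,4)] integral_indicator_Icc[OF q_integrable xy(1,4), of n] by simp
	have "\<bar>S (Ph n) t y - S (Ph n) t x - integral {x..y} (q n)\<bar> <=
			(LI leb (%r. \<bar>indicator {x..y} r * C.rate ?p r - indicator {x..y} r * q n r\<bar>))"
		unfolding eq2 by (rule integral_abs_bound)
	also have "... <= (LI leb (%r. 2 * om * (indicator {x..y} r * k1 r)))"
	proof (rule integral_mono_AE)
		show "integrable leb (%r. \<bar>indicator {x..y} r * C.rate ?p r - indicator {x..y} r * q n r\<bar>)"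
			by (intro integrable_abs Bochner_Integration.integrable_diff integral_indicator_Icc ip q_integrable xy)
		show "integrable leb (%r. 2 * om * (indicator {x..y} r * k1 r))"
			by (intro integrable_mult_right integral_indicator_Icc k1_integrable xy)
		show "AE r in leb. \<bar>indicator {x..y} r * C.rate ?p r - indicator {x..y} r * q n r\<bar> <= 2 * om * (indicator {x..y} r * k1 r)"
			using AE_good
		proof eventually_elim
			case (elim r)
			show ?case
			proof (cases "r : {x..y}")
				case True
				then have "\<bar>r - t\<bar> <= de1" using xy by auto
				then show ?thesis using rate[OF elim] True by simp
			qed simp
		qed
	qed
	also have "... = 2 * om * integral {x..y} k1"
		using integral_indicator_Icc[OF k1_integrable xy(1,4)] by simp
	also have "... <= 2 * om * ((k1 t + 1) * (y - x))"
	proof (rule mult_left_mono)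
		have "\<bar>integral {x..y} k1 - (y - x) * k1 t\<bar> <= 1 * (y - x)" using xy by (intro de3(2)) auto
		then show "integral {x..y} k1 <= (k1 t + 1) * (y - x)" by (simp add: algebra_simps)
	qed (use om in auto)
	also have "... = et / 2 * (y - x)" using om(2) by (metis mult.assoc)
	finally have A: "\<bar>S (Ph n) t y - S (Ph n) t x - integral {x..y} (q n)\<bar> <= et / 2 * (y - x)" .
	have "\<bar>integral {x..y} (q n) - (y - x) * q n t\<bar> <= et / 2 * (y - x)" using xy by (intro de2(2)) auto
	moreover have "et * (y - x) = et / 2 * (y - x) + et / 2 * (y - x)" by simp
	ultimately show "\<bar>S (Ph n) t y - S (Ph n) t x - (y - x) * q n t\<bar> <= et * (y - x)" using A by linarith
qed (use de1 de2 de3 in auto)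
qed

end

context flux_curve begin

definition reg :: "real => bool" where
"reg t \<longleftrightarrow> good t & lebesgue_pt a2 t & lebesgue_pt k1 t & (ALL n. lebesgue_pt (q n) t)"

lemma AE_reg: "AE t in leb. reg t"
proof -
have "AE t in leb. ALL n. lebesgue_pt (q n) t"
	by (subst AE_all_countable) (intro allI AE_lebesgue_pt q_integrable)
then show ?thesis
	using AE_good AE_lebesgue_pt[OF a2_integrable] AE_lebesgue_pt[OF k1_integrable]
	by eventually_elim (simp add: reg_def)
qed

text \<open>
The piece of the curve between \<open>t\<close> and \<open>t + h\<close> is a competitor, and its action per unit of time is
close to \<open>a2 t\<close> at a Lebesgue point.
\<close>

lemma dA_upper:
assumes t: "reg t" and et: "0 < et"
obtains de where "0 < de" "!!h. h ~= 0 ==> \<bar>h\<bar> < de ==> t + h : {0<..<T}"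
	"!!h. h ~= 0 ==> \<bar>h\<bar> < de ==> dA e (f (t + h)) (f t) <= ennreal (\<bar>h\<bar> * sqrt (a2 t + et))"
	"!!h. h ~= 0 ==> \<bar>h\<bar> < de ==> dA e (f t) (f (t + h)) <= ennreal (\<bar>h\<bar> * sqrt (a2 t + et))"
proof -
have t0: "0 < t" "t < T" and la: "lebesgue_pt a2 t" using t by (auto simp: reg_def good_def)
obtain de where de: "0 < de" "!!x y. 0 <= x ==> x <= t ==> t <= y ==> y <= T ==> x < y ==> y - x < de ==>
		\<bar>integral {x..y} a2 - (y - x) * a2 t\<bar> <= et * (y - x)"
	by (rule lebesgue_ptD[OF la et]) (rule that; assumption)
have in0: "t + h : {0<..<T}" if "\<bar>h\<bar> < min de (min t (T - t))" for h using that by auto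
have le: "sqrt (\<bar>h\<bar> * integral {x..y} a2) <= \<bar>h\<bar> * sqrt (a2 t + et)"
	if h: "h ~= 0" "\<bar>h\<bar> < min de (min t (T - t))" and xy: "x = min t (t + h)" "y = max t (t + h)" for h x y
proof -
	have y: "y - x = \<bar>h\<bar>" "x < y" using h xy by (auto simp: min_def max_def)
	have "\<bar>integral {x..y} a2 - (y - x) * a2 t\<bar> <= et * (y - x)"
		using in0[OF h(2)] t0 h y by (intro de(2)) (auto simp: xy)
	then have "integral {x..y} a2 <= \<bar>h\<bar> * (a2 t + et)" unfolding y(1) by (simp add: algebra_simps)
	then have "\<bar>h\<bar> * integral {x..y} a2 <= \<bar>h\<bar> * (\<bar>h\<bar> * (a2 t + et))" by (rule mult_left_mono) simp
	then have "sqrt (\<bar>h\<bar> * integral {x..y} a2) <= sqrt (\<bar>h\<bar> * (\<bar>h\<bar> * (a2 t + et)))" by simp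
	also have "... = \<bar>h\<bar> * sqrt (a2 t + et)" by (simp add: real_sqrt_mult mult.assoc[symmetric])
	finally show ?thesis .
qed
show ?thesis
proof (rule that[of "min de (min t (T - t))"])
	fix h :: real assume h: "h ~= 0" "\<bar>h\<bar> < min de (min t (T - t))"
	show "t + h : {0<..<T}" by (rule in0[OF h(2)])
	then have th: "t + h : {0..T}" "t : {0..T}" using t0 by auto
	have "dA e (f (t + h)) (f t) <= ennreal (sqrt (\<bar>t - (t + h)\<bar> * integral {min (t + h) t..max (t + h) t} a2))"
		using th h by (intro dA_le_a2) auto
	also have "... <= ennreal (\<bar>h\<bar> * sqrt (a2 t + et))"
		using le[OF h refl refl] by (intro ennreal_leI) (simp add: min.commute max.commute)
	finally show "dA e (f (t + h)) (f t) <= ennreal (\<bar>h\<bar> * sqrt (a2 t + et))" .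
	have "dA e (f t) (f (t + h)) <= ennreal (sqrt (\<bar>(t + h) - t\<bar> * integral {min t (t + h)..max t (t + h)} a2))"
		using th h by (intro dA_le_a2) auto
	also have "... <= ennreal (\<bar>h\<bar> * sqrt (a2 t + et))"
		using le[OF h refl refl] by (intro ennreal_leI) simp
	finally show "dA e (f t) (f (t + h)) <= ennreal (\<bar>h\<bar> * sqrt (a2 t + et))" .
qed (use de t0 in auto)
qed

text \<open>
  Conversely the cost cannot be smaller: the increment of the test function \<open>Ph n (t, _)\<close>, which is
  about \<open>h * q n t\<close>, is at most the cost times the square root of \<open>Q (Ph n) t\<close>, and both
  \<open>q n t\<close> and \<open>Q (Ph n) t\<close> tend to \<open>a2 t\<close>.
\<close>

lemma dA_lower:
assumes t: "reg t" and c: "0 < c" "c^2 < a2 t"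
obtains de where "0 < de" "!!h. h ~= 0 ==> \<bar>h\<bar> < de ==> ennreal (\<bar>h\<bar> * c) <= dA e (f (t + h)) (f t)"
proof -
have gt: "good t" using t by (simp add: reg_def)
have tI: "t : {0<..<T}" "t : {0..T}" using gt by (auto simp: good_def)
have a: "0 < a2 t" using c zero_le_power2[of c] by linarith
have "(%n. (q n t)^2 - c^2 * Q (Ph n) t) ----> (a2 t)^2 - c^2 * a2 t"
	by (intro tendsto_intros good_limits[OF gt])
moreover have "0 < (a2 t)^2 - c^2 * a2 t" using a c by (simp add: power2_eq_square)
ultimately have "eventually (%n. 0 < (q n t)^2 - c^2 * Q (Ph n) t) sequentially" by (rule order_tendstoD)
moreover have "eventually (%n. 0 < q n t) sequentially" by (rule order_tendstoD(1)[OF good_limits(1)[OF gt] a])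
ultimately have "eventually (%n. 0 < (q n t)^2 - c^2 * Q (Ph n) t & 0 < q n t) sequentially" by (rule eventually_conj)
then obtain n where n: "0 < (q n t)^2 - c^2 * Q (Ph n) t" "0 < q n t"
	using eventually_sequentially by auto
have "((%et. (q n t - et)^2 - c^2 * (Q (Ph n) t + et + et)) \<longlongrightarrow> (q n t - 0)^2 - c^2 * (Q (Ph n) t + 0 + 0)) (at_right 0)"
	by (intro tendsto_intros)
then have "eventually (%et. 0 < (q n t - et)^2 - c^2 * (Q (Ph n) t + et + et)) (at_right 0)"
	by (rule order_tendstoD(1)) (use n(1) in \<open>simp only: add_0_right diff_0_right\<close>)
moreover have "eventually (%et. et < q n t) (at_right 0)" using n(2) by (auto simp: eventually_at_right_field)
ultimately have "eventually (%et. 0 < (q n t - et)^2 - c^2 * (Q (Ph n) t + et + et) & et < q n t) (at_right 0)"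
	by (rule eventually_conj)
then obtain b where b: "0 < b" "!!et. 0 < et ==> et < b ==> 0 < (q n t - et)^2 - c^2 * (Q (Ph n) t + et + et) & et < q n t"
	unfolding eventually_at_right_field by auto
define et where "et = b / 2"
have et: "0 < et" "c^2 * (Q (Ph n) t + et + et) < (q n t - et)^2" "et < q n t"
	using b(1) b(2)[of et] by (auto simp: et_def)
obtain d0 where d0: "0 < d0"
	"!!d s t nu. 0 < d ==> d < d0 ==> s : {0<..<T} ==> dA e (f s) nu < ennreal d ==>
		((LI nu (%v. Ph n (t, v))) - (LI (f s) (%v. Ph n (t, v))))^2 <= d^2 * (Qform e (f s) (%v. vder (Ph n) (t, v)) + et)"
	"!!d s t nu. 0 < d ==> d < d0 ==> s : {0<..<T} ==> dA e (f s) nu < ennreal d ==>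
		Qform e nu (%v. vder (Ph n) (t, v)) <= Qform e (f s) (%v. vder (Ph n) (t, v)) + et"
	by (rule test_function_increment[OF Ph et(1)]) (rule that; assumption)
have lq: "lebesgue_pt (q n) t" "lebesgue_pt k1 t" using t by (simp_all add: reg_def)
obtain de1 where de1: "0 < de1" "!!x y. 0 <= x ==> x <= t ==> t <= y ==> y <= T ==> x < y ==> y - x < de1 ==>
	\<bar>S (Ph n) t y - S (Ph n) t x - (y - x) * q n t\<bar> <= et * (y - x)"
	by (rule frozen_derivative[OF tI(2) lq et(1)]) (rule that; assumption)
obtain de2 where de2: "0 < de2" "!!h. h ~= 0 ==> \<bar>h\<bar> < de2 ==> t + h : {0<..<T}"
	"!!h. h ~= 0 ==> \<bar>h\<bar> < de2 ==> dA e (f (t + h)) (f t) <= ennreal (\<bar>h\<bar> * sqrt (a2 t + 1))"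
	"!!h. h ~= 0 ==> \<bar>h\<bar> < de2 ==> dA e (f t) (f (t + h)) <= ennreal (\<bar>h\<bar> * sqrt (a2 t + 1))"
	by (rule dA_upper[OF t zero_less_one]) (rule that; assumption)
define M where "M = c + sqrt (a2 t + 1) + 1"
have M: "0 < M" "c <= M" "sqrt (a2 t + 1) < M" using c a by (auto simp: M_def intro!: add_pos_nonneg)
show ?thesis
proof (rule that[of "min (min de1 de2) (d0 / M)"])
	fix h :: real assume h: "h ~= 0" "\<bar>h\<bar> < min (min de1 de2) (d0 / M)"
	then have hM: "\<bar>h\<bar> * M < d0" using M by (simp add: pos_less_divide_eq)
	have "\<bar>h\<bar> * c <= \<bar>h\<bar> * M" using M by (intro mult_left_mono) auto
	from le_less_trans[OF this hM] have hc: "0 < \<bar>h\<bar> * c" "\<bar>h\<bar> * c < d0" using h c by auto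
	have th: "t + h : {0<..<T}" using h by (intro de2(2)) auto
	show "ennreal (\<bar>h\<bar> * c) <= dA e (f (t + h)) (f t)"
	proof (rule ccontr)
		assume "\<not> ennreal (\<bar>h\<bar> * c) <= dA e (f (t + h)) (f t)"
		then have lt: "dA e (f (t + h)) (f t) < ennreal (\<bar>h\<bar> * c)" by simp
		have "dA e (f t) (f (t + h)) <= ennreal (\<bar>h\<bar> * sqrt (a2 t + 1))" using h by (intro de2(4)) auto
		also have "... < ennreal (\<bar>h\<bar> * M)" using h M a by (intro ennreal_lessI mult_strict_left_mono mult_pos_pos) auto
		finally have lt': "dA e (f t) (f (t + h)) < ennreal (\<bar>h\<bar> * M)" .
		have "0 < \<bar>h\<bar> * M" using h M by simp
		from d0(3)[OF this hM tI(1) lt', of t]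
		have Qh: "Qform e (f (t + h)) (%v. vder (Ph n) (t, v)) <= Q (Ph n) t + et" by (simp add: Q_def)
		have "(S (Ph n) t t - S (Ph n) t (t + h))^2 <= (\<bar>h\<bar> * c)^2 * (Qform e (f (t + h)) (%v. vder (Ph n) (t, v)) + et)"
			unfolding S_def by (rule d0(2)[OF hc th lt])
		also have "... <= (\<bar>h\<bar> * c)^2 * (Q (Ph n) t + et + et)" using Qh by (intro mult_left_mono) auto
		also have "... = \<bar>h\<bar>^2 * (c^2 * (Q (Ph n) t + et + et))" by (simp add: power_mult_distrib)
		also have "... < \<bar>h\<bar>^2 * (q n t - et)^2" using h by (intro mult_strict_left_mono et(2)) auto
		also have "... = (\<bar>h\<bar> * (q n t - et))^2" by (simp add: power_mult_distrib)
		finally have up: "(S (Ph n) t t - S (Ph n) t (t + h))^2 < (\<bar>h\<bar> * (q n t - et))^2" .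
		have arith: "\<bar>x - a\<bar> <= b ==> \<bar>x\<bar> = y ==> d = a - b ==> d <= y" for a b d x y :: real by linarith
		have "\<bar>S (Ph n) t (max t (t + h)) - S (Ph n) t (min t (t + h)) - \<bar>h\<bar> * q n t\<bar> <= et * \<bar>h\<bar>"
			using de1(2)[of "min t (t + h)" "max t (t + h)"] h th tI by (auto simp: min_def max_def split: if_splits)
		moreover have "\<bar>S (Ph n) t (max t (t + h)) - S (Ph n) t (min t (t + h))\<bar> = \<bar>S (Ph n) t t - S (Ph n) t (t + h)\<bar>"
			by (simp add: min_def max_def abs_minus_commute)
		moreover have "\<bar>h\<bar> * (q n t - et) = \<bar>h\<bar> * q n t - et * \<bar>h\<bar>" by (simp add: algebra_simps)
		ultimately have "\<bar>h\<bar> * (q n t - et) <= \<bar>S (Ph n) t t - S (Ph n) t (t + h)\<bar>" by (rule arith)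
		then have "(\<bar>h\<bar> * (q n t - et))^2 <= \<bar>S (Ph n) t t - S (Ph n) t (t + h)\<bar>^2"
			using et(3) by (intro power_mono) auto
		then show False using up by simp
	qed
qed (use de1 de2 d0 M in auto)
qed

lemma metric_deriv_eq:
assumes t: "reg t"
shows "metric_deriv e f t = ennreal (sqrt (a2 t))"
proof -
have div: "ennreal (\<bar>h\<bar> * c) / ennreal \<bar>h\<bar> = ennreal c" if "h ~= 0" "0 <= c" for h c :: real
	using that by (subst divide_ennreal) auto
have "((%h. dA e (f (t + h)) (f t) / ennreal \<bar>h\<bar>) \<longlongrightarrow> ennreal (sqrt (a2 t))) (at 0)"
proof (rule order_tendstoI)
	fix a assume "a < ennreal (sqrt (a2 t))"
	then obtain c where c: "0 <= c" "a = ennreal c" "c < sqrt (a2 t)"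
		by (cases a) (auto simp: ennreal_less_iff top_unique)
	define c' where "c' = (c + sqrt (a2 t)) / 2"
	have c': "0 < c'" "c < c'" "c' < sqrt (a2 t)" using c by (auto simp: c'_def)
	have "c'^2 < (sqrt (a2 t))^2" using c' by (intro power_strict_mono) auto
	then have "c'^2 < a2 t" using a2_nonneg by simp
	then obtain de where de: "0 < de" "!!h. h ~= 0 ==> \<bar>h\<bar> < de ==> ennreal (\<bar>h\<bar> * c') <= dA e (f (t + h)) (f t)"
		by (rule dA_lower[OF t c'(1)]) (rule that; assumption)
	have "a < dA e (f (t + h)) (f t) / ennreal \<bar>h\<bar>" if h: "h ~= 0" "\<bar>h\<bar> < de" for h
	proof -
		have "a < ennreal c'" using c c' by (simp add: ennreal_less_iff)
		also have "... = ennreal (\<bar>h\<bar> * c') / ennreal \<bar>h\<bar>" using h c' by (simp add: div)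
		also have "... <= dA e (f (t + h)) (f t) / ennreal \<bar>h\<bar>" by (rule divide_right_mono_ennreal[OF de(2)[OF h]])
		finally show ?thesis .
	qed
	then show "eventually (%h. a < dA e (f (t + h)) (f t) / ennreal \<bar>h\<bar>) (at 0)"
		using de(1) unfolding eventually_at by (intro exI[of _ de]) (auto simp: dist_real_def)
next
	fix a assume a: "ennreal (sqrt (a2 t)) < a"
	have "((%et. ennreal (sqrt (a2 t + et))) \<longlongrightarrow> ennreal (sqrt (a2 t + 0))) (at_right 0)"
		by (intro tendsto_intros)
	then have "eventually (%et. ennreal (sqrt (a2 t + et)) < a) (at_right 0)"
		using a by (intro order_tendstoD(2)) simp_all
	then obtain b where b: "0 < b" "!!et. 0 < et ==> et < b ==> ennreal (sqrt (a2 t + et)) < a"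
		unfolding eventually_at_right_field by auto
	obtain de where de: "0 < de" "!!h. h ~= 0 ==> \<bar>h\<bar> < de ==> t + h : {0<..<T}"
		"!!h. h ~= 0 ==> \<bar>h\<bar> < de ==> dA e (f (t + h)) (f t) <= ennreal (\<bar>h\<bar> * sqrt (a2 t + b / 2))"
		"!!h. h ~= 0 ==> \<bar>h\<bar> < de ==> dA e (f t) (f (t + h)) <= ennreal (\<bar>h\<bar> * sqrt (a2 t + b / 2))"
		by (rule dA_upper[OF t half_gt_zero[OF b(1)]]) (rule that; assumption)
	have "dA e (f (t + h)) (f t) / ennreal \<bar>h\<bar> < a" if h: "h ~= 0" "\<bar>h\<bar> < de" for h
	proof -
		have "dA e (f (t + h)) (f t) / ennreal \<bar>h\<bar> <= ennreal (\<bar>h\<bar> * sqrt (a2 t + b / 2)) / ennreal \<bar>h\<bar>"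
			by (rule divide_right_mono_ennreal[OF de(3)[OF h]])
		also have "... = ennreal (sqrt (a2 t + b / 2))" using h b a2_nonneg[of t] by (intro div) auto
		also have "... < a" using b by (intro b(2)) auto
		finally show ?thesis .
	qed
	then show "eventually (%h. dA e (f (t + h)) (f t) / ennreal \<bar>h\<bar> < a) (at 0)"
		using de(1) unfolding eventually_at by (intro exI[of _ de]) (auto simp: dist_real_def)
qed
then show ?thesis unfolding metric_deriv_def by (intro tendsto_Lim) auto
qed

lemma is_flux_w: "is_flux e T f (%t. dens_flux (f t) (w t))"
unfolding is_flux_def
proof
show "AE t in leb. (metric_deriv e f t)^2 = action e (f t) (dens_flux (f t) (w t))"
	using AE_reg
proof eventually_elim
	case (elim t)
	then have t: "good t" by (simp add: reg_def)
	have "action e (f t) (dens_flux (f t) (w t)) = W.act t"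
		using W.action_eq_act[OF good_interior[OF t], of 1] by simp
	moreover have "(metric_deriv e f t)^2 = ennreal (a2 t)"
		using a2_nonneg by (simp add: metric_deriv_eq[OF elim] ennreal_power)
	ultimately show ?case using act_eq[OF t] by simp
qed
qed (rule W.CE_dens_flux)

text \<open>Every flux of the curve, in particular the chosen one, has action \<open>a2\<close> at almost all times.\<close>

lemma action_flux: "(NI leb (%t. action e (f t) (flux e T f t))) = ennreal (LI Th (%x. (u x)^2))"
proof -
have "is_flux e T f (flux e T f)" unfolding flux_def by (rule someI[of "is_flux e T f", OF is_flux_w])
then have "AE t in leb. (metric_deriv e f t)^2 = action e (f t) (flux e T f t)" by (simp add: is_flux_def)
then have AE: "AE t in leb. action e (f t) (flux e T f t) = ennreal (a2 t)"
	using AE_reg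
proof eventually_elim
	case (elim t)
	show ?case using a2_nonneg by (simp add: elim(1)[symmetric] metric_deriv_eq[OF elim(2)] ennreal_power)
qed
have "(NI leb (%t. action e (f t) (flux e T f t))) = (NI leb (%t. ennreal (a2 t)))"
	using AE by (rule nn_integral_cong_AE)
also have "... = ennreal (LI leb (%t. a2 t))"
	using a2_nonneg by (intro nn_integral_eq_integral a2_integrable) auto
also have "(LI leb (%t. a2 t)) = (LI Th (%x. (u x)^2))"
	unfolding a2_def by (rule integral_Th(3)[OF u_sq, symmetric])
finally show ?thesis .
qed

end

section \<open>Regularized energies\<close>

lemma DERIV_jb': "((%v. v / jb v) has_real_derivative 1 / (jb v)^3) (at v)"
proof -
have "0 <= 1 + v * v" by simp
then have j: "0 < jb v" "jb v * jb v = 1 + v * v" using jb_bounds(1)[of v] by (simp, simp add: jb_def power2_eq_square)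
have "((%v. v / jb v) has_real_derivative (1 * jb v - v * (v / jb v)) / (jb v * jb v)) (at v)"
	using j by (intro DERIV_divide DERIV_ident DERIV_jb) auto
moreover have "1 * jb v - v * (v / jb v) = (jb v * jb v - v * v) / jb v" using j(1) by (simp add: field_simps)
ultimately show ?thesis using j by (simp add: power3_eq_cube mult.commute)
qed

text \<open>
  A convex approximation of \<open>v\<^sup>2/2\<close> with bounded derivative \<open>clip n\<close>, which is increasing and
  \<open>1\<close>-Lipschitz.
\<close>

definition energy_approx :: "nat => real => real" where
"energy_approx n v = (real (Suc n))^2 * (jb (v / real (Suc n)) - 1)"

definition clip :: "nat => real => real" where "clip n v = v / jb (v / real (Suc n))"

lemma clip_scaled: "clip n v = real (Suc n) * ((v / real (Suc n)) / jb (v / real (Suc n)))"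
by (simp add: clip_def)

lemma DERIV_energy_approx: "(energy_approx n has_real_derivative clip n v) (at v)"
proof -
have "((%v. v / real (Suc n)) has_real_derivative 1 / real (Suc n)) (at v)" by (auto intro!: derivative_eq_intros)
from DERIV_chain2[OF DERIV_jb this]
have "(energy_approx n has_real_derivative (real (Suc n))^2 * (v / real (Suc n) / jb (v / real (Suc n)) * (1 / real (Suc n)) - 0)) (at v)"
	unfolding energy_approx_def[abs_def] by (intro DERIV_cmult DERIV_diff DERIV_const)
moreover have "R^2 * (v / R / y * (1 / R) - 0) = v / y" if "0 < R" for R y :: real
	using that by (simp add: power2_eq_square)
ultimately show ?thesis unfolding clip_def by simp
qed

lemma continuous_clip: "continuous_on UNIV (clip n)"
unfolding clip_scaled[abs_def]
by (intro continuous_on_mult continuous_on_const continuous_on_compose2[OF continuous_on_jb'[of UNIV]] continuous_intros) auto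

lemma clip_le: "\<bar>clip n v\<bar> <= real (Suc n)"
unfolding clip_scaled abs_mult using mult_left_mono[OF abs_jb'_le[of "v / real (Suc n)"], of "real (Suc n)"] by simp

lemma clip_increment: "0 <= (clip n w - clip n v) * (w - v)" "\<bar>clip n w - clip n v\<bar> <= \<bar>w - v\<bar>"
proof -
have g: "x / jb x <= y / jb y" "x - x / jb x <= y - y / jb y" if "x <= y" for x y
proof -
	have j: "0 <= 1 / (jb v)^3" "0 <= 1 - 1 / (jb v)^3" for v
		using jb_bounds(1)[of v] one_le_power[OF jb_bounds(1), of v 3] by auto
	show "x / jb x <= y / jb y" using DERIV_jb' j(1) by (intro DERIV_nonneg_imp_nondecreasing[OF that]) blast
	have "((%v. v - v / jb v) has_real_derivative 1 - 1 / (jb v)^3) (at v)" for v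
		by (intro DERIV_diff DERIV_ident DERIV_jb')
	then show "x - x / jb x <= y - y / jb y" using j(2) by (intro DERIV_nonneg_imp_nondecreasing[OF that]) blast
qed
have c: "clip n x <= clip n y & clip n y - clip n x <= y - x" if "x <= y" for x y
proof -
	define R where "R = real (Suc n)"
	have R: "0 < R" by (simp add: R_def)
	have "x / R <= y / R" using that R by (simp add: divide_right_mono)
	from mult_left_mono[OF g(1)[OF this], of R] mult_left_mono[OF g(2)[OF this], of R] R
	show ?thesis unfolding clip_def R_def[symmetric] by (simp add: right_diff_distrib)
qed
have "0 <= (clip n w - clip n v) * (w - v) & \<bar>clip n w - clip n v\<bar> <= \<bar>w - v\<bar>"
proof (cases "v <= w")
	case True
	with c[OF True] show ?thesis by (intro conjI mult_nonneg_nonneg) linarith+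
next
	case False
	with c[of w v] show ?thesis by (intro conjI mult_nonpos_nonpos) linarith+
qed
then show "0 <= (clip n w - clip n v) * (w - v)" "\<bar>clip n w - clip n v\<bar> <= \<bar>w - v\<bar>" by auto
qed

lemma energy_approx_bounds: "0 <= energy_approx n v" "energy_approx n v <= v^2 / 2"
proof -
define R where "R = real (Suc n)"
have R: "0 < R" by (simp add: R_def)
show "0 <= energy_approx n v" unfolding energy_approx_def using jb_bounds(1) by simp
have "jb x <= 1 + x^2 / 2" for x
	unfolding jb_def by (rule real_le_lsqrt) (auto simp: power2_sum power_divide)
from this[of "v / R"] have "R^2 * (jb (v / R) - 1) <= R^2 * ((v / R)^2 / 2)" by (intro mult_left_mono) auto
then show "energy_approx n v <= v^2 / 2" using R unfolding energy_approx_def R_def[symmetric] by (simp add: power_divide)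
qed

lemma clip_tendsto: "(%n. clip n v) ----> v" and energy_approx_tendsto: "(%n. energy_approx n v) ----> v^2 / 2"
proof -
have "(%n. v * inverse (real (Suc n))) ----> v * 0" by (intro tendsto_mult tendsto_const LIMSEQ_inverse_real_of_nat)
then have "(%n. v / real (Suc n)) ----> 0" by (simp add: divide_inverse)
from isCont_tendsto_compose[OF DERIV_isCont[OF DERIV_jb] this]
have "(%n. jb (v / real (Suc n))) ----> jb 0" .
then have j: "(%n. jb (v / real (Suc n))) ----> 1" by (simp add: jb_def)
have "(%n. v / jb (v / real (Suc n))) ----> v / 1" by (intro tendsto_divide tendsto_const j) simp
then show "(%n. clip n v) ----> v" by (simp add: clip_def)
have "energy_approx n v = v^2 / (jb (v / real (Suc n)) + 1)" for n
proof -
	define R where "R = real (Suc n)"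
	have R: "0 < R" by (simp add: R_def)
	have "(jb x - 1) * (jb x + 1) = x^2" for x by (simp add: jb_def algebra_simps)
	then have "R^2 * (jb (v / R) - 1) * (jb (v / R) + 1) = R^2 * (v / R)^2" by (simp add: mult.assoc)
	also have "... = v^2" using R by (simp add: power_divide)
	finally show ?thesis using jb_bounds(1)[of "v / R"]
		unfolding energy_approx_def R_def[symmetric] by (simp add: eq_divide_eq)
qed
moreover have "(%n. v^2 / (jb (v / real (Suc n)) + 1)) ----> v^2 / (1 + 1)"
	by (intro tendsto_divide tendsto_const tendsto_add j) simp
ultimately show "(%n. energy_approx n v) ----> v^2 / 2" by simp
qed

section \<open>The energy along the curve\<close>

context narrow_curve begin

definition r :: "real \<times> (real \<times> real) => real" where "r x = fst (snd x) - snd (snd x)"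

definition cg :: "nat => real \<times> (real \<times> real) => real" where
"cg n x = clip n (snd (snd x)) - clip n (fst (snd x))"

lemma r_measurable: "r : bm borel"
unfolding r_def[abs_def] by (intro borel_measurable_continuous_onI continuous_intros)

lemma cg_measurable: "cg n : bm borel"
unfolding cg_def[abs_def]
by (intro borel_measurable_continuous_onI continuous_intros continuous_on_compose2[OF continuous_clip]) auto

lemma r_cg: "\<bar>cg n x\<bar> <= \<bar>r x\<bar>" "0 <= - (r x * cg n x)"
using clip_increment[where w="snd (snd x)" and v="fst (snd x)", of n] by (auto simp: r_def cg_def algebra_simps)

lemma cg_tendsto: "(%n. cg n x) ----> - r x"
using tendsto_diff[OF clip_tendsto[of "snd (snd x)"] clip_tendsto[of "fst (snd x)"]] by (simp add: cg_def r_def)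

lemma energy_approx_flow:
assumes CE: "CE e T f U"
	and rate: "AE t in leb. signed_integral offdiag_borel (U t) (%z. kernel e z * (clip n (snd z) - clip n (fst z))) =
		(LI (mu t) (%z. kernel e z * (g (t, z) * cg n (t, z))))"
	and i: "integrable Th (%x. g x * cg n x)"
shows "(LI (f T) (%v. energy_approx n v)) - (LI (f 0) (%v. energy_approx n v)) = (LI Th (%x. g x * cg n x))"
proof -
interpret C: continuity_eq e T f U by (rule continuity_eq.intro[OF e T CE])
have "(LI (f T) (%v. energy_approx n v)) - (LI (f 0) (%v. energy_approx n v)) = (LI leb (%t. indicator {0..T} t * C.rate (clip n) t))"
	using T by (intro C.flow[OF jb_f DERIV_energy_approx continuous_clip clip_le]) auto
also have "... = (LI leb (%t. C.rate (clip n) t))" by (intro Bochner_Integration.integral_cong) auto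
also have "... = (LI leb (%t. LI (mu t) (%z. kernel e z * (g (t, z) * cg n (t, z)))))"
	using rate integral_Th(2)[OF i] unfolding C.rate_def[symmetric]
	by (intro integral_cong_AE C.rate_measurable borel_measurable_continuous_onI[OF continuous_clip]) auto
also have "... = (LI Th (%x. g x * cg n x))" by (rule integral_Th(3)[OF i, symmetric])
finally show ?thesis .
qed

end

lemma energy_flux_eq: "energy_flux f = dens_flux f (%z. fst z - snd z)"
proof -
have "(energy_variation has_real_derivative v) (at v)" for v
	unfolding energy_variation_def[abs_def] by (auto intro!: derivative_eq_intros)
then have "deriv energy_variation v = v" for v by (rule DERIV_imp_deriv)
then have "- ngrad energy_variation z = fst z - snd z" for z by (simp add: ngrad_def case_prod_beta)
then show ?thesis by (simp add: energy_flux_def[abs_def] dens_flux_def[abs_def])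
qed

text \<open>
The kernel grows linearly, so that second moments suffice.
\<close>

lemma P2cm_pair:
assumes f: "f : P2cm" and e: "0 <= e" "e < 1"
shows "integrable (tensor f) (%z. fst z - snd z)" "integrable (tensor f) (%z. kernel e z * (fst z - snd z))"
proof -
have rd: "real_distribution f" and i: "integrable f (%v. v^2)" using f by (auto simp: P2cm_def)
interpret real_distribution f by fact
note s = real_distribution_sets[OF rd]
define h where "h v = 1 + v^2" for v :: real
have h: "0 <= h v" for v by (simp add: h_def)
have mh: "h : bm borel" unfolding h_def[abs_def] by measurable
have "integrable f h" using i unfolding h_def[abs_def] by simp
then have fin: "(NI f (%v. ennreal (h v))) < \<infinity>" using h by (simp add: integrable_iff_bounded)
have mf: "(%v. ennreal (h v)) : bm f" using mh s by (simp cong: measurable_cong_sets)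
have mhh: "(%z. h (fst z) * h (snd z)) : bm (sq f)"
	using mh s by (intro borel_measurable_times measurable_compose[OF measurable_fst] measurable_compose[OF measurable_snd]) (simp_all cong: measurable_cong_sets)
have "(NI (sq f) (%z. ennreal (h (fst z) * h (snd z)))) = (NI f (%v. NI f (%w. ennreal (h v) * ennreal (h w))))"
	using nn_integral_fst[OF measurable_compose[OF mhh measurable_ennreal]] h by (simp add: ennreal_mult)
also have "... = (NI f (%v. ennreal (h v))) * (NI f (%v. ennreal (h v)))"
	using mf by (simp add: nn_integral_cmult nn_integral_multc)
also have "... < \<infinity>" using fin by (simp add: ennreal_mult_less_top)
finally have hh: "integrable (sq f) (%z. h (fst z) * h (snd z))" using mhh h by (intro integrableI_bounded) simp_all
have sq: "\<bar>v - w\<bar>^2 <= 2 * (h v * h w)" for v w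
	using zero_le_power2[of "v + w"] zero_le_power2[of "v * w"] by (simp add: h_def power2_eq_square algebra_simps)
have ab: "\<bar>v - w\<bar> <= 2 * (h v * h w)" for v w
proof -
	have "1 * 1 <= h v * h w" by (intro mult_mono) (auto simp: h_def)
	then have "\<bar>v - w\<bar> * \<bar>v - w\<bar> <= 2 * (h v * h w)" "1 <= h v * h w" using sq[of v w] by (auto simp: power2_eq_square)
	moreover have "\<bar>v - w\<bar> <= 1 | \<bar>v - w\<bar> * 1 <= \<bar>v - w\<bar> * \<bar>v - w\<bar>" using mult_left_mono[of 1 "\<bar>v - w\<bar>" "\<bar>v - w\<bar>"] by linarith
	moreover have "z <= 2 * y ==> 1 <= y ==> x <= 1 | x * 1 <= z ==> x <= 2 * y" for x y z :: real by linarith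
	ultimately show ?thesis by blast
qed
have md: "(%z. fst z - snd z :: real) : bm borel" by (intro borel_measurable_continuous_onI continuous_intros)
have "integrable (sq f) (%z. fst z - snd z)"
proof (rule Bochner_Integration.integrable_bound[OF integrable_mult_right[OF hh, of 2]])
	show "(%z. fst z - snd z) : bm (sq f)" using md sets_pair_borel[OF s] by (simp cong: measurable_cong_sets)
	show "AE z in f \<Otimes>\<^sub>M f. norm (fst z - snd z) <= norm (2 * (h (fst z) * h (snd z)))" using ab h by (simp add: abs_mult)
qed
then show "integrable (tensor f) (%z. fst z - snd z)" by (subst integral_tensor(2)[OF s]) (auto simp: offdiag_def)
have "integrable (sq f) (%z. kernel e z * (fst z - snd z))"
proof (rule Bochner_Integration.integrable_bound[OF integrable_mult_right[OF hh, of "(1 - e) / 4 * 2"]])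
	show "(%z. kernel e z * (fst z - snd z)) : bm (sq f)"
		using borel_measurable_times[OF kernel_measurable md, of e] sets_pair_borel[OF s] by (simp cong: measurable_cong_sets)
	have "\<bar>kernel e z * (fst z - snd z)\<bar> <= \<bar>(1 - e) / 4 * 2 * (h (fst z) * h (snd z))\<bar>" for z
	proof -
		have "\<bar>kernel e z * (fst z - snd z)\<bar> = (1 - e) / 4 * \<bar>fst z - snd z\<bar>^2"
			using e by (simp add: kernel_eq abs_mult power2_eq_square)
		also have "... <= (1 - e) / 4 * (2 * (h (fst z) * h (snd z)))" using e by (intro mult_left_mono sq) auto
		also have "... = \<bar>(1 - e) / 4 * 2 * (h (fst z) * h (snd z))\<bar>" using e h by (simp add: abs_mult)
		finally show ?thesis .
	qed
	then show "AE z in f \<Otimes>\<^sub>M f. norm (kernel e z * (fst z - snd z)) <= norm ((1 - e) / 4 * 2 * (h (fst z) * h (snd z)))" by simp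
qed
then show "integrable (tensor f) (%z. kernel e z * (fst z - snd z))" by (subst integral_tensor(2)[OF s]) (auto simp: offdiag_def)
qed

section \<open>The energy dissipation identity\<close>

lemma clip_difference_le: "\<bar>clip n w - clip n v\<bar> <= 2 * real (Suc n)"
proof -
have "\<bar>x\<bar> <= c ==> \<bar>y\<bar> <= c ==> \<bar>x - y\<bar> <= 2 * c" for x y c :: real by linarith
from this[OF clip_le clip_le] show ?thesis .
qed

lemma half_enn2ereal: "0 <= a ==> enn2ereal (ennreal a) / 2 = ereal (a / 2)"
by (simp add: enn2ereal_ennreal numeral_eq_ereal)

locale energy_curve = flux_curve +
assumes P2: "!!t. t : {0..T} ==> f t : P2cm"
begin

lemma energy_approx_energy:
assumes t: "t : {0..T}"
shows "(%n. LI (f t) (%v. energy_approx n v)) ----> energy (f t)"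
proof -
have i: "integrable (f t) (%v. v^2)" using P2[OF t] by (simp add: P2cm_def)
have m: "h : bm (f t)" if "continuous_on UNIV h" for h :: "real => real"
	using borel_measurable_continuous_onI[OF that] measurable_cong_sets[OF real_distribution_sets[OF distr_f[OF t]] refl] by blast
have "(%n. LI (f t) (%v. energy_approx n v)) ----> (LI (f t) (%v. v^2 / 2))"
proof (rule integral_dominated_convergence[where w="%v. v^2"])
	show "energy_approx n : bm (f t)" for n
		by (rule m) (meson DERIV_energy_approx DERIV_isCont continuous_at_imp_continuous_on)
	show "(%v. v^2 / 2) : bm (f t)" by (intro m continuous_intros) auto
	show "AE v in f t. (%n. energy_approx n v) ----> v^2 / 2" using energy_approx_tendsto by simp
	show "AE v in f t. norm (energy_approx n v) <= v^2" for n
	proof (intro AE_I2)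
		fix v show "norm (energy_approx n v) <= v^2"
			using energy_approx_bounds[of n v] zero_le_power2[of v] by simp
	qed
qed (rule i)
then show ?thesis by (simp add: energy_def)
qed

lemma energy_approx_difference:
"(%n. (LI (f T) (%v. energy_approx n v)) - (LI (f 0) (%v. energy_approx n v))) ----> energy (f T) - energy (f 0)"
using T by (intro tendsto_diff energy_approx_energy) auto

lemma measurable_Th: "h : bm borel ==> h : bm Th"
using measurable_cong_sets[OF sets_Th refl] by blast

lemma nn_integral_dissipation: "(NI leb (%t. dissipation e (f t))) = (NI Th (%x. ennreal ((r x)^2)))"
proof -
have "dissipation e (f t) = (NI (mu t) (%z. ennreal (kernel e z * (r (t, z))^2)))" if "t : {0..T}" for t
	unfolding dissipation_def mu_def
	by (subst nn_integral_tensor[OF real_distribution_sets[OF distr_f[OF that]]]) (auto simp: offdiag_def r_def mult.commute)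
then show ?thesis
	unfolding nn_Th[OF borel_measurable_power[OF r_measurable]] by (intro nn_integral_cong) simp
qed

text \<open>The chain rule for the energy, when the dissipation is finite.\<close>

lemma energy_chain_rule:
assumes r2: "integrable Th (%x. (r x)^2)"
shows "integrable Th (%x. u x * r x)" "energy (f T) - energy (f 0) = - (LI Th (%x. u x * r x))"
proof -
show ur: "integrable Th (%x. u x * r x)"
	by (rule Cauchy_Schwarz_integral(1)[OF measurable_Th[OF u_meas] measurable_Th[OF r_measurable] u_sq r2])
have m: "(%x. u x * cg n x) : bm Th" for n
	by (intro measurable_Th borel_measurable_times u_meas cg_measurable)
have le: "norm (u x * cg n x) <= norm (u x * r x)" for n x
	using mult_left_mono[OF r_cg(1)[of n x], of "\<bar>u x\<bar>"] by (simp add: abs_mult)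
have i: "integrable Th (%x. u x * cg n x)" for n
	by (rule Bochner_Integration.integrable_bound[OF ur m]) (intro AE_I2 le)
have "AE t in leb. signed_integral offdiag_borel (dens_flux (f t) (w t)) (%z. kernel e z * (clip n (snd z) - clip n (fst z))) =
		(LI (mu t) (%z. kernel e z * (u (t, z) * cg n (t, z))))" for n
	using AE_good
proof eventually_elim
	case (elim t)
	show ?case
		using rate_good[OF elim borel_measurable_continuous_onI[OF continuous_clip] clip_le, of n]
		by (simp add: C.rate_def cg_def)
qed
note eq = energy_approx_flow[OF W.CE_dens_flux this i]
have "(%n. LI Th (%x. u x * cg n x)) ----> (LI Th (%x. u x * - r x))"
proof (rule integral_dominated_convergence[OF _ m integrable_norm[OF ur]])
	show "(%x. u x * - r x) : bm Th"
		by (intro measurable_Th borel_measurable_times borel_measurable_uminus u_meas r_measurable)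
	show "AE x in Th. (%n. u x * cg n x) ----> u x * - r x"
		by (intro AE_I2 tendsto_mult tendsto_const cg_tendsto)
	show "AE x in Th. norm (u x * cg n x) <= norm (u x * r x)" for n by (intro AE_I2 le)
qed
then have "energy (f T) - energy (f 0) = (LI Th (%x. u x * - r x))"
	using energy_approx_difference unfolding eq by (intro LIMSEQ_unique)
then show "energy (f T) - energy (f 0) = - (LI Th (%x. u x * r x))" by simp
qed

lemma square_expand:
assumes r2: "integrable Th (%x. (r x)^2)"
shows "integrable Th (%x. (u x - r x)^2)"
	and "(LI Th (%x. (u x - r x)^2)) = (LI Th (%x. (u x)^2)) - 2 * (LI Th (%x. u x * r x)) + (LI Th (%x. (r x)^2))"
proof -
note i = energy_chain_rule(1)[OF r2]
have eq: "(u x - r x)^2 = (u x)^2 - 2 * (u x * r x) + (r x)^2" for x by (simp add: power2_diff)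
show "integrable Th (%x. (u x - r x)^2)" unfolding eq using u_sq i r2 by simp
show "(LI Th (%x. (u x - r x)^2)) = (LI Th (%x. (u x)^2)) - 2 * (LI Th (%x. u x * r x)) + (LI Th (%x. (r x)^2))"
	unfolding eq using u_sq i r2 by simp
qed

lemma De_Giorgi_eq:
"De_Giorgi e T f = ereal (energy (f T) - energy (f 0)) + ereal ((LI Th (%x. (u x)^2)) / 2) + enn2ereal (NI Th (%x. ennreal ((r x)^2))) / 2"
proof -
have "enn2ereal (ennreal (LI Th (%x. (u x)^2))) / 2 = ereal ((LI Th (%x. (u x)^2)) / 2)"
	by (rule half_enn2ereal) simp
then show ?thesis by (simp only: De_Giorgi_def action_flux nn_integral_dissipation)
qed

lemma energy_flux_integral:
assumes t: "t : {0..T}" and h: "h : bm borel" "!!z. \<bar>h z\<bar> <= (B :: real)"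
shows "signed_integral offdiag_borel (energy_flux (f t)) (%z. kernel e z * h z) = (LI (mu t) (%z. kernel e z * (r (t, z) * h z)))"
proof -
note s = real_distribution_sets[OF distr_f[OF t]]
have i: "integrable (tensor (f t)) (%z. kernel e z * h z * (fst z - snd z))"
proof (rule Bochner_Integration.integrable_bound[OF integrable_mult_right[OF P2cm_pair(2)[OF P2[OF t] e], of B]])
	show "(%z. kernel e z * h z * (fst z - snd z)) : bm (tensor (f t))"
		by (intro measurable_tensor[OF s] borel_measurable_times kernel_measurable h borel_measurable_continuous_onI continuous_intros)
	have "\<bar>kernel e z * h z * (fst z - snd z)\<bar> <= \<bar>B * (kernel e z * (fst z - snd z))\<bar>" for z
	proof -
		have "\<bar>kernel e z * (fst z - snd z)\<bar> * \<bar>h z\<bar> <= \<bar>kernel e z * (fst z - snd z)\<bar> * \<bar>B\<bar>"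
			using h(2)[of z] by (intro mult_left_mono) linarith+
		then show ?thesis by (simp add: abs_mult ac_simps)
	qed
	then show "AE z in tensor (f t). norm (kernel e z * h z * (fst z - snd z)) <= norm (B * (kernel e z * (fst z - snd z)))" by simp
qed
have "signed_integral offdiag_borel (energy_flux (f t)) (%z. kernel e z * h z) = (LI (tensor (f t)) (%z. kernel e z * h z * (fst z - snd z)))"
	unfolding energy_flux_eq
	by (intro signed_integral_dens_flux[OF distr_f[OF t] P2cm_pair(1)[OF P2[OF t] e]] borel_measurable_times kernel_measurable h i)
also have "... = (LI (mu t) (%z. kernel e z * h z * (fst z - snd z)))"
	unfolding mu_def by (rule integral_tensor(1)[OF s]) (auto simp: offdiag_def)
also have "... = (LI (mu t) (%z. kernel e z * (r (t, z) * h z)))" by (simp add: r_def ac_simps)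
finally show ?thesis .
qed

lemma r_vgrad_integrable:
assumes ph: "ph : C1c T" and r1: "integrable Th r"
shows "integrable Th (%x. r x * vgrad ph x)"
proof -
obtain B where B: "!!x. \<bar>vgrad ph x\<bar> <= B" by (rule vgrad_bounded[OF ph]) (rule that; assumption)
show ?thesis
proof (rule Bochner_Integration.integrable_bound[OF integrable_mult_right[OF r1, of B]])
	show "(%x. r x * vgrad ph x) : bm Th"
		by (intro measurable_Th borel_measurable_times r_measurable vgrad_measurable[OF ph])
	have "\<bar>r x\<bar> * \<bar>vgrad ph x\<bar> <= \<bar>r x\<bar> * \<bar>B\<bar>" for x
		using B[of x] by (intro mult_left_mono) linarith+
	then show "AE x in Th. norm (r x * vgrad ph x) <= norm (B * r x)" by (simp add: abs_mult mult.commute)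
qed
qed

lemma integral_r_vgrad:
assumes ph: "ph : C1c T" and r1: "integrable Th r"
shows "(LI leb (%t. signed_integral offdiag_borel (energy_flux (f t)) (%z. kernel e z * ngrad (%v. ph (t, v)) z))) = (LI Th (%x. r x * vgrad ph x))"
proof -
obtain B where B: "!!x. \<bar>vgrad ph x\<bar> <= B" by (rule vgrad_bounded[OF ph]) (rule that; assumption)
have "(LI leb (%t. signed_integral offdiag_borel (energy_flux (f t)) (%z. kernel e z * ngrad (%v. ph (t, v)) z))) =
		(LI leb (%t. LI (mu t) (%z. kernel e z * (r (t, z) * vgrad ph (t, z)))))"
	unfolding vgrad_eq_ngrad
	by (intro Bochner_Integration.integral_cong refl energy_flux_integral[OF _ measurable_slice[OF vgrad_measurable[OF ph]] B]) simp
also have "... = (LI Th (%x. r x * vgrad ph x))"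
	by (rule integral_Th(3)[OF r_vgrad_integrable[OF ph r1], symmetric])
finally show ?thesis .
qed

text \<open>
  Solutions have finite dissipation: test the equation with the regularized energies, whose
  dissipations increase to the full one. The flux of the equation and the optimal flux then
  coincide, as both represent the same functional on gradients and \<open>u\<close> is a limit of gradients,
  while the chain rule holds for both.
\<close>

lemma De_Giorgi_solution:
assumes CE: "CE e T f (%t. energy_flux (f t))"
shows "De_Giorgi e T f = 0"
proof -
have "(NI Th (%x. ennreal \<bar>r x\<bar>)) = (NI leb (%t. NI (total_variation offdiag_borel (energy_flux (f t))) (%z. ennreal (kernel e z))))"
	unfolding nn_Th[OF borel_measurable_abs[OF r_measurable]]
proof (rule nn_integral_cong)
	fix t assume "t : space leb"
	then have t: "t : {0..T}" by simp
	note s = real_distribution_sets[OF distr_f[OF t]]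
	have "(NI (total_variation offdiag_borel (energy_flux (f t))) (%z. ennreal (kernel e z))) =
			(NI (tensor (f t)) (%z. ennreal (kernel e z) * ennreal \<bar>fst z - snd z\<bar>))"
		unfolding energy_flux_eq
		by (intro nn_integral_total_variation_dens_flux[OF distr_f[OF t] P2cm_pair(1)[OF P2[OF t] e]]
				measurable_compose[OF kernel_measurable measurable_ennreal])
	also have "... = (NI (mu t) (%z. ennreal (kernel e z) * ennreal \<bar>fst z - snd z\<bar>))"
		unfolding mu_def by (rule nn_integral_tensor[OF s]) (auto simp: offdiag_def)
	also have "... = (NI (mu t) (%z. ennreal (kernel e z * \<bar>r (t, z)\<bar>)))"
		using kernel_nonneg[OF e(2)] by (simp add: r_def ennreal_mult')
	finally show "(NI (mu t) (%z. ennreal (kernel e z * \<bar>r (t, z)\<bar>))) =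
		(NI (total_variation offdiag_borel (energy_flux (f t))) (%z. ennreal (kernel e z)))" by simp
qed
also have "... < \<infinity>" using CE unfolding CE_def by blast
finally have r1: "integrable Th r" by (intro integrableI_bounded measurable_Th[OF r_measurable]) simp
have icg: "integrable Th (%x. r x * cg n x)" for n
proof (rule Bochner_Integration.integrable_bound[OF integrable_mult_right[OF r1, of "2 * real (Suc n)"]])
	show "(%x. r x * cg n x) : bm Th" by (intro measurable_Th borel_measurable_times r_measurable cg_measurable)
	have "\<bar>cg n x\<bar> <= 2 * real (Suc n)" for x
		unfolding cg_def by (rule clip_difference_le)
	then have "\<bar>r x\<bar> * \<bar>cg n x\<bar> <= \<bar>r x\<bar> * (2 * real (Suc n))" for x by (intro mult_left_mono) auto
	then show "AE x in Th. norm (r x * cg n x) <= norm (2 * real (Suc n) * r x)" by (simp add: abs_mult mult.commute)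
qed
have "AE t in leb. signed_integral offdiag_borel (energy_flux (f t)) (%z. kernel e z * (clip n (snd z) - clip n (fst z))) =
		(LI (mu t) (%z. kernel e z * (r (t, z) * cg n (t, z))))" for n
proof (intro AE_I2)
	fix t assume "t : space leb"
	then have t: "t : {0..T}" by simp
	have "\<bar>clip n (snd z) - clip n (fst z)\<bar> <= 2 * real (Suc n)" for z by (rule clip_difference_le)
	from energy_flux_integral[OF t ngrad_measurable[OF borel_measurable_continuous_onI[OF continuous_clip]] this]
	show "signed_integral offdiag_borel (energy_flux (f t)) (%z. kernel e z * (clip n (snd z) - clip n (fst z))) =
		(LI (mu t) (%z. kernel e z * (r (t, z) * cg n (t, z))))" by (simp add: cg_def)
qed
note eq = energy_approx_flow[OF CE this icg]
have lim: "(%n. LI Th (%x. r x * cg n x)) ----> energy (f T) - energy (f 0)"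
	using energy_approx_difference unfolding eq .
have "(NI Th (%x. ennreal ((r x)^2))) = (NI Th (%x. liminf (%n. ennreal (- (r x * cg n x)))))"
proof (rule nn_integral_cong)
	fix x
	have "(%n. ennreal (- (r x * cg n x))) ----> ennreal (- (r x * - r x))"
		by (intro tendsto_ennrealI tendsto_minus tendsto_mult tendsto_const cg_tendsto)
	from lim_imp_Liminf[OF _ this] show "ennreal ((r x)^2) = liminf (%n. ennreal (- (r x * cg n x)))"
		by (simp add: power2_eq_square)
qed
also have "... <= liminf (%n. NI Th (%x. ennreal (- (r x * cg n x))))"
	by (intro nn_integral_liminf measurable_compose[OF _ measurable_ennreal] borel_measurable_uminus borel_measurable_integrable[OF icg])
also have "... = liminf (%n. ennreal (- (LI Th (%x. r x * cg n x))))"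
proof -
	have "(NI Th (%x. ennreal (- (r x * cg n x)))) = ennreal (LI Th (%x. - (r x * cg n x)))" for n
		by (rule nn_integral_eq_integral[OF integrable_minus[OF icg]]) (simp only: r_cg(2) AE_I2)
	then show ?thesis by simp
qed
also have "... = ennreal (- (energy (f T) - energy (f 0)))"
	by (rule lim_imp_Liminf[OF _ tendsto_ennrealI[OF tendsto_minus[OF lim]]]) simp
also have "... < \<infinity>" by simp
finally have fin: "(NI Th (%x. ennreal ((r x)^2))) < \<infinity>" .
then have r2: "integrable Th (%x. (r x)^2)"
	by (intro integrableI_bounded measurable_Th borel_measurable_power r_measurable) simp
have "(%n. LI Th (%x. r x * cg n x)) ----> (LI Th (%x. r x * - r x))"
proof (rule integral_dominated_convergence[OF _ borel_measurable_integrable[OF icg] r2])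
	show "(%x. r x * - r x) : bm Th"
		by (intro measurable_Th borel_measurable_times borel_measurable_uminus r_measurable)
	show "AE x in Th. (%n. r x * cg n x) ----> r x * - r x" by (intro AE_I2 tendsto_mult tendsto_const cg_tendsto)
	have "\<bar>r x * cg n x\<bar> <= (r x)^2" for n x
		using mult_left_mono[OF r_cg(1)[of n x], of "\<bar>r x\<bar>"] by (simp add: abs_mult power2_eq_square)
	then show "AE x in Th. norm (r x * cg n x) <= (r x)^2" for n by simp
qed
then have "energy (f T) - energy (f 0) = (LI Th (%x. r x * - r x))" using lim by (intro LIMSEQ_unique)
then have E: "energy (f T) - energy (f 0) = - (LI Th (%x. (r x)^2))" by (simp add: power2_eq_square)
have orth: "(LI Th (%x. (u x - r x) * vgrad ph x)) = 0" if ph: "ph : C1c T" for ph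
proof -
	have "- lfun ph + (LI Th (%x. r x * vgrad ph x)) = 0"
		using CE ph integral_r_vgrad[OF ph r1] unfolding CE_def lfun_def tder_def by auto
	then show ?thesis
		using u_vgrad_integrable[OF ph] r_vgrad_integrable[OF ph r1] by (simp add: repr[OF ph] left_diff_distrib)
qed
note sq = square_expand[OF r2]
define N where "N = (LI Th (%x. (u x - r x)^2))"
have mur: "(%x. u x - r x) : bm Th" by (intro measurable_Th borel_measurable_diff u_meas r_measurable)
have mug: "(%x. u x - vgrad (Ph n) x) : bm Th" for n
	by (intro measurable_Th borel_measurable_diff u_meas vgrad_measurable[OF Ph])
have bound: "(LI Th (%x. (u x - r x) * u x))^2 <= N * (1/2)^n" for n
proof -
	note i = Cauchy_Schwarz_integral[OF mur mug sq(1) gap_int, of n]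
	have "(LI Th (%x. (u x - r x) * u x)) = (LI Th (%x. (u x - r x) * (u x - vgrad (Ph n) x) + (u x - r x) * vgrad (Ph n) x))"
		by (simp add: algebra_simps)
	also have "... = (LI Th (%x. (u x - r x) * (u x - vgrad (Ph n) x))) + (LI Th (%x. (u x - r x) * vgrad (Ph n) x))"
		using u_vgrad_integrable[OF Ph[of n]] r_vgrad_integrable[OF Ph[of n] r1]
		by (intro Bochner_Integration.integral_add i(1)) (simp add: left_diff_distrib)
	finally have "(LI Th (%x. (u x - r x) * u x))^2 <= N * (LI Th (%x. (u x - vgrad (Ph n) x)^2))"
		using i(2) by (simp add: orth[OF Ph] N_def)
	also have "... <= N * (1/2)^n" unfolding N_def by (intro mult_left_mono gap_le) simp
	finally show ?thesis .
qed
have "(%n. N * (1/2)^n) ----> N * 0" by (intro tendsto_mult tendsto_const LIMSEQ_realpow_zero) auto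
then have "(LI Th (%x. (u x - r x) * u x))^2 <= N * 0" by (rule LIMSEQ_le_const) (use bound in blast)
then have "(LI Th (%x. (u x - r x) * u x)) = 0" by simp
moreover have "(LI Th (%x. (u x - r x) * u x)) = (LI Th (%x. (u x)^2 - u x * r x))"
	by (simp add: algebra_simps power2_eq_square)
ultimately have U: "(LI Th (%x. (u x)^2)) = (LI Th (%x. u x * r x))"
	using u_sq energy_chain_rule(1)[OF r2] by simp
have "(NI Th (%x. ennreal ((r x)^2))) = ennreal (LI Th (%x. (r x)^2))" by (rule nn_integral_eq_integral[OF r2]) simp
then have "enn2ereal (NI Th (%x. ennreal ((r x)^2))) / 2 = ereal ((LI Th (%x. (r x)^2)) / 2)"
	by (simp only: half_enn2ereal[OF Bochner_Integration.integral_nonneg] zero_le_power2)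
moreover have "(LI Th (%x. (u x)^2)) = (LI Th (%x. (r x)^2))" using U E energy_chain_rule(2)[OF r2] by simp
ultimately show ?thesis unfolding De_Giorgi_eq E by simp
qed

text \<open>
  Conversely, if the functional vanishes then \<open>u\<close> and \<open>r\<close> have distance \<open>0\<close>, by completing the
  square, so that the optimal flux is the flux of the aggregation equation.
\<close>

lemma De_Giorgi_zero_solution:
assumes G0: "De_Giorgi e T f = 0"
shows "CE e T f (%t. energy_flux (f t))"
proof -
have fin: "(NI Th (%x. ennreal ((r x)^2))) < \<infinity>"
proof (rule ccontr)
	assume "\<not> (NI Th (%x. ennreal ((r x)^2))) < \<infinity>"
	then have "(NI Th (%x. ennreal ((r x)^2))) = \<infinity>" by (simp add: not_less top_unique)
	then have "De_Giorgi e T f = \<infinity>" unfolding De_Giorgi_eq by simp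
	then show False using G0 by simp
qed
then have r2: "integrable Th (%x. (r x)^2)"
	by (intro integrableI_bounded measurable_Th borel_measurable_power r_measurable) simp
have "(NI Th (%x. ennreal ((r x)^2))) = ennreal (LI Th (%x. (r x)^2))" by (rule nn_integral_eq_integral[OF r2]) simp
then have "enn2ereal (NI Th (%x. ennreal ((r x)^2))) / 2 = ereal ((LI Th (%x. (r x)^2)) / 2)"
	by (simp only: half_enn2ereal[OF Bochner_Integration.integral_nonneg] zero_le_power2)
then have "energy (f T) - energy (f 0) + (LI Th (%x. (u x)^2)) / 2 + (LI Th (%x. (r x)^2)) / 2 = 0"
	using G0 unfolding De_Giorgi_eq by simp
then have "(LI Th (%x. (u x - r x)^2)) = 0"
	unfolding square_expand(2)[OF r2] energy_chain_rule(2)[OF r2] by simp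
then have AE: "AE x in Th. u x = r x"
	using integral_nonneg_eq_0_iff_AE[OF square_expand(1)[OF r2]] by simp
have r1: "integrable Th r"
	using u_integrable AE by (subst integrable_cong_AE[of r _ u]) (auto intro: measurable_Th r_measurable u_meas)
have "dens_curve e T f (%t z. fst z - snd z)"
proof (rule dens_curve.intro[OF e T distr_f narrow P2cm_pair(1)[OF P2 e] P2cm_pair(2)[OF P2 e]])
	have "(%z. fst z - snd z :: real) : bm borel" by (intro borel_measurable_continuous_onI continuous_intros)
	then show "(%x. fst (snd x) - snd (snd x) :: real) : bm (Tb \<Otimes>\<^sub>M borel)"
		by (rule measurable_compose[OF measurable_snd])
	have "(NI leb (%t. NI (sq (f t)) (%z. ennreal (kernel e z * \<bar>fst z - snd z\<bar>)))) = (NI Th (%x. ennreal \<bar>r x\<bar>))"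
		unfolding nn_Th[OF borel_measurable_abs[OF r_measurable]] by (simp add: r_def mu_def)
	also have "... < \<infinity>" using r1 by (simp add: integrable_iff_bounded)
	finally show "(NI leb (%t. NI (sq (f t)) (%z. ennreal (kernel e z * \<bar>fst z - snd z\<bar>)))) < \<infinity>" .
	fix ph assume ph: "ph : C1c T"
	have "lfun ph = (LI Th (%x. r x * vgrad ph x))"
		unfolding repr[OF ph] using AE
		by (intro integral_cong_AE measurable_Th borel_measurable_times u_meas r_measurable vgrad_measurable[OF ph]) auto
	also have "... = (LI leb (%t. LI (mu t) (%z. kernel e z * (r (t, z) * vgrad ph (t, z)))))"
		by (rule integral_Th(3)[OF r_vgrad_integrable[OF ph r1]])
	finally show "(LI leb (%t. LI (f t) (%v. tder ph (t, v)))) + (LI leb (%t. LI (sq (f t)) (%z. kernel e z * vgrad ph (t, z) * (fst z - snd z)))) = 0"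
		by (simp add: lfun_def r_def mu_def ac_simps)
qed
from dens_curve.CE_dens_flux[OF this] show ?thesis unfolding energy_flux_eq .
qed

end

text \<open>Absolutely continuous curves have bounded first moments, by the moment bounds for the cost.\<close>

lemma AC_imp_ac_curve:
assumes e: "0 <= e" "e < 1" and T: "0 < T" and AC: "f : AC e T P2cm"
obtains Mb m where "ac_curve e T f Mb m"
proof -
have P2: "f t : P2cm" if "t : {0..T}" for t using AC that unfolding AC_def by blast
obtain m where m: "m : bm (lebesgue_on {0..T})" "integrable (lebesgue_on {0..T}) (%t. (m t)^2)"
	"!!s t. 0 < s ==> s <= t ==> t < T ==> enn2ereal (dA e (f s) (f t)) <= ereal (LI (lebesgue_on {s..t}) (%r. m r))"
	using AC unfolding AC_def by blast
have distr: "real_distribution (f t)" if "t : {0..T}" for t using P2[OF that] by (simp add: P2cm_def)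
have jb_f: "integrable (f t) jb" if t: "t : {0..T}" for t
proof -
	interpret real_distribution "f t" by (rule distr[OF t])
	have i: "integrable (f t) (%v. v^2)" using P2[OF t] by (simp add: P2cm_def)
	show ?thesis
	proof (rule Bochner_Integration.integrable_bound)
		show "integrable (f t) (%v. 1 + v^2)" using i by simp
		show "jb : bm (f t)" by simp
		have "\<bar>jb v\<bar> <= 1 + v^2" for v
			unfolding jb_def using real_sqrt_ge_one[of "1 + v^2"] by (simp add: real_le_lsqrt power2_eq_square mult_le_cancel_left1)
		then show "AE v in f t. norm (jb v) <= norm (1 + v^2)" by simp
	qed
qed
have im: "integrable (lebesgue_on {0..T}) m"
proof (rule Bochner_Integration.integrable_bound)
	show "integrable (lebesgue_on {0..T}) (%t. 1 + (m t)^2)"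
		using m(2) continuous_integrable_lebesgue_on(1)[OF continuous_on_const] by (intro Bochner_Integration.integrable_add)
	have "\<bar>x\<bar> <= 1 + x^2" for x :: real using zero_le_power2[of "\<bar>x\<bar> - 1"] by (simp add: power2_diff)
	then show "AE t in lebesgue_on {0..T}. norm (m t) <= norm (1 + (m t)^2)" by simp
qed (rule m(1))
define d where "d = (LI (lebesgue_on {0..T}) (%r. \<bar>m r\<bar>)) + 1"
have d: "0 < d" unfolding d_def by (simp add: add_nonneg_pos)
have dA: "dA e (f s) (f t) < ennreal d" if st: "0 < s" "s <= t" "t < T" for s t
proof -
	have "enn2ereal (dA e (f s) (f t)) <= ereal (LI (lebesgue_on {s..t}) (%r. m r))" by (rule m(3)[OF st])
	also have "(LI (lebesgue_on {s..t}) (%r. m r)) <= (LI (lebesgue_on {0..T}) (%r. \<bar>m r\<bar>))"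
	proof -
		have sub: "{s..t} \<subseteq> {0..T}" using st by auto
		note ia = integrable_abs[OF im]
		note iS = Equivalence_Lebesgue_Henstock_Integration.integrable_subinterval[OF im sub]
		have "(LI (lebesgue_on {s..t}) (%r. m r)) <= (LI (lebesgue_on {s..t}) (%r. \<bar>m r\<bar>))"
			by (intro integral_mono iS integrable_abs) auto
		also have "... = (LI (lebesgue_on {0..T}) (%r. indicator {s..t} r * \<bar>m r\<bar>))"
			using st lebesgue_integral_eq_integral[OF integrable_abs[OF iS]]
			by (subst integral_indicator_Icc[OF ia]) auto
		also have "... <= (LI (lebesgue_on {0..T}) (%r. \<bar>m r\<bar>))"
			using st by (intro integral_mono ia integral_indicator_Icc(1)) (auto simp: indicator_def)
		finally show ?thesis .
	qed
	also have "(LI (lebesgue_on {0..T}) (%r. \<bar>m r\<bar>)) < d" by (simp add: d_def)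
	also have "ereal d = enn2ereal (ennreal d)" using d by simp
	finally show ?thesis by (simp add: less_ennreal.rep_eq)
qed
have "mom (f t) <= 2 * mom (f (T / 2)) + 17 * ((1 - e) * d^2)" if t: "t : {0<..<T}" for t
proof (cases "T / 2 <= t")
	case True
	have "mom (f t) <= 2 * mom (f (T / 2)) + 2 * (1 - e) * d^2"
		using True t T by (intro mom_dA[OF e jb_f dA]) auto
	moreover have "0 <= (1 - e) * d^2" using e by simp
	moreover have "x <= y + 2 * z ==> 0 <= z ==> x <= y + 17 * z" for x y z :: real by linarith
	ultimately show ?thesis unfolding mult.assoc by blast
next
	case False
	show ?thesis using False t T by (intro mom_dA_reverse[OF e distr jb_f dA]) auto
qed
note momb = this
have nar: "narrowly_continuous T f" using AC unfolding AC_def by blast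
have "ac_curve e T f (2 * mom (f (T / 2)) + 17 * ((1 - e) * d^2)) m"
	by (rule ac_curve.intro[OF narrow_curve.intro[OF e T distr jb_f nar momb] ac_curve_axioms.intro[OF m]])
then show ?thesis by (rule that)
qed

theorem theorem3p6:
fixes e T :: real and f :: "real \<Rightarrow> real measure"
assumes "0 \<le> e" and "e < 1" and "0 < T"
	and "f \<in> AC e T P2cm"
shows "aggregation_solution e T f \<longleftrightarrow> De_Giorgi e T f = 0"
proof -
obtain Mb m where "ac_curve e T f Mb m" by (rule AC_imp_ac_curve[OF assms])
then interpret ac_curve e T f Mb m .
obtain u Ph where "flux_curve e T f Mb m u Ph" by (rule flux_exists)
then interpret flux_curve e T f Mb m u Ph .
have P2: "f t : P2cm" if "t : {0..T}" for t using assms(4) that unfolding AC_def by blast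
interpret energy_curve e T f Mb m u Ph by unfold_locales (rule P2)
show ?thesis
	unfolding aggregation_solution_def using P2 De_Giorgi_solution De_Giorgi_zero_solution by blast
qed

end
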